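(* Let $A$ and $B$ be two rings and $T=\begin{pmatrix} A & M\\ 0 & B\end{pmatrix}$ with $M$ an $A$-$B$-bimodule. Let $\mathcal{A}_A,\mathcal{B}_A$ be classes of left $A$-modules and $\mathcal{C}_B,\mathcal{D}_B$ classes of left $B$-modules. Suppose that $\mathrm{Tor}_1^B(M,E)=0$ for any $E\in\mathcal{C}_B$ and $\mathrm{Ext}^1_A(M,F)=0$ for any $F\in\mathcal{B}_A$. Then the following are equivalent: (1) $(\mathcal{A}_A,\mathcal{B}_A)$ and $(\mathcal{C}_B,\mathcal{D}_B)$ are hereditary cotorsion pairs (in $A$-Mod and $B$-Mod respectively), each generated by a set. (2) $(\Phi(\mathcal{A}_A,\mathcal{C}_B),\mathrm{Rep}(\mathcal{B}_A,\mathcal{D}_B))$ and $(\mathrm{Rep}(\mathcal{A}_A,\mathcal{C}_B),\Psi(\mathcal{B}_A,\mathcal{D}_B))$ are hereditary cotorsion pairs in $T$-Mod, each generated by a set.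
   Context: Rings are associative with identity, modules are unital, and $R$-Mod is the category of left $R$-modules. A left $T$-module is identified with a triple $X=\binom{X_1}{X_2}_{\phi^X}$ where $X_1\in A$-Mod, $X_2\in B$-Mod and $\phi^X:M\otimes_B X_2\to X_1$ is an $A$-homomorphism; the action is $\begin{pmatrix} a&m\\0&b\end{pmatrix}\binom{x_1}{x_2}=\binom{ax_1+\phi^X(m\otimes x_2)}{bx_2}$. Morphisms $X\to Y$ are pairs $\binom{f_1}{f_2}$ with $f_1\in\mathrm{Hom}_A(X_1,Y_1)$, $f_2\in\mathrm{Hom}_B(X_2,Y_2)$ and $f_1\phi^X=\phi^Y(1_M\otimes f_2)$. The adjoint of $\phi^X$ is $\psi^X:X_2\to\mathrm{Hom}_A(M,X_1)$, $\psi^X(x)(m)=\phi^X(m\otimes x)$. For a class $\mathcal{C}_A$ of left $A$-modules and a class $\mathcal{D}_B$ of left $B$-modules define classes of left $T$-modules: - $\mathrm{Rep}(\mathcal{C}_A,\mathcal{D}_B)=\{N \mid N_1\in\mathcal{C}_A,\ N_2\in\mathcal{D}_B\}$; - $\Phi(\mathcal{C}_A,\mathcal{D}_B)=\{X\mid \phi^X \text{ is monomorphic},\ \mathrm{coker}\,\phi^X\in\mathcal{C}_A,\ X_2\in\mathcal{D}_B\}$; - $\Psi(\mathcal{C}_A,\mathcal{D}_B)=\{Y\mid \psi^Y\text{ is epimorphic},\ Y_1\in\mathcal{C}_A,\ \ker\psi^Y\in\mathcal{D}_B\}$. For a class $\mathcal{S}$ of left $R$-modules, $\mathcal{S}^\perp=\{X\mid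 \mathrm{Ext}^1_R(S,X)=0\ \forall S\in\mathcal{S}\}$ and ${}^\perp\mathcal{S}=\{Y\mid\mathrm{Ext}^1_R(Y,S)=0\ \forall S\in\mathcal{S}\}$. A cotorsion pair is a pair $(\mathcal{X},\mathcal{Y})$ of classes with $\mathcal{X}^\perp=\mathcal{Y}$ and $\mathcal{X}={}^\perp\mathcal{Y}$. It is generated by a set if $\mathcal{Y}=\mathcal{S}^\perp$ for some set $\mathcal{S}$ of modules (the cotorsion pair generated by $\mathcal{S}$ is $({}^\perp(\mathcal{S}^\perp),\mathcal{S}^\perp)$). It is hereditary if $\mathcal{X}$ is resolving (contains the projectives; closed under extensions, kernels of epimorphisms and direct summands) and $\mathcal{Y}$ is coresolving (dual). *)

theory Defs
  imports "HOL-Algebra.Module" "HOL-Algebra.AbelCoset" "HOL-Algebra.Elementary_Groups"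
    "HOL-Algebra.Free_Abelian_Groups" "HOL-Library.Countable_Set" "HOL-Library.Equipollence"
begin

text \<open>
  The locale \<^locale>\<open>module\<close> of HOL-Algebra is restricted to commutative rings. Its record type is
  reused here for left modules over arbitrary rings with identity; as usual in HOL-Algebra, the
  fields \<^const>\<open>monoid.mult\<close> and \<^const>\<open>one\<close> of a module record carry no meaning.
\<close>

locale left_module = R?: ring R + X?: abelian_group X for R (structure) and X (structure) +
  assumes smult_closed: "\<lbrakk>a \<in> carrier R; x \<in> carrier X\<rbrakk> \<Longrightarrow> a \<odot>\<^bsub>X\<^esub> x \<in> carrier X"
    and smult_l_distr: "\<lbrakk>a \<in> carrier R; b \<in> carrier R; x \<in> carrier X\<rbrakk> \<Longrightarrow>
      (a \<oplus>\<^bsub>R\<^esub> b) \<odot>\<^bsub>X\<^esub> x = a \<odot>\<^bsub>X\<^esub> x \<oplus>\<^bsub>X\<^esub> b \<odot>\<^bsub>X\<^esub> x"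
    and smult_r_distr: "\<lbrakk>a \<in> carrier R; x \<in> carrier X; y \<in> carrier X\<rbrakk> \<Longrightarrow>
      a \<odot>\<^bsub>X\<^esub> (x \<oplus>\<^bsub>X\<^esub> y) = a \<odot>\<^bsub>X\<^esub> x \<oplus>\<^bsub>X\<^esub> a \<odot>\<^bsub>X\<^esub> y"
    and smult_assoc: "\<lbrakk>a \<in> carrier R; b \<in> carrier R; x \<in> carrier X\<rbrakk> \<Longrightarrow>
      (a \<otimes>\<^bsub>R\<^esub> b) \<odot>\<^bsub>X\<^esub> x = a \<odot>\<^bsub>X\<^esub> (b \<odot>\<^bsub>X\<^esub> x)"
    and smult_one: "x \<in> carrier X \<Longrightarrow> \<one>\<^bsub>R\<^esub> \<odot>\<^bsub>X\<^esub> x = x"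

record ('a, 'b, 'm) bimodule = "('a, 'm) module" +
  rsmult :: "'m \<Rightarrow> 'b \<Rightarrow> 'm"

locale bimodule = left_module A M + B?: ring B
  for A (structure) and B (structure) and M (structure) +
  assumes rsmult_closed: "\<lbrakk>m \<in> carrier M; b \<in> carrier B\<rbrakk> \<Longrightarrow> rsmult M m b \<in> carrier M"
    and rsmult_l_distr: "\<lbrakk>m \<in> carrier M; n \<in> carrier M; b \<in> carrier B\<rbrakk> \<Longrightarrow>
      rsmult M (m \<oplus>\<^bsub>M\<^esub> n) b = rsmult M m b \<oplus>\<^bsub>M\<^esub> rsmult M n b"
    and rsmult_r_distr: "\<lbrakk>m \<in> carrier M; b \<in> carrier B; c \<in> carrier B\<rbrakk> \<Longrightarrow>
      rsmult M m (b \<oplus>\<^bsub>B\<^esub> c) = rsmult M m b \<oplus>\<^bsub>M\<^esub> rsmult M m c"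
    and rsmult_assoc: "\<lbrakk>m \<in> carrier M; b \<in> carrier B; c \<in> carrier B\<rbrakk> \<Longrightarrow>
      rsmult M m (b \<otimes>\<^bsub>B\<^esub> c) = rsmult M (rsmult M m b) c"
    and rsmult_one: "m \<in> carrier M \<Longrightarrow> rsmult M m \<one>\<^bsub>B\<^esub> = m"
    and smult_rsmult: "\<lbrakk>a \<in> carrier A; m \<in> carrier M; b \<in> carrier B\<rbrakk> \<Longrightarrow>
      rsmult M (a \<odot>\<^bsub>M\<^esub> m) b = a \<odot>\<^bsub>M\<^esub> rsmult M m b"

definition mod_hom ::
  "('r, 'p) ring_scheme \<Rightarrow> ('r, 'x, 'q) module_scheme \<Rightarrow> ('r, 'y, 's) module_scheme \<Rightarrow> ('x \<Rightarrow> 'y) set"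
  where "mod_hom R X Y = {f \<in> carrier X \<rightarrow>\<^sub>E carrier Y.
    (\<forall>x\<in>carrier X. \<forall>y\<in>carrier X. f (x \<oplus>\<^bsub>X\<^esub> y) = f x \<oplus>\<^bsub>Y\<^esub> f y) \<and>
    (\<forall>a\<in>carrier R. \<forall>x\<in>carrier X. f (a \<odot>\<^bsub>X\<^esub> x) = a \<odot>\<^bsub>Y\<^esub> f x)}"

definition mod_iso ::
  "('r, 'p) ring_scheme \<Rightarrow> ('r, 'x, 'q) module_scheme \<Rightarrow> ('r, 'y, 's) module_scheme \<Rightarrow> bool"
  where "mod_iso R X Y \<longleftrightarrow> (\<exists>f\<in>mod_hom R X Y. bij_betw f (carrier X) (carrier Y))"

definition hom_group ::
  "('r, 'p) ring_scheme \<Rightarrow> ('r, 'x, 'q) module_scheme \<Rightarrow> ('r, 'y, 's) module_scheme \<Rightarrow> ('x \<Rightarrow> 'y) monoid"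
  where "hom_group R X Y = \<lparr>carrier = mod_hom R X Y,
    monoid.mult = (\<lambda>f g. \<lambda>x\<in>carrier X. f x \<oplus>\<^bsub>Y\<^esub> g x),
    one = (\<lambda>x\<in>carrier X. \<zero>\<^bsub>Y\<^esub>)\<rparr>"

definition short_exact ::
  "('r, 'p) ring_scheme \<Rightarrow> ('r, 'x, 'q) module_scheme \<Rightarrow> ('r, 'y, 's) module_scheme \<Rightarrow>
   ('r, 'z, 't) module_scheme \<Rightarrow> ('x \<Rightarrow> 'y) \<Rightarrow> ('y \<Rightarrow> 'z) \<Rightarrow> bool"
  where "short_exact R X Y Z f g \<longleftrightarrow> f \<in> mod_hom R X Y \<and> g \<in> mod_hom R Y Z \<and>
    inj_on f (carrier X) \<and> f ` carrier X = {y \<in> carrier Y. g y = \<zero>\<^bsub>Z\<^esub>} \<and>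
    g ` carrier Y = carrier Z"

definition quotient_module :: "('r, 'x) module \<Rightarrow> 'x set \<Rightarrow> ('r, 'x set) module"
  where "quotient_module X H = \<lparr>carrier = a_rcosets\<^bsub>X\<^esub> H, monoid.mult = undefined, one = undefined,
    ring.zero = H, ring.add = (\<lambda>C D. C <+>\<^bsub>X\<^esub> D),
    smult = (\<lambda>a C. the_elem ((\<lambda>x. H +>\<^bsub>X\<^esub> (a \<odot>\<^bsub>X\<^esub> x)) ` C))\<rparr>"

subsection \<open>Ext and Tor\<close>

text \<open>
  \<open>Ext\<^sup>1\<close> and \<open>Tor\<^sub>1\<close> are computed from the canonical free resolution
  \<open>\<dots> \<rightarrow> F\<^sub>2 \<rightarrow> F\<^sub>1 \<rightarrow> F\<^sub>0 \<rightarrow> X \<rightarrow> 0\<close>, where \<open>F\<^sub>0\<close> is free on the carrier of \<open>X\<close> and each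
  \<open>F\<^sub>n\<^sub>+\<^sub>1\<close> is free on the kernel of the map out of \<open>F\<^sub>n\<close>. All augmentations and differentials are
  instances of \<open>lin_comb\<close>, the homomorphism extending the inclusion of the basis.
\<close>

definition free_module :: "('r, 'p) ring_scheme \<Rightarrow> 's set \<Rightarrow> ('r, 's \<Rightarrow> 'r) module"
  where "free_module R S = \<lparr>carrier = {f. range f \<subseteq> carrier R \<and> finite {s. f s \<noteq> \<zero>\<^bsub>R\<^esub>} \<and>
      {s. f s \<noteq> \<zero>\<^bsub>R\<^esub>} \<subseteq> S},
    monoid.mult = undefined, one = undefined,
    ring.zero = (\<lambda>s. \<zero>\<^bsub>R\<^esub>), ring.add = (\<lambda>f g s. f s \<oplus>\<^bsub>R\<^esub> g s),
    smult = (\<lambda>a f s. a \<otimes>\<^bsub>R\<^esub> f s)\<rparr>"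

definition lin_comb :: "('r, 'p) ring_scheme \<Rightarrow> ('r, 'x, 'q) module_scheme \<Rightarrow> ('x \<Rightarrow> 'r) \<Rightarrow> 'x"
  where "lin_comb R X f = (\<Oplus>\<^bsub>X\<^esub>x\<in>{x. f x \<noteq> \<zero>\<^bsub>R\<^esub>}. f x \<odot>\<^bsub>X\<^esub> x)"

definition res0 :: "('r, 'p) ring_scheme \<Rightarrow> ('r, 'x, 'q) module_scheme \<Rightarrow> ('r, 'x \<Rightarrow> 'r) module"
  where "res0 R X = free_module R (carrier X)"

definition res1 ::
  "('r, 'p) ring_scheme \<Rightarrow> ('r, 'x, 'q) module_scheme \<Rightarrow> ('r, ('x \<Rightarrow> 'r) \<Rightarrow> 'r) module"
  where "res1 R X = free_module R {f \<in> carrier (res0 R X). lin_comb R X f = \<zero>\<^bsub>X\<^esub>}"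

definition res_d1 ::
  "('r, 'p) ring_scheme \<Rightarrow> ('r, 'x, 'q) module_scheme \<Rightarrow> (('x \<Rightarrow> 'r) \<Rightarrow> 'r) \<Rightarrow> ('x \<Rightarrow> 'r)"
  where "res_d1 R X = (\<lambda>f\<in>carrier (res1 R X). lin_comb R (res0 R X) f)"

definition res2 ::
  "('r, 'p) ring_scheme \<Rightarrow> ('r, 'x, 'q) module_scheme \<Rightarrow> ('r, (('x \<Rightarrow> 'r) \<Rightarrow> 'r) \<Rightarrow> 'r) module"
  where "res2 R X = free_module R {f \<in> carrier (res1 R X). res_d1 R X f = \<zero>\<^bsub>res0 R X\<^esub>}"

definition res_d2 ::
  "('r, 'p) ring_scheme \<Rightarrow> ('r, 'x, 'q) module_scheme \<Rightarrow> ((('x \<Rightarrow> 'r) \<Rightarrow> 'r) \<Rightarrow> 'r) \<Rightarrow> (('x \<Rightarrow> 'r) \<Rightarrow> 'r)"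
  where "res_d2 R X = (\<lambda>f\<in>carrier (res2 R X). lin_comb R (res1 R X) f)"

definition Ext1 ::
  "('r, 'p) ring_scheme \<Rightarrow> ('r, 'x, 'q) module_scheme \<Rightarrow> ('r, 'y, 's) module_scheme \<Rightarrow>
   ((('x \<Rightarrow> 'r) \<Rightarrow> 'r) \<Rightarrow> 'y) set monoid"
  where "Ext1 R X Y =
    (hom_group R (res1 R X) Y)
      \<lparr>carrier := {f \<in> mod_hom R (res1 R X) Y.
         compose (carrier (res2 R X)) f (res_d2 R X) = (\<lambda>z\<in>carrier (res2 R X). \<zero>\<^bsub>Y\<^esub>)}\<rparr>
    Mod ((\<lambda>g. compose (carrier (res1 R X)) g (res_d1 R X)) ` mod_hom R (res0 R X) Y)"

subsection \<open>Tensor products\<close>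

definition tensor_rel ::
  "('b, 'p) ring_scheme \<Rightarrow> ('a, 'b, 'm) bimodule \<Rightarrow> ('b, 'x, 'q) module_scheme \<Rightarrow> ('m \<times> 'x \<Rightarrow>\<^sub>0 int) set"
  where "tensor_rel B M X = generate (free_Abelian_group (carrier M \<times> carrier X))
    ({frag_of (m \<oplus>\<^bsub>M\<^esub> n, x) - frag_of (m, x) - frag_of (n, x) | m n x.
        m \<in> carrier M \<and> n \<in> carrier M \<and> x \<in> carrier X} \<union>
     {frag_of (m, x \<oplus>\<^bsub>X\<^esub> y) - frag_of (m, x) - frag_of (m, y) | m x y.
        m \<in> carrier M \<and> x \<in> carrier X \<and> y \<in> carrier X} \<union>
     {frag_of (rsmult M m b, x) - frag_of (m, b \<odot>\<^bsub>X\<^esub> x) | m b x.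
        m \<in> carrier M \<and> b \<in> carrier B \<and> x \<in> carrier X})"

definition tensor_class ::
  "('b, 'p) ring_scheme \<Rightarrow> ('a, 'b, 'm) bimodule \<Rightarrow> ('b, 'x, 'q) module_scheme \<Rightarrow>
   ('m \<times> 'x \<Rightarrow>\<^sub>0 int) \<Rightarrow> ('m \<times> 'x \<Rightarrow>\<^sub>0 int) set"
  where "tensor_class B M X p =
    tensor_rel B M X #>\<^bsub>free_Abelian_group (carrier M \<times> carrier X)\<^esub> p"

text \<open>The left \<open>A\<close>-module \<open>M \<otimes>\<^sub>B X\<close>.\<close>

definition tensor ::
  "('b, 'p) ring_scheme \<Rightarrow> ('a, 'b, 'm) bimodule \<Rightarrow> ('b, 'x, 'q) module_scheme \<Rightarrow>
   ('a, ('m \<times> 'x \<Rightarrow>\<^sub>0 int) set) module"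
  where "tensor B M X = (let F = free_Abelian_group (carrier M \<times> carrier X) in
    \<lparr>carrier = tensor_class B M X ` carrier F, monoid.mult = undefined, one = undefined,
     ring.zero = tensor_class B M X 0, ring.add = (\<lambda>C D. C <#>\<^bsub>F\<^esub> D),
     smult = (\<lambda>a C. the_elem
       ((\<lambda>p. tensor_class B M X (frag_extend (\<lambda>(m, x). frag_of (a \<odot>\<^bsub>M\<^esub> m, x)) p)) ` C))\<rparr>)"

definition pure_tensor ::
  "('b, 'p) ring_scheme \<Rightarrow> ('a, 'b, 'm) bimodule \<Rightarrow> ('b, 'x, 'q) module_scheme \<Rightarrow>
   'm \<Rightarrow> 'x \<Rightarrow> ('m \<times> 'x \<Rightarrow>\<^sub>0 int) set"
  where "pure_tensor B M X m x = tensor_class B M X (frag_of (m, x))"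

text \<open>
  The additive map \<open>M \<otimes>\<^sub>B X \<rightarrow> G\<close> with \<open>m \<otimes> x \<mapsto> h m x\<close> induced by a biadditive, \<open>B\<close>-balanced map
  \<open>h\<close>: each representative of a coset is sent to the corresponding integral combination of values
  of \<open>h\<close>, which does not depend on the representative.
\<close>

definition tensor_lift ::
  "('b, 'p) ring_scheme \<Rightarrow> ('a, 'b, 'm) bimodule \<Rightarrow> ('b, 'x, 'q) module_scheme \<Rightarrow>
   ('g, 's) ring_scheme \<Rightarrow> ('m \<Rightarrow> 'x \<Rightarrow> 'g) \<Rightarrow> ('m \<times> 'x \<Rightarrow>\<^sub>0 int) set \<Rightarrow> 'g"
  where "tensor_lift B M X G h = (\<lambda>C\<in>carrier (tensor B M X). the_elem
    ((\<lambda>p. \<Oplus>\<^bsub>G\<^esub>q\<in>Poly_Mapping.keys p. [Poly_Mapping.lookup p q] \<cdot>\<^bsub>G\<^esub> h (fst q) (snd q)) ` C))"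

text \<open>The map \<open>1\<^sub>M \<otimes> f : M \<otimes>\<^sub>B X \<rightarrow> M \<otimes>\<^sub>B Y\<close>.\<close>

definition tensor_map ::
  "('b, 'p) ring_scheme \<Rightarrow> ('a, 'b, 'm) bimodule \<Rightarrow> ('b, 'x, 'q) module_scheme \<Rightarrow>
   ('b, 'y, 's) module_scheme \<Rightarrow> ('x \<Rightarrow> 'y) \<Rightarrow> ('m \<times> 'x \<Rightarrow>\<^sub>0 int) set \<Rightarrow> ('m \<times> 'y \<Rightarrow>\<^sub>0 int) set"
  where "tensor_map B M X Y f =
    tensor_lift B M X (tensor B M Y) (\<lambda>m x. pure_tensor B M Y m (f x))"

definition Tor1 ::
  "('b, 'p) ring_scheme \<Rightarrow> ('a, 'b, 'm) bimodule \<Rightarrow> ('b, 'x, 'q) module_scheme \<Rightarrow>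
   ('m \<times> (('x \<Rightarrow> 'b) \<Rightarrow> 'b) \<Rightarrow>\<^sub>0 int) set set monoid"
  where "Tor1 B M X =
    (add_monoid (tensor B M (res1 B X)))
      \<lparr>carrier := {t \<in> carrier (tensor B M (res1 B X)).
         tensor_map B M (res1 B X) (res0 B X) (res_d1 B X) t = \<zero>\<^bsub>tensor B M (res0 B X)\<^esub>}\<rparr>
    Mod (tensor_map B M (res2 B X) (res1 B X) (res_d2 B X) ` carrier (tensor B M (res2 B X)))"

subsection \<open>Classes of modules and cotorsion pairs\<close>

text \<open>
  HOL has no proper classes, so \<open>R\<close>-Mod is formed inside a universe, namely a type \<open>'u\<close>. A set is
  small if its cardinality is strictly less than that of \<open>'u\<close>; the objects of \<open>R\<close>-Mod are the left
  modules whose carrier is a small subset of \<open>'u\<close>, a class of modules is any HOL set of objects,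
  and a cotorsion pair is generated by a set if it is generated by a small set of objects.

  The universe is required to contain the natural numbers and the given index sets \<open>I\<close> (the
  carriers of the rings and of the bimodule), and to be closed under \<open>I\<close>-fold powers. Every type of
  strongly inaccessible cardinality, i.e. every Grothendieck universe, containing these sets has
  this property, and so has every type of cardinality \<open>\<kappa>\<^sup>+\<close> where \<open>\<kappa>\<close> is infinite and
  \<open>\<kappa>\<^bsup>|I|\<^esup> = \<kappa>\<close> for each \<open>I\<close>.
\<close>

definition universe_for :: "'u itself \<Rightarrow> 'i set \<Rightarrow> bool"
  where "universe_for U I \<longleftrightarrow> uncountable (UNIV :: 'u set) \<and> I \<prec> (UNIV :: 'u set) \<and>
    (\<forall>X :: 'u set. X \<prec> (UNIV :: 'u set) \<longrightarrow> (I \<rightarrow>\<^sub>E X) \<prec> (UNIV :: 'u set))"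

definition Mod_cat :: "('r, 'p) ring_scheme \<Rightarrow> ('r, 'u) module set"
  where "Mod_cat R = {X. left_module R X \<and> carrier X \<prec> (UNIV :: 'u set)}"

definition right_perp :: "('r, 'p) ring_scheme \<Rightarrow> ('r, 'u) module set \<Rightarrow> ('r, 'u) module set"
  where "right_perp R \<S> = {X \<in> Mod_cat R. \<forall>S\<in>\<S>. trivial_group (Ext1 R S X)}"

definition left_perp :: "('r, 'p) ring_scheme \<Rightarrow> ('r, 'u) module set \<Rightarrow> ('r, 'u) module set"
  where "left_perp R \<S> = {Y \<in> Mod_cat R. \<forall>S\<in>\<S>. trivial_group (Ext1 R Y S)}"

definition cotorsion_pair ::
  "('r, 'p) ring_scheme \<Rightarrow> ('r, 'u) module set \<Rightarrow> ('r, 'u) module set \<Rightarrow> bool"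
  where "cotorsion_pair R \<X> \<Y> \<longleftrightarrow> right_perp R \<X> = \<Y> \<and> \<X> = left_perp R \<Y>"

definition generated_by_set ::
  "('r, 'p) ring_scheme \<Rightarrow> ('r, 'u) module set \<Rightarrow> ('r, 'u) module set \<Rightarrow> bool"
  where "generated_by_set R \<X> \<Y> \<longleftrightarrow>
    (\<exists>\<S> \<subseteq> Mod_cat R. \<S> \<prec> (UNIV :: 'u set) \<and> \<Y> = right_perp R \<S>)"

definition projective :: "('r, 'p) ring_scheme \<Rightarrow> ('r, 'u) module \<Rightarrow> bool"
  where "projective R P \<longleftrightarrow> P \<in> Mod_cat R \<and>
    (\<forall>Y \<in> (Mod_cat R :: ('r, 'u) module set). \<forall>Z \<in> (Mod_cat R :: ('r, 'u) module set).
      \<forall>g \<in> mod_hom R Y Z. \<forall>f \<in> mod_hom R P Z. g ` carrier Y = carrier Z \<longrightarrow>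
        (\<exists>h \<in> mod_hom R P Y. \<forall>x\<in>carrier P. g (h x) = f x))"

definition injective :: "('r, 'p) ring_scheme \<Rightarrow> ('r, 'u) module \<Rightarrow> bool"
  where "injective R J \<longleftrightarrow> J \<in> Mod_cat R \<and>
    (\<forall>X \<in> (Mod_cat R :: ('r, 'u) module set). \<forall>Y \<in> (Mod_cat R :: ('r, 'u) module set).
      \<forall>i \<in> mod_hom R X Y. \<forall>f \<in> mod_hom R X J. inj_on i (carrier X) \<longrightarrow>
        (\<exists>h \<in> mod_hom R Y J. \<forall>x\<in>carrier X. h (i x) = f x))"

definition closed_under_extensions :: "('r, 'p) ring_scheme \<Rightarrow> ('r, 'u) module set \<Rightarrow> bool"
  where "closed_under_extensions R \<X> \<longleftrightarrow>
    (\<forall>X \<in> \<X>. \<forall>Y \<in> Mod_cat R. \<forall>Z \<in> \<X>. \<forall>f g. short_exact R X Y Z f g \<longrightarrow> Y \<in> \<X>)"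

definition closed_under_epi_kernels :: "('r, 'p) ring_scheme \<Rightarrow> ('r, 'u) module set \<Rightarrow> bool"
  where "closed_under_epi_kernels R \<X> \<longleftrightarrow>
    (\<forall>X \<in> Mod_cat R. \<forall>Y \<in> \<X>. \<forall>Z \<in> \<X>. \<forall>f g. short_exact R X Y Z f g \<longrightarrow> X \<in> \<X>)"

definition closed_under_mono_cokernels :: "('r, 'p) ring_scheme \<Rightarrow> ('r, 'u) module set \<Rightarrow> bool"
  where "closed_under_mono_cokernels R \<X> \<longleftrightarrow>
    (\<forall>X \<in> \<X>. \<forall>Y \<in> \<X>. \<forall>Z \<in> Mod_cat R. \<forall>f g. short_exact R X Y Z f g \<longrightarrow> Z \<in> \<X>)"

definition closed_under_summands :: "('r, 'p) ring_scheme \<Rightarrow> ('r, 'u) module set \<Rightarrow> bool"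
  where "closed_under_summands R \<X> \<longleftrightarrow>
    (\<forall>X \<in> Mod_cat R. \<forall>Y \<in> \<X>. \<forall>i \<in> mod_hom R X Y. \<forall>p \<in> mod_hom R Y X.
      (\<forall>x\<in>carrier X. p (i x) = x) \<longrightarrow> X \<in> \<X>)"

definition resolving :: "('r, 'p) ring_scheme \<Rightarrow> ('r, 'u) module set \<Rightarrow> bool"
  where "resolving R \<X> \<longleftrightarrow> (\<forall>P. projective R P \<longrightarrow> P \<in> \<X>) \<and> closed_under_extensions R \<X> \<and>
    closed_under_epi_kernels R \<X> \<and> closed_under_summands R \<X>"

definition coresolving :: "('r, 'p) ring_scheme \<Rightarrow> ('r, 'u) module set \<Rightarrow> bool"
  where "coresolving R \<Y> \<longleftrightarrow> (\<forall>J. injective R J \<longrightarrow> J \<in> \<Y>) \<and> closed_under_extensions R \<Y> \<and>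
    closed_under_mono_cokernels R \<Y> \<and> closed_under_summands R \<Y>"

definition hereditary_cotorsion_pair ::
  "('r, 'p) ring_scheme \<Rightarrow> ('r, 'u) module set \<Rightarrow> ('r, 'u) module set \<Rightarrow> bool"
  where "hereditary_cotorsion_pair R \<X> \<Y> \<longleftrightarrow>
    cotorsion_pair R \<X> \<Y> \<and> resolving R \<X> \<and> coresolving R \<Y>"

subsection \<open>Triangular matrix rings and their modules\<close>

text \<open>The triple \<open>(a, m, b)\<close> stands for the matrix with rows \<open>(a, m)\<close> and \<open>(0, b)\<close>.\<close>

definition tri_ring ::
  "('a, 'p) ring_scheme \<Rightarrow> ('b, 'q) ring_scheme \<Rightarrow> ('a, 'b, 'm) bimodule \<Rightarrow> ('a \<times> 'm \<times> 'b) ring"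
  where "tri_ring A B M = \<lparr>carrier = carrier A \<times> carrier M \<times> carrier B,
    monoid.mult = (\<lambda>(a, m, b) (a', m', b').
      (a \<otimes>\<^bsub>A\<^esub> a', a \<odot>\<^bsub>M\<^esub> m' \<oplus>\<^bsub>M\<^esub> rsmult M m b', b \<otimes>\<^bsub>B\<^esub> b')),
    one = (\<one>\<^bsub>A\<^esub>, \<zero>\<^bsub>M\<^esub>, \<one>\<^bsub>B\<^esub>), ring.zero = (\<zero>\<^bsub>A\<^esub>, \<zero>\<^bsub>M\<^esub>, \<zero>\<^bsub>B\<^esub>),
    ring.add = (\<lambda>(a, m, b) (a', m', b'). (a \<oplus>\<^bsub>A\<^esub> a', m \<oplus>\<^bsub>M\<^esub> m', b \<oplus>\<^bsub>B\<^esub> b'))\<rparr>"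

text \<open>
  A left \<open>T\<close>-module \<open>N\<close> is identified with the triple \<open>(N\<^sub>1, N\<^sub>2, \<phi>)\<close> given by the Peirce components
  \<open>N\<^sub>1 = (1, 0, 0) N\<close> and \<open>N\<^sub>2 = (0, 0, 1) N\<close> and by \<open>\<phi> (m \<otimes> x) = (0, m, 0) x\<close>, so that
  \<open>N\<close> is the direct sum of \<open>N\<^sub>1\<close> and \<open>N\<^sub>2\<close> with
  \<open>(a, m, b) (x\<^sub>1 + x\<^sub>2) = (a x\<^sub>1 + \<phi> (m \<otimes> x\<^sub>2)) + b x\<^sub>2\<close>.
\<close>

definition tri_fst ::
  "('a, 'p) ring_scheme \<Rightarrow> ('b, 'q) ring_scheme \<Rightarrow> ('a, 'b, 'm) bimodule \<Rightarrow>
   ('a \<times> 'm \<times> 'b, 'u) module \<Rightarrow> ('a, 'u) module"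
  where "tri_fst A B M N = \<lparr>carrier = (\<lambda>x. (\<one>\<^bsub>A\<^esub>, \<zero>\<^bsub>M\<^esub>, \<zero>\<^bsub>B\<^esub>) \<odot>\<^bsub>N\<^esub> x) ` carrier N,
    monoid.mult = monoid.mult N, one = one N, ring.zero = ring.zero N, ring.add = ring.add N,
    smult = (\<lambda>a x. (a, \<zero>\<^bsub>M\<^esub>, \<zero>\<^bsub>B\<^esub>) \<odot>\<^bsub>N\<^esub> x)\<rparr>"

definition tri_snd ::
  "('a, 'p) ring_scheme \<Rightarrow> ('b, 'q) ring_scheme \<Rightarrow> ('a, 'b, 'm) bimodule \<Rightarrow>
   ('a \<times> 'm \<times> 'b, 'u) module \<Rightarrow> ('b, 'u) module"
  where "tri_snd A B M N = \<lparr>carrier = (\<lambda>x. (\<zero>\<^bsub>A\<^esub>, \<zero>\<^bsub>M\<^esub>, \<one>\<^bsub>B\<^esub>) \<odot>\<^bsub>N\<^esub> x) ` carrier N,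
    monoid.mult = monoid.mult N, one = one N, ring.zero = ring.zero N, ring.add = ring.add N,
    smult = (\<lambda>b x. (\<zero>\<^bsub>A\<^esub>, \<zero>\<^bsub>M\<^esub>, b) \<odot>\<^bsub>N\<^esub> x)\<rparr>"

definition tri_phi ::
  "('a, 'p) ring_scheme \<Rightarrow> ('b, 'q) ring_scheme \<Rightarrow> ('a, 'b, 'm) bimodule \<Rightarrow>
   ('a \<times> 'm \<times> 'b, 'u) module \<Rightarrow> ('m \<times> 'u \<Rightarrow>\<^sub>0 int) set \<Rightarrow> 'u"
  where "tri_phi A B M N = tensor_lift B M (tri_snd A B M N) (tri_fst A B M N)
    (\<lambda>m x. (\<zero>\<^bsub>A\<^esub>, m, \<zero>\<^bsub>B\<^esub>) \<odot>\<^bsub>N\<^esub> x)"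

definition tri_psi ::
  "('a, 'p) ring_scheme \<Rightarrow> ('b, 'q) ring_scheme \<Rightarrow> ('a, 'b, 'm) bimodule \<Rightarrow>
   ('a \<times> 'm \<times> 'b, 'u) module \<Rightarrow> 'u \<Rightarrow> 'm \<Rightarrow> 'u"
  where "tri_psi A B M N = (\<lambda>x\<in>carrier (tri_snd A B M N). \<lambda>m\<in>carrier M.
    tri_phi A B M N (pure_tensor B M (tri_snd A B M N) m x))"

definition Rep_class ::
  "('a, 'p) ring_scheme \<Rightarrow> ('b, 'q) ring_scheme \<Rightarrow> ('a, 'b, 'm) bimodule \<Rightarrow>
   ('a, 'u) module set \<Rightarrow> ('b, 'u) module set \<Rightarrow> ('a \<times> 'm \<times> 'b, 'u) module set"
  where "Rep_class A B M \<C> \<D> =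
    {N \<in> Mod_cat (tri_ring A B M). tri_fst A B M N \<in> \<C> \<and> tri_snd A B M N \<in> \<D>}"

text \<open>
  The elements of the cokernel of \<open>\<phi>\<close> are cosets, so its membership in a class of modules with
  elements in \<open>'u\<close> is understood up to isomorphism.
\<close>

definition Phi_class ::
  "('a, 'p) ring_scheme \<Rightarrow> ('b, 'q) ring_scheme \<Rightarrow> ('a, 'b, 'm) bimodule \<Rightarrow>
   ('a, 'u) module set \<Rightarrow> ('b, 'u) module set \<Rightarrow> ('a \<times> 'm \<times> 'b, 'u) module set"
  where "Phi_class A B M \<C> \<D> = {N \<in> Mod_cat (tri_ring A B M).
    inj_on (tri_phi A B M N) (carrier (tensor B M (tri_snd A B M N))) \<and>
    (\<exists>C\<in>\<C>. mod_iso A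
      (quotient_module (tri_fst A B M N) (tri_phi A B M N ` carrier (tensor B M (tri_snd A B M N)))) C) \<and>
    tri_snd A B M N \<in> \<D>}"

definition Psi_class ::
  "('a, 'p) ring_scheme \<Rightarrow> ('b, 'q) ring_scheme \<Rightarrow> ('a, 'b, 'm) bimodule \<Rightarrow>
   ('a, 'u) module set \<Rightarrow> ('b, 'u) module set \<Rightarrow> ('a \<times> 'm \<times> 'b, 'u) module set"
  where "Psi_class A B M \<C> \<D> = {N \<in> Mod_cat (tri_ring A B M).
    tri_psi A B M N ` carrier (tri_snd A B M N) = mod_hom A M (tri_fst A B M N) \<and>
    tri_fst A B M N \<in> \<C> \<and>
    (tri_snd A B M N)\<lparr>carrier := {x \<in> carrier (tri_snd A B M N).
       tri_psi A B M N x = (\<lambda>m\<in>carrier M. \<zero>\<^bsub>tri_fst A B M N\<^esub>)}\<rparr> \<in> \<D>}"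

end

theory Submission
 imports Defs
begin

text \<open>
 A \<open>T\<close>-module \<open>N\<close> has components \<open>N\<^sub>1\<close>, \<open>N\<^sub>2\<close> and structure maps \<open>\<phi>\<close>, \<open>\<psi>\<close>. Four computations of Ext over \<open>T\<close>
 carry the proof:

 \<^item> \<open>Ext (X \<oplus> 0, N) = 0\<close> iff \<open>Ext (X, N\<^sub>1) = 0\<close>, and \<open>Ext (N, 0 \<oplus> Y) = 0\<close> iff \<open>Ext (N\<^sub>2, Y) = 0\<close>
  (\<open>ext_zero_inc1\<close>, \<open>ext_zero_inc2\<close>);
 \<^item> \<open>Ext (M \<otimes> Y \<oplus> Y, N) = 0\<close> iff \<open>Ext (Y, N\<^sub>2) = 0\<close> if \<open>Tor\<^sub>1 (M, Y) = 0\<close> (\<open>ext_zero_indI\<close>, \<open>ext_zero_indD\<close>);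
 \<^item> \<open>Ext (N, X \<oplus> Hom (M, X)) = 0\<close> iff \<open>Ext (N\<^sub>1, X) = 0\<close> if \<open>Ext (M, X) = 0\<close> (\<open>ext_zero_coindI\<close>,
  \<open>ext_zero_coindD\<close>).

 If \<open>\<phi>\<close> is injective, then \<open>N\<close> is an extension of \<open>coker \<phi> \<oplus> 0\<close> by the submodule generated by \<open>N\<^sub>2\<close>, which
 is induced from \<open>N\<^sub>2\<close>; hence \<open>\<Phi>\<close> is orthogonal to \<open>Rep (\<B>, \<D>)\<close>. If \<open>\<psi>\<close> is onto, then \<open>N\<close> is an extension of
 \<open>N\<^sub>1 \<oplus> Hom (M, N\<^sub>1)\<close> by \<open>0 \<oplus> ker \<psi>\<close>; hence \<open>Rep (\<A>, \<C>)\<close> is orthogonal to \<open>\<Psi>\<close>. Conversely, the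
 components of a module in an orthogonal class are detected by test modules of the above forms. That \<open>\<phi>\<close>
 is injective is detected by \<open>J \<oplus> 0\<close> with \<open>J\<close> the injective cogenerator of \<open>A\<close>-Mod, and that \<open>\<psi>\<close> is onto by
 \<open>0 \<oplus> B\<close>. Test modules built from generating sets of \<open>(\<A>, \<B>)\<close> and \<open>(\<C>, \<D>)\<close> generate the pairs over \<open>T\<close>.
 For the converse implication, the modules \<open>X \<oplus> 0\<close> and \<open>0 \<oplus> Y\<close> carry the pairs over \<open>T\<close> back to the
 components; the cokernels and the second components of a generating set of the first pair are generating sets.

 Tensor products enter through characters, that is, additive maps to \<open>\<rat>/\<int>\<close>. A homomorphism from \<open>Y\<close> to the
 character module \<open>M\<^sup>+\<close> is a character of \<open>M \<otimes> Y\<close>, so that \<open>\<phi>\<close> is injective iff every homomorphism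
 \<open>N\<^sub>2 \<rightarrow> M\<^sup>+\<close> comes from a character of \<open>N\<^sub>1\<close> (\<open>phi_inj_iff\<close>), and \<open>Tor\<^sub>1 (M, Y) = 0\<close> implies
 \<open>Ext (Y, M\<^sup>+) = 0\<close> (\<open>Tor1_ext_zero\<close>).
\<close>

section \<open>Modules and homomorphisms\<close>

lemma left_moduleI:
 assumes "ring R"
  and "!!x y. [|x \<in> carrier X; y \<in> carrier X|] ==> x \<oplus>\<^bsub>X\<^esub> y \<in> carrier X"
  and "\<zero>\<^bsub>X\<^esub> \<in> carrier X"
  and "!!x y z. [|x \<in> carrier X; y \<in> carrier X; z \<in> carrier X|] ==>
   (x \<oplus>\<^bsub>X\<^esub> y) \<oplus>\<^bsub>X\<^esub> z = x \<oplus>\<^bsub>X\<^esub> (y \<oplus>\<^bsub>X\<^esub> z)"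
  and "!!x y. [|x \<in> carrier X; y \<in> carrier X|] ==> x \<oplus>\<^bsub>X\<^esub> y = y \<oplus>\<^bsub>X\<^esub> x"
  and "!!x. x \<in> carrier X ==> \<zero>\<^bsub>X\<^esub> \<oplus>\<^bsub>X\<^esub> x = x"
  and "!!x. x \<in> carrier X ==> \<exists>y\<in>carrier X. y \<oplus>\<^bsub>X\<^esub> x = \<zero>\<^bsub>X\<^esub>"
  and "!!a x. [|a \<in> carrier R; x \<in> carrier X|] ==> a \<odot>\<^bsub>X\<^esub> x \<in> carrier X"
  and "!!a b x. [|a \<in> carrier R; b \<in> carrier R; x \<in> carrier X|] ==>
   (a \<oplus>\<^bsub>R\<^esub> b) \<odot>\<^bsub>X\<^esub> x = a \<odot>\<^bsub>X\<^esub> x \<oplus>\<^bsub>X\<^esub> b \<odot>\<^bsub>X\<^esub> x"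
  and "!!a x y. [|a \<in> carrier R; x \<in> carrier X; y \<in> carrier X|] ==>
   a \<odot>\<^bsub>X\<^esub> (x \<oplus>\<^bsub>X\<^esub> y) = a \<odot>\<^bsub>X\<^esub> x \<oplus>\<^bsub>X\<^esub> a \<odot>\<^bsub>X\<^esub> y"
  and "!!a b x. [|a \<in> carrier R; b \<in> carrier R; x \<in> carrier X|] ==>
   (a \<otimes>\<^bsub>R\<^esub> b) \<odot>\<^bsub>X\<^esub> x = a \<odot>\<^bsub>X\<^esub> (b \<odot>\<^bsub>X\<^esub> x)"
  and "!!x. x \<in> carrier X ==> \<one>\<^bsub>R\<^esub> \<odot>\<^bsub>X\<^esub> x = x"
 shows "left_module R X"
proof -
 have "abelian_group X" by (rule abelian_groupI) (use assms in auto)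
 then show ?thesis using assms by (auto simp: left_module_def left_module_axioms_def)
qed

context left_module
begin

lemma smult_r_zero [simp]:
 assumes "a \<in> carrier R" shows "a \<odot>\<^bsub>X\<^esub> \<zero>\<^bsub>X\<^esub> = \<zero>\<^bsub>X\<^esub>"
proof -
 have "a \<odot>\<^bsub>X\<^esub> \<zero>\<^bsub>X\<^esub> \<oplus>\<^bsub>X\<^esub> a \<odot>\<^bsub>X\<^esub> \<zero>\<^bsub>X\<^esub> = a \<odot>\<^bsub>X\<^esub> \<zero>\<^bsub>X\<^esub> \<oplus>\<^bsub>X\<^esub> \<zero>\<^bsub>X\<^esub>"
  using assms smult_r_distr[of a "\<zero>\<^bsub>X\<^esub>" "\<zero>\<^bsub>X\<^esub>"] smult_closed by simp
 then show ?thesis using assms smult_closed[of a "\<zero>\<^bsub>X\<^esub>"] by simp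
qed

lemma smult_l_zero [simp]:
 assumes "x \<in> carrier X" shows "\<zero>\<^bsub>R\<^esub> \<odot>\<^bsub>X\<^esub> x = \<zero>\<^bsub>X\<^esub>"
proof -
 have "\<zero>\<^bsub>R\<^esub> \<odot>\<^bsub>X\<^esub> x \<oplus>\<^bsub>X\<^esub> \<zero>\<^bsub>R\<^esub> \<odot>\<^bsub>X\<^esub> x = \<zero>\<^bsub>R\<^esub> \<odot>\<^bsub>X\<^esub> x \<oplus>\<^bsub>X\<^esub> \<zero>\<^bsub>X\<^esub>"
  using assms smult_l_distr[of "\<zero>\<^bsub>R\<^esub>" "\<zero>\<^bsub>R\<^esub>" x] smult_closed[of "\<zero>\<^bsub>R\<^esub>" x] by simp
 then show ?thesis using assms smult_closed[of "\<zero>\<^bsub>R\<^esub>" x] by simp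
qed

lemma smult_minus_one:
 assumes "x \<in> carrier X" shows "(\<ominus>\<^bsub>R\<^esub> \<one>\<^bsub>R\<^esub>) \<odot>\<^bsub>X\<^esub> x = \<ominus>\<^bsub>X\<^esub> x"
proof -
 have "(\<ominus>\<^bsub>R\<^esub> \<one>\<^bsub>R\<^esub>) \<odot>\<^bsub>X\<^esub> x \<oplus>\<^bsub>X\<^esub> x = \<zero>\<^bsub>X\<^esub>"
  using assms smult_l_distr[of "\<ominus>\<^bsub>R\<^esub> \<one>\<^bsub>R\<^esub>" "\<one>\<^bsub>R\<^esub>" x] by (simp add: R.l_neg smult_one)
 then show ?thesis
  using assms smult_closed[of "\<ominus>\<^bsub>R\<^esub> \<one>\<^bsub>R\<^esub>" x] X.minus_equality by fastforce
qed

lemma diff_zero_imp_eq: "[|x \<in> carrier X; y \<in> carrier X; x \<ominus>\<^bsub>X\<^esub> y = \<zero>\<^bsub>X\<^esub>|] ==> x = y"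
 by (metis X.add.inv_closed X.add.inv_equality X.add.inv_inv a_minus_def)

lemma add_diff_cancel: "[|x \<in> carrier X; y \<in> carrier X|] ==> x \<oplus>\<^bsub>X\<^esub> (y \<ominus>\<^bsub>X\<^esub> x) = y"
 by (simp add: a_minus_def X.a_comm[of y] X.r_neg2)

lemma diff_add_cancel: "[|x \<in> carrier X; y \<in> carrier X|] ==> (y \<ominus>\<^bsub>X\<^esub> x) \<oplus>\<^bsub>X\<^esub> x = y"
 by (simp add: a_minus_def X.a_assoc X.l_neg)

lemma diff_self: "x \<in> carrier X ==> x \<ominus>\<^bsub>X\<^esub> x = \<zero>\<^bsub>X\<^esub>"
 by (simp add: a_minus_def X.r_neg)

lemma diff_zero: "x \<in> carrier X ==> x \<ominus>\<^bsub>X\<^esub> \<zero>\<^bsub>X\<^esub> = x"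
 using diff_add_cancel[of "\<zero>\<^bsub>X\<^esub>" x] X.minus_closed[of x "\<zero>\<^bsub>X\<^esub>"] by simp

end

lemma mod_homI:
 assumes "f \<in> extensional (carrier X)"
  and "!!x. x \<in> carrier X ==> f x \<in> carrier Y"
  and "!!x y. [|x \<in> carrier X; y \<in> carrier X|] ==> f (x \<oplus>\<^bsub>X\<^esub> y) = f x \<oplus>\<^bsub>Y\<^esub> f y"
  and "!!a x. [|a \<in> carrier R; x \<in> carrier X|] ==> f (a \<odot>\<^bsub>X\<^esub> x) = a \<odot>\<^bsub>Y\<^esub> f x"
 shows "f \<in> mod_hom R X Y" using assms by (auto simp: mod_hom_def PiE_def)

lemma mhom_restrictI:
 assumes "left_module R X"
  and "!!x. x \<in> carrier X ==> f x \<in> carrier Y"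
  and "!!x y. [|x \<in> carrier X; y \<in> carrier X|] ==> f (x \<oplus>\<^bsub>X\<^esub> y) = f x \<oplus>\<^bsub>Y\<^esub> f y"
  and "!!a x. [|a \<in> carrier R; x \<in> carrier X|] ==> f (a \<odot>\<^bsub>X\<^esub> x) = a \<odot>\<^bsub>Y\<^esub> f x"
 shows "(\<lambda>x\<in>carrier X. f x) \<in> mod_hom R X Y"
proof -
 interpret X: left_module R X by fact
 show ?thesis by (rule mod_homI) (use assms X.smult_closed in auto)
qed

lemma mhom_closed: "[|f \<in> mod_hom R X Y; x \<in> carrier X|] ==> f x \<in> carrier Y"
 by (auto simp: mod_hom_def)

lemma mhom_add:
 "[|f \<in> mod_hom R X Y; x \<in> carrier X; y \<in> carrier X|] ==> f (x \<oplus>\<^bsub>X\<^esub> y) = f x \<oplus>\<^bsub>Y\<^esub> f y"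
 by (auto simp: mod_hom_def)

lemma mhom_smult:
 "[|f \<in> mod_hom R X Y; a \<in> carrier R; x \<in> carrier X|] ==> f (a \<odot>\<^bsub>X\<^esub> x) = a \<odot>\<^bsub>Y\<^esub> f x"
 by (auto simp: mod_hom_def)

lemma mhom_extensional: "f \<in> mod_hom R X Y ==> f \<in> extensional (carrier X)"
 by (auto simp: mod_hom_def PiE_def)

lemma mhom_eqI:
 "[|f \<in> mod_hom R X Y; g \<in> mod_hom R X Y'; !!x. x \<in> carrier X ==> f x = g x|] ==> f = g"
 by (meson extensionalityI mhom_extensional)

lemma mhom_zero:
 assumes "left_module R X" "left_module R Y" "f \<in> mod_hom R X Y"
 shows "f \<zero>\<^bsub>X\<^esub> = \<zero>\<^bsub>Y\<^esub>"
proof -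
 interpret X: left_module R X by fact
 interpret Y: left_module R Y by fact
 have "f (\<zero>\<^bsub>R\<^esub> \<odot>\<^bsub>X\<^esub> \<zero>\<^bsub>X\<^esub>) = \<zero>\<^bsub>R\<^esub> \<odot>\<^bsub>Y\<^esub> f \<zero>\<^bsub>X\<^esub>"
  using mhom_smult[OF assms(3), of "\<zero>\<^bsub>R\<^esub>" "\<zero>\<^bsub>X\<^esub>"] by simp
 then show ?thesis using mhom_closed[OF assms(3), of "\<zero>\<^bsub>X\<^esub>"] by simp
qed

lemma mhom_uminus:
 assumes "left_module R X" "left_module R Y" "f \<in> mod_hom R X Y" "x \<in> carrier X"
 shows "f (\<ominus>\<^bsub>X\<^esub> x) = \<ominus>\<^bsub>Y\<^esub> f x"
proof -
 interpret X: left_module R X by fact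
 interpret Y: left_module R Y by fact
 have "f ((\<ominus>\<^bsub>R\<^esub> \<one>\<^bsub>R\<^esub>) \<odot>\<^bsub>X\<^esub> x) = (\<ominus>\<^bsub>R\<^esub> \<one>\<^bsub>R\<^esub>) \<odot>\<^bsub>Y\<^esub> f x"
  using assms(4) mhom_smult[OF assms(3)] by simp
 then show ?thesis using assms(4) mhom_closed[OF assms(3)] by (simp add: X.smult_minus_one Y.smult_minus_one)
qed

lemma mhom_diff:
 assumes "left_module R X" "left_module R Y" "f \<in> mod_hom R X Y" "x \<in> carrier X" "y \<in> carrier X"
 shows "f (x \<ominus>\<^bsub>X\<^esub> y) = f x \<ominus>\<^bsub>Y\<^esub> f y"
proof -
 interpret X: left_module R X by fact
 show ?thesis using assms by (simp add: a_minus_def mhom_add mhom_uminus)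
qed

lemma mhom_compose:
 assumes "left_module R X" "f \<in> mod_hom R X Y" "g \<in> mod_hom R Y Z"
 shows "compose (carrier X) g f \<in> mod_hom R X Z"
 unfolding compose_def by (rule mhom_restrictI)
  (use assms in \<open>auto simp: mhom_closed mhom_add mhom_smult\<close>)

lemma mhom_id: "left_module R X ==> (\<lambda>x\<in>carrier X. x) \<in> mod_hom R X X"
 by (rule mhom_restrictI) auto

lemma mhom_diff_map:
 assumes "left_module R X" "left_module R Y" "f \<in> mod_hom R X Y" "g \<in> mod_hom R X Y"
 shows "(\<lambda>x\<in>carrier X. f x \<ominus>\<^bsub>Y\<^esub> g x) \<in> mod_hom R X Y"
proof -
 interpret X: left_module R X by fact
 interpret Y: left_module R Y by fact
 have r: "a \<odot>\<^bsub>Y\<^esub> (u \<ominus>\<^bsub>Y\<^esub> v) = a \<odot>\<^bsub>Y\<^esub> u \<ominus>\<^bsub>Y\<^esub> a \<odot>\<^bsub>Y\<^esub> v"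
  if "a \<in> carrier R" "u \<in> carrier Y" "v \<in> carrier Y" for a u v
 proof -
  have "a \<odot>\<^bsub>Y\<^esub> (u \<ominus>\<^bsub>Y\<^esub> v) \<oplus>\<^bsub>Y\<^esub> a \<odot>\<^bsub>Y\<^esub> v = a \<odot>\<^bsub>Y\<^esub> u"
   using that by (simp add: Y.smult_r_distr[symmetric] Y.diff_add_cancel)
  then show ?thesis using that Y.smult_closed
   by (metis Y.add.inv_solve_right Y.add.m_closed Y.minus_closed a_minus_def)
 qed
 have d: "(u \<oplus>\<^bsub>Y\<^esub> v) \<ominus>\<^bsub>Y\<^esub> (u' \<oplus>\<^bsub>Y\<^esub> v') = (u \<ominus>\<^bsub>Y\<^esub> u') \<oplus>\<^bsub>Y\<^esub> (v \<ominus>\<^bsub>Y\<^esub> v')"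
  if "u \<in> carrier Y" "v \<in> carrier Y" "u' \<in> carrier Y" "v' \<in> carrier Y" for u v u' v'
  using that by (simp add: a_minus_def Y.minus_add Y.a_ac)
 show ?thesis by (rule mhom_restrictI)
   (use assms in \<open>auto simp: mhom_closed mhom_add mhom_smult r d\<close>)
qed

subsection \<open>Submodules\<close>

definition submodule_of :: "('r, 'p) ring_scheme => ('r, 'x, 'q) module_scheme => 'x set => bool"
 where "submodule_of R X H \<longleftrightarrow> H \<subseteq> carrier X \<and> \<zero>\<^bsub>X\<^esub> \<in> H \<and>
  (\<forall>x\<in>H. \<forall>y\<in>H. x \<oplus>\<^bsub>X\<^esub> y \<in> H) \<and> (\<forall>a\<in>carrier R. \<forall>x\<in>H. a \<odot>\<^bsub>X\<^esub> x \<in> H)"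

abbreviation sub_module :: "('r, 'x, 'q) module_scheme => 'x set => ('r, 'x, 'q) module_scheme"
 where "sub_module X H \<equiv> X\<lparr>carrier := H\<rparr>"

definition hom_kernel ::
 "('r, 'x, 'q) module_scheme => ('r, 'y, 's) module_scheme => ('x => 'y) => 'x set"
 where "hom_kernel X Y f = {x \<in> carrier X. f x = \<zero>\<^bsub>Y\<^esub>}"

lemma submodule_uminus:
 assumes "left_module R X" "submodule_of R X H" "x \<in> H"
 shows "\<ominus>\<^bsub>X\<^esub> x \<in> H"
proof -
 interpret X: left_module R X by fact
 have "(\<ominus>\<^bsub>R\<^esub> \<one>\<^bsub>R\<^esub>) \<odot>\<^bsub>X\<^esub> x \<in> H"
  using assms by (auto simp: submodule_of_def)
 then show ?thesis using assms X.smult_minus_one[of x] by (simp add: submodule_of_def subset_iff)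
qed

lemma lmod_sub:
 assumes "left_module R X" "submodule_of R X H"
 shows "left_module R (sub_module X H)"
proof -
 interpret X: left_module R X by fact
 have H: "!!x. x \<in> H ==> x \<in> carrier X" using assms(2) by (auto simp: submodule_of_def)
 show ?thesis by (rule left_moduleI)
   (use assms in \<open>auto simp: submodule_of_def X.smult_l_distr X.smult_r_distr X.smult_assoc
    X.smult_one H X.a_ac X.ring_axioms
    intro!: bexI[OF _ submodule_uminus] X.r_neg\<close>)
qed

lemma submodule_hom_kernel:
 assumes "left_module R X" "left_module R Y" "f \<in> mod_hom R X Y"
 shows "submodule_of R X (hom_kernel X Y f)"
proof -
 interpret X: left_module R X by fact
 interpret Y: left_module R Y by fact
 show ?thesis using assms by (auto simp: submodule_of_def hom_kernel_def mhom_add mhom_smult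
    X.smult_closed mhom_zero)
qed

lemma submodule_image:
 assumes "left_module R X" "left_module R Y" "f \<in> mod_hom R X Y"
 shows "submodule_of R Y (f ` carrier X)"
proof -
 interpret X: left_module R X by fact
 interpret Y: left_module R Y by fact
 show ?thesis using assms
  apply (auto simp: submodule_of_def mhom_closed mhom_zero[symmetric]
    mhom_smult[symmetric] X.smult_closed mhom_add[symmetric] )
  done
qed

lemma mhom_sub_incl:
 assumes "left_module R X" "submodule_of R X H" "f \<in> mod_hom R X Y"
 shows "restrict f H \<in> mod_hom R (sub_module X H) Y"
 using assms by (auto simp: mod_hom_def submodule_of_def subset_iff)

lemma mhom_into_sub:
 assumes "f \<in> mod_hom R X Y" "!!x. x \<in> carrier X ==> f x \<in> H"
 shows "f \<in> mod_hom R X (sub_module Y H)" using assms by (auto simp: mod_hom_def)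

subsection \<open>Short exact sequences\<close>

lemma short_exactD:
 assumes "short_exact R X Y Z f g"
 shows "f \<in> mod_hom R X Y" "g \<in> mod_hom R Y Z" "inj_on f (carrier X)"
  "!!x. x \<in> carrier X ==> g (f x) = \<zero>\<^bsub>Z\<^esub>"
  "!!y. [|y \<in> carrier Y; g y = \<zero>\<^bsub>Z\<^esub>|] ==> \<exists>x\<in>carrier X. y = f x"
  "!!z. z \<in> carrier Z ==> \<exists>y\<in>carrier Y. z = g y"
proof -
 have e: "f ` carrier X = {y \<in> carrier Y. g y = \<zero>\<^bsub>Z\<^esub>}" "g ` carrier Y = carrier Z"
  using assms by (auto simp: short_exact_def)
 show "f \<in> mod_hom R X Y" "g \<in> mod_hom R Y Z" "inj_on f (carrier X)"
  using assms by (auto simp: short_exact_def)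
 show "g (f x) = \<zero>\<^bsub>Z\<^esub>" if "x \<in> carrier X" for x using e(1) that by blast
 show "\<exists>x\<in>carrier X. y = f x" if "y \<in> carrier Y" "g y = \<zero>\<^bsub>Z\<^esub>" for y
  using e(1) that by blast
 show "\<exists>y\<in>carrier Y. z = g y" if "z \<in> carrier Z" for z using e(2) that by blast
qed

lemma short_exactI:
 assumes "left_module R X" "left_module R Y"
  and "f \<in> mod_hom R X Y" "g \<in> mod_hom R Y Z"
  and inj: "!!x. [|x \<in> carrier X; f x = \<zero>\<^bsub>Y\<^esub>|] ==> x = \<zero>\<^bsub>X\<^esub>"
  and "!!x. x \<in> carrier X ==> g (f x) = \<zero>\<^bsub>Z\<^esub>"
  and "!!y. [|y \<in> carrier Y; g y = \<zero>\<^bsub>Z\<^esub>|] ==> \<exists>x\<in>carrier X. y = f x"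
  and "!!z. z \<in> carrier Z ==> \<exists>y\<in>carrier Y. z = g y"
 shows "short_exact R X Y Z f g"
proof -
 interpret X: left_module R X by fact
 interpret Y: left_module R Y by fact
 have "inj_on f (carrier X)"
 proof (rule inj_onI)
  fix x y assume xy: "x \<in> carrier X" "y \<in> carrier X" "f x = f y"
  then have "f (x \<ominus>\<^bsub>X\<^esub> y) = \<zero>\<^bsub>Y\<^esub>"
   using mhom_diff[OF assms(1-3)] mhom_closed[OF assms(3)] by (simp add: Y.diff_self)
  then show "x = y" using inj xy X.diff_zero_imp_eq by blast
 qed
 then show ?thesis using assms mhom_closed[OF assms(3)] mhom_closed[OF assms(4)]
  unfolding short_exact_def by (intro conjI set_eqI iffI) (auto simp: image_iff)
qed

lemma inj_mod_hom_zero: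
 assumes "left_module R X" "left_module R Y" "f \<in> mod_hom R X Y" "inj_on f (carrier X)"
  "x \<in> carrier X" "f x = \<zero>\<^bsub>Y\<^esub>"
 shows "x = \<zero>\<^bsub>X\<^esub>"
proof -
 interpret X: left_module R X by fact
 show ?thesis using assms mhom_zero[OF assms(1-3)] by (metis X.zero_closed inj_onD)
qed

lemma short_exact_kernel:
 assumes "left_module R Y" "left_module R Z" "g \<in> mod_hom R Y Z" "g ` carrier Y = carrier Z"
 shows "short_exact R (sub_module Y (hom_kernel Y Z g)) Y Z (\<lambda>x\<in>hom_kernel Y Z g. x) g"
proof -
 have "(\<lambda>x\<in>hom_kernel Y Z g. x) \<in> mod_hom R (sub_module Y (hom_kernel Y Z g)) Y"
  using mhom_sub_incl[OF assms(1) submodule_hom_kernel[OF assms(1-3)] mhom_id[OF assms(1)]]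
  by (simp add: hom_kernel_def cong: restrict_cong)
 then show ?thesis using assms by (auto simp: short_exact_def hom_kernel_def inj_on_def)
qed

text \<open>A homomorphism that kills the kernel of a surjection descends along it; dually, one whose
 values die in the quotient lifts to the kernel.\<close>

lemma factor_through_surj:
 assumes "left_module R Y" "left_module R Z" "left_module R V"
  and p: "p \<in> mod_hom R Y Z" "p ` carrier Y = carrier Z"
  and h: "h \<in> mod_hom R Y V" "!!y. [|y \<in> carrier Y; p y = \<zero>\<^bsub>Z\<^esub>|] ==> h y = \<zero>\<^bsub>V\<^esub>"
 shows "\<exists>k\<in>mod_hom R Z V. \<forall>y\<in>carrier Y. k (p y) = h y"
proof -
 interpret Y: left_module R Y by fact
 interpret Z: left_module R Z by fact
 interpret V: left_module R V by fact
 define k where "k = (\<lambda>z\<in>carrier Z. h (inv_into (carrier Y) p z))"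
 have kp: "k (p y) = h y" if y: "y \<in> carrier Y" for y
 proof -
  let ?y = "inv_into (carrier Y) p (p y)"
  have y': "?y \<in> carrier Y" "p ?y = p y" using y by (auto simp: inv_into_into f_inv_into_f)
  have "p (?y \<ominus>\<^bsub>Y\<^esub> y) = \<zero>\<^bsub>Z\<^esub>"
   using y y' mhom_diff[OF assms(1,2) p(1)] mhom_closed[OF p(1)] by (simp add: Z.diff_self)
  then have "h ?y \<ominus>\<^bsub>V\<^esub> h y = \<zero>\<^bsub>V\<^esub>"
   using y y' h(2)[of "?y \<ominus>\<^bsub>Y\<^esub> y"] mhom_diff[OF assms(1,3) h(1) y'(1) y] Y.minus_closed by metis
  then have "h ?y = h y" using V.diff_zero_imp_eq y y' mhom_closed[OF h(1)] by blast
  then show ?thesis using y mhom_closed[OF p(1)] by (simp add: k_def)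
 qed
 have s: "\<exists>y\<in>carrier Y. z = p y" if "z \<in> carrier Z" for z using that p(2) by blast
 have "k \<in> mod_hom R Z V"
 proof (rule mod_homI)
  show "k \<in> extensional (carrier Z)" by (simp add: k_def)
  fix z assume "z \<in> carrier Z"
  then obtain y where y: "y \<in> carrier Y" "z = p y" using s by blast
  then show "k z \<in> carrier V" using kp mhom_closed[OF h(1)] by simp
  fix a assume a: "a \<in> carrier R"
  show "k (a \<odot>\<^bsub>Z\<^esub> z) = a \<odot>\<^bsub>V\<^esub> k z"
   using a y kp mhom_smult[OF p(1), symmetric] mhom_smult[OF h(1)] Y.smult_closed by simp
 next
  fix z z' assume "z \<in> carrier Z" "z' \<in> carrier Z"
  then obtain y y' where "y \<in> carrier Y" "z = p y" "y' \<in> carrier Y" "z' = p y'" using s by meson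
  then show "k (z \<oplus>\<^bsub>Z\<^esub> z') = k z \<oplus>\<^bsub>V\<^esub> k z'"
   using kp mhom_add[OF p(1), symmetric] mhom_add[OF h(1)] by simp
 qed
 then show ?thesis using kp by blast
qed

lemma factor_through_inj:
 assumes "left_module R N" "left_module R X" "left_module R Y"
  and i: "i \<in> mod_hom R X Y" "inj_on i (carrier X)"
  and h: "h \<in> mod_hom R N Y" "!!n. n \<in> carrier N ==> \<exists>x\<in>carrier X. h n = i x"
 shows "\<exists>k\<in>mod_hom R N X. \<forall>n\<in>carrier N. i (k n) = h n"
proof -
 interpret N: left_module R N by fact
 interpret X: left_module R X by fact
 have "\<exists>x. x \<in> carrier X \<and> i x = h n" if "n \<in> carrier N" for n using h(2)[OF that] by metis
 then obtain k0 where k0: "!!n. n \<in> carrier N ==> k0 n \<in> carrier X \<and> i (k0 n) = h n" by metis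
 have inj: "!!x y. [|x \<in> carrier X; y \<in> carrier X; i x = i y|] ==> x = y"
  using i(2) by (auto dest: inj_onD)
 have "(\<lambda>n\<in>carrier N. k0 n) \<in> mod_hom R N X"
 proof (rule mhom_restrictI)
  fix x y assume "x \<in> carrier N" "y \<in> carrier N"
  then show "k0 (x \<oplus>\<^bsub>N\<^esub> y) = k0 x \<oplus>\<^bsub>X\<^esub> k0 y"
   by (intro inj) (auto simp: k0 mhom_add[OF i(1)] mhom_add[OF h(1)])
 next
  fix a x assume "a \<in> carrier R" "x \<in> carrier N"
  then show "k0 (a \<odot>\<^bsub>N\<^esub> x) = a \<odot>\<^bsub>X\<^esub> k0 x"
   by (intro inj) (auto simp: k0 mhom_smult[OF i(1)] mhom_smult[OF h(1)] N.smult_closed X.smult_closed)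
 qed (use assms k0 in auto)
 then show ?thesis using k0 by (intro bexI[where x = "\<lambda>n\<in>carrier N. k0 n"]) auto
qed

lemma lmod_surj_image:
 assumes "left_module R X"
  and onto: "\<pi> ` carrier X = carrier Q"
  and add: "!!x y. [|x \<in> carrier X; y \<in> carrier X|] ==> \<pi> (x \<oplus>\<^bsub>X\<^esub> y) = \<pi> x \<oplus>\<^bsub>Q\<^esub> \<pi> y"
  and smult: "!!a x. [|a \<in> carrier R; x \<in> carrier X|] ==> \<pi> (a \<odot>\<^bsub>X\<^esub> x) = a \<odot>\<^bsub>Q\<^esub> \<pi> x"
  and zero: "\<pi> \<zero>\<^bsub>X\<^esub> = \<zero>\<^bsub>Q\<^esub>"
 shows "left_module R Q"
proof -
 interpret X: left_module R X by fact
 have s: "\<exists>x\<in>carrier X. z = \<pi> x" if "z \<in> carrier Q" for z using that onto by blast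
 have c: "\<pi> x \<in> carrier Q" if "x \<in> carrier X" for x using that onto by blast
 show ?thesis
 proof (rule left_moduleI)
  fix x y z assume "x \<in> carrier Q" "y \<in> carrier Q" "z \<in> carrier Q"
  then obtain x' y' z' where xyz: "x' \<in> carrier X" "x = \<pi> x'" "y' \<in> carrier X" "y = \<pi> y'"
   "z' \<in> carrier X" "z = \<pi> z'" using s by meson
  show "(x \<oplus>\<^bsub>Q\<^esub> y) \<oplus>\<^bsub>Q\<^esub> z = x \<oplus>\<^bsub>Q\<^esub> (y \<oplus>\<^bsub>Q\<^esub> z)"
   using xyz by (simp add: add[symmetric] X.a_assoc)
 next
  fix x y assume "x \<in> carrier Q" "y \<in> carrier Q"
  then obtain x' y' where xy: "x' \<in> carrier X" "x = \<pi> x'" "y' \<in> carrier X" "y = \<pi> y'"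
   using s by meson
  show "x \<oplus>\<^bsub>Q\<^esub> y \<in> carrier Q" "x \<oplus>\<^bsub>Q\<^esub> y = y \<oplus>\<^bsub>Q\<^esub> x"
   using xy by (simp_all add: add[symmetric] c X.a_comm)
  fix a assume "a \<in> carrier R"
  then show "a \<odot>\<^bsub>Q\<^esub> (x \<oplus>\<^bsub>Q\<^esub> y) = a \<odot>\<^bsub>Q\<^esub> x \<oplus>\<^bsub>Q\<^esub> a \<odot>\<^bsub>Q\<^esub> y"
   using xy by (simp add: add[symmetric] smult[symmetric] X.smult_r_distr X.smult_closed)
 next
  fix x assume "x \<in> carrier Q"
  then obtain x' where x: "x' \<in> carrier X" "x = \<pi> x'" using s by meson
  show "\<zero>\<^bsub>Q\<^esub> \<oplus>\<^bsub>Q\<^esub> x = x" "\<one>\<^bsub>R\<^esub> \<odot>\<^bsub>Q\<^esub> x = x"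
   using x by (simp_all add: zero[symmetric] add[symmetric] smult[symmetric] X.smult_one)
  have "\<pi> (\<ominus>\<^bsub>X\<^esub> x') \<in> carrier Q" "\<pi> (\<ominus>\<^bsub>X\<^esub> x') \<oplus>\<^bsub>Q\<^esub> x = \<zero>\<^bsub>Q\<^esub>"
   using x by (simp_all add: zero[symmetric] add[symmetric] X.l_neg c)
  then show "\<exists>y\<in>carrier Q. y \<oplus>\<^bsub>Q\<^esub> x = \<zero>\<^bsub>Q\<^esub>" by blast
  fix a assume a: "a \<in> carrier R"
  show "a \<odot>\<^bsub>Q\<^esub> x \<in> carrier Q" using x a by (simp add: smult[symmetric] c X.smult_closed)
  fix b assume b: "b \<in> carrier R"
  show "(a \<oplus>\<^bsub>R\<^esub> b) \<odot>\<^bsub>Q\<^esub> x = a \<odot>\<^bsub>Q\<^esub> x \<oplus>\<^bsub>Q\<^esub> b \<odot>\<^bsub>Q\<^esub> x"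
   "(a \<otimes>\<^bsub>R\<^esub> b) \<odot>\<^bsub>Q\<^esub> x = a \<odot>\<^bsub>Q\<^esub> (b \<odot>\<^bsub>Q\<^esub> x)"
   using x a b by (simp_all add: smult[symmetric] X.smult_closed X.smult_l_distr add[symmetric] X.smult_assoc)
 qed (use X.ring_axioms zero c in \<open>auto simp flip: zero\<close>)
qed

subsection \<open>Direct sums and quotients\<close>

definition direct_sum ::
 "('r, 'x, 'q) module_scheme => ('r, 'y, 's) module_scheme => ('r, 'x \<times> 'y) module"
 where "direct_sum X Y = \<lparr>carrier = carrier X \<times> carrier Y, monoid.mult = undefined, one = undefined,
  ring.zero = (\<zero>\<^bsub>X\<^esub>, \<zero>\<^bsub>Y\<^esub>), ring.add = (\<lambda>u v. (fst u \<oplus>\<^bsub>X\<^esub> fst v, snd u \<oplus>\<^bsub>Y\<^esub> snd v)),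
  smult = (\<lambda>a u. (a \<odot>\<^bsub>X\<^esub> fst u, a \<odot>\<^bsub>Y\<^esub> snd u))\<rparr>"

lemma direct_sum_simps [simp]:
 "carrier (direct_sum X Y) = carrier X \<times> carrier Y"
 "\<zero>\<^bsub>direct_sum X Y\<^esub> = (\<zero>\<^bsub>X\<^esub>, \<zero>\<^bsub>Y\<^esub>)"
 "u \<oplus>\<^bsub>direct_sum X Y\<^esub> v = (fst u \<oplus>\<^bsub>X\<^esub> fst v, snd u \<oplus>\<^bsub>Y\<^esub> snd v)"
 "a \<odot>\<^bsub>direct_sum X Y\<^esub> u = (a \<odot>\<^bsub>X\<^esub> fst u, a \<odot>\<^bsub>Y\<^esub> snd u)"
 by (auto simp: direct_sum_def)

lemma lmod_direct_sum:
 assumes "left_module R X" "left_module R Y"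
 shows "left_module R (direct_sum X Y)"
proof -
 interpret X: left_module R X by fact
 interpret Y: left_module R Y by fact
 have n: "\<exists>y\<in>carrier (direct_sum X Y). y \<oplus>\<^bsub>direct_sum X Y\<^esub> x = \<zero>\<^bsub>direct_sum X Y\<^esub>"
  if "x \<in> carrier (direct_sum X Y)" for x
  by (rule bexI[where x = "(\<ominus>\<^bsub>X\<^esub> fst x, \<ominus>\<^bsub>Y\<^esub> snd x)"]) (use that in \<open>auto simp: X.l_neg Y.l_neg\<close>)
 show ?thesis by (rule left_moduleI)
   (use n in \<open>auto simp: X.ring_axioms X.a_ac Y.a_ac X.smult_closed Y.smult_closed X.smult_l_distr
   Y.smult_l_distr X.smult_r_distr Y.smult_r_distr X.smult_assoc Y.smult_assoc X.smult_one
   Y.smult_one\<close>)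
qed

lemma mhom_sum_map:
 assumes "left_module R X" "left_module R Y" "left_module R Z" "f \<in> mod_hom R X Z" "g \<in> mod_hom R Y Z"
 shows "(\<lambda>u\<in>carrier (direct_sum X Y). f (fst u) \<oplus>\<^bsub>Z\<^esub> g (snd u)) \<in> mod_hom R (direct_sum X Y) Z"
proof -
 interpret X: left_module R X by fact
 interpret Y: left_module R Y by fact
 interpret Z: left_module R Z by fact
 note [simp] = mhom_closed[OF assms(4)] mhom_closed[OF assms(5)]
 show ?thesis by (rule mhom_restrictI[OF lmod_direct_sum[OF assms(1,2)]])
   (auto simp: mhom_add[OF assms(4)] mhom_add[OF assms(5)] mhom_smult[OF assms(4)]
    mhom_smult[OF assms(5)] Z.smult_r_distr Z.a_ac)
qed

lemma mhom_snd: "[|left_module R X; left_module R Y|] ==>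
  (\<lambda>u\<in>carrier (direct_sum X Y). snd u) \<in> mod_hom R (direct_sum X Y) Y"
 by (rule mhom_restrictI[OF lmod_direct_sum]) auto

lemma mhom_add_map:
 assumes "left_module R X" "left_module R Y" "f \<in> mod_hom R X Y" "g \<in> mod_hom R X Y"
 shows "(\<lambda>x\<in>carrier X. f x \<oplus>\<^bsub>Y\<^esub> g x) \<in> mod_hom R X Y"
proof -
 interpret X: left_module R X by fact
 interpret Y: left_module R Y by fact
 note [simp] = mhom_closed[OF assms(3)] mhom_closed[OF assms(4)]
 show ?thesis by (rule mhom_restrictI)
   (auto simp: assms(1) mhom_add[OF assms(3)] mhom_add[OF assms(4)] mhom_smult[OF assms(3)]
    mhom_smult[OF assms(4)] Y.smult_r_distr Y.a_ac)
qed

lemma mhom_zero_map: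
 assumes "left_module R X" "left_module R Y" shows "(\<lambda>x\<in>carrier X. \<zero>\<^bsub>Y\<^esub>) \<in> mod_hom R X Y"
proof -
 interpret Y: left_module R Y by fact
 show ?thesis by (rule mhom_restrictI) (use assms in auto)
qed

lemma abelian_subgroup_submodule:
 assumes "left_module R X" "submodule_of R X H"
 shows "abelian_subgroup H X"
proof -
 interpret X: left_module R X by fact
 have "subgroup H (add_monoid X)" by (rule X.add.subgroupI)
   (use assms submodule_uminus[OF assms] in \<open>auto simp: submodule_of_def\<close>)
 then show ?thesis by (intro abelian_subgroupI3 additive_subgroup.intro X.abelian_group_axioms)
qed

lemma quotient_module_facts:
 fixes X :: "('r, 'x) module"
 assumes "left_module R X" "submodule_of R X H"
 shows lmod_quotient: "left_module R (quotient_module X H)"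
  and mhom_quotient: "(\<lambda>x\<in>carrier X. H +>\<^bsub>X\<^esub> x) \<in> mod_hom R X (quotient_module X H)"
  and quotient_onto: "(\<lambda>x. H +>\<^bsub>X\<^esub> x) ` carrier X = carrier (quotient_module X H)"
  and quotient_zero_iff: "!!x. x \<in> carrier X ==> H +>\<^bsub>X\<^esub> x = \<zero>\<^bsub>quotient_module X H\<^esub> \<longleftrightarrow> x \<in> H"
proof -
 interpret X: left_module R X by fact
 interpret H: abelian_subgroup H X by (rule abelian_subgroup_submodule[OF assms])
 show onto: "(\<lambda>x. H +>\<^bsub>X\<^esub> x) ` carrier X = carrier (quotient_module X H)"
  by (auto simp: quotient_module_def A_RCOSETS_def' image_iff)
 have add: "H +>\<^bsub>X\<^esub> (x \<oplus>\<^bsub>X\<^esub> y) = (H +>\<^bsub>X\<^esub> x) \<oplus>\<^bsub>quotient_module X H\<^esub> (H +>\<^bsub>X\<^esub> y)"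
  if "x \<in> carrier X" "y \<in> carrier X" for x y using that by (simp add: quotient_module_def H.a_rcos_sum)
 have smult: "H +>\<^bsub>X\<^esub> (a \<odot>\<^bsub>X\<^esub> x) = a \<odot>\<^bsub>quotient_module X H\<^esub> (H +>\<^bsub>X\<^esub> x)"
  if a: "a \<in> carrier R" and x: "x \<in> carrier X" for a x
 proof -
  have e: "H +>\<^bsub>X\<^esub> (a \<odot>\<^bsub>X\<^esub> y) = H +>\<^bsub>X\<^esub> (a \<odot>\<^bsub>X\<^esub> x)" if yH: "y \<in> H +>\<^bsub>X\<^esub> x" for y
  proof -
   obtain h where h: "h \<in> H" "y = h \<oplus>\<^bsub>X\<^esub> x" using yH by (auto simp: a_r_coset_defs)
   then have "a \<odot>\<^bsub>X\<^esub> y = a \<odot>\<^bsub>X\<^esub> h \<oplus>\<^bsub>X\<^esub> a \<odot>\<^bsub>X\<^esub> x" "a \<odot>\<^bsub>X\<^esub> h \<in> H"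
    using a x assms(2) X.smult_r_distr by (auto simp: submodule_of_def)
   then have aH: "a \<odot>\<^bsub>X\<^esub> y \<in> H +>\<^bsub>X\<^esub> (a \<odot>\<^bsub>X\<^esub> x)"
    by (auto simp: a_r_coset_defs)
   show ?thesis using H.a_repr_independence'[OF aH X.smult_closed[OF a x]] by simp
  qed
  have "(\<lambda>y. H +>\<^bsub>X\<^esub> (a \<odot>\<^bsub>X\<^esub> y)) ` (H +>\<^bsub>X\<^esub> x) = {H +>\<^bsub>X\<^esub> (a \<odot>\<^bsub>X\<^esub> x)}"
  proof -
   have "(\<lambda>y. H +>\<^bsub>X\<^esub> (a \<odot>\<^bsub>X\<^esub> y)) ` (H +>\<^bsub>X\<^esub> x) = (\<lambda>y. H +>\<^bsub>X\<^esub> (a \<odot>\<^bsub>X\<^esub> x)) ` (H +>\<^bsub>X\<^esub> x)"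
    by (rule image_cong[OF refl e])
   then show ?thesis using H.a_rcos_self[OF x] by blast
  qed
  then show ?thesis by (simp add: quotient_module_def)
 qed
 have zero: "H +>\<^bsub>X\<^esub> \<zero>\<^bsub>X\<^esub> = \<zero>\<^bsub>quotient_module X H\<^esub>"
  using H.a_subset by (simp add: quotient_module_def X.a_coset_add_zero)
 show "left_module R (quotient_module X H)" by (rule lmod_surj_image[OF assms(1) onto add smult zero])
 show "(\<lambda>x\<in>carrier X. H +>\<^bsub>X\<^esub> x) \<in> mod_hom R X (quotient_module X H)"
  using onto by (intro mhom_restrictI[OF assms(1)] add smult) auto
 show "H +>\<^bsub>X\<^esub> x = \<zero>\<^bsub>quotient_module X H\<^esub> \<longleftrightarrow> x \<in> H" if "x \<in> carrier X" for x
  using that H.a_rcos_self[OF that] H.a_rcos_const by (auto simp: quotient_module_def)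
qed

subsection \<open>Free modules\<close>

definition free_basis :: "('r, 'p) ring_scheme => 's => 's => 'r"
 where "free_basis R s = (\<lambda>t. if t = s then \<one>\<^bsub>R\<^esub> else \<zero>\<^bsub>R\<^esub>)"

definition lin_ext ::
 "('r, 'p) ring_scheme => ('r, 'x, 'q) module_scheme => ('s => 'x) => ('s => 'r) => 'x"
 where "lin_ext R X v f = (\<Oplus>\<^bsub>X\<^esub>s\<in>{s. f s \<noteq> \<zero>\<^bsub>R\<^esub>}. f s \<odot>\<^bsub>X\<^esub> v s)"

lemma free_module_simps [simp]:
 "f \<in> carrier (free_module R S) \<longleftrightarrow>
  range f \<subseteq> carrier R \<and> finite {s. f s \<noteq> \<zero>\<^bsub>R\<^esub>} \<and> {s. f s \<noteq> \<zero>\<^bsub>R\<^esub>} \<subseteq> S"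
 "\<zero>\<^bsub>free_module R S\<^esub> = (\<lambda>s. \<zero>\<^bsub>R\<^esub>)"
 "f \<oplus>\<^bsub>free_module R S\<^esub> g = (\<lambda>s. f s \<oplus>\<^bsub>R\<^esub> g s)"
 "a \<odot>\<^bsub>free_module R S\<^esub> f = (\<lambda>s. a \<otimes>\<^bsub>R\<^esub> f s)"
 by (auto simp: free_module_def)

lemma lmod_free:
 fixes S :: "'s set"
 assumes "ring R" shows "left_module R (free_module R S)"
proof -
 interpret ring R by fact
 have c: "f s \<in> carrier R" if "range f \<subseteq> carrier R" for f and s :: 's using that by auto
 have inv: "\<exists>y\<in>carrier (free_module R S). y \<oplus>\<^bsub>free_module R S\<^esub> x = \<zero>\<^bsub>free_module R S\<^esub>"
  if "x \<in> carrier (free_module R S)" for x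
 proof (rule bexI[where x = "\<lambda>s. \<ominus>\<^bsub>R\<^esub> x s"])
  have "{s. \<ominus>\<^bsub>R\<^esub> x s \<noteq> \<zero>\<^bsub>R\<^esub>} \<subseteq> {s. x s \<noteq> \<zero>\<^bsub>R\<^esub>}" by auto
  then show "(\<lambda>s. \<ominus>\<^bsub>R\<^esub> x s) \<in> carrier (free_module R S)"
   using that c[of x] by (auto intro: finite_subset)
 qed (use that c[of x] in \<open>auto simp: l_neg\<close>)
 show ?thesis
 proof (rule left_moduleI)
  fix x y assume xy: "x \<in> carrier (free_module R S)" "y \<in> carrier (free_module R S)"
  have "{s. x s \<oplus>\<^bsub>R\<^esub> y s \<noteq> \<zero>\<^bsub>R\<^esub>} \<subseteq> {s. x s \<noteq> \<zero>\<^bsub>R\<^esub>} \<union> {s. y s \<noteq> \<zero>\<^bsub>R\<^esub>}" by auto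
  then show "x \<oplus>\<^bsub>free_module R S\<^esub> y \<in> carrier (free_module R S)"
   using xy c[of x] c[of y] by (auto intro: finite_subset)
 next
  fix a x assume xy: "a \<in> carrier R" "x \<in> carrier (free_module R S)"
  have "{s. a \<otimes>\<^bsub>R\<^esub> x s \<noteq> \<zero>\<^bsub>R\<^esub>} \<subseteq> {s. x s \<noteq> \<zero>\<^bsub>R\<^esub>}" using xy by auto
  then show "a \<odot>\<^bsub>free_module R S\<^esub> x \<in> carrier (free_module R S)"
   using xy c[of x] by (auto intro: finite_subset)
 qed (use inv in \<open>auto simp: assms c a_ac l_distr r_distr m_assoc\<close>)
qed

lemma free_basis_closed: "[|ring R; s \<in> S|] ==> free_basis R s \<in> carrier (free_module R S)"
 by (auto simp: free_basis_def ring.ring_simprules)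

context left_module
begin

lemma lin_ext_eq:
 assumes f: "f \<in> carrier (free_module R S)" and v: "!!s. s \<in> S ==> v s \<in> carrier X"
  and T: "finite T" "T \<subseteq> S" "{s. f s \<noteq> \<zero>\<^bsub>R\<^esub>} \<subseteq> T"
 shows "lin_ext R X v f = (\<Oplus>\<^bsub>X\<^esub>s\<in>T. f s \<odot>\<^bsub>X\<^esub> v s)"
 unfolding lin_ext_def by (rule X.add.finprod_mono_neutral_cong_left)
  (use assms in \<open>auto intro!: smult_closed\<close>)

lemma smult_finsum:
 assumes "finite T" "a \<in> carrier R" "!!s. s \<in> T ==> g s \<in> carrier X"
 shows "a \<odot>\<^bsub>X\<^esub> (\<Oplus>\<^bsub>X\<^esub>s\<in>T. g s) = (\<Oplus>\<^bsub>X\<^esub>s\<in>T. a \<odot>\<^bsub>X\<^esub> g s)"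
 using assms
proof (induction T rule: finite_induct)
 case (insert t T)
 have "g \<in> T \<rightarrow> carrier X" "(\<lambda>s. a \<odot>\<^bsub>X\<^esub> g s) \<in> T \<rightarrow> carrier X"
  using insert smult_closed by auto
 with insert show ?case by (simp add: smult_r_distr smult_closed)
qed simp

lemma mhom_lin_ext:
 assumes v: "!!s. s \<in> S ==> v s \<in> carrier X"
 shows "(\<lambda>f\<in>carrier (free_module R S). lin_ext R X v f) \<in> mod_hom R (free_module R S) X"
proof (rule mhom_restrictI[OF lmod_free])
 interpret F: left_module R "free_module R S" by (rule lmod_free[OF R.ring_axioms])
 fix f assume f: "f \<in> carrier (free_module R S)"
 let ?T = "{s. f s \<noteq> \<zero>\<^bsub>R\<^esub>}"
 have fc: "f s \<in> carrier R" for s using f by auto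
 have fe: "lin_ext R X v f = (\<Oplus>\<^bsub>X\<^esub>s\<in>?T. f s \<odot>\<^bsub>X\<^esub> v s)"
  by (simp add: lin_ext_def)
 show "lin_ext R X v f \<in> carrier X"
  unfolding fe by (rule X.finsum_closed) (use f fc v smult_closed in auto)
 {
  fix a assume a: "a \<in> carrier R"
  have "lin_ext R X v (a \<odot>\<^bsub>free_module R S\<^esub> f) =
    (\<Oplus>\<^bsub>X\<^esub>s\<in>?T. (a \<odot>\<^bsub>free_module R S\<^esub> f) s \<odot>\<^bsub>X\<^esub> v s)"
   by (rule lin_ext_eq[OF F.smult_closed[OF a f] v]) (use f a in auto)
  also have "\<dots> = (\<Oplus>\<^bsub>X\<^esub>s\<in>?T. a \<odot>\<^bsub>X\<^esub> (f s \<odot>\<^bsub>X\<^esub> v s))"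
   by (rule X.finsum_cong') (use f fc v a in \<open>auto simp: smult_assoc subset_iff intro!: smult_closed\<close>)
  also have "\<dots> = a \<odot>\<^bsub>X\<^esub> lin_ext R X v f"
   unfolding fe by (rule smult_finsum[symmetric]) (use f fc v a in \<open>auto intro!: smult_closed\<close>)
  finally show "lin_ext R X v (a \<odot>\<^bsub>free_module R S\<^esub> f) = a \<odot>\<^bsub>X\<^esub> lin_ext R X v f" .
 next
  fix g assume g: "g \<in> carrier (free_module R S)"
  have gc: "g s \<in> carrier R" for s using g by auto
  let ?U = "?T \<union> {s. g s \<noteq> \<zero>\<^bsub>R\<^esub>}"
  have U: "finite ?U" "?U \<subseteq> S" using f g by auto
  have e: "lin_ext R X v h = (\<Oplus>\<^bsub>X\<^esub>s\<in>?U. h s \<odot>\<^bsub>X\<^esub> v s)"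
   if "h \<in> carrier (free_module R S)" "{s. h s \<noteq> \<zero>\<^bsub>R\<^esub>} \<subseteq> ?U" for h
   by (rule lin_ext_eq[OF that(1) v U that(2)])
  have "lin_ext R X v (f \<oplus>\<^bsub>free_module R S\<^esub> g) =
    (\<Oplus>\<^bsub>X\<^esub>s\<in>?U. (f \<oplus>\<^bsub>free_module R S\<^esub> g) s \<odot>\<^bsub>X\<^esub> v s)"
   by (rule e[OF F.a_closed[OF f g]]) auto
  also have "\<dots> = (\<Oplus>\<^bsub>X\<^esub>s\<in>?U. f s \<odot>\<^bsub>X\<^esub> v s \<oplus>\<^bsub>X\<^esub> g s \<odot>\<^bsub>X\<^esub> v s)"
   by (rule X.finsum_cong')
    (use U fc gc v in \<open>auto simp: smult_l_distr subset_iff intro!: smult_closed X.a_closed\<close>)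
  also have "\<dots> = (\<Oplus>\<^bsub>X\<^esub>s\<in>?U. f s \<odot>\<^bsub>X\<^esub> v s) \<oplus>\<^bsub>X\<^esub> (\<Oplus>\<^bsub>X\<^esub>s\<in>?U. g s \<odot>\<^bsub>X\<^esub> v s)"
   by (rule X.finsum_addf) (use U fc gc v in \<open>auto intro!: smult_closed\<close>)
  also have "\<dots> = lin_ext R X v f \<oplus>\<^bsub>X\<^esub> lin_ext R X v g" using e[OF f] e[OF g] by auto
  finally show "lin_ext R X v (f \<oplus>\<^bsub>free_module R S\<^esub> g) = lin_ext R X v f \<oplus>\<^bsub>X\<^esub> lin_ext R X v g" .
 }
qed (rule R.ring_axioms)

lemma lin_ext_basis:
 assumes "s \<in> S" "!!s. s \<in> S ==> v s \<in> carrier X"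
 shows "lin_ext R X v (free_basis R s) = v s"
proof -
 have "lin_ext R X v (free_basis R s) = (\<Oplus>\<^bsub>X\<^esub>t\<in>{s}. free_basis R s t \<odot>\<^bsub>X\<^esub> v t)"
  by (rule lin_ext_eq[OF free_basis_closed[OF R.ring_axioms assms(1)]])
   (use assms in \<open>auto simp: free_basis_def split: if_splits\<close>)
 then show ?thesis using assms by (simp add: X.finsum_insert free_basis_def smult_one)
qed

end

lemma free_hom_eq:
 assumes "left_module R X" and g: "g \<in> mod_hom R (free_module R S) X"
  and h: "h \<in> mod_hom R (free_module R S) X"
  and eq: "!!s. s \<in> S ==> g (free_basis R s) = h (free_basis R s)"
  and f: "f \<in> carrier (free_module R S)"
 shows "g f = h f"
proof -
 interpret X: left_module R X by fact
 let ?F = "free_module R S"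
 have FM: "left_module R ?F" by (rule lmod_free[OF X.ring_axioms])
 interpret F: left_module R ?F by fact
 have "finite T ==> f \<in> carrier ?F ==> {s. f s \<noteq> \<zero>\<^bsub>R\<^esub>} \<subseteq> T ==> g f = h f" for T f
 proof (induction T arbitrary: f rule: finite_induct)
  case empty
  then have "f = \<zero>\<^bsub>?F\<^esub>" by auto
  then show ?case using mhom_zero[OF FM assms(1)] g h by metis
 next
  case (insert t T)
  show ?case
  proof (cases "f t = \<zero>\<^bsub>R\<^esub>")
   case True
   then have "{s. f s \<noteq> \<zero>\<^bsub>R\<^esub>} \<subseteq> T" using insert.prems by auto
   then show ?thesis using insert by blast
  next
   case False
   then have tS: "t \<in> S" using insert.prems by auto
   let ?f = "f(t := \<zero>\<^bsub>R\<^esub>)" and ?b = "free_basis R t"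
   have fc: "f s \<in> carrier R" for s using insert.prems by auto
   have "{s. ?f s \<noteq> \<zero>\<^bsub>R\<^esub>} \<subseteq> {s. f s \<noteq> \<zero>\<^bsub>R\<^esub>}" by auto
   then have f': "?f \<in> carrier ?F"
    using insert.prems finite_subset[of "{s. ?f s \<noteq> \<zero>\<^bsub>R\<^esub>}" "{s. f s \<noteq> \<zero>\<^bsub>R\<^esub>}"]
    by (auto simp: fc)
   have IH: "g ?f = h ?f" by (rule insert.IH[OF f']) (use insert.prems in auto)
   have b: "?b \<in> carrier ?F" by (rule free_basis_closed[OF X.ring_axioms tS])
   have fe: "f = ?f \<oplus>\<^bsub>?F\<^esub> f t \<odot>\<^bsub>?F\<^esub> ?b"
    by (auto simp: free_basis_def fc)
   have "k f = k ?f \<oplus>\<^bsub>X\<^esub> f t \<odot>\<^bsub>X\<^esub> k ?b" if "k \<in> mod_hom R ?F X" for k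
    by (subst fe, subst mhom_add[OF that f' F.smult_closed[OF fc b]])
     (simp add: mhom_smult[OF that fc b] del: free_module_simps)
   then show ?thesis using IH eq[OF tS] g h by metis
  qed
 qed
 then show ?thesis using f by auto
qed

lemma free_lift:
 assumes "left_module R E" "left_module R Z" "p \<in> mod_hom R E Z" "p ` carrier E = carrier Z"
  and u: "u \<in> mod_hom R (free_module R S) Z"
 shows "\<exists>w\<in>mod_hom R (free_module R S) E. \<forall>x\<in>carrier (free_module R S). p (w x) = u x"
proof -
 interpret E: left_module R E by fact
 have F: "left_module R (free_module R S)" by (rule lmod_free[OF E.ring_axioms])
 have "\<exists>e\<in>carrier E. p e = u (free_basis R s)" if "s \<in> S" for s
  using assms(4) mhom_closed[OF u free_basis_closed[OF E.ring_axioms that]] by (metis imageE)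
 then obtain v where v: "!!s. s \<in> S ==> v s \<in> carrier E" "!!s. s \<in> S ==> p (v s) = u (free_basis R s)"
  by metis
 define w where "w = (\<lambda>f\<in>carrier (free_module R S). lin_ext R E v f)"
 have w: "w \<in> mod_hom R (free_module R S) E"
  unfolding w_def by (rule E.mhom_lin_ext[OF v(1)])
 have "compose (carrier (free_module R S)) p w x = u x" if "x \<in> carrier (free_module R S)" for x
 proof (rule free_hom_eq[OF assms(2) mhom_compose[OF F w assms(3)] u _ that])
  fix s assume s: "s \<in> S"
  show "compose (carrier (free_module R S)) p w (free_basis R s) = u (free_basis R s)"
   using free_basis_closed[OF E.ring_axioms s] E.lin_ext_basis[of s S v, OF s v(1)] v(2)[OF s]
   by (simp add: compose_def w_def)
 qed
 then show ?thesis using w by (auto simp: compose_def intro!: bexI[of _ w])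
qed

definition augmentation ::
 "('r, 'p) ring_scheme => ('r, 'x, 'q) module_scheme => ('x => 'r) => 'x"
 where "augmentation R X = (\<lambda>f\<in>carrier (res0 R X). lin_comb R X f)"

lemma lin_comb_lin_ext: "lin_comb R X = lin_ext R X (\<lambda>x. x)"
 by (simp add: fun_eq_iff lin_comb_def lin_ext_def)

lemma lmod_res0: "left_module R X ==> left_module R (res0 R X)"
 unfolding res0_def by (rule lmod_free) (simp add: left_module_def)

lemma mhom_lin_comb:
 assumes "left_module R X" "S \<subseteq> carrier X"
 shows "(\<lambda>f\<in>carrier (free_module R S). lin_comb R X f) \<in> mod_hom R (free_module R S) X"
proof -
 interpret X: left_module R X by fact
 show ?thesis
  unfolding lin_comb_lin_ext by (rule X.mhom_lin_ext) (use assms in auto)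
qed

lemma lin_comb_basis:
 assumes "left_module R X" "x \<in> carrier X"
 shows "lin_comb R X (free_basis R x) = x"
proof -
 interpret X: left_module R X by fact
 show ?thesis
  unfolding lin_comb_lin_ext by (rule X.lin_ext_basis[of x "carrier X"]) (use assms in auto)
qed

lemma mhom_augmentation: "left_module R X ==> augmentation R X \<in> mod_hom R (res0 R X) X"
 unfolding augmentation_def res0_def by (rule mhom_lin_comb) auto

lemma res0_basis: "[|left_module R X; x \<in> carrier X|] ==> free_basis R x \<in> carrier (res0 R X)"
 by (simp only: res0_def free_basis_closed left_module_def)

lemma augmentation_onto:
 assumes "left_module R X" shows "augmentation R X ` carrier (res0 R X) = carrier X"
proof -
 have "x \<in> augmentation R X ` carrier (res0 R X)" if "x \<in> carrier X" for x
  using lin_comb_basis[OF assms that] res0_basis[OF assms that]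
  by (metis augmentation_def imageI restrict_apply')
 then show ?thesis using mhom_closed[OF mhom_augmentation[OF assms]] by auto
qed

subsection \<open>Vanishing of Ext\<close>

definition syzygy :: "('r, 'p) ring_scheme => ('r, 'x, 'q) module_scheme => ('r, 'x => 'r) module"
 where "syzygy R X = sub_module (res0 R X) (hom_kernel (res0 R X) X (augmentation R X))"

text \<open>
 The vanishing of \<open>Ext\<^sup>1 (X, Y)\<close> (see \<open>trivial_Ext1_iff\<close>): every homomorphism from the syzygy of \<open>X\<close> extends to
 the free module. This form allows the two modules to have elements of different types.
\<close>

definition ext_zero ::
 "('r, 'p) ring_scheme => ('r, 'x, 'q) module_scheme => ('r, 'y, 's) module_scheme => bool"
 where "ext_zero R X Y \<longleftrightarrow> (\<forall>f\<in>mod_hom R (syzygy R X) Y. \<exists>g\<in>mod_hom R (res0 R X) Y.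
  \<forall>k\<in>carrier (syzygy R X). g k = f k)"

lemma carrier_syzygy: "carrier (syzygy R X) = hom_kernel (res0 R X) X (augmentation R X)"
 by (simp add: syzygy_def)

lemma lmod_syzygy: "left_module R X ==> left_module R (syzygy R X)"
 unfolding syzygy_def by (intro lmod_sub lmod_res0 submodule_hom_kernel mhom_augmentation)

lemma short_exact_syzygy:
 "left_module R X ==> short_exact R (syzygy R X) (res0 R X) X
  (\<lambda>k\<in>carrier (syzygy R X). k) (augmentation R X)"
 unfolding syzygy_def using short_exact_kernel[OF lmod_res0 _ mhom_augmentation augmentation_onto]
 by (simp add: hom_kernel_def cong: restrict_cong)

lemma syzygyD:
 assumes "k \<in> carrier (syzygy R X)"
 shows "k \<in> carrier (res0 R X)" "augmentation R X k = \<zero>\<^bsub>X\<^esub>"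
 using assms by (auto simp: carrier_syzygy hom_kernel_def)

lemma mhom_restrict_syzygy:
 "[|left_module R X; f \<in> mod_hom R (res0 R X) Y|] ==>
  restrict f (carrier (syzygy R X)) \<in> mod_hom R (syzygy R X) Y"
 using mhom_sub_incl[OF lmod_res0 submodule_hom_kernel[OF lmod_res0 _ mhom_augmentation]]
 by (simp add: syzygy_def)

lemma mhom_syzygy_incl: "left_module R X ==>
  (\<lambda>k\<in>carrier (syzygy R X). k) \<in> mod_hom R (syzygy R X) (res0 R X)"
 by (rule short_exactD(1)[OF short_exact_syzygy])

lemma res0_lift:
 assumes "left_module R X" "left_module R E" "left_module R Z" "p \<in> mod_hom R E Z"
  "p ` carrier E = carrier Z" "u \<in> mod_hom R (res0 R X) Z"
 shows "\<exists>w\<in>mod_hom R (res0 R X) E. \<forall>x\<in>carrier (res0 R X). p (w x) = u x"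
 using assms unfolding res0_def by (intro free_lift) auto

lemma short_exact_onto: "short_exact R X Y Z f g ==> g ` carrier Y = carrier Z" by (simp add: short_exact_def)

text \<open>The exactness of \<open>Hom (-, N)\<close> at the third term of a short exact sequence.\<close>

lemma ext_zero_extend:
 assumes "left_module R X" "left_module R Y" "left_module R Z" "left_module R N"
  and se: "short_exact R X Y Z i p" and ext: "ext_zero R Z N" and f: "f \<in> mod_hom R X N"
 shows "\<exists>g\<in>mod_hom R Y N. \<forall>x\<in>carrier X. g (i x) = f x"
proof -
 note se' = short_exactD[OF se]
 let ?F = "res0 R Z" and ?K = "syzygy R Z"
 have F: "left_module R ?F" and K: "left_module R ?K" using assms by (auto intro: lmod_res0 lmod_syzygy)
 interpret X: left_module R X by fact
 interpret Y: left_module R Y by fact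
 interpret N: left_module R N by fact
 interpret F: left_module R ?F by fact
 obtain u where u: "u \<in> mod_hom R ?F Y" "!!x. x \<in> carrier ?F ==> p (u x) = augmentation R Z x"
  using res0_lift[OF assms(3,2,3) se'(2) short_exact_onto[OF se] mhom_augmentation[OF assms(3)]] by blast
 have "\<exists>k\<in>mod_hom R ?K X. \<forall>n\<in>carrier ?K. i (k n) = restrict u (carrier ?K) n"
  by (rule factor_through_inj[OF K assms(1,2) se'(1,3) mhom_restrict_syzygy[OF assms(3) u(1)]])
   (use u se'(5) syzygyD mhom_closed[OF u(1)] in \<open>force simp: \<close>)
 then obtain k where k: "k \<in> mod_hom R ?K X" "!!n. n \<in> carrier ?K ==> i (k n) = u n" by auto
 obtain e where e: "e \<in> mod_hom R ?F N" "!!n. n \<in> carrier ?K ==> e n = f (k n)"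
  using ext[unfolded ext_zero_def, rule_format, OF mhom_compose[OF K k(1) f]] by (auto simp: compose_def)
 let ?S = "direct_sum X ?F"
 define \<sigma> where "\<sigma> = (\<lambda>v\<in>carrier ?S. i (fst v) \<oplus>\<^bsub>Y\<^esub> u (snd v))"
 define h where "h = (\<lambda>v\<in>carrier ?S. f (fst v) \<oplus>\<^bsub>N\<^esub> e (snd v))"
 have S: "left_module R ?S" by (rule lmod_direct_sum[OF assms(1) F])
 have \<sigma>: "\<sigma> \<in> mod_hom R ?S Y" and h: "h \<in> mod_hom R ?S N"
  unfolding \<sigma>_def h_def by (rule mhom_sum_map[OF assms(1) F] assms se' u f e)+
 note [simp] = mhom_closed[OF se'(1)] mhom_closed[OF u(1)] mhom_closed[OF f]
  mhom_closed[OF e(1)] mhom_closed[OF k(1)]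
 have onto: "\<sigma> ` carrier ?S = carrier Y"
 proof -
  have "y \<in> \<sigma> ` carrier ?S" if y: "y \<in> carrier Y" for y
  proof -
   obtain x where x: "x \<in> carrier ?F" "augmentation R Z x = p y"
    using augmentation_onto[OF assms(3)] mhom_closed[OF se'(2) y] by (metis imageE)
   then have "p (y \<ominus>\<^bsub>Y\<^esub> u x) = \<zero>\<^bsub>Z\<^esub>"
    using mhom_diff[OF assms(2,3) se'(2) y, of "u x"] u(2)[OF x(1)] left_module.diff_self[OF assms(3)]
     mhom_closed[OF se'(2) y] by simp
   then obtain x' where x': "x' \<in> carrier X" "y \<ominus>\<^bsub>Y\<^esub> u x = i x'"
    using se'(5)[of "y \<ominus>\<^bsub>Y\<^esub> u x"] y x by auto
   then have "y = \<sigma> (x', x)" using x y Y.diff_add_cancel[of "u x" y] by (simp add: \<sigma>_def)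
   then show ?thesis using x x' by auto
  qed
  then show ?thesis using mhom_closed[OF \<sigma>] by auto
 qed
 have ker: "h v = \<zero>\<^bsub>N\<^esub>" if v: "v \<in> carrier ?S" "\<sigma> v = \<zero>\<^bsub>Y\<^esub>" for v
 proof -
  obtain x n where xn: "v = (x, n)" "x \<in> carrier X" "n \<in> carrier ?F" using v by auto
  have 0: "i x \<oplus>\<^bsub>Y\<^esub> u n = \<zero>\<^bsub>Y\<^esub>" using v xn by (simp add: \<sigma>_def)
  then have "p (i x) \<oplus>\<^bsub>Z\<^esub> p (u n) = \<zero>\<^bsub>Z\<^esub>"
   using xn mhom_add[OF se'(2), of "i x" "u n"] mhom_zero[OF assms(2,3) se'(2)] by simp
  moreover interpret Z: left_module R Z by fact
  have "augmentation R Z n \<in> carrier Z" using xn mhom_closed[OF mhom_augmentation[OF assms(3)]] by simp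
  ultimately have nK: "n \<in> carrier ?K" using xn se'(4) u(2) by (simp add: carrier_syzygy hom_kernel_def)
  have "i (x \<oplus>\<^bsub>X\<^esub> k n) = \<zero>\<^bsub>Y\<^esub>"
   using 0 xn nK k by (simp add: mhom_add[OF se'(1)])
  then have "x \<oplus>\<^bsub>X\<^esub> k n = \<zero>\<^bsub>X\<^esub>"
   using inj_mod_hom_zero[OF assms(1,2) se'(1,3)] xn nK by simp
  then have "f x \<oplus>\<^bsub>N\<^esub> f (k n) = \<zero>\<^bsub>N\<^esub>"
   using xn nK mhom_add[OF f, of x "k n"] mhom_zero[OF assms(1,4) f] by simp
  then show ?thesis using xn nK e by (simp add: h_def)
 qed
 obtain g where g: "g \<in> mod_hom R Y N" "!!v. v \<in> carrier ?S ==> g (\<sigma> v) = h v"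
  using factor_through_surj[OF S assms(2,4) \<sigma> onto h ker] by blast
 have "g (i x) = f x" if x: "x \<in> carrier X" for x
  using g(2)[of "(x, \<zero>\<^bsub>?F\<^esub>)"] x mhom_zero[OF F assms(2) u(1)] mhom_zero[OF F assms(4) e(1)]
  by (simp add: \<sigma>_def h_def)
 then show ?thesis using g by blast
qed

text \<open>The exactness of \<open>Hom (N, -)\<close> at the third term of a short exact sequence.\<close>

lemma ext_zero_lift:
 assumes "left_module R V" "left_module R E" "left_module R Z" "left_module R N"
  and se: "short_exact R V E Z i p" and ext: "ext_zero R N V" and q: "q \<in> mod_hom R N Z"
 shows "\<exists>s\<in>mod_hom R N E. \<forall>n\<in>carrier N. p (s n) = q n"
proof -
 note se' = short_exactD[OF se]
 let ?F = "res0 R N" and ?K = "syzygy R N" and ?a = "augmentation R N"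
 have F: "left_module R ?F" and K: "left_module R ?K" using assms by (auto intro: lmod_res0 lmod_syzygy)
 interpret E: left_module R E by fact
 interpret Z: left_module R Z by fact
 note a = mhom_augmentation[OF assms(4)]
 obtain u where u: "u \<in> mod_hom R ?F E" "!!x. x \<in> carrier ?F ==> p (u x) = q (?a x)"
  using res0_lift[OF assms(4,2,3) se'(2) short_exact_onto[OF se] mhom_compose[OF F a q]]
  by (auto simp: compose_def)
 have "\<exists>k\<in>mod_hom R ?K V. \<forall>n\<in>carrier ?K. i (k n) = restrict u (carrier ?K) n"
 proof (rule factor_through_inj[OF K assms(1,2) se'(1,3) mhom_restrict_syzygy[OF assms(4) u(1)]])
  fix n assume n: "n \<in> carrier ?K"
  then show "\<exists>x\<in>carrier V. restrict u (carrier ?K) n = i x"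
   using se'(5)[of "u n"] syzygyD[OF n] u(2)[of n] mhom_closed[OF u(1)]
    mhom_zero[OF assms(4,3) q] by simp
 qed
 then obtain k where k: "k \<in> mod_hom R ?K V" "!!n. n \<in> carrier ?K ==> i (k n) = u n" by auto
 obtain e where e: "e \<in> mod_hom R ?F V" "!!n. n \<in> carrier ?K ==> e n = k n"
  using ext[unfolded ext_zero_def, rule_format, OF k(1)] by blast
 note [simp] = mhom_closed[OF se'(1)] mhom_closed[OF u(1)] mhom_closed[OF e(1)]
  mhom_closed[OF q] mhom_closed[OF a]
 define w where "w = (\<lambda>x\<in>carrier ?F. u x \<ominus>\<^bsub>E\<^esub> compose (carrier ?F) i e x)"
 have w: "w \<in> mod_hom R ?F E"
  unfolding w_def by (intro mhom_diff_map F assms u mhom_compose[OF F e(1) se'(1)])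
 have wk: "w x = \<zero>\<^bsub>E\<^esub>" if "x \<in> carrier ?F" "?a x = \<zero>\<^bsub>N\<^esub>" for x
 proof -
  have "x \<in> carrier ?K" using that by (simp add: carrier_syzygy hom_kernel_def)
  then show ?thesis using that k e by (simp add: w_def compose_def E.diff_self)
 qed
 obtain s where s: "s \<in> mod_hom R N E" "!!x. x \<in> carrier ?F ==> s (?a x) = w x"
  using factor_through_surj[OF F assms(4,2) a augmentation_onto[OF assms(4)] w wk] by blast
 have "p (s n) = q n" if n: "n \<in> carrier N" for n
 proof -
  obtain x where x: "x \<in> carrier ?F" "n = ?a x" using augmentation_onto[OF assms(4)] n by (metis imageE)
  have "p (w x) = q (?a x)" using x by (simp add: w_def compose_def mhom_diff[OF assms(2,3) se'(2)] u se'(4))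
    (simp add: a_minus_def)
  then show ?thesis using s x by simp
 qed
 then show ?thesis using s by blast
qed

text \<open>
 An extension of \<open>p f\<close> to the free module is lifted along \<open>p\<close>; it then differs from \<open>f\<close> on the syzygy by a
 homomorphism into \<open>X\<close>, which extends.
\<close>

lemma ext_zero_extension_right:
 assumes "left_module R X" "left_module R Y" "left_module R Z" "left_module R N"
  and se: "short_exact R X Y Z i p" and ext: "ext_zero R N X" "ext_zero R N Z"
 shows "ext_zero R N Y"
 unfolding ext_zero_def
proof
 note se' = short_exactD[OF se]
 let ?F = "res0 R N" and ?K = "syzygy R N"
 have F: "left_module R ?F" and K: "left_module R ?K" using assms by (auto intro: lmod_res0 lmod_syzygy)
 interpret Y: left_module R Y by fact
 interpret Z: left_module R Z by fact
 fix f assume f: "f \<in> mod_hom R ?K Y"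
 obtain h where h: "h \<in> mod_hom R ?F Z" "!!n. n \<in> carrier ?K ==> h n = p (f n)"
  using ext(2)[unfolded ext_zero_def, rule_format, OF mhom_compose[OF K f se'(2)]] by (auto simp: compose_def)
 obtain h' where h': "h' \<in> mod_hom R ?F Y" "!!x. x \<in> carrier ?F ==> p (h' x) = h x"
  using res0_lift[OF assms(4,2,3) se'(2) short_exact_onto[OF se] h(1)] by blast
 note h'K = mhom_restrict_syzygy[OF assms(4) h'(1)]
 note [simp] = mhom_closed[OF f] mhom_closed[OF h'(1)] mhom_closed[OF se'(1)]
 have "\<exists>k\<in>mod_hom R ?K X. \<forall>n\<in>carrier ?K. i (k n) =
   (\<lambda>n\<in>carrier ?K. f n \<ominus>\<^bsub>Y\<^esub> restrict h' (carrier ?K) n) n"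
 proof (rule factor_through_inj[OF K assms(1,2) se'(1,3) mhom_diff_map[OF K assms(2) f h'K]])
  fix n assume n: "n \<in> carrier ?K"
  then have "p (f n \<ominus>\<^bsub>Y\<^esub> h' n) = \<zero>\<^bsub>Z\<^esub>"
   using syzygyD[OF n] h h' mhom_closed[OF h(1), of n]
   by (simp add: mhom_diff[OF assms(2,3) se'(2)]) (metis Z.diff_self)
  then show "\<exists>x\<in>carrier X. (\<lambda>n\<in>carrier ?K. f n \<ominus>\<^bsub>Y\<^esub> restrict h' (carrier ?K) n) n = i x"
   using se'(5)[of "f n \<ominus>\<^bsub>Y\<^esub> h' n"] n syzygyD[OF n] by simp
 qed
 then obtain k where k: "k \<in> mod_hom R ?K X" "!!n. n \<in> carrier ?K ==> i (k n) = f n \<ominus>\<^bsub>Y\<^esub> h' n"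
  by auto
 obtain e where e: "e \<in> mod_hom R ?F X" "!!n. n \<in> carrier ?K ==> e n = k n"
  using ext(1)[unfolded ext_zero_def, rule_format, OF k(1)] by blast
 let ?g = "\<lambda>x\<in>carrier ?F. h' x \<oplus>\<^bsub>Y\<^esub> compose (carrier ?F) i e x"
 have "?g \<in> mod_hom R ?F Y" by (intro mhom_add_map F assms h' mhom_compose[OF F e(1) se'(1)])
 moreover have "?g n = f n" if n: "n \<in> carrier ?K" for n
  using syzygyD[OF n] n e k by (simp add: compose_def Y.add_diff_cancel)
 ultimately show "\<exists>g\<in>mod_hom R ?F Y. \<forall>k\<in>carrier ?K. g k = f k" by blast
qed

lemma ext_zero_extension_left:
 assumes "left_module R X" "left_module R Y" "left_module R Z" "left_module R N"
  and se: "short_exact R X Y Z i p" and ext: "ext_zero R X N" "ext_zero R Z N"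
 shows "ext_zero R Y N"
 unfolding ext_zero_def
proof
 note se' = short_exactD[OF se]
 let ?F = "res0 R Y" and ?K = "syzygy R Y" and ?a = "augmentation R Y"
 have F: "left_module R ?F" and K: "left_module R ?K" using assms by (auto intro: lmod_res0 lmod_syzygy)
 interpret Y: left_module R Y by fact
 note a = mhom_augmentation[OF assms(2)]
 fix f assume f: "f \<in> mod_hom R ?K N"
 let ?pa = "compose (carrier ?F) p ?a"
 have pa: "?pa \<in> mod_hom R ?F Z" by (rule mhom_compose[OF F a se'(2)])
 have onto: "?pa ` carrier ?F = carrier Z"
  by (rule surj_compose[OF augmentation_onto[OF assms(2)] short_exact_onto[OF se]])
 define H where "H = hom_kernel ?F Z ?pa"
 have H: "submodule_of R ?F H" unfolding H_def by (rule submodule_hom_kernel[OF F assms(3) pa])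
 let ?P = "sub_module ?F H"
 have P: "left_module R ?P" by (rule lmod_sub[OF F H])
 have HD: "x \<in> carrier ?F" "p (?a x) = \<zero>\<^bsub>Z\<^esub>" if "x \<in> H" for x
  using that by (auto simp: H_def hom_kernel_def compose_def)
 have KH: "n \<in> H" if "n \<in> carrier ?K" for n
  using syzygyD[OF that] mhom_zero[OF assms(2,3) se'(2)] by (simp add: H_def hom_kernel_def compose_def)
 have "\<exists>k\<in>mod_hom R ?P X. \<forall>x\<in>carrier ?P. i (k x) = restrict ?a H x"
  by (rule factor_through_inj[OF P assms(1,2) se'(1,3) mhom_sub_incl[OF F H a]])
   (use se'(5) HD mhom_closed[OF a] in simp)
 then obtain k where k: "k \<in> mod_hom R ?P X" "!!x. x \<in> H ==> i (k x) = ?a x" by auto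
 have se1: "short_exact R ?K ?P X (\<lambda>n\<in>carrier ?K. n) k"
 proof (rule short_exactI[OF K P])
  show "(\<lambda>n\<in>carrier ?K. n) \<in> mod_hom R ?K ?P"
   by (rule mhom_into_sub[OF mhom_syzygy_incl[OF assms(2)]]) (simp add: KH)
 next
  fix x assume x: "x \<in> carrier ?K"
  have "i (k x) = \<zero>\<^bsub>Y\<^esub>" using k(2)[OF KH[OF x]] syzygyD[OF x] by simp
  then show "k ((\<lambda>n\<in>carrier ?K. n) x) = \<zero>\<^bsub>X\<^esub>"
   using inj_mod_hom_zero[OF assms(1,2) se'(1,3)] mhom_closed[OF k(1)] KH[OF x] x by simp
 next
  fix y assume y: "y \<in> carrier ?P" "k y = \<zero>\<^bsub>X\<^esub>"
  then have "?a y = \<zero>\<^bsub>Y\<^esub>" using k(2)[of y] mhom_zero[OF assms(1,2) se'(1)] by simp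
  then have "y \<in> carrier ?K" using HD(1) y by (simp add: carrier_syzygy hom_kernel_def)
  then show "\<exists>x\<in>carrier ?K. y = (\<lambda>n\<in>carrier ?K. n) x" by auto
 next
  fix z assume z: "z \<in> carrier X"
  obtain x where x: "x \<in> carrier ?F" "i z = ?a x"
   using augmentation_onto[OF assms(2)] mhom_closed[OF se'(1) z] by (metis imageE)
  then have xH: "x \<in> H" using se'(4)[OF z] by (simp add: H_def hom_kernel_def compose_def)
  then have "z = k x" using k(2)[OF xH] x z mhom_closed[OF k(1), of x] inj_onD[OF se'(3), of "k x" z] by simp
  then show "\<exists>y\<in>carrier ?P. z = k y" using xH by auto
 qed (use k in \<open>auto simp: syzygy_def\<close>)
 obtain f1 where f1: "f1 \<in> mod_hom R ?P N" "!!n. n \<in> carrier ?K ==> f1 n = f n"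
  using ext_zero_extend[OF K P assms(1,4) se1 ext(1) f] by auto
 obtain g where g: "g \<in> mod_hom R ?F N" "!!x. x \<in> H ==> g x = f1 x"
  using ext_zero_extend[OF P F assms(3,4) short_exact_kernel[OF F assms(3) pa onto, folded H_def] ext(2) f1(1)]
  by auto
 show "\<exists>g\<in>mod_hom R ?F N. \<forall>k\<in>carrier ?K. g k = f k"
  by (intro bexI[OF _ g(1)]) (simp add: g f1 KH)
qed

text \<open>
 The pushout of the free presentation of \<open>Z\<close> along \<open>f\<close> is an extension of \<open>Z\<close> by \<open>Y\<close>, and a retraction of it
 extends \<open>f\<close>. The type of \<open>E\<close> is that of a quotient of the direct sum of \<open>Y\<close> and the free module.
\<close>

lemma ext_zeroI_split:
 fixes Y :: "('r, 'y, 's) module_scheme" and Z :: "('r, 'z, 't) module_scheme"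
 assumes "left_module R Y" "left_module R Z"
  and split: "!!(E :: ('r, ('y \<times> ('z => 'r)) set) module) i p.
   [|left_module R E; short_exact R Y E Z i p|] ==> \<exists>r\<in>mod_hom R E Y. \<forall>y\<in>carrier Y. r (i y) = y"
 shows "ext_zero R Z Y"
 unfolding ext_zero_def
proof
 let ?F = "res0 R Z" and ?K = "syzygy R Z" and ?a = "augmentation R Z"
 have F: "left_module R ?F" and K: "left_module R ?K" using assms by (auto intro: lmod_res0 lmod_syzygy)
 interpret Y: left_module R Y by fact
 interpret Z: left_module R Z by fact
 interpret F: left_module R ?F by fact
 note a = mhom_augmentation[OF assms(2)]
 fix f assume f: "f \<in> mod_hom R ?K Y"
 note [simp] = mhom_closed[OF f] mhom_closed[OF a]
 let ?D = "direct_sum Y ?F"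
 have D: "left_module R ?D" by (rule lmod_direct_sum[OF assms(1) F])
 interpret D: left_module R ?D by fact
 have KF: "n \<in> carrier ?F" "?a n = \<zero>\<^bsub>Z\<^esub>" if "n \<in> carrier ?K" for n using syzygyD[OF that] .
 define j where "j = (\<lambda>n\<in>carrier ?K. (f n, \<ominus>\<^bsub>?F\<^esub> n))"
 have smn: "\<ominus>\<^bsub>?F\<^esub> (a \<odot>\<^bsub>?F\<^esub> n) = a \<odot>\<^bsub>?F\<^esub> (\<ominus>\<^bsub>?F\<^esub> n)" if "a \<in> carrier R" "n \<in> carrier ?F" for a n
 proof (rule F.minus_equality)
  show "a \<odot>\<^bsub>?F\<^esub> (\<ominus>\<^bsub>?F\<^esub> n) \<oplus>\<^bsub>?F\<^esub> a \<odot>\<^bsub>?F\<^esub> n = \<zero>\<^bsub>?F\<^esub>"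
   using that by (simp only: F.smult_r_distr[symmetric] F.a_inv_closed F.l_neg F.smult_r_zero)
 qed (use that F.smult_closed in auto)
 have j: "j \<in> mod_hom R ?K ?D"
  unfolding j_def
 proof (rule mhom_restrictI[OF K])
  fix x y assume xy: "x \<in> carrier ?K" "y \<in> carrier ?K"
  have "x \<oplus>\<^bsub>?K\<^esub> y = x \<oplus>\<^bsub>?F\<^esub> y" by (simp add: syzygy_def)
  then show "(f (x \<oplus>\<^bsub>?K\<^esub> y), \<ominus>\<^bsub>?F\<^esub> (x \<oplus>\<^bsub>?K\<^esub> y)) = (f x, \<ominus>\<^bsub>?F\<^esub> x) \<oplus>\<^bsub>?D\<^esub> (f y, \<ominus>\<^bsub>?F\<^esub> y)"
   using xy KF mhom_add[OF f xy] F.minus_add by simp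
 next
  fix a x assume ax: "a \<in> carrier R" "x \<in> carrier ?K"
  have "a \<odot>\<^bsub>?K\<^esub> x = a \<odot>\<^bsub>?F\<^esub> x" by (simp add: syzygy_def)
  then show "(f (a \<odot>\<^bsub>?K\<^esub> x), \<ominus>\<^bsub>?F\<^esub> (a \<odot>\<^bsub>?K\<^esub> x)) = a \<odot>\<^bsub>?D\<^esub> (f x, \<ominus>\<^bsub>?F\<^esub> x)"
   using KF ax mhom_smult[OF f ax] smn by simp
 qed (use KF in simp)
 define H where "H = j ` carrier ?K"
 have H: "submodule_of R ?D H" unfolding H_def by (rule submodule_image[OF K D j])
 let ?E = "quotient_module ?D H" and ?q = "\<lambda>x\<in>carrier ?D. H +>\<^bsub>?D\<^esub> x"
 note E = lmod_quotient[OF D H] and q = mhom_quotient[OF D H]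
 have qonto: "?q ` carrier ?D = carrier ?E" using quotient_onto[OF D H] by (simp cong: image_cong)
 have qzero: "?q x = \<zero>\<^bsub>?E\<^esub> \<longleftrightarrow> x \<in> H" if "x \<in> carrier ?D" for x
  using quotient_zero_iff[OF D H that] that by simp
 have j1: "(\<lambda>y\<in>carrier Y. (y, \<zero>\<^bsub>?F\<^esub>)) \<in> mod_hom R Y ?D"
  by (rule mhom_restrictI[OF assms(1)]) (simp_all del: free_module_simps)
 have j2: "(\<lambda>x\<in>carrier ?F. (\<zero>\<^bsub>Y\<^esub>, x)) \<in> mod_hom R ?F ?D"
  by (rule mhom_restrictI[OF F]) (simp_all del: free_module_simps)
 define i where "i = compose (carrier Y) ?q (\<lambda>y\<in>carrier Y. (y, \<zero>\<^bsub>?F\<^esub>))"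
 have i: "i \<in> mod_hom R Y ?E" unfolding i_def by (rule mhom_compose[OF assms(1) j1 q])
 define b where "b = compose (carrier ?D) ?a (\<lambda>u\<in>carrier ?D. snd u)"
 have b: "b \<in> mod_hom R ?D Z"
  unfolding b_def by (rule mhom_compose[OF D mhom_snd[OF assms(1) F] a])
 have b0: "b y = \<zero>\<^bsub>Z\<^esub>" if "y \<in> carrier ?D" "?q y = \<zero>\<^bsub>?E\<^esub>" for y
 proof -
  have "y \<in> H" using qzero that by blast
  then obtain n where n: "n \<in> carrier ?K" "y = j n" by (auto simp: H_def)
  then show ?thesis using KF[OF n(1)] that(1) mhom_uminus[OF F assms(2) a]
   by (simp add: b_def compose_def j_def)
 qed
 obtain p where p: "p \<in> mod_hom R ?E Z" "!!u. u \<in> carrier ?D ==> p (?q u) = b u"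
  using factor_through_surj[OF D E assms(2) q qonto b b0] by blast
 have qD: "?q u \<in> carrier ?E" if "u \<in> carrier ?D" for u using mhom_closed[OF q that] .
 have iq: "i y = ?q (y, \<zero>\<^bsub>?F\<^esub>)" if "y \<in> carrier Y" for y using that by (simp add: i_def compose_def)
 have bv: "b (y, x) = ?a x" if "y \<in> carrier Y" "x \<in> carrier ?F" for y x
  using that by (simp add: b_def compose_def)
 have jv: "j n = (f n, \<ominus>\<^bsub>?F\<^esub> n)" if "n \<in> carrier ?K" for n using that by (simp add: j_def)
 have F0: "\<zero>\<^bsub>?F\<^esub> \<in> carrier ?F" by (rule F.zero_closed)
 have a0: "?a \<zero>\<^bsub>?F\<^esub> = \<zero>\<^bsub>Z\<^esub>" by (rule mhom_zero[OF F assms(2) a])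
 have se: "short_exact R Y ?E Z i p"
 proof (rule short_exactI[OF assms(1) E i p(1)])
  fix y assume y: "y \<in> carrier Y" "i y = \<zero>\<^bsub>?E\<^esub>"
  then have "(y, \<zero>\<^bsub>?F\<^esub>) \<in> H" using iq[OF y(1)] qzero[of "(y, \<zero>\<^bsub>?F\<^esub>)"] F0 by simp
  then obtain n where n: "n \<in> carrier ?K" "y = f n" "\<zero>\<^bsub>?F\<^esub> = \<ominus>\<^bsub>?F\<^esub> n"
   using jv by (auto simp: H_def simp del: free_module_simps)
  then have "n = \<zero>\<^bsub>?K\<^esub>"
   using KF(1)[OF n(1)] F.r_neg[OF KF(1)[OF n(1)]] n(3)[symmetric] by (simp add: syzygy_def)
  then show "y = \<zero>\<^bsub>Y\<^esub>" using n mhom_zero[OF K assms(1) f] by simp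
 next
  fix y assume y: "y \<in> carrier Y"
  then show "p (i y) = \<zero>\<^bsub>Z\<^esub>"
   using iq[OF y] p(2)[of "(y, \<zero>\<^bsub>?F\<^esub>)"] bv[OF y F0] F0 a0 by simp
 next
  fix e assume e: "e \<in> carrier ?E" "p e = \<zero>\<^bsub>Z\<^esub>"
  obtain u where "u \<in> carrier ?D" "e = ?q u" using e(1) qonto by blast
  then obtain y x where yx: "y \<in> carrier Y" "x \<in> carrier ?F" "e = ?q (y, x)" by (cases u) auto
  then have "?a x = \<zero>\<^bsub>Z\<^esub>" using e(2) p(2)[of "(y, x)"] bv by simp
  then have xK: "x \<in> carrier ?K" using yx by (simp add: carrier_syzygy hom_kernel_def)
  have jx: "j x \<in> carrier ?D" by (rule mhom_closed[OF j xK])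
  have "(y \<oplus>\<^bsub>Y\<^esub> f x, \<zero>\<^bsub>?F\<^esub>) = (y, x) \<oplus>\<^bsub>?D\<^esub> j x"
   using yx xK jv[OF xK] F.r_neg[of x] by (simp del: free_module_simps)
  moreover have "?q (j x) = \<zero>\<^bsub>?E\<^esub>" using qzero[OF jx] xK by (simp add: H_def)
  moreover have "?q ((y, x) \<oplus>\<^bsub>?D\<^esub> j x) = ?q (y, x) \<oplus>\<^bsub>?E\<^esub> ?q (j x)"
   by (rule mhom_add[OF q]) (use yx jx in auto)
  moreover have "i (y \<oplus>\<^bsub>Y\<^esub> f x) = ?q (y \<oplus>\<^bsub>Y\<^esub> f x, \<zero>\<^bsub>?F\<^esub>)"
   by (rule iq) (use yx xK in auto)
  ultimately have "i (y \<oplus>\<^bsub>Y\<^esub> f x) = e \<oplus>\<^bsub>?E\<^esub> \<zero>\<^bsub>?E\<^esub>"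
   unfolding yx(3) by (simp only:)
  also interpret E: left_module R ?E by (rule E)
  have "e \<oplus>\<^bsub>?E\<^esub> \<zero>\<^bsub>?E\<^esub> = e" using e by simp
  finally show "\<exists>x\<in>carrier Y. e = i x"
   using yx xK by (intro bexI[of _ "y \<oplus>\<^bsub>Y\<^esub> f x"]) auto
 next
  fix z assume "z \<in> carrier Z"
  then obtain x where x: "x \<in> carrier ?F" "z = ?a x" using augmentation_onto[OF assms(2)] by (metis imageE)
  then have "z = p (?q (\<zero>\<^bsub>Y\<^esub>, x))" using p(2)[of "(\<zero>\<^bsub>Y\<^esub>, x)"] bv[of "\<zero>\<^bsub>Y\<^esub>" x] by simp
  then show "\<exists>y\<in>carrier ?E. z = p y" using qD[of "(\<zero>\<^bsub>Y\<^esub>, x)"] x by auto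
 qed
 obtain r where r: "r \<in> mod_hom R ?E Y" "!!y. y \<in> carrier Y ==> r (i y) = y"
  using split[OF E se] by blast
 define g where "g = compose (carrier ?F) (compose (carrier ?D) r ?q) (\<lambda>x\<in>carrier ?F. (\<zero>\<^bsub>Y\<^esub>, x))"
 have g: "g \<in> mod_hom R ?F Y"
  unfolding g_def by (rule mhom_compose[OF F j2 mhom_compose[OF D q r(1)]])
 have "g n = f n" if n: "n \<in> carrier ?K" for n
 proof -
  have jn: "j n \<in> carrier ?D" by (rule mhom_closed[OF j n])
  have "(f n, \<zero>\<^bsub>?F\<^esub>) = (\<zero>\<^bsub>Y\<^esub>, n) \<oplus>\<^bsub>?D\<^esub> j n"
   using KF[OF n] n jv[OF n] F.r_neg[of n] by (simp del: free_module_simps)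
  moreover have "?q (j n) = \<zero>\<^bsub>?E\<^esub>" using qzero[OF jn] n by (simp add: H_def)
  moreover have "?q ((\<zero>\<^bsub>Y\<^esub>, n) \<oplus>\<^bsub>?D\<^esub> j n) = ?q (\<zero>\<^bsub>Y\<^esub>, n) \<oplus>\<^bsub>?E\<^esub> ?q (j n)"
   by (rule mhom_add[OF q]) (use KF n jn in auto)
  moreover interpret E: left_module R ?E by (rule E)
  have "?q (\<zero>\<^bsub>Y\<^esub>, n) \<oplus>\<^bsub>?E\<^esub> \<zero>\<^bsub>?E\<^esub> = ?q (\<zero>\<^bsub>Y\<^esub>, n)" using KF[OF n] qD[of "(\<zero>\<^bsub>Y\<^esub>, n)"] by simp
  moreover have "i (f n) = ?q (f n, \<zero>\<^bsub>?F\<^esub>)" by (rule iq) (use n in simp)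
  ultimately have "i (f n) = ?q (\<zero>\<^bsub>Y\<^esub>, n)" by (simp only:)
  then show ?thesis using r(2)[of "f n"] n KF[OF n] by (simp add: g_def compose_def)
 qed
 then show "\<exists>g\<in>mod_hom R ?F Y. \<forall>k\<in>carrier ?K. g k = f k" using g by blast
qed

text \<open>A section \<open>s\<close> of \<open>p\<close> gives the retraction \<open>e \<mapsto> e - s (p e)\<close>, which takes values in \<open>ker p = im i\<close>.\<close>

lemma retraction_of_section:
 assumes "left_module R V" "left_module R E" "left_module R Z" "short_exact R V E Z i p"
  and s: "s \<in> mod_hom R Z E" "!!z. z \<in> carrier Z ==> p (s z) = z"
 shows "\<exists>r\<in>mod_hom R E V. \<forall>v\<in>carrier V. r (i v) = v"
proof -
 note se' = short_exactD[OF assms(4)]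
 interpret V: left_module R V by fact
 interpret E: left_module R E by fact
 interpret Z: left_module R Z by fact
 note [simp] = mhom_closed[OF se'(1)] mhom_closed[OF se'(2)] mhom_closed[OF s(1)]
 let ?h = "\<lambda>e\<in>carrier E. (\<lambda>e\<in>carrier E. e) e \<ominus>\<^bsub>E\<^esub> compose (carrier E) s p e"
 have "\<exists>r\<in>mod_hom R E V. \<forall>e\<in>carrier E. i (r e) = ?h e"
 proof (rule factor_through_inj[OF assms(2,1,2) se'(1,3)])
  show "?h \<in> mod_hom R E E" by (intro mhom_diff_map assms mhom_id mhom_compose[OF assms(2) se'(2) s(1)])
  fix e assume e: "e \<in> carrier E"
  then have "p (e \<ominus>\<^bsub>E\<^esub> s (p e)) = \<zero>\<^bsub>Z\<^esub>"
   by (simp add: mhom_diff[OF assms(2,3) se'(2)] s(2) Z.diff_self)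
  then show "\<exists>x\<in>carrier V. ?h e = i x"
   using se'(5)[of "e \<ominus>\<^bsub>E\<^esub> s (p e)"] e by (simp add: compose_def)
 qed
 then obtain r where r: "r \<in> mod_hom R E V" "!!e. e \<in> carrier E ==> i (r e) = e \<ominus>\<^bsub>E\<^esub> s (p e)"
  by (auto simp: compose_def)
 have "r (i v) = v" if v: "v \<in> carrier V" for v
 proof -
  have "i (r (i v)) = i v"
   using r(2)[of "i v"] v se'(4)[OF v] mhom_zero[OF assms(3,2) s(1)] by (simp add: a_minus_def)
  then show ?thesis using se'(3) v mhom_closed[OF r(1)] by (auto dest: inj_onD)
 qed
 then show ?thesis using r by blast
qed

subsection \<open>Isomorphic and zero modules\<close>

text \<open>
 If all homomorphisms \<open>I \<rightarrow> V\<close> extend to \<open>N\<close>, the vanishing of Ext passes from \<open>N\<close> to \<open>N/I\<close>: in an extension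
 of \<open>N/I\<close> by \<open>V\<close>, the map \<open>N \<rightarrow> N/I\<close> lifts, and the lift can be corrected to kill \<open>I\<close>.
\<close>

lemma ext_zero_quotient:
 fixes Z :: "('r, 'z, 't) module_scheme" and V :: "('r, 'v, 's) module_scheme"
 assumes I: "left_module R I" and N: "left_module R N" and Z: "left_module R Z" and V: "left_module R V"
  and se: "short_exact R I N Z i p" and ext: "ext_zero R N V"
  and res: "!!f. f \<in> mod_hom R I V ==> \<exists>g\<in>mod_hom R N V. \<forall>x\<in>carrier I. g (i x) = f x"
 shows "ext_zero R Z V"
proof (rule ext_zeroI_split[OF V Z])
 fix E :: "('r, ('v \<times> ('z => 'r)) set) module" and j q
 assume E: "left_module R E" and seE: "short_exact R V E Z j q"
 interpret E: left_module R E by fact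
 interpret Z: left_module R Z by fact
 note i = short_exactD(1)[OF se] and p = short_exactD(2)[OF se]
 note j = short_exactD(1)[OF seE] and q = short_exactD(2)[OF seE]
 obtain s where s: "s \<in> mod_hom R N E" "!!n. n \<in> carrier N ==> q (s n) = p n"
  using ext_zero_lift[OF V E Z N seE ext p] by blast
 note si = mhom_compose[OF I i s(1)]
 have "\<exists>v\<in>carrier V. compose (carrier I) s i x = j v" if x: "x \<in> carrier I" for x
  using short_exactD(5)[OF seE mhom_closed[OF si x]] s(2)[OF mhom_closed[OF i x]] short_exactD(4)[OF se x] x
  by (simp add: compose_def)
 from factor_through_inj[OF I V E j short_exactD(3)[OF seE] si this]
 obtain k where k: "k \<in> mod_hom R I V" "!!x. x \<in> carrier I ==> j (k x) = s (i x)" by (auto simp: compose_def)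
 obtain g where g: "g \<in> mod_hom R N V" "!!x. x \<in> carrier I ==> g (i x) = k x" using res[OF k(1)] by blast
 let ?d = "\<lambda>n\<in>carrier N. s n \<ominus>\<^bsub>E\<^esub> compose (carrier N) j g n"
 have d: "?d \<in> mod_hom R N E" by (intro mhom_diff_map N E s(1) mhom_compose[OF N g(1) j])
 have "?d n = \<zero>\<^bsub>E\<^esub>" if n: "n \<in> carrier N" "p n = \<zero>\<^bsub>Z\<^esub>" for n
 proof -
  obtain x where x: "x \<in> carrier I" "n = i x" using short_exactD(5)[OF se n] by blast
  then show ?thesis
   using n(1) g(2)[OF x(1)] k(2)[OF x(1)] E.diff_self[OF mhom_closed[OF s(1) n(1)]] by (simp add: compose_def)
 qed
 from factor_through_surj[OF N Z E p short_exact_onto[OF se] d this]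
 obtain t where t: "t \<in> mod_hom R Z E" "\<forall>n\<in>carrier N. t (p n) = ?d n" by blast
 have "q (t z) = z" if z: "z \<in> carrier Z" for z
 proof -
  obtain n where n: "n \<in> carrier N" "z = p n" using short_exactD(6)[OF se z] by blast
  note jg = mhom_closed[OF j mhom_closed[OF g(1) n(1)]]
  have "q (?d n) = z"
   using n mhom_diff[OF E Z q mhom_closed[OF s(1) n(1)] jg] s(2)[OF n(1)] short_exactD(4)[OF seE mhom_closed[OF g(1) n(1)]]
    Z.diff_zero[OF z] by (simp add: compose_def)
  then show ?thesis using t(2) n by simp
 qed
 then show "\<exists>r\<in>mod_hom R E V. \<forall>y\<in>carrier V. r (j y) = y" by (rule retraction_of_section[OF V E Z seE t(1)])
qed

text \<open>
 Dually, if all homomorphisms \<open>N \<rightarrow> Y/V\<close> lift to \<open>Y\<close>, the vanishing of Ext passes from \<open>Y\<close> to \<open>V\<close>.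
\<close>

lemma ext_zero_submodule:
 fixes N :: "('r, 'n, 't) module_scheme" and V :: "('r, 'v, 's) module_scheme"
 assumes V: "left_module R V" and Y: "left_module R Y" and Q: "left_module R Q" and N: "left_module R N"
  and se: "short_exact R V Y Q i p" and ext: "ext_zero R N Y"
  and lift: "!!h. h \<in> mod_hom R N Q ==> \<exists>w\<in>mod_hom R N Y. \<forall>x\<in>carrier N. p (w x) = h x"
 shows "ext_zero R N V"
proof (rule ext_zeroI_split[OF V N])
 fix E :: "('r, ('v \<times> ('n => 'r)) set) module" and j q
 assume E: "left_module R E" and seE: "short_exact R V E N j q"
 interpret Y: left_module R Y by fact
 interpret Q: left_module R Q by fact
 note i = short_exactD(1)[OF se] and p = short_exactD(2)[OF se]
 note j = short_exactD(1)[OF seE] and q = short_exactD(2)[OF seE]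
 obtain g where g: "g \<in> mod_hom R E Y" "!!v. v \<in> carrier V ==> g (j v) = i v"
  using ext_zero_extend[OF V E N Y seE ext i] by blast
 note pg = mhom_compose[OF E g(1) p]
 have "compose (carrier E) p g e = \<zero>\<^bsub>Q\<^esub>" if e: "e \<in> carrier E" "q e = \<zero>\<^bsub>N\<^esub>" for e
  using short_exactD(5)[OF seE e] g(2) short_exactD(4)[OF se] e(1) by (auto simp: compose_def)
 from factor_through_surj[OF E N Q q short_exact_onto[OF seE] pg this]
 obtain h where h: "h \<in> mod_hom R N Q" "!!e. e \<in> carrier E ==> h (q e) = p (g e)" by (auto simp: compose_def)
 obtain w where w: "w \<in> mod_hom R N Y" "!!x. x \<in> carrier N ==> p (w x) = h x" using lift[OF h(1)] by blast
 let ?d = "\<lambda>e\<in>carrier E. g e \<ominus>\<^bsub>Y\<^esub> compose (carrier E) w q e"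
 have d: "?d \<in> mod_hom R E Y" by (intro mhom_diff_map E Y g(1) mhom_compose[OF E q w(1)])
 have "\<exists>v\<in>carrier V. ?d e = i v" if e: "e \<in> carrier E" for e
 proof (rule short_exactD(5)[OF se mhom_closed[OF d e]])
  note ge = mhom_closed[OF g(1) e] and qe = mhom_closed[OF q e]
  show "p (?d e) = \<zero>\<^bsub>Q\<^esub>"
   using e mhom_diff[OF Y Q p ge mhom_closed[OF w(1) qe]] w(2)[OF qe] h(2)[OF e] Q.diff_self[OF mhom_closed[OF p ge]]
   by (simp add: compose_def)
 qed
 from factor_through_inj[OF E V Y i short_exactD(3)[OF se] d this]
 obtain r where r: "r \<in> mod_hom R E V" "\<forall>e\<in>carrier E. i (r e) = ?d e" by blast
 have "r (j v) = v" if v: "v \<in> carrier V" for v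
 proof (rule inj_onD[OF short_exactD(3)[OF se] _ _ v])
  note jv = mhom_closed[OF j v]
  show "i (r (j v)) = i v"
   using r(2)[rule_format, OF jv] jv g(2)[OF v] short_exactD(4)[OF seE v] mhom_zero[OF N Y w(1)] Y.diff_zero[OF mhom_closed[OF i v]]
   by (simp add: compose_def)
  show "r (j v) \<in> carrier V" by (rule mhom_closed[OF r(1) jv])
 qed
 then show "\<exists>r\<in>mod_hom R E V. \<forall>y\<in>carrier V. r (j y) = y" using r(1) by blast
qed

lemma mhom_inverse:
 assumes "left_module R X" "left_module R Y" "f \<in> mod_hom R X Y" "bij_betw f (carrier X) (carrier Y)"
 shows "\<exists>g\<in>mod_hom R Y X. bij_betw g (carrier Y) (carrier X) \<and>
  (\<forall>y\<in>carrier Y. f (g y) = y) \<and> (\<forall>x\<in>carrier X. g (f x) = x)"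
proof -
 have im: "f ` carrier X = carrier Y" and inj: "inj_on f (carrier X)"
  using assms(4) by (auto simp: bij_betw_def)
 obtain g where g: "g \<in> mod_hom R Y X" "!!y. y \<in> carrier Y ==> f (g y) = (\<lambda>y\<in>carrier Y. y) y"
  using factor_through_inj[OF assms(2,1,2,3) inj mhom_id[OF assms(2)]] im by fastforce
 have gf: "g (f x) = x" if "x \<in> carrier X" for x
  using g that mhom_closed[OF assms(3)] mhom_closed[OF g(1)] inj by (auto dest: inj_onD)
 have "bij_betw g (carrier Y) (carrier X)" by (rule bij_betw_byWitness[where f' = f])
   (use g gf mhom_closed[OF assms(3)] mhom_closed[OF g(1)] in auto)
 then show ?thesis using g gf by auto
qed

lemma ext_zero_iso_right:
 assumes "left_module R N" "left_module R Y" "left_module R Y'"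
  and i: "i \<in> mod_hom R Y Y'" "bij_betw i (carrier Y) (carrier Y')" and ext: "ext_zero R N Y"
 shows "ext_zero R N Y'"
 unfolding ext_zero_def
proof
 fix f assume f: "f \<in> mod_hom R (syzygy R N) Y'"
 obtain j where j: "j \<in> mod_hom R Y' Y" "!!y. y \<in> carrier Y' ==> i (j y) = y"
  using mhom_inverse[OF assms(2,3) i] by blast
 obtain g where g: "g \<in> mod_hom R (res0 R N) Y" "!!k. k \<in> carrier (syzygy R N) ==> g k = j (f k)"
  using ext[unfolded ext_zero_def, rule_format, OF mhom_compose[OF lmod_syzygy[OF assms(1)] f j(1)]]
  by (auto simp: compose_def)
 have "compose (carrier (res0 R N)) i g \<in> mod_hom R (res0 R N) Y'"
  by (rule mhom_compose[OF lmod_res0[OF assms(1)] g(1) i(1)])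
 moreover have "compose (carrier (res0 R N)) i g k = f k" if "k \<in> carrier (syzygy R N)" for k
  using that syzygyD[OF that] g j mhom_closed[OF f] by (simp add: compose_def)
 ultimately show "\<exists>g\<in>mod_hom R (res0 R N) Y'. \<forall>k\<in>carrier (syzygy R N). g k = f k" by blast
qed

lemma ext_zero_iso_left:
 assumes "left_module R X" "left_module R X'" "left_module R V"
  and i: "i \<in> mod_hom R X X'" "bij_betw i (carrier X) (carrier X')" and ext: "ext_zero R X V"
 shows "ext_zero R X' V"
proof -
 interpret X: left_module R X by fact
 interpret V: left_module R V by fact
 let ?I = "sub_module X {\<zero>\<^bsub>X\<^esub>}"
 have s: "submodule_of R X {\<zero>\<^bsub>X\<^esub>}" by (auto simp: submodule_of_def)
 have I: "left_module R ?I" by (rule lmod_sub[OF assms(1) s])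
 have se: "short_exact R ?I X X' (\<lambda>x\<in>{\<zero>\<^bsub>X\<^esub>}. x) i"
 proof -
  have "(\<lambda>x\<in>{\<zero>\<^bsub>X\<^esub>}. x) \<in> mod_hom R ?I X"
   using mhom_sub_incl[OF assms(1) s mhom_id[OF assms(1)]] by (simp cong: restrict_cong)
  then show ?thesis using i mhom_zero[OF assms(1,2) i(1)] mhom_closed[OF i(1)]
    inj_mod_hom_zero[OF assms(1,2) i(1)] by (auto simp: short_exact_def bij_betw_def)
 qed
 show ?thesis
 proof (rule ext_zero_quotient[OF I assms(1-3) se ext])
  fix f assume f: "f \<in> mod_hom R ?I V"
  then have "f \<zero>\<^bsub>X\<^esub> = \<zero>\<^bsub>V\<^esub>" using mhom_zero[OF I assms(3) f] by simp
  then show "\<exists>g\<in>mod_hom R X V. \<forall>x\<in>carrier ?I. g ((\<lambda>x\<in>{\<zero>\<^bsub>X\<^esub>}. x) x) = f x"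
   by (intro bexI[OF _ mhom_zero_map[OF assms(1,3)]]) auto
 qed
qed

lemma ext_zero_zero_left:
 assumes "left_module R X" "left_module R V" "carrier X = {\<zero>\<^bsub>X\<^esub>}"
 shows "ext_zero R X V"
proof -
 have "carrier (syzygy R X) = carrier (res0 R X)" using mhom_closed[OF mhom_augmentation[OF assms(1)]] assms(3)
  by (auto simp: carrier_syzygy hom_kernel_def)
 then have "syzygy R X = res0 R X" by (simp add: syzygy_def)
 then show ?thesis by (auto simp: ext_zero_def)
qed

lemma ext_zero_zero_right:
 assumes "left_module R X" "left_module R V" "carrier V = {\<zero>\<^bsub>V\<^esub>}"
 shows "ext_zero R X V"
 unfolding ext_zero_def
proof
 fix f assume f: "f \<in> mod_hom R (syzygy R X) V"
 show "\<exists>g\<in>mod_hom R (res0 R X) V. \<forall>k\<in>carrier (syzygy R X). g k = f k"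
  by (rule bexI[OF _ mhom_zero_map[OF lmod_res0[OF assms(1)] assms(2)]])
   (use mhom_closed[OF f] assms(3) syzygyD(1) in fastforce)
qed

subsection \<open>Small modules\<close>

lemma lesspoll_iff_ordLess: "A \<prec> B \<longleftrightarrow> |A| <o |B|"
proof -
 have "A \<lesssim> B \<longleftrightarrow> |A| \<le>o |B|" by (simp add: lepoll_def card_of_ordLeq)
 then show ?thesis
  unfolding lesspoll_def eqpoll_iff_card_of_ordIso
  using ordLeq_iff_ordLess_or_ordIso not_ordLess_ordIso by blast
qed

lemma times_small:
 assumes "infinite (UNIV :: 'u set)" "A \<prec> (UNIV :: 'u set)" "B \<prec> (UNIV :: 'u set)"
 shows "A \<times> B \<prec> (UNIV :: 'u set)"
 using assms unfolding lesspoll_iff_ordLess by (rule card_of_Times_ordLess_infinite)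

lemma small_copy:
 fixes X :: "('r, 'x, 'q) module_scheme"
 assumes "left_module R X" "carrier X \<prec> (UNIV :: 'u set)"
 shows "\<exists>X'\<in>(Mod_cat R :: ('r, 'u) module set). \<exists>g\<in>mod_hom R X X'. bij_betw g (carrier X) (carrier X')"
proof -
 interpret X: left_module R X by fact
 obtain g :: "'x => 'u" where g: "inj_on g (carrier X)" using assms(2) by (auto simp: lesspoll_def lepoll_def)
 define h where "h = inv_into (carrier X) g"
 have h: "h (g x) = x" if "x \<in> carrier X" for x using g that by (simp add: h_def)
 define X' :: "('r, 'u) module" where "X' = \<lparr>carrier = g ` carrier X, monoid.mult = undefined,
  one = undefined, ring.zero = g \<zero>\<^bsub>X\<^esub>, ring.add = (\<lambda>x y. g (h x \<oplus>\<^bsub>X\<^esub> h y)),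
  smult = (\<lambda>a x. g (a \<odot>\<^bsub>X\<^esub> h x))\<rparr>"
 have X': "left_module R X'" by (rule lmod_surj_image[OF assms(1), where \<pi> = g]) (auto simp: X'_def h)
 have "g ` carrier X \<prec> (UNIV :: 'u set)" by (rule lesspoll_trans1[OF image_lepoll assms(2)])
 then have "X' \<in> Mod_cat R" using X' by (simp add: Mod_cat_def X'_def)
 moreover have "(\<lambda>x\<in>carrier X. g x) \<in> mod_hom R X X'"
  by (rule mhom_restrictI[OF assms(1)]) (auto simp: X'_def h)
 moreover have "bij_betw (\<lambda>x\<in>carrier X. g x) (carrier X) (carrier X')"
  using g by (auto simp: bij_betw_def X'_def inj_on_def)
 ultimately show ?thesis by blast
qed

lemma extension_small:
 assumes "left_module R Y" "left_module R E" "left_module R Z" "short_exact R Y E Z i p"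
 shows "carrier E \<lesssim> carrier Y \<times> carrier Z"
proof -
 note se' = short_exactD[OF assms(4)]
 interpret E: left_module R E by fact
 interpret Z: left_module R Z by fact
 obtain \<sigma> where \<sigma>: "!!z. z \<in> carrier Z ==> \<sigma> z \<in> carrier E \<and> p (\<sigma> z) = z"
  using se'(6) by metis
 note [simp] = mhom_closed[OF se'(2)]
 have "\<exists>y. y \<in> carrier Y \<and> i y = e \<ominus>\<^bsub>E\<^esub> \<sigma> (p e)" if e: "e \<in> carrier E" for e
 proof -
  have "p (e \<ominus>\<^bsub>E\<^esub> \<sigma> (p e)) = \<zero>\<^bsub>Z\<^esub>"
   using e \<sigma> by (simp add: mhom_diff[OF assms(2,3) se'(2)] Z.diff_self)
  then show ?thesis using se'(5)[of "e \<ominus>\<^bsub>E\<^esub> \<sigma> (p e)"] e \<sigma>[of "p e"] by (metis E.minus_closed mhom_closed[OF se'(2)])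
 qed
 then obtain k where k: "!!e. e \<in> carrier E ==> k e \<in> carrier Y \<and> i (k e) = e \<ominus>\<^bsub>E\<^esub> \<sigma> (p e)"
  by metis
 have "inj_on (\<lambda>e. (k e, p e)) (carrier E)"
 proof (rule inj_onI)
  fix e e' assume e: "e \<in> carrier E" "e' \<in> carrier E" "(k e, p e) = (k e', p e')"
  then have "e \<ominus>\<^bsub>E\<^esub> \<sigma> (p e) = e' \<ominus>\<^bsub>E\<^esub> \<sigma> (p e)" using k by (metis prod.inject)
  then show "e = e'"
   using e \<sigma>[of "p e"] E.diff_add_cancel[of "\<sigma> (p e)"] by (metis mhom_closed[OF se'(2)])
 qed
 moreover have "(\<lambda>e. (k e, p e)) ` carrier E \<subseteq> carrier Y \<times> carrier Z" using k by auto
 ultimately show ?thesis unfolding lepoll_def by blast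
qed

text \<open>
 An extension of small modules is small, so splitting need only be tested inside the universe. This links Ext
 with projective and injective objects, which are defined by test modules in the universe.
\<close>

lemma ext_zeroI_small_split:
 fixes Y Z :: "('r, 'u) module"
 assumes inf: "infinite (UNIV :: 'u set)" and Y: "Y \<in> Mod_cat R" and Z: "Z \<in> Mod_cat R"
  and split: "!!(E :: ('r, 'u) module) i p. [|E \<in> Mod_cat R; short_exact R Y E Z i p|] ==>
   \<exists>r\<in>mod_hom R E Y. \<forall>y\<in>carrier Y. r (i y) = y"
 shows "ext_zero R Z Y"
proof (rule ext_zeroI_split)
 show YM: "left_module R Y" and ZM: "left_module R Z" using Y Z by (auto simp: Mod_cat_def)
 fix E :: "('r, ('u \<times> ('u => 'r)) set) module" and i p
 assume E: "left_module R E" and se: "short_exact R Y E Z i p"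
 note se' = short_exactD[OF se]
 have "carrier E \<prec> (UNIV :: 'u set)"
  by (rule lesspoll_trans1[OF extension_small[OF YM E ZM se] times_small[OF inf]])
   (use Y Z in \<open>auto simp: Mod_cat_def\<close>)
 then obtain E' :: "('r, 'u) module" and g where E': "E' \<in> Mod_cat R" "g \<in> mod_hom R E E'"
   "bij_betw g (carrier E) (carrier E')" using small_copy[OF E] by blast
 then have EM: "left_module R E'" by (simp add: Mod_cat_def)
 obtain h where h: "h \<in> mod_hom R E' E" "!!e. e \<in> carrier E' ==> g (h e) = e"
   "!!e. e \<in> carrier E ==> h (g e) = e" using mhom_inverse[OF E EM E'(2,3)] by blast
 note [simp] = mhom_closed[OF se'(1)] mhom_closed[OF se'(2)] mhom_closed[OF E'(2)]
  mhom_closed[OF h(1)]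
 have "short_exact R Y E' Z (compose (carrier Y) g i) (compose (carrier E') p h)"
 proof (rule short_exactI[OF YM EM])
  show "compose (carrier Y) g i \<in> mod_hom R Y E'" by (rule mhom_compose[OF YM se'(1) E'(2)])
  show "compose (carrier E') p h \<in> mod_hom R E' Z" by (rule mhom_compose[OF EM h(1) se'(2)])
 next
  fix x assume x: "x \<in> carrier Y" "compose (carrier Y) g i x = \<zero>\<^bsub>E'\<^esub>"
  then have "i x = \<zero>\<^bsub>E\<^esub>" using h(3)[of "i x"] mhom_zero[OF EM E h(1)] by (simp add: compose_def)
  then show "x = \<zero>\<^bsub>Y\<^esub>" using inj_mod_hom_zero[OF YM E se'(1,3)] x by simp
 next
  fix x assume x: "x \<in> carrier Y"
  then show "compose (carrier E') p h (compose (carrier Y) g i x) = \<zero>\<^bsub>Z\<^esub>"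
   by (simp add: compose_def h se'(4))
 next
  fix y assume y: "y \<in> carrier E'" "compose (carrier E') p h y = \<zero>\<^bsub>Z\<^esub>"
  then obtain x where "x \<in> carrier Y" "h y = i x" using se'(5)[of "h y"] by (auto simp: compose_def)
  then show "\<exists>x\<in>carrier Y. y = compose (carrier Y) g i x"
   using h(2)[OF y(1)] by (auto simp: compose_def)
 next
  fix z assume "z \<in> carrier Z"
  then obtain e where e: "e \<in> carrier E" "z = p e" using se'(6) by blast
  then show "\<exists>y\<in>carrier E'. z = compose (carrier E') p h y"
   by (intro bexI[of _ "g e"]) (auto simp: compose_def h)
 qed
 then obtain r where r: "r \<in> mod_hom R E' Y" "!!y. y \<in> carrier Y ==> r (g (i y)) = y"
  using split[OF E'(1)] by (fastforce simp: compose_def)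
 have "compose (carrier E) r g \<in> mod_hom R E Y" by (rule mhom_compose[OF E E'(2) r(1)])
 then show "\<exists>r\<in>mod_hom R E Y. \<forall>y\<in>carrier Y. r (i y) = y"
  by (rule bexI[rotated]) (simp add: compose_def r(2))
qed

lemma projective_ext_zero:
 fixes P X :: "('r, 'u) module"
 assumes "infinite (UNIV :: 'u set)" "projective R P" "X \<in> Mod_cat R"
 shows "ext_zero R P X"
proof (rule ext_zeroI_small_split[OF assms(1,3)])
 show P: "P \<in> Mod_cat R" using assms(2) by (simp add: projective_def)
 have PM: "left_module R P" and XM: "left_module R X" using P assms(3) by (auto simp: Mod_cat_def)
 fix E :: "('r, 'u) module" and i p assume E: "E \<in> Mod_cat R" and se: "short_exact R X E P i p"
 obtain s where "s \<in> mod_hom R P E" "!!x. x \<in> carrier P ==> p (s x) = (\<lambda>x\<in>carrier P. x) x"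
  using assms(2)[unfolded projective_def] E P short_exactD(2)[OF se] mhom_id[OF PM]
   short_exact_onto[OF se] by meson
 then show "\<exists>r\<in>mod_hom R E X. \<forall>x\<in>carrier X. r (i x) = x"
  using E by (intro retraction_of_section[OF XM _ PM se]) (auto simp: Mod_cat_def)
qed

lemma injective_ext_zero:
 fixes J X :: "('r, 'u) module"
 assumes "infinite (UNIV :: 'u set)" "injective R J" "X \<in> Mod_cat R"
 shows "ext_zero R X J"
proof (rule ext_zeroI_small_split[OF assms(1) _ assms(3)])
 show J: "J \<in> Mod_cat R" using assms(2) by (simp add: injective_def)
 have JM: "left_module R J" using J by (auto simp: Mod_cat_def)
 fix E :: "('r, 'u) module" and i p assume E: "E \<in> Mod_cat R" and se: "short_exact R J E X i p"
 obtain s where "s \<in> mod_hom R E J" "!!x. x \<in> carrier J ==> s (i x) = (\<lambda>x\<in>carrier J. x) x"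
  using assms(2)[unfolded injective_def] E J short_exactD(1,3)[OF se] mhom_id[OF JM] by meson
 then show "\<exists>r\<in>mod_hom R E J. \<forall>x\<in>carrier J. r (i x) = x" by auto
qed

subsection \<open>The group Ext\<close>

lemma trivial_factor_group:
 assumes "comm_group G" "subgroup N G"
 shows "trivial_group (G Mod N) \<longleftrightarrow> carrier G \<subseteq> N"
proof -
 interpret comm_group G by fact
 have n: "N \<lhd> G" by (rule subgroup_imp_normal[OF assms(2)])
 then interpret normal N G .
 have g: "group (G Mod N)" by (rule factorgroup_is_group)
 have "carrier (G Mod N) \<subseteq> {\<one>\<^bsub>G Mod N\<^esub>} \<longleftrightarrow> (\<forall>x\<in>carrier G. N #>\<^bsub>G\<^esub> x = N)"
  by (auto simp: FactGroup_def RCOSETS_def)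
 also have "\<dots> \<longleftrightarrow> carrier G \<subseteq> N"
  using rcos_self[OF _ assms(2)] rcos_const[OF group_axioms] by blast
 finally show ?thesis using group.trivial_group_subset[OF g] by simp
qed

lemma comm_group_homs:
 assumes "left_module R X" "left_module R Y" and S: "S \<subseteq> mod_hom R X Y"
  and add: "!!f g. [|f \<in> S; g \<in> S|] ==> (\<lambda>x\<in>carrier X. f x \<oplus>\<^bsub>Y\<^esub> g x) \<in> S"
  and zero: "(\<lambda>x\<in>carrier X. \<zero>\<^bsub>Y\<^esub>) \<in> S"
  and minus: "!!f. f \<in> S ==> (\<lambda>x\<in>carrier X. \<ominus>\<^bsub>Y\<^esub> f x) \<in> S"
 shows "comm_group ((hom_group R X Y)\<lparr>carrier := S\<rparr>)"
  and "f \<in> S ==> inv\<^bsub>(hom_group R X Y)\<lparr>carrier := S\<rparr>\<^esub> f = (\<lambda>x\<in>carrier X. \<ominus>\<^bsub>Y\<^esub> f x)"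
proof -
 interpret Y: left_module R Y by fact
 have c: "f x \<in> carrier Y" if "f \<in> S" "x \<in> carrier X" for f x
  by (rule mhom_closed[OF subsetD[OF S that(1)] that(2)])
 have e: "(\<lambda>x\<in>carrier X. f x) = f" if "f \<in> S" for f
  using subsetD[OF S that, THEN mhom_extensional] by (rule extensional_restrict)
 let ?G = "(hom_group R X Y)\<lparr>carrier := S\<rparr>"
 have inv: "(\<lambda>x\<in>carrier X. \<ominus>\<^bsub>Y\<^esub> f x) \<otimes>\<^bsub>?G\<^esub> f = \<one>\<^bsub>?G\<^esub>" if "f \<in> S" for f
  by (auto simp: hom_group_def c[OF that] Y.l_neg intro!: restrict_ext)
 show g: "comm_group ?G"
 proof (rule comm_groupI)
  fix f assume f: "f \<in> carrier ?G"
  show "\<exists>y\<in>carrier ?G. y \<otimes>\<^bsub>?G\<^esub> f = \<one>\<^bsub>?G\<^esub>"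
   using inv minus f by (intro bexI[of _ "\<lambda>x\<in>carrier X. \<ominus>\<^bsub>Y\<^esub> f x"]) auto
  have "(\<lambda>x\<in>carrier X. (\<lambda>x\<in>carrier X. \<zero>\<^bsub>Y\<^esub>) x \<oplus>\<^bsub>Y\<^esub> f x) = (\<lambda>x\<in>carrier X. f x)"
   using c f by (intro restrict_ext) auto
  then show "\<one>\<^bsub>?G\<^esub> \<otimes>\<^bsub>?G\<^esub> f = f" using f e by (simp add: hom_group_def)
 next
  fix f g h assume "f \<in> carrier ?G" "g \<in> carrier ?G" "h \<in> carrier ?G"
  then show "f \<otimes>\<^bsub>?G\<^esub> g \<otimes>\<^bsub>?G\<^esub> h = f \<otimes>\<^bsub>?G\<^esub> (g \<otimes>\<^bsub>?G\<^esub> h)"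
   by (auto simp: hom_group_def c Y.a_assoc intro!: restrict_ext)
 next
  fix f g assume "f \<in> carrier ?G" "g \<in> carrier ?G"
  then show "f \<otimes>\<^bsub>?G\<^esub> g = g \<otimes>\<^bsub>?G\<^esub> f"
   by (auto simp: hom_group_def c Y.a_comm intro!: restrict_ext)
 qed (use add zero in \<open>auto simp: hom_group_def\<close>)
 interpret comm_group ?G by fact
 show "inv\<^bsub>?G\<^esub> f = (\<lambda>x\<in>carrier X. \<ominus>\<^bsub>Y\<^esub> f x)" if "f \<in> S"
  by (rule inv_equality[OF inv[OF that]]) (use that minus in auto)
qed

lemma mhom_uminus_map:
 assumes "left_module R X" "left_module R Y" "f \<in> mod_hom R X Y"
 shows "(\<lambda>x\<in>carrier X. \<ominus>\<^bsub>Y\<^esub> f x) \<in> mod_hom R X Y"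
proof -
 interpret Y: left_module R Y by fact
 have "(\<lambda>x\<in>carrier X. (\<lambda>x\<in>carrier X. \<zero>\<^bsub>Y\<^esub>) x \<ominus>\<^bsub>Y\<^esub> f x) \<in> mod_hom R X Y"
  by (rule mhom_diff_map[OF assms(1,2) mhom_zero_map[OF assms(1,2)] assms(3)])
 also have "(\<lambda>x\<in>carrier X. (\<lambda>x\<in>carrier X. \<zero>\<^bsub>Y\<^esub>) x \<ominus>\<^bsub>Y\<^esub> f x) = (\<lambda>x\<in>carrier X. \<ominus>\<^bsub>Y\<^esub> f x)"
  by (rule restrict_ext) (simp add: a_minus_def mhom_closed[OF assms(3)])
 finally show ?thesis .
qed

lemma lin_comb_kernel:
 assumes "left_module R X" "left_module R Y" "g \<in> mod_hom R X Y"
  and f: "f \<in> carrier (free_module R (hom_kernel X Y g))"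
 shows "g (lin_comb R X f) = \<zero>\<^bsub>Y\<^esub>"
proof -
 let ?F = "free_module R (hom_kernel X Y g)"
 interpret X: left_module R X by fact
 have F: "left_module R ?F" by (rule lmod_free[OF X.ring_axioms])
 have l: "(\<lambda>f\<in>carrier ?F. lin_comb R X f) \<in> mod_hom R ?F X"
  by (rule mhom_lin_comb[OF assms(1)]) (auto simp: hom_kernel_def)
 have "compose (carrier ?F) g (\<lambda>f\<in>carrier ?F. lin_comb R X f) f = (\<lambda>x\<in>carrier ?F. \<zero>\<^bsub>Y\<^esub>) f"
 proof (rule free_hom_eq[OF assms(2) mhom_compose[OF F l assms(3)] mhom_zero_map[OF F assms(2)] _ f])
  fix s assume s: "s \<in> hom_kernel X Y g"
  have "free_basis R s \<in> carrier ?F" by (rule free_basis_closed[OF X.ring_axioms s])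
  then show "compose (carrier ?F) g (\<lambda>f\<in>carrier ?F. lin_comb R X f) (free_basis R s) =
    (\<lambda>x\<in>carrier ?F. \<zero>\<^bsub>Y\<^esub>) (free_basis R s)"
   using s lin_comb_basis[OF assms(1), of s] by (simp add: compose_def hom_kernel_def del: free_module_simps)
 qed
 then show ?thesis using f by (simp add: compose_def del: free_module_simps)
qed

lemma free_kernel_onto:
 assumes "left_module R X" "left_module R Y" "g \<in> mod_hom R X Y" and x: "x \<in> hom_kernel X Y g"
 shows "free_basis R x \<in> carrier (free_module R (hom_kernel X Y g))"
  and "lin_comb R X (free_basis R x) = x"
proof -
 interpret X: left_module R X by fact
 show "free_basis R x \<in> carrier (free_module R (hom_kernel X Y g))"
  by (rule free_basis_closed[OF X.ring_axioms x])
 show "lin_comb R X (free_basis R x) = x"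
  by (rule lin_comb_basis[OF assms(1)]) (use x in \<open>simp add: hom_kernel_def\<close>)
qed

context
 fixes R :: "('r, 'p) ring_scheme" and X :: "('r, 'x, 'q) module_scheme"
 assumes X: "left_module R X"
begin

lemma res1_eq: "res1 R X = free_module R (hom_kernel (res0 R X) X (augmentation R X))"
 unfolding res1_def hom_kernel_def by (rule arg_cong[where f = "free_module R"]) (auto simp: augmentation_def)

lemma lmod_res1: "left_module R (res1 R X)"
 unfolding res1_eq using X by (intro lmod_free) (simp add: left_module_def)

lemma mhom_res_d1: "res_d1 R X \<in> mod_hom R (res1 R X) (res0 R X)"
 unfolding res_d1_def res1_eq by (rule mhom_lin_comb[OF lmod_res0[OF X]]) (auto simp: hom_kernel_def)

lemma res_d1_syzygy:
 assumes "x \<in> carrier (res1 R X)" shows "res_d1 R X x \<in> carrier (syzygy R X)"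
proof -
 have "augmentation R X (lin_comb R (res0 R X) x) = \<zero>\<^bsub>X\<^esub>"
  by (rule lin_comb_kernel[OF lmod_res0[OF X] X mhom_augmentation[OF X]])
   (use assms in \<open>simp only: res1_eq\<close>)
 moreover have "res_d1 R X x = lin_comb R (res0 R X) x" using assms by (simp add: res_d1_def)
 ultimately show ?thesis using mhom_closed[OF mhom_res_d1 assms] by (simp add: carrier_syzygy hom_kernel_def)
qed

lemma res_d1_basis:
 assumes "k \<in> carrier (syzygy R X)"
 shows "free_basis R k \<in> carrier (res1 R X)" "res_d1 R X (free_basis R k) = k"
 using free_kernel_onto[OF lmod_res0[OF X] X mhom_augmentation[OF X]] assms
 by (simp_all add: res_d1_def res1_eq carrier_syzygy del: free_module_simps)

lemma mhom_res_d1': "res_d1 R X \<in> mod_hom R (res1 R X) (syzygy R X)"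
 unfolding syzygy_def by (rule mhom_into_sub[OF mhom_res_d1]) (metis res_d1_syzygy carrier_syzygy)

lemma res_d1_onto: "res_d1 R X ` carrier (res1 R X) = carrier (syzygy R X)"
 using res_d1_basis res_d1_syzygy by (metis image_eqI image_subsetI subsetI subset_antisym)

lemma res2_eq: "res2 R X = free_module R (hom_kernel (res1 R X) (res0 R X) (res_d1 R X))"
 unfolding res2_def hom_kernel_def ..

lemma lmod_res2: "left_module R (res2 R X)"
 unfolding res2_eq using X by (intro lmod_free) (simp add: left_module_def)

lemma mhom_res_d2: "res_d2 R X \<in> mod_hom R (res2 R X) (res1 R X)"
 unfolding res_d2_def res2_eq by (rule mhom_lin_comb[OF lmod_res1]) (auto simp: hom_kernel_def)

lemma res_d1_d2: "x \<in> carrier (res2 R X) ==> res_d1 R X (res_d2 R X x) = \<zero>\<^bsub>res0 R X\<^esub>"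
 using lin_comb_kernel[OF lmod_res1 lmod_res0[OF X] mhom_res_d1]
 by (simp add: res_d2_def res2_eq[symmetric] del: free_module_simps)

lemma res_d2_basis:
 assumes "x \<in> carrier (res1 R X)" "res_d1 R X x = \<zero>\<^bsub>res0 R X\<^esub>"
 shows "free_basis R x \<in> carrier (res2 R X)" "res_d2 R X (free_basis R x) = x"
 using free_kernel_onto[OF lmod_res1 lmod_res0[OF X] mhom_res_d1, of x] assms
 by (simp_all add: res_d2_def res2_eq hom_kernel_def del: free_module_simps)

end

text \<open>
 A homomorphism from the second free module that kills the image of the third is a homomorphism from the
 syzygy, and it is a coboundary iff the latter extends to the first free module.
\<close>

lemma trivial_Ext1_iff:
 assumes X: "left_module R X" and Y: "left_module R Y"
 shows "trivial_group (Ext1 R X Y) \<longleftrightarrow> ext_zero R X Y"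
proof -
 interpret Y: left_module R Y by fact
 let ?F0 = "res0 R X" and ?F1 = "res1 R X" and ?F2 = "res2 R X" and ?K = "syzygy R X"
 let ?d1 = "res_d1 R X" and ?d2 = "res_d2 R X"
 have F0: "left_module R ?F0" and F1: "left_module R ?F1" and F2: "left_module R ?F2"
  and K: "left_module R ?K" using X by (auto intro: lmod_res0 lmod_res1 lmod_res2 lmod_syzygy)
 note d1 = mhom_res_d1[OF X] and d2 = mhom_res_d2[OF X]
 define Z where "Z = {f \<in> mod_hom R ?F1 Y. compose (carrier ?F2) f ?d2 = (\<lambda>z\<in>carrier ?F2. \<zero>\<^bsub>Y\<^esub>)}"
 define C where "C = (\<lambda>g. compose (carrier ?F1) g ?d1) ` mod_hom R ?F0 Y"
 have Ziff: "f \<in> Z \<longleftrightarrow> f \<in> mod_hom R ?F1 Y \<and> (\<forall>z\<in>carrier ?F2. f (?d2 z) = \<zero>\<^bsub>Y\<^esub>)" for f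
  by (auto simp: Z_def compose_def fun_eq_iff restrict_def split: if_splits)
 note uminus = mhom_uminus_map[OF _ Y]
 have c1: "?d1 x \<in> carrier ?F0" if "x \<in> carrier ?F1" for x using mhom_closed[OF d1 that] .
 have c2: "?d2 x \<in> carrier ?F1" if "x \<in> carrier ?F2" for x using mhom_closed[OF d2 that] .
 let ?G = "(hom_group R ?F1 Y)\<lparr>carrier := Z\<rparr>"
 have G: "comm_group ?G"
  and inv: "!!f. f \<in> Z ==> inv\<^bsub>?G\<^esub> f = (\<lambda>x\<in>carrier ?F1. \<ominus>\<^bsub>Y\<^esub> f x)"
  by (rule comm_group_homs[OF F1 Y]; auto simp: Ziff c2 mhom_zero_map[OF F1 Y] uminus[OF F1]
   mhom_add_map[OF F1 Y])+
 interpret G: comm_group ?G by fact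
 have Cin: "compose (carrier ?F1) g ?d1 \<in> Z" if g: "g \<in> mod_hom R ?F0 Y" for g
  using mhom_compose[OF F1 d1 g] c2 res_d1_d2[OF X] mhom_zero[OF F0 Y g] by (auto simp: Ziff compose_def)
 have C: "subgroup C ?G"
 proof (rule G.subgroupI)
  show "C \<subseteq> carrier ?G" using Cin by (auto simp: C_def)
  show "C \<noteq> {}" using mhom_zero_map[OF F0 Y] by (auto simp: C_def)
 next
  fix a assume "a \<in> C"
  then obtain g where g: "g \<in> mod_hom R ?F0 Y" "a = compose (carrier ?F1) g ?d1" by (auto simp: C_def)
  have "inv\<^bsub>?G\<^esub> a = compose (carrier ?F1) (\<lambda>x\<in>carrier ?F0. \<ominus>\<^bsub>Y\<^esub> g x) ?d1"
   unfolding g(2) using inv[OF Cin[OF g(1)]] by (auto simp: compose_def c1 intro!: restrict_ext)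
  then show "inv\<^bsub>?G\<^esub> a \<in> C" using uminus[OF F0 g(1)] by (auto simp: C_def)
 next
  fix a b assume "a \<in> C" "b \<in> C"
  then obtain g h where gh: "g \<in> mod_hom R ?F0 Y" "a = compose (carrier ?F1) g ?d1"
   "h \<in> mod_hom R ?F0 Y" "b = compose (carrier ?F1) h ?d1" by (auto simp: C_def)
  have "a \<otimes>\<^bsub>?G\<^esub> b = compose (carrier ?F1) (\<lambda>x\<in>carrier ?F0. g x \<oplus>\<^bsub>Y\<^esub> h x) ?d1"
   unfolding gh by (auto simp: compose_def c1 hom_group_def intro!: restrict_ext)
  then show "a \<otimes>\<^bsub>?G\<^esub> b \<in> C" using mhom_add_map[OF F0 Y gh(1,3)] by (auto simp: C_def)
 qed
 have "trivial_group (Ext1 R X Y) \<longleftrightarrow> Z \<subseteq> C"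
  using trivial_factor_group[OF G C] by (simp add: Ext1_def Z_def C_def)
 also have "\<dots> \<longleftrightarrow> ext_zero R X Y"
 proof
  assume ZC: "Z \<subseteq> C"
  show "ext_zero R X Y"
   unfolding ext_zero_def
  proof
   fix f assume f: "f \<in> mod_hom R ?K Y"
   have K0: "\<zero>\<^bsub>?F0\<^esub> = \<zero>\<^bsub>?K\<^esub>" by (simp add: syzygy_def)
   have "compose (carrier ?F1) f ?d1 \<in> Z"
    using mhom_compose[OF F1 mhom_res_d1'[OF X] f] c2 res_d1_d2[OF X] mhom_zero[OF K Y f] K0
    by (simp add: Ziff compose_def del: free_module_simps)
   then obtain g where g: "g \<in> mod_hom R ?F0 Y"
     "compose (carrier ?F1) f ?d1 = compose (carrier ?F1) g ?d1" using ZC by (auto simp: C_def)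
   have "g k = f k" if k: "k \<in> carrier ?K" for k
    using res_d1_basis[OF X k] fun_cong[OF g(2), of "free_basis R k"] by (simp add: compose_def)
   then show "\<exists>g\<in>mod_hom R ?F0 Y. \<forall>k\<in>carrier ?K. g k = f k" using g(1) by blast
  qed
 next
  assume ext: "ext_zero R X Y"
  show "Z \<subseteq> C"
  proof
   fix z assume "z \<in> Z"
   then have z: "z \<in> mod_hom R ?F1 Y" "!!x. x \<in> carrier ?F2 ==> z (?d2 x) = \<zero>\<^bsub>Y\<^esub>" by (auto simp: Ziff)
   have "z x = \<zero>\<^bsub>Y\<^esub>" if "x \<in> carrier ?F1" "?d1 x = \<zero>\<^bsub>?K\<^esub>" for x
    using res_d2_basis[OF X that(1)] that(2) z(2)[of "free_basis R x"]
    by (simp add: syzygy_def del: free_module_simps)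
   then obtain k where k: "k \<in> mod_hom R ?K Y" "!!x. x \<in> carrier ?F1 ==> k (?d1 x) = z x"
    using factor_through_surj[OF F1 K Y mhom_res_d1'[OF X] res_d1_onto[OF X] z(1)] by blast
   obtain g where g: "g \<in> mod_hom R ?F0 Y" "!!n. n \<in> carrier ?K ==> g n = k n"
    using ext k(1) by (auto simp: ext_zero_def)
   have "z = compose (carrier ?F1) g ?d1" by (rule mhom_eqI[OF z(1) mhom_compose[OF F1 d1 g(1)]])
     (simp add: compose_def g(2) res_d1_syzygy[OF X] k(2))
   then show "z \<in> C" using g(1) by (auto simp: C_def)
  qed
 qed
 finally show ?thesis .
qed

section \<open>Tensor products\<close>

definition frag_sum :: "('g, 'q) monoid_scheme => ('c => 'g) => ('c \<Rightarrow>\<^sub>0 int) => 'g"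
 where "frag_sum G h p =
  finprod G (\<lambda>q. h q [^]\<^bsub>G\<^esub> Poly_Mapping.lookup p q) (Poly_Mapping.keys p)"

context comm_group
begin

lemma frag_sum_superset:
 assumes "finite T" "Poly_Mapping.keys p \<subseteq> T" "h \<in> T \<rightarrow> carrier G"
 shows "frag_sum G h p = finprod G (\<lambda>q. h q [^] Poly_Mapping.lookup p q) T"
 unfolding frag_sum_def
 by (rule finprod_mono_neutral_cong_left) (use assms in \<open>auto simp: in_keys_iff\<close>)

lemma hom_frag_sum:
 assumes h: "h \<in> S \<rightarrow> carrier G"
 shows "frag_sum G h \<in> hom (free_Abelian_group S) G"
proof (rule homI)
 fix p assume p: "p \<in> carrier (free_Abelian_group S)"
 then show "frag_sum G h p \<in> carrier G" using h unfolding frag_sum_def by (intro finprod_closed) auto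
 fix q assume q: "q \<in> carrier (free_Abelian_group S)"
 let ?T = "Poly_Mapping.keys p \<union> Poly_Mapping.keys q"
 have T: "finite ?T" "h \<in> ?T \<rightarrow> carrier G" using p q h by auto
 have hc: "h c \<in> carrier G" if "c \<in> ?T" for c using T(2) that by blast
 have "frag_sum G h (p + q) = finprod G (\<lambda>c. h c [^] Poly_Mapping.lookup (p + q) c) ?T"
  by (rule frag_sum_superset[OF T(1) _ T(2)]) (rule keys_add)
 also have "\<dots> = finprod G (\<lambda>c. h c [^] Poly_Mapping.lookup p c \<otimes> h c [^] Poly_Mapping.lookup q c) ?T"
  by (rule finprod_cong') (use hc in \<open>auto simp: Poly_Mapping.lookup_add int_pow_mult\<close>)
 also have "\<dots> = finprod G (\<lambda>c. h c [^] Poly_Mapping.lookup p c) ?T \<otimes>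
   finprod G (\<lambda>c. h c [^] Poly_Mapping.lookup q c) ?T" by (rule finprod_multf) (use T in auto)
 also have "\<dots> = frag_sum G h p \<otimes> frag_sum G h q" using frag_sum_superset[OF T(1) _ T(2)] by simp
 finally show "frag_sum G h (p \<otimes>\<^bsub>free_Abelian_group S\<^esub> q) = frag_sum G h p \<otimes> frag_sum G h q" by simp
qed

lemma frag_sum_of:
 assumes "h c \<in> carrier G" shows "frag_sum G h (frag_of c) = h c" using assms by (simp add: frag_sum_def)

end

definition balanced ::
 "('b, 'p) ring_scheme => ('a, 'b, 'm) bimodule => ('b, 'x, 'q) module_scheme =>
  ('g, 's) ring_scheme => ('m => 'x => 'g) => bool"
 where "balanced B M X G h \<longleftrightarrow>
  (\<forall>m\<in>carrier M. \<forall>x\<in>carrier X. h m x \<in> carrier G) \<and>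
  (\<forall>m\<in>carrier M. \<forall>n\<in>carrier M. \<forall>x\<in>carrier X. h (m \<oplus>\<^bsub>M\<^esub> n) x = h m x \<oplus>\<^bsub>G\<^esub> h n x) \<and>
  (\<forall>m\<in>carrier M. \<forall>x\<in>carrier X. \<forall>y\<in>carrier X. h m (x \<oplus>\<^bsub>X\<^esub> y) = h m x \<oplus>\<^bsub>G\<^esub> h m y) \<and>
  (\<forall>m\<in>carrier M. \<forall>b\<in>carrier B. \<forall>x\<in>carrier X. h (rsmult M m b) x = h m (b \<odot>\<^bsub>X\<^esub> x))"

locale tensor_context = bimodule A B M + md: left_module B X
 for A :: "('a, 'p) ring_scheme" (structure) and B :: "('b, 'r) ring_scheme" (structure)
  and M :: "('a, 'b, 'm) bimodule" (structure) and X :: "('b, 'x, 'q) module_scheme" (structure)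
begin

abbreviation "FA \<equiv> free_Abelian_group (carrier M \<times> carrier X)"
abbreviation "TR \<equiv> tensor_rel B M X"
abbreviation "TC \<equiv> tensor_class B M X"
abbreviation "MX \<equiv> tensor B M X"

definition "rel_gens =
  {frag_of (m \<oplus>\<^bsub>M\<^esub> n, x) - frag_of (m, x) - frag_of (n, x) | m n x.
    m \<in> carrier M \<and> n \<in> carrier M \<and> x \<in> carrier X} \<union>
   {frag_of (m, x \<oplus>\<^bsub>X\<^esub> y) - frag_of (m, x) - frag_of (m, y) | m x y.
    m \<in> carrier M \<and> x \<in> carrier X \<and> y \<in> carrier X} \<union>
   {frag_of (rsmult M m b, x) - frag_of (m, b \<odot>\<^bsub>X\<^esub> x) | m b x.
    m \<in> carrier M \<and> b \<in> carrier B \<and> x \<in> carrier X}"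

lemma TR_def: "TR = generate FA rel_gens" by (simp add: tensor_rel_def rel_gens_def)

lemma rel_gens_add_left: "[|m \<in> carrier M; n \<in> carrier M; x \<in> carrier X|] ==>
  frag_of (m \<oplus>\<^bsub>M\<^esub> n, x) - frag_of (m, x) - frag_of (n, x) \<in> rel_gens"
 unfolding rel_gens_def by blast

lemma rel_gens_add_right: "[|m \<in> carrier M; x \<in> carrier X; y \<in> carrier X|] ==>
  frag_of (m, x \<oplus>\<^bsub>X\<^esub> y) - frag_of (m, x) - frag_of (m, y) \<in> rel_gens"
 unfolding rel_gens_def by blast

lemma rel_gens_balanced: "[|m \<in> carrier M; b \<in> carrier B; x \<in> carrier X|] ==>
  frag_of (rsmult M m b, x) - frag_of (m, b \<odot>\<^bsub>X\<^esub> x) \<in> rel_gens"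
 unfolding rel_gens_def by blast

lemma rel_gensE:
 assumes "p \<in> rel_gens"
 obtains m n x where "p = frag_of (m \<oplus>\<^bsub>M\<^esub> n, x) - frag_of (m, x) - frag_of (n, x)"
   "m \<in> carrier M" "n \<in> carrier M" "x \<in> carrier X"
  | m x y where "p = frag_of (m, x \<oplus>\<^bsub>X\<^esub> y) - frag_of (m, x) - frag_of (m, y)"
   "m \<in> carrier M" "x \<in> carrier X" "y \<in> carrier X"
  | m b x where "p = frag_of (rsmult M m b, x) - frag_of (m, b \<odot>\<^bsub>X\<^esub> x)"
   "m \<in> carrier M" "b \<in> carrier B" "x \<in> carrier X" using assms unfolding rel_gens_def by blast

sublocale FA: comm_group FA by (rule abelian_free_Abelian_group)

lemma FA_of [simp]: "[|m \<in> carrier M; x \<in> carrier X|] ==> frag_of (m, x) \<in> carrier FA" by simp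

lemma FA_add: "[|p \<in> carrier FA; q \<in> carrier FA|] ==> p + q \<in> carrier FA"
 using FA.m_closed[of p q] by simp

lemma FA_diff: "[|p \<in> carrier FA; q \<in> carrier FA|] ==> p - q \<in> carrier FA"
 using keys_diff[of p q] by auto

lemma rel_gens_subset: "rel_gens \<subseteq> carrier FA"
 unfolding rel_gens_def by (auto simp del: carrier_free_Abelian_group_iff
   intro!: FA_diff FA_of X.a_closed md.X.a_closed rsmult_closed md.smult_closed)

lemma TR_subgroup: "subgroup TR FA"
 unfolding TR_def by (rule FA.generate_is_subgroup[OF rel_gens_subset])

sublocale TR: normal TR FA by (rule FA.subgroup_imp_normal[OF TR_subgroup])

lemma rel_gens_TR: "p \<in> rel_gens ==> p \<in> TR"
 unfolding TR_def by (rule generate.incl)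

lemma TC_eq_iff:
 assumes "p \<in> carrier FA" "q \<in> carrier FA"
 shows "TC p = TC q \<longleftrightarrow> p - q \<in> TR"
proof -
 have "TC p = TC q \<longleftrightarrow> p \<in> TC q"
  unfolding tensor_class_def
  using assms FA.repr_independence[OF _ assms(2) TR_subgroup] FA.rcos_self[OF assms(1) TR_subgroup] by metis
 also have "\<dots> \<longleftrightarrow> p - q \<in> TR"
  unfolding tensor_class_def using TR.rcos_module[OF FA.group_axioms assms(2,1)] assms by simp
 finally show ?thesis .
qed

lemma MX_simps:
 "carrier MX = TC ` carrier FA" "\<zero>\<^bsub>MX\<^esub> = TC 0"
 "C \<oplus>\<^bsub>MX\<^esub> D = C <#>\<^bsub>FA\<^esub> D" by (simp_all add: tensor_def Let_def)

lemma TC_closed: "p \<in> carrier FA ==> TC p \<in> carrier MX" by (simp add: MX_simps)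

lemma TC_add: "[|p \<in> carrier FA; q \<in> carrier FA|] ==> TC (p + q) = TC p \<oplus>\<^bsub>MX\<^esub> TC q"
 unfolding tensor_class_def using TR.rcos_sum[of p q] by (simp add: MX_simps)

lemma TC_mem: "[|p \<in> carrier FA; q \<in> TC p|] ==> q \<in> carrier FA \<and> TC q = TC p"
 unfolding tensor_class_def
 using subsetD[OF FA.r_coset_subset_G[OF TR.subset], of p q] FA.repr_independence[OF _ _ TR_subgroup, of q p]
 by metis

lemma TC_self: "p \<in> carrier FA ==> p \<in> TC p"
 unfolding tensor_class_def by (rule FA.rcos_self[OF _ TR_subgroup])

lemma MX_E:
 assumes "t \<in> carrier MX" obtains p where "p \<in> carrier FA" "t = TC p"
 using assms by (auto simp only: MX_simps)

lemma TC_the_elem: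
 assumes p: "p \<in> carrier FA" and c: "!!q. [|q \<in> carrier FA; TC q = TC p|] ==> g q = g p"
 shows "the_elem (g ` TC p) = g p"
proof -
 have "g ` TC p = {g p}" using c TC_mem[OF p] TC_self[OF p] by blast
 then show ?thesis by simp
qed

definition act :: "'a => ('m \<times> 'x \<Rightarrow>\<^sub>0 int) => ('m \<times> 'x \<Rightarrow>\<^sub>0 int)"
 where "act a = frag_extend (\<lambda>(m, x). frag_of (a \<odot>\<^bsub>M\<^esub> m, x))"

lemma act_closed:
 assumes "a \<in> carrier A" "p \<in> carrier FA" shows "act a p \<in> carrier FA"
proof -
 have "Poly_Mapping.keys (act a p) \<subseteq> (\<Union>z\<in>Poly_Mapping.keys p. Poly_Mapping.keys ((\<lambda>(m, x). frag_of (a \<odot>\<^bsub>M\<^esub> m, x)) z))"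
  unfolding act_def by (rule keys_frag_extend)
 also have "\<dots> \<subseteq> carrier M \<times> carrier X"
  using assms smult_closed by (auto split: if_splits)
 finally show ?thesis by simp
qed

lemma act_rel:
 assumes a: "a \<in> carrier A" and p: "p \<in> TR" shows "act a p \<in> TR"
proof -
 have hom: "act a \<in> hom FA FA" using act_closed[OF a] by (intro homI) (auto simp: act_def frag_extend_add)
 let ?H = "{p \<in> carrier FA. act a p \<in> TR}"
 have "subgroup ?H FA"
 proof (rule FA.subgroupI)
  have "act a 0 = 0" by (simp add: act_def)
  then show "?H \<noteq> {}" using TR.one_closed by auto
 next
  fix p assume p: "p \<in> ?H"
  then have k: "Poly_Mapping.keys (act a p) \<subseteq> carrier M \<times> carrier X"
   using act_closed[OF a, of p] by simp
  have "inv\<^bsub>FA\<^esub> (act a p) \<in> TR" using p TR.m_inv_closed by blast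
  moreover have "act a (- p) = - act a p" by (simp add: act_def frag_extend_minus)
  ultimately show "inv\<^bsub>FA\<^esub> p \<in> ?H" using p inv_free_Abelian_group[OF k] by auto
 next
  fix p q assume "p \<in> ?H" "q \<in> ?H"
  then show "p \<otimes>\<^bsub>FA\<^esub> q \<in> ?H"
   using TR.m_closed[of "act a p" "act a q"] FA_add[of p q] hom_mult[OF hom, of p q] by simp
 qed auto
 moreover have "rel_gens \<subseteq> ?H"
 proof
  fix p assume p: "p \<in> rel_gens"
  have fd: "act a (u - v) = act a u - act a v" for u v by (simp add: act_def frag_extend_diff)
  have fo: "act a (frag_of (m, x)) = frag_of (a \<odot>\<^bsub>M\<^esub> m, x)" for m x by (simp add: act_def)
  from p have "act a p \<in> rel_gens"
  proof (cases rule: rel_gensE)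
   case (1 m n x)
   then show ?thesis
    using rel_gens_add_left[of "a \<odot>\<^bsub>M\<^esub> m" "a \<odot>\<^bsub>M\<^esub> n" x] smult_closed[OF a]
    by (simp add: fd fo smult_r_distr[OF a])
  next
   case (2 m x y)
   then show ?thesis
    using rel_gens_add_right[of "a \<odot>\<^bsub>M\<^esub> m" x y] smult_closed[OF a] by (simp add: fd fo)
  next
   case (3 m b x)
   then show ?thesis using rel_gens_balanced[of "a \<odot>\<^bsub>M\<^esub> m" b x] smult_closed[OF a]
    by (simp add: fd fo smult_rsmult[OF a])
  qed
  then show "p \<in> ?H" using p rel_gens_subset rel_gens_TR by blast
 qed
 ultimately have "TR \<subseteq> ?H"
  unfolding TR_def by (intro FA.generate_subgroup_incl)
 then show ?thesis using p by auto
qed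

lemma MX_smult:
 assumes a: "a \<in> carrier A" and p: "p \<in> carrier FA"
 shows "a \<odot>\<^bsub>MX\<^esub> TC p = TC (act a p)"
proof -
 have "a \<odot>\<^bsub>MX\<^esub> TC p = the_elem ((\<lambda>p. TC (act a p)) ` TC p)"
  by (simp add: tensor_def Let_def act_def)
 also have "\<dots> = TC (act a p)"
 proof (rule TC_the_elem[OF p])
  fix q assume q: "q \<in> carrier FA" "TC q = TC p"
  then have "act a (q - p) \<in> TR" using act_rel[OF a] TC_eq_iff[OF q(1) p] by simp
  moreover have "act a (q - p) = act a q - act a p" by (simp add: act_def frag_extend_diff)
  ultimately show "TC (act a q) = TC (act a p)" using TC_eq_iff act_closed[OF a] p q by metis
 qed
 finally show ?thesis .
qed

lemma act_eqI:
 assumes "p \<in> carrier FA"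
  and "!!p q. [|p \<in> carrier FA; q \<in> carrier FA|] ==> g (p - q) = g p - g q"
  and "!!p q. [|p \<in> carrier FA; q \<in> carrier FA|] ==> h (p - q) = h p - h q"
  and "!!p. p \<in> carrier FA ==> g p \<in> carrier FA" "!!p. p \<in> carrier FA ==> h p \<in> carrier FA"
  and "!!m x. [|m \<in> carrier M; x \<in> carrier X|] ==> g (frag_of (m, x)) - h (frag_of (m, x)) \<in> TR"
 shows "g p - h p \<in> TR"
proof -
 have "Poly_Mapping.keys p \<subseteq> carrier M \<times> carrier X" using assms(1) by simp
 then show ?thesis
 proof (induction p rule: free_Abelian_group_induct[consumes 1, case_names zero diff of])
  case zero
  have "g 0 = 0" "h 0 = 0" using assms(2)[of 0 0] assms(3)[of 0 0] by auto
  then show ?case using TR.one_closed by simp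
 next
  case (diff x y)
  then have c: "x \<in> carrier FA" "y \<in> carrier FA" by auto
  have d: "g x - h x \<in> carrier FA" "g y - h y \<in> carrier FA" using FA_diff assms(4,5) c by auto
  have "(g x - h x) + - (g y - h y) \<in> TR"
   using TR.m_closed[OF diff(3) TR.m_inv_closed[OF diff(4)]] d by simp
  then show ?case by (simp add: assms(2,3)[OF c] algebra_simps)
 next
  case (of a)
  then show ?case using assms(6) by (cases a) auto
 qed
qed

lemma abelian_group_MX: "abelian_group MX"
proof (rule abelian_groupI)
 fix x y z assume "x \<in> carrier MX" "y \<in> carrier MX" "z \<in> carrier MX"
 then obtain p q r where "p \<in> carrier FA" "x = TC p" "q \<in> carrier FA" "y = TC q"
  "r \<in> carrier FA" "z = TC r" by (metis MX_E)
 then show "(x \<oplus>\<^bsub>MX\<^esub> y) \<oplus>\<^bsub>MX\<^esub> z = x \<oplus>\<^bsub>MX\<^esub> (y \<oplus>\<^bsub>MX\<^esub> z)"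
  by (simp only: TC_add[symmetric] FA_add add.assoc)
next
 fix x y assume "x \<in> carrier MX" "y \<in> carrier MX"
 then obtain p q where pq: "p \<in> carrier FA" "x = TC p" "q \<in> carrier FA" "y = TC q" by (metis MX_E)
 then show "x \<oplus>\<^bsub>MX\<^esub> y \<in> carrier MX" "x \<oplus>\<^bsub>MX\<^esub> y = y \<oplus>\<^bsub>MX\<^esub> x"
  by (simp_all only: TC_add[symmetric] FA_add TC_closed add.commute)
next
 have 0: "0 \<in> carrier FA" by simp
 show "\<zero>\<^bsub>MX\<^esub> \<in> carrier MX" using TC_closed[OF 0] by (simp add: MX_simps)
 fix x assume "x \<in> carrier MX"
 then obtain p where p: "p \<in> carrier FA" "x = TC p" by (metis MX_E)
 show "\<zero>\<^bsub>MX\<^esub> \<oplus>\<^bsub>MX\<^esub> x = x"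
  using TC_add[OF 0 p(1)] p by (simp only: MX_simps(2) add_0)
 have np: "- p \<in> carrier FA" using p by simp
 have "TC (- p) \<oplus>\<^bsub>MX\<^esub> x = \<zero>\<^bsub>MX\<^esub>"
  using TC_add[OF np p(1)] p(2) by (simp add: MX_simps(2))
 then show "\<exists>y\<in>carrier MX. y \<oplus>\<^bsub>MX\<^esub> x = \<zero>\<^bsub>MX\<^esub>" using TC_closed[OF np] by blast
qed

lemma lmod_MX: "left_module A MX"
proof -
 interpret MX: abelian_group MX by (rule abelian_group_MX)
 have add: "act a (p + q) = act a p + act a q" for a p q by (simp add: act_def frag_extend_add)
 have diff: "act a (p - q) = act a p - act a q" for a p q by (simp add: act_def frag_extend_diff)
 have of: "act a (frag_of (m, x)) = frag_of (a \<odot>\<^bsub>M\<^esub> m, x)" for a m x by (simp add: act_def)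
 have ax: "left_module_axioms A MX"
 proof
  fix a x assume a: "a \<in> carrier A" and "x \<in> carrier MX"
  then obtain p where p: "p \<in> carrier FA" "x = TC p" by (metis MX_E)
  show "a \<odot>\<^bsub>MX\<^esub> x \<in> carrier MX"
   using MX_smult[OF a p(1)] p TC_closed[OF act_closed[OF a p(1)]] by simp
  fix b assume b: "b \<in> carrier A"
  have "act (a \<oplus>\<^bsub>A\<^esub> b) p - (\<lambda>p. act a p + act b p) p \<in> TR"
  proof (rule act_eqI[OF p(1)])
   fix m x assume mx: "m \<in> carrier M" "x \<in> carrier X"
   have "frag_of (a \<odot>\<^bsub>M\<^esub> m \<oplus>\<^bsub>M\<^esub> b \<odot>\<^bsub>M\<^esub> m, x) - frag_of (a \<odot>\<^bsub>M\<^esub> m, x) - frag_of (b \<odot>\<^bsub>M\<^esub> m, x) \<in> rel_gens"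
    by (intro rel_gens_add_left smult_closed mx a b)
   then show "act (a \<oplus>\<^bsub>A\<^esub> b) (frag_of (m, x)) - (act a (frag_of (m, x)) + act b (frag_of (m, x))) \<in> TR"
    using rel_gens_TR by (simp add: of smult_l_distr a b mx diff_diff_eq)
  qed (auto simp: diff algebra_simps simp del: carrier_free_Abelian_group_iff
    intro!: act_closed FA_add a b R.a_closed)
  then have "TC (act (a \<oplus>\<^bsub>A\<^esub> b) p) = TC (act a p + act b p)"
   using a b p by (subst TC_eq_iff) (auto simp del: carrier_free_Abelian_group_iff intro!: act_closed FA_add)
  then show "(a \<oplus>\<^bsub>A\<^esub> b) \<odot>\<^bsub>MX\<^esub> x = a \<odot>\<^bsub>MX\<^esub> x \<oplus>\<^bsub>MX\<^esub> b \<odot>\<^bsub>MX\<^esub> x"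
   using a b p by (simp only: MX_smult TC_add[symmetric] act_closed R.a_closed)
  have "act (a \<otimes>\<^bsub>A\<^esub> b) p - (\<lambda>p. act a (act b p)) p \<in> TR"
   by (rule act_eqI[OF p(1)])
    (use TR.one_closed in \<open>auto simp: diff of smult_assoc a b simp del: carrier_free_Abelian_group_iff
    intro!: act_closed FA_add a b R.m_closed\<close>)
  then have "TC (act (a \<otimes>\<^bsub>A\<^esub> b) p) = TC (act a (act b p))"
   using a b p by (subst TC_eq_iff) (auto simp del: carrier_free_Abelian_group_iff intro!: act_closed FA_add)
  then show "(a \<otimes>\<^bsub>A\<^esub> b) \<odot>\<^bsub>MX\<^esub> x = a \<odot>\<^bsub>MX\<^esub> (b \<odot>\<^bsub>MX\<^esub> x)"
   using a b p by (simp only: MX_smult act_closed R.m_closed)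
 next
  fix a x y assume a: "a \<in> carrier A" and "x \<in> carrier MX" "y \<in> carrier MX"
  then obtain p q where pq: "p \<in> carrier FA" "x = TC p" "q \<in> carrier FA" "y = TC q" by (metis MX_E)
  show "a \<odot>\<^bsub>MX\<^esub> (x \<oplus>\<^bsub>MX\<^esub> y) = a \<odot>\<^bsub>MX\<^esub> x \<oplus>\<^bsub>MX\<^esub> a \<odot>\<^bsub>MX\<^esub> y"
   using a pq by (simp only: TC_add[symmetric] MX_smult FA_add act_closed add)
 next
  fix x assume "x \<in> carrier MX"
  then obtain p where p: "p \<in> carrier FA" "x = TC p" by (metis MX_E)
  have "act \<one>\<^bsub>A\<^esub> p - (\<lambda>p. p) p \<in> TR" by (rule act_eqI[OF p(1)])
    (use TR.one_closed in \<open>auto simp: diff of smult_one simp del: carrier_free_Abelian_group_iff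
    intro!: act_closed R.one_closed\<close>)
  then have "TC (act \<one>\<^bsub>A\<^esub> p) = TC p"
   using p by (subst TC_eq_iff) (auto simp del: carrier_free_Abelian_group_iff intro!: act_closed)
  then show "\<one>\<^bsub>A\<^esub> \<odot>\<^bsub>MX\<^esub> x = x" using p by (simp only: MX_smult R.one_closed)
 qed
 show ?thesis by (intro left_module.intro abelian_group_MX ax R.ring_axioms)
qed

abbreviation "pt \<equiv> pure_tensor B M X"

lemma pt_closed [simp]: "[|m \<in> carrier M; x \<in> carrier X|] ==> pt m x \<in> carrier MX"
 unfolding pure_tensor_def by (intro TC_closed) simp

lemma pt_add_left:
 assumes "m \<in> carrier M" "n \<in> carrier M" "x \<in> carrier X"
 shows "pt (m \<oplus>\<^bsub>M\<^esub> n) x = pt m x \<oplus>\<^bsub>MX\<^esub> pt n x"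
proof -
 have "frag_of (m \<oplus>\<^bsub>M\<^esub> n, x) - frag_of (m, x) - frag_of (n, x) \<in> rel_gens"
  using assms by (rule rel_gens_add_left)
 then have "TC (frag_of (m \<oplus>\<^bsub>M\<^esub> n, x)) = TC (frag_of (m, x) + frag_of (n, x))"
  using assms rel_gens_TR
  by (subst TC_eq_iff) (auto simp: diff_diff_eq simp del: carrier_free_Abelian_group_iff intro!: FA_add)
 then show ?thesis using assms by (simp add: pure_tensor_def TC_add)
qed

lemma pt_add_right:
 assumes "m \<in> carrier M" "x \<in> carrier X" "y \<in> carrier X"
 shows "pt m (x \<oplus>\<^bsub>X\<^esub> y) = pt m x \<oplus>\<^bsub>MX\<^esub> pt m y"
proof -
 have "frag_of (m, x \<oplus>\<^bsub>X\<^esub> y) - frag_of (m, x) - frag_of (m, y) \<in> rel_gens"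
  using assms by (rule rel_gens_add_right)
 then have "TC (frag_of (m, x \<oplus>\<^bsub>X\<^esub> y)) = TC (frag_of (m, x) + frag_of (m, y))"
  using assms rel_gens_TR
  by (subst TC_eq_iff) (auto simp: diff_diff_eq simp del: carrier_free_Abelian_group_iff intro!: FA_add)
 then show ?thesis using assms by (simp add: pure_tensor_def TC_add)
qed

lemma pt_balanced:
 assumes "m \<in> carrier M" "b \<in> carrier B" "x \<in> carrier X"
 shows "pt (rsmult M m b) x = pt m (b \<odot>\<^bsub>X\<^esub> x)"
proof -
 have "frag_of (rsmult M m b, x) - frag_of (m, b \<odot>\<^bsub>X\<^esub> x) \<in> rel_gens"
  using assms by (rule rel_gens_balanced)
 then show ?thesis
  unfolding pure_tensor_def using assms rel_gens_TR rsmult_closed md.smult_closed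
  by (subst TC_eq_iff) (auto simp del: carrier_free_Abelian_group_iff)
qed

lemma balanced_pt: "balanced B M X MX pt" by (simp add: balanced_def pt_add_left pt_add_right pt_balanced)

lemma pt_smult:
 assumes "a \<in> carrier A" "m \<in> carrier M" "x \<in> carrier X"
 shows "a \<odot>\<^bsub>MX\<^esub> pt m x = pt (a \<odot>\<^bsub>M\<^esub> m) x"
 using assms MX_smult[of a "frag_of (m, x)"] by (simp add: pure_tensor_def act_def)

lemma tensor_induct [consumes 1, case_names pure zero diff]:
 assumes t: "t \<in> carrier MX"
  and pure: "!!m x. [|m \<in> carrier M; x \<in> carrier X|] ==> P (pt m x)"
  and base: "P \<zero>\<^bsub>MX\<^esub>"
  and step: "!!s t. [|s \<in> carrier MX; t \<in> carrier MX; P s; P t|] ==> P (s \<ominus>\<^bsub>MX\<^esub> t)"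
 shows "P t"
proof -
 interpret MX: abelian_group MX by (rule abelian_group_MX)
 obtain p where p: "p \<in> carrier FA" "t = TC p" using t by (rule MX_E)
 have d: "TC (p - q) = TC p \<ominus>\<^bsub>MX\<^esub> TC q" if "p \<in> carrier FA" "q \<in> carrier FA" for p q
 proof -
  have "TC (p - q) \<oplus>\<^bsub>MX\<^esub> TC q = TC p" using TC_add[OF FA_diff[OF that] that(2)] by simp
  then show ?thesis
   using MX.add.inv_solve_right[OF TC_closed[OF FA_diff[OF that]] TC_closed[OF that(1)] TC_closed[OF that(2)]]
   by (simp add: a_minus_def)
 qed
 have "Poly_Mapping.keys p \<subseteq> carrier M \<times> carrier X" using p by simp
 then have "P (TC p)"
 proof (induction p rule: free_Abelian_group_induct[consumes 1, case_names zero diff of])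
  case zero then show ?case using base by (simp add: MX_simps)
 next
  case (diff x y)
  then show ?case using d[of x y] step[of "TC x" "TC y"] TC_closed by simp
 next
  case (of a)
  then show ?case using pure by (cases a) (auto simp: pure_tensor_def)
 qed
 then show ?thesis using p by simp
qed

lemma tensor_lift_facts:
 assumes G: "abelian_group G" and h: "balanced B M X G h"
 shows tensor_lift_pt: "!!m x. [|m \<in> carrier M; x \<in> carrier X|] ==> tensor_lift B M X G h (pt m x) = h m x"
  and tensor_lift_closed: "!!t. t \<in> carrier MX ==> tensor_lift B M X G h t \<in> carrier G"
  and tensor_lift_add: "!!s t. [|s \<in> carrier MX; t \<in> carrier MX|] ==>
   tensor_lift B M X G h (s \<oplus>\<^bsub>MX\<^esub> t) = tensor_lift B M X G h s \<oplus>\<^bsub>G\<^esub> tensor_lift B M X G h t"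
proof -
 interpret G: abelian_group G by fact
 interpret MX: abelian_group MX by (rule abelian_group_MX)
 let ?h = "\<lambda>q. h (fst q) (snd q)"
 note hb = h[unfolded balanced_def]
 define L where "L = frag_sum (add_monoid G) ?h"
 have hc: "?h \<in> carrier M \<times> carrier X \<rightarrow> carrier (add_monoid G)" using hb by auto
 have L: "L \<in> hom FA (add_monoid G)"
  unfolding L_def by (rule comm_group.hom_frag_sum[OF G.a_comm_group hc])
 interpret L: group_hom FA "add_monoid G" L
  by (intro group_hom.intro group_hom_axioms.intro FA.group_axioms G.a_group L)
 have Lof: "L (frag_of (m, x)) = h m x" if "m \<in> carrier M" "x \<in> carrier X" for m x
  using comm_group.frag_sum_of[OF G.a_comm_group, of ?h "(m, x)"] hb that by (simp add: L_def)
 have Lc: "L p \<in> carrier G" if "p \<in> carrier FA" for p using L.hom_closed[OF that] by simp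
 have Ladd: "L (p + q) = L p \<oplus>\<^bsub>G\<^esub> L q" if "p \<in> carrier FA" "q \<in> carrier FA" for p q
  using L.hom_mult[OF that] by simp
 have Ldiff: "L (p - q) = L p \<ominus>\<^bsub>G\<^esub> L q" if "p \<in> carrier FA" "q \<in> carrier FA" for p q
 proof -
  have "L (p - q) \<oplus>\<^bsub>G\<^esub> L q = L p" using Ladd[OF FA_diff[OF that] that(2)] by simp
  then show ?thesis using G.add.inv_solve_right[OF Lc[OF FA_diff[OF that]] Lc[OF that(1)] Lc[OF that(2)]]
   by (simp add: a_minus_def)
 qed
 have sub0: "u \<ominus>\<^bsub>G\<^esub> v = \<zero>\<^bsub>G\<^esub>" if "u = v" "v \<in> carrier G" for u v
  using that by (simp add: a_minus_def G.r_neg)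
 have sub1: "(u \<oplus>\<^bsub>G\<^esub> v) \<ominus>\<^bsub>G\<^esub> u = v" if "u \<in> carrier G" "v \<in> carrier G" for u v
  using that by (simp add: a_minus_def G.a_assoc G.a_comm[of v] G.r_neg2)
 have "L p = \<zero>\<^bsub>G\<^esub>" if p: "p \<in> rel_gens" for p using p
 proof (cases rule: rel_gensE)
  case a: (1 m n x)
  then have "L p = ((h m x \<oplus>\<^bsub>G\<^esub> h n x) \<ominus>\<^bsub>G\<^esub> h m x) \<ominus>\<^bsub>G\<^esub> h n x"
   using hb X.a_closed by (simp add: Ldiff FA_diff FA_of Lof del: carrier_free_Abelian_group_iff)
  then show ?thesis using a hb by (simp add: sub0 sub1)
 next
  case a: (2 m x y)
  then have "L p = ((h m x \<oplus>\<^bsub>G\<^esub> h m y) \<ominus>\<^bsub>G\<^esub> h m x) \<ominus>\<^bsub>G\<^esub> h m y"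
   using hb md.X.a_closed by (simp add: Ldiff FA_diff FA_of Lof del: carrier_free_Abelian_group_iff)
  then show ?thesis using a hb by (simp add: sub0 sub1)
 next
  case a: (3 m b x)
  then have "L p = h (rsmult M m b) x \<ominus>\<^bsub>G\<^esub> h m (b \<odot>\<^bsub>X\<^esub> x)"
   using rsmult_closed md.smult_closed by (simp add: Ldiff FA_of Lof del: carrier_free_Abelian_group_iff)
  then show ?thesis using a hb md.smult_closed by (simp add: sub0)
 qed
 then have "rel_gens \<subseteq> kernel FA (add_monoid G) L"
  using rel_gens_subset by (auto simp: kernel_def simp del: carrier_free_Abelian_group_iff)
 then have LTR: "TR \<subseteq> kernel FA (add_monoid G) L"
  unfolding TR_def by (intro FA.generate_subgroup_incl L.subgroup_kernel)
 have lift: "tensor_lift B M X G h (TC p) = L p" if p: "p \<in> carrier FA" for p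
 proof -
  have e: "(\<lambda>p. \<Oplus>\<^bsub>G\<^esub>q\<in>Poly_Mapping.keys p. [Poly_Mapping.lookup p q] \<cdot>\<^bsub>G\<^esub> h (fst q) (snd q)) = L"
   by (simp add: L_def frag_sum_def finsum_def add_pow_def fun_eq_iff)
  have "tensor_lift B M X G h (TC p) = the_elem ((\<lambda>p. \<Oplus>\<^bsub>G\<^esub>q\<in>Poly_Mapping.keys p.
    [Poly_Mapping.lookup p q] \<cdot>\<^bsub>G\<^esub> h (fst q) (snd q)) ` TC p)"
   using TC_closed[OF p] by (simp add: tensor_lift_def)
  also have "\<dots> = the_elem (L ` TC p)"
   by (rule arg_cong[OF e, where f = "\<lambda>g. the_elem (g ` TC p)"])
  also have "\<dots> = L p"
  proof (rule TC_the_elem[OF p])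
   fix q assume q: "q \<in> carrier FA" "TC q = TC p"
   then have "L (q - p) = \<zero>\<^bsub>G\<^esub>" using TC_eq_iff[OF q(1) p] LTR by (auto simp: kernel_def)
   then have "L q \<ominus>\<^bsub>G\<^esub> L p = \<zero>\<^bsub>G\<^esub>" using Ldiff[OF q(1) p] by simp
   then show "L q = L p" using Lc q p by (metis G.add.inv_closed G.add.inv_equality G.add.inv_inv a_minus_def)
  qed
  finally show ?thesis .
 qed
 show "tensor_lift B M X G h (pt m x) = h m x" if "m \<in> carrier M" "x \<in> carrier X" for m x
  using lift[OF FA_of[OF that]] Lof[OF that] by (simp add: pure_tensor_def)
 fix s assume "s \<in> carrier MX"
 then obtain p where p: "p \<in> carrier FA" "s = TC p" by (rule MX_E)
 show "tensor_lift B M X G h s \<in> carrier G" using lift p Lc by simp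
 fix t assume "t \<in> carrier MX"
 then obtain q where q: "q \<in> carrier FA" "t = TC q" by (rule MX_E)
 show "tensor_lift B M X G h (s \<oplus>\<^bsub>MX\<^esub> t) = tensor_lift B M X G h s \<oplus>\<^bsub>G\<^esub> tensor_lift B M X G h t"
  using lift[OF FA_add[OF p(1) q(1)]] Ladd[OF p(1) q(1)] p q TC_add[OF p(1) q(1)] lift by simp
qed

end

section \<open>Characters\<close>

definition char_group :: "rat ring"
 where "char_group = \<lparr>carrier = {0..<1}, monoid.mult = undefined, one = undefined,
  ring.zero = 0, ring.add = (\<lambda>x y. frac (x + y))\<rparr>"

definition characters :: "('g, 'p) ring_scheme => ('g => rat) set"
 where "characters G = {\<chi> \<in> carrier G \<rightarrow>\<^sub>E {0..<1}.
  \<forall>x\<in>carrier G. \<forall>y\<in>carrier G. \<chi> (x \<oplus>\<^bsub>G\<^esub> y) = frac (\<chi> x + \<chi> y)}"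

lemma char_group_simps [simp]:
 "carrier char_group = {0..<1}" "\<zero>\<^bsub>char_group\<^esub> = 0" "x \<oplus>\<^bsub>char_group\<^esub> y = frac (x + y)"
 by (simp_all add: char_group_def)

lemma frac_in: "frac (x::rat) \<in> {0..<1}" by (simp add: frac_lt_1)

lemma frac_eq_iff: "frac (x::rat) = frac y \<longleftrightarrow> x - y \<in> \<int>"
proof
 assume "frac x = frac y"
 then have "x - y = of_int (\<lfloor>x\<rfloor> - \<lfloor>y\<rfloor>)" by (simp add: frac_def algebra_simps)
 then show "x - y \<in> \<int>" by (metis Ints_of_int)
next
 assume "x - y \<in> \<int>"
 then have "frac (y + (x - y)) = frac y" by (rule frac_add_int_right)
 then show "frac x = frac y" by simp
qed

lemma abelian_group_char_group: "abelian_group char_group"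
proof (rule abelian_groupI)
 fix x :: rat assume x: "x \<in> carrier char_group"
 show "\<exists>y\<in>carrier char_group. y \<oplus>\<^bsub>char_group\<^esub> x = \<zero>\<^bsub>char_group\<^esub>"
  by (rule bexI[of _ "frac (- x)"]) (use frac_in in auto)
qed (use frac_in in \<open>auto simp: frac_eq add_ac\<close>)

lemma characterI:
 assumes "!!x. x \<in> carrier G ==> \<chi> x \<in> {0..<1}"
  and "!!x y. [|x \<in> carrier G; y \<in> carrier G|] ==> \<chi> (x \<oplus>\<^bsub>G\<^esub> y) = frac (\<chi> x + \<chi> y)"
  and "!!x y. [|x \<in> carrier G; y \<in> carrier G|] ==> x \<oplus>\<^bsub>G\<^esub> y \<in> carrier G"
 shows "(\<lambda>x\<in>carrier G. \<chi> x) \<in> characters G" using assms by (auto simp: characters_def)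

lemma character_closed: "[|\<chi> \<in> characters G; x \<in> carrier G|] ==> \<chi> x \<in> {0..<1}"
 by (auto simp: characters_def PiE_iff)

lemma character_add:
 "[|\<chi> \<in> characters G; x \<in> carrier G; y \<in> carrier G|] ==> \<chi> (x \<oplus>\<^bsub>G\<^esub> y) = frac (\<chi> x + \<chi> y)"
 by (auto simp: characters_def)

lemma character_frac: "[|\<chi> \<in> characters G; x \<in> carrier G|] ==> frac (\<chi> x) = \<chi> x"
 using character_closed by (metis frac_eq_id)

lemma character_zero:
 assumes "abelian_group G" "\<chi> \<in> characters G" shows "\<chi> \<zero>\<^bsub>G\<^esub> = 0"
proof -
 interpret abelian_group G by fact
 have "frac (\<chi> \<zero>\<^bsub>G\<^esub>) = frac (\<chi> \<zero>\<^bsub>G\<^esub> + \<chi> \<zero>\<^bsub>G\<^esub>)"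
  using character_add[OF assms(2), of "\<zero>\<^bsub>G\<^esub>" "\<zero>\<^bsub>G\<^esub>"] character_frac[OF assms(2), of "\<zero>\<^bsub>G\<^esub>"] by simp
 then have "\<chi> \<zero>\<^bsub>G\<^esub> \<in> \<int>" by (simp add: frac_eq_iff)
 then have "frac (\<chi> \<zero>\<^bsub>G\<^esub>) = 0" by simp
 then show ?thesis using character_frac[OF assms(2), of "\<zero>\<^bsub>G\<^esub>"] by simp
qed

lemma character_uminus:
 assumes "abelian_group G" "\<chi> \<in> characters G" "x \<in> carrier G"
 shows "\<chi> (\<ominus>\<^bsub>G\<^esub> x) = frac (- \<chi> x)"
proof -
 interpret abelian_group G by fact
 have "frac (\<chi> (\<ominus>\<^bsub>G\<^esub> x) + \<chi> x) = 0"
  using character_add[OF assms(2), of "\<ominus>\<^bsub>G\<^esub> x" x] assms(3) character_zero[OF assms(1,2)] l_neg by simp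
 then have "frac (\<chi> (\<ominus>\<^bsub>G\<^esub> x)) = frac (- \<chi> x)" by (simp add: frac_eq_iff)
 then show ?thesis using character_frac[OF assms(2), of "\<ominus>\<^bsub>G\<^esub> x"] assms(3) by simp
qed

lemma character_diff:
 assumes "abelian_group G" "\<chi> \<in> characters G" "x \<in> carrier G" "y \<in> carrier G"
 shows "\<chi> (x \<ominus>\<^bsub>G\<^esub> y) = frac (\<chi> x - \<chi> y)"
proof -
 interpret abelian_group G by fact
 show ?thesis using assms by (simp add: a_minus_def character_add character_uminus)
qed

text \<open>A partial character is a subgroup of the product of \<open>G\<close> and the rationals whose fibre over
 zero is exactly the integers.\<close>

definition partial_character :: "('g, 'p) ring_scheme => ('g \<times> rat) set => bool"
 where "partial_character G \<rho> \<longleftrightarrow> fst ` \<rho> \<subseteq> carrier G \<and>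
  (\<forall>x p y q. (x, p) \<in> \<rho> --> (y, q) \<in> \<rho> --> (x \<oplus>\<^bsub>G\<^esub> y, p + q) \<in> \<rho>) \<and>
  (\<forall>x p. (x, p) \<in> \<rho> --> (\<ominus>\<^bsub>G\<^esub> x, - p) \<in> \<rho>) \<and> (\<forall>q. (\<zero>\<^bsub>G\<^esub>, q) \<in> \<rho> \<longleftrightarrow> q \<in> \<int>)"

context abelian_group
begin

lemma int_mult_facts:
 assumes "x \<in> carrier G"
 shows "[(i::int)] \<cdot> x \<in> carrier G" "[(i + j::int)] \<cdot> x = [i] \<cdot> x \<oplus> [j] \<cdot> x"
  "[(- i::int)] \<cdot> x = \<ominus> ([i] \<cdot> x)" "[(0::int)] \<cdot> x = \<zero>" "[(1::int)] \<cdot> x = x"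
 using assms add.int_pow_mult[of x i j] add.int_pow_neg[of x i] by (simp_all add: add_pow_def[of G "0::int"])

text \<open>
 Let \<open>d\<close> be the least positive multiplier for which \<open>d x\<close> has a value \<open>q\<^sub>0\<close>. Then \<open>q\<^sub>0/d\<close> and \<open>(q\<^sub>0 + 1)/d\<close> are both
 admissible values at \<open>x\<close>, and not both are integers as \<open>d > 1\<close>. If there is no such \<open>d\<close>, any non-integral
 value will do.
\<close>

lemma partial_character_step:
 assumes \<rho>: "partial_character G \<rho>" and x: "x \<in> carrier G" "x \<notin> fst ` \<rho>"
 shows "\<exists>\<sigma> c. \<rho> \<subseteq> \<sigma> \<and> partial_character G \<sigma> \<and> (x, c) \<in> \<sigma> \<and> c \<notin> \<int>"
proof -
 note im = int_mult_facts[OF x(1)]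
 have add: "(y \<oplus> z, p + q) \<in> \<rho>" if "(y, p) \<in> \<rho>" "(z, q) \<in> \<rho>" for y z p q
  using \<rho> that by (auto simp: partial_character_def)
 have neg: "(\<ominus> y, - p) \<in> \<rho>" if "(y, p) \<in> \<rho>" for y p
  using \<rho> that by (auto simp: partial_character_def)
 have zero: "(\<zero>, q) \<in> \<rho> \<longleftrightarrow> q \<in> \<int>" for q
  using \<rho> by (auto simp: partial_character_def)
 have carr: "y \<in> carrier G" if "(y, p) \<in> \<rho>" for y p
  using \<rho> that by (auto simp: partial_character_def)
 define P where "P n q \<longleftrightarrow> ([n] \<cdot> x, q) \<in> \<rho>" for n :: int and q
 have P0: "P 0 q \<longleftrightarrow> q \<in> \<int>" for q unfolding P_def by (simp add: im zero)
 have Padd: "P (m + n) (p + q)" if "P m p" "P n q" for m n p q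
  using add[OF that[unfolded P_def]] by (simp add: P_def im)
 have Pneg: "P (- n) (- q)" if "P n q" for n q using neg[OF that[unfolded P_def]] by (simp add: P_def im)
 have Pmult: "P (k * n) (of_int k * q)" if "P n q" for k n q
 proof (induction k rule: int_induct[where k = 0])
  case base then show ?case by (simp add: P0)
 next
  case (step1 i) then show ?case using Padd[OF step1(2) \<open>P n q\<close>] by (simp add: algebra_simps)
 next
  case (step2 i)
  have "P (i * n + - n) (of_int i * q + - q)" by (rule Padd[OF step2(2) Pneg[OF \<open>P n q\<close>]])
  then show ?case by (simp add: algebra_simps)
 qed
 have "\<exists>c. c \<notin> \<int> \<and> (\<forall>n q. P n q --> q - of_int n * c \<in> \<int>)"
 proof (cases "\<exists>n q. n \<noteq> 0 \<and> P n q")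
  case False
  then have "q - of_int n * (1/2) \<in> \<int>" if "P n q" for n q using that P0[of q] by (cases "n = 0") auto
  moreover have "(1/2::rat) \<notin> \<int>"
   using frac_eq_0_iff[of "1/2::rat"] frac_eq_id[of "1/2::rat"] by simp
  ultimately show ?thesis by blast
 next
  case True
  then obtain n0 p0 where n0: "n0 \<noteq> 0" "P n0 p0" by blast
  define d where "d = (LEAST d::nat. 0 < d \<and> (\<exists>q. P (int d) q))"
  have "\<exists>d::nat. 0 < d \<and> (\<exists>q. P (int d) q)"
  proof (cases "n0 > 0")
   case True then show ?thesis using n0 by (intro exI[of _ "nat n0"]) auto
  next
   case False then show ?thesis using n0 Pneg[OF n0(2)] by (intro exI[of _ "nat (- n0)"]) auto
  qed
  then have d: "0 < d" "\<exists>q. P (int d) q"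
   using LeastI_ex[of "\<lambda>d. 0 < d \<and> (\<exists>q. P (int d) q)"] by (auto simp: d_def)
  have dmin: "e = 0" if "P (int e) q" "e < d" for e q
   using not_less_Least[of e "\<lambda>d. 0 < d \<and> (\<exists>q. P (int d) q)"] that by (auto simp: d_def)
  obtain q0 where q0: "P (int d) q0" using d by blast
  have d1: "d \<noteq> 1" using x(2) q0 by (force simp: P_def im)
  have key: "q - of_int n * (r / of_nat d) \<in> \<int>" if Pn: "P n q" and r: "r - q0 \<in> \<int>" for n q r
  proof -
   have "P (n + - (n div int d) * int d) (q + of_int (- (n div int d)) * q0)" by (rule Padd[OF Pn Pmult[OF q0]])
   then have "P (n mod int d) (q + of_int (- (n div int d)) * q0)" by (simp add: minus_div_mult_eq_mod)
   then have "P (int (nat (n mod int d))) (q + of_int (- (n div int d)) * q0)" using d(1) by simp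
   moreover have "nat (n mod int d) < d" using d(1) by (auto simp: nat_less_iff)
   ultimately have "nat (n mod int d) = 0" by (rule dmin)
   moreover have "0 \<le> n mod int d" using d(1) by simp
   ultimately have m0: "n mod int d = 0" by linarith
   then obtain k where k: "n = int d * k" by (metis dvdE mod_0_imp_dvd)
   have "P (n + - k * int d) (q + of_int (- k) * q0)" by (rule Padd[OF Pn Pmult[OF q0]])
   then have "q - of_int k * q0 \<in> \<int>" using P0 by (simp add: k)
   moreover have "of_int k * (r - q0) \<in> \<int>" using r by (intro Ints_mult) auto
   ultimately have "(q - of_int k * q0) - of_int k * (r - q0) \<in> \<int>" by (rule Ints_diff)
   moreover have "of_int n * (r / of_nat d) = of_int k * r" using d(1) by (simp add: k)
   ultimately show ?thesis by (simp add: algebra_simps)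
  qed
  have "q0 / of_nat d \<notin> \<int> \<or> (q0 + 1) / of_nat d \<notin> \<int>"
  proof (rule ccontr)
   assume "\<not> ?thesis"
   then have "(q0 + 1) / of_nat d - q0 / of_nat d \<in> \<int>" by (intro Ints_diff) auto
   then have "1 / rat_of_nat d \<in> \<int>" by (simp add: diff_divide_distrib[symmetric])
   moreover have "1 / rat_of_nat d \<in> {0..<1}" using d d1 by auto
   ultimately show False using frac_eq_0_iff[of "1 / rat_of_nat d"] frac_eq_id[of "1 / rat_of_nat d"] d by simp
  qed
  moreover have "q0 - q0 \<in> \<int>" "(q0 + 1) - q0 \<in> \<int>" by simp_all
  ultimately show ?thesis using key by blast
 qed
 then obtain c where c: "c \<notin> \<int>" "!!n q. P n q ==> q - of_int n * c \<in> \<int>" by blast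
 define \<sigma> where "\<sigma> = {(y \<oplus> [n] \<cdot> x, p + of_int n * c) | y p n. (y, p) \<in> \<rho>}"
 have sub: "\<rho> \<subseteq> \<sigma>"
 proof clarify
  fix y p assume yp: "(y, p) \<in> \<rho>"
  then have "(y, p) = (y \<oplus> [(0::int)] \<cdot> x, p + of_int 0 * c)" using carr by (simp add: im)
  then show "(y, p) \<in> \<sigma>" unfolding \<sigma>_def using yp by blast
 qed
 have "(x, c) = (\<zero> \<oplus> [(1::int)] \<cdot> x, 0 + of_int 1 * c)" using x by (simp add: im)
 moreover have "(\<zero>, 0) \<in> \<rho>" by (simp add: zero)
 ultimately have xc: "(x, c) \<in> \<sigma>" unfolding \<sigma>_def by blast
 have "partial_character G \<sigma>"
  unfolding partial_character_def
 proof (intro conjI allI impI)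
  show "fst ` \<sigma> \<subseteq> carrier G" using carr im by (auto simp: \<sigma>_def)
 next
  fix y p z q assume "(y, p) \<in> \<sigma>" "(z, q) \<in> \<sigma>"
  then obtain y' p' n z' q' m where e: "y = y' \<oplus> [(n::int)] \<cdot> x" "p = p' + of_int n * c" "(y', p') \<in> \<rho>"
   "z = z' \<oplus> [(m::int)] \<cdot> x" "q = q' + of_int m * c" "(z', q') \<in> \<rho>" by (auto simp: \<sigma>_def)
  have "(y \<oplus> z, p + q) = ((y' \<oplus> z') \<oplus> [(n + m)] \<cdot> x, (p' + q') + of_int (n + m) * c)"
   using carr[OF e(3)] carr[OF e(6)] e by (simp add: im a_ac algebra_simps)
  then show "(y \<oplus> z, p + q) \<in> \<sigma>" unfolding \<sigma>_def using add[OF e(3,6)] by blast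
 next
  fix y p assume "(y, p) \<in> \<sigma>"
  then obtain y' p' n where e: "y = y' \<oplus> [(n::int)] \<cdot> x" "p = p' + of_int n * c" "(y', p') \<in> \<rho>"
   by (auto simp: \<sigma>_def)
  have "(\<ominus> y, - p) = (\<ominus> y' \<oplus> [(- n)] \<cdot> x, - p' + of_int (- n) * c)"
   using carr[OF e(3)] e by (simp add: im minus_add)
  then show "(\<ominus> y, - p) \<in> \<sigma>" unfolding \<sigma>_def using neg[OF e(3)] by blast
 next
  fix q
  show "(\<zero>, q) \<in> \<sigma> \<longleftrightarrow> q \<in> \<int>"
  proof
   assume "(\<zero>, q) \<in> \<sigma>"
   then obtain y p n where e: "\<zero> = y \<oplus> [(n::int)] \<cdot> x" "q = p + of_int n * c" "(y, p) \<in> \<rho>"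
    by (auto simp: \<sigma>_def)
   have "[(- n)] \<cdot> x = y" using e(1) carr[OF e(3)] im(1)[of n] by (metis im(3) minus_equality)
   then have "P (- n) p" using e(3) by (simp add: P_def)
   then show "q \<in> \<int>" using c(2)[of "- n" p] e(2) by simp
  next
   assume "q \<in> \<int>"
   then show "(\<zero>, q) \<in> \<sigma>" using zero sub by blast
  qed
 qed
 then show ?thesis using sub xc c by blast
qed

lemma partial_character_extend:
 assumes \<rho>: "partial_character G \<rho>"
 shows "\<exists>\<chi>\<in>characters G. \<forall>(x, q)\<in>\<rho>. \<chi> x = frac q"
proof -
 let ?A = "{\<sigma>. \<rho> \<subseteq> \<sigma> \<and> partial_character G \<sigma>}"
 have "\<exists>\<mu>\<in>?A. \<forall>\<tau>\<in>?A. \<mu> \<subseteq> \<tau> --> \<tau> = \<mu>"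
 proof (rule subset_Zorn_nonempty)
  show "?A \<noteq> {}" using \<rho> by blast
  fix \<C> assume C: "\<C> \<noteq> {}" "subset.chain ?A \<C>"
  then have pc: "partial_character G \<sigma>" "\<rho> \<subseteq> \<sigma>" if "\<sigma> \<in> \<C>" for \<sigma>
   using that by (auto simp: subset.chain_def)
  have "partial_character G (\<Union> \<C>)"
   unfolding partial_character_def
  proof (intro conjI allI impI)
   have "fst ` \<sigma> \<subseteq> carrier G" if "\<sigma> \<in> \<C>" for \<sigma>
    using pc(1)[OF that] by (simp add: partial_character_def)
   then show "fst ` \<Union> \<C> \<subseteq> carrier G" by blast
  next
   fix y p z q assume "(y, p) \<in> \<Union> \<C>" "(z, q) \<in> \<Union> \<C>"
   then obtain \<sigma> \<tau> where st: "\<sigma> \<in> \<C>" "(y, p) \<in> \<sigma>" "\<tau> \<in> \<C>" "(z, q) \<in> \<tau>" by blast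
   have "\<sigma> \<subset> \<tau> \<or> \<sigma> = \<tau> \<or> \<tau> \<subset> \<sigma> \<or> \<tau> = \<sigma>"
    using C(2) st(1,3) unfolding subset.chain_def by simp
   then have "\<sigma> \<subseteq> \<tau> \<or> \<tau> \<subseteq> \<sigma>" by (elim disjE) (simp_all add: psubset_imp_subset)
   then obtain \<upsilon> where u: "\<upsilon> \<in> \<C>" "(y, p) \<in> \<upsilon>" "(z, q) \<in> \<upsilon>" using st by blast
   then have "(y \<oplus> z, p + q) \<in> \<upsilon>" using pc(1)[OF u(1)] by (simp add: partial_character_def)
   then show "(y \<oplus> z, p + q) \<in> \<Union> \<C>" using u(1) by blast
  next
   fix y p assume "(y, p) \<in> \<Union> \<C>"
   then obtain \<upsilon> where u: "\<upsilon> \<in> \<C>" "(y, p) \<in> \<upsilon>" by blast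
   then have "(\<ominus> y, - p) \<in> \<upsilon>" using pc(1)[OF u(1)] by (simp add: partial_character_def)
   then show "(\<ominus> y, - p) \<in> \<Union> \<C>" using u(1) by blast
  next
   fix q
   have "(\<zero>, q) \<in> \<upsilon> \<longleftrightarrow> q \<in> \<int>" if "\<upsilon> \<in> \<C>" for \<upsilon>
    using pc(1)[OF that] by (simp add: partial_character_def)
   then show "(\<zero>, q) \<in> \<Union> \<C> \<longleftrightarrow> q \<in> \<int>" using C(1) by blast
  qed
  then show "\<Union> \<C> \<in> ?A" using pc(2) C(1) by blast
 qed
 then obtain \<mu> where m: "\<mu> \<in> ?A" "\<forall>\<tau>\<in>?A. \<mu> \<subseteq> \<tau> --> \<tau> = \<mu>" by (rule bexE)
 then have \<mu>: "\<rho> \<subseteq> \<mu>" "partial_character G \<mu>" by simp_all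
 have max: "\<tau> = \<mu>" if "partial_character G \<tau>" "\<mu> \<subseteq> \<tau>" for \<tau>
  using m(2) that order_trans[OF \<mu>(1) that(2)] by simp
 have dom: "x \<in> fst ` \<mu>" if xG: "x \<in> carrier G" for x
 proof (rule ccontr)
  assume x: "x \<notin> fst ` \<mu>"
  obtain \<sigma> c where "\<mu> \<subseteq> \<sigma>" "partial_character G \<sigma>" "(x, c) \<in> \<sigma>"
   using partial_character_step[OF \<mu>(2) xG x] by (elim exE conjE)
  then show False using max[of \<sigma>] x by force
 qed
 have carr: "x \<in> carrier G" if "(x, p) \<in> \<mu>" for x p
  using \<mu>(2) that by (auto simp: partial_character_def)
 define \<chi> where "\<chi> x = frac (SOME q. (x, q) \<in> \<mu>)" for x
 have \<chi>: "\<chi> x = frac q" if q: "(x, q) \<in> \<mu>" for x q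
 proof -
  have "(x, SOME q. (x, q) \<in> \<mu>) \<in> \<mu>" using q by (rule someI)
  moreover have "(\<ominus> x, - q) \<in> \<mu>" using \<mu>(2) q by (simp add: partial_character_def)
  ultimately have "(x \<oplus> \<ominus> x, (SOME q. (x, q) \<in> \<mu>) + - q) \<in> \<mu>"
   using \<mu>(2) unfolding partial_character_def by meson
  then have "(\<zero>, (SOME q. (x, q) \<in> \<mu>) - q) \<in> \<mu>" using carr[OF q] by (simp add: r_neg)
  then show ?thesis using \<mu>(2) by (simp add: \<chi>_def frac_eq_iff partial_character_def)
 qed
 have "(\<lambda>x\<in>carrier G. \<chi> x) \<in> characters G"
 proof (rule characterI)
  fix x y assume "x \<in> carrier G" "y \<in> carrier G"
  then obtain p q where pq: "(x, p) \<in> \<mu>" "(y, q) \<in> \<mu>" using dom by fastforce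
  then have "(x \<oplus> y, p + q) \<in> \<mu>" using \<mu>(2) by (simp add: partial_character_def)
  then show "\<chi> (x \<oplus> y) = frac (\<chi> x + \<chi> y)" using \<chi> pq by simp
 qed (auto simp: \<chi>_def frac_lt_1)
 moreover have "(\<lambda>x\<in>carrier G. \<chi> x) x = frac q" if "(x, q) \<in> \<rho>" for x q
  using \<chi>[of x q] carr[of x q] \<mu>(1) that by auto
 ultimately show ?thesis by blast
qed

lemma character_extend:
 assumes H: "subgroup H (add_monoid G)"
  and \<psi>: "!!x. x \<in> H ==> \<psi> x \<in> {0..<1}" "!!x y. [|x \<in> H; y \<in> H|] ==> \<psi> (x \<oplus> y) = frac (\<psi> x + \<psi> y)"
 shows "\<exists>\<chi>\<in>characters G. \<forall>x\<in>H. \<chi> x = \<psi> x"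
proof -
 have Hc: "x \<in> carrier G" if "x \<in> H" for x using subgroup.subset[OF H] that by auto
 have H0: "\<zero> \<in> H" using subgroup.one_closed[OF H] by simp
 have Hadd: "x \<oplus> y \<in> H" if "x \<in> H" "y \<in> H" for x y using subgroup.m_closed[OF H that] by simp
 have Hneg: "\<ominus> x \<in> H" if "x \<in> H" for x
  using subgroup.m_inv_closed[OF H that] by (simp add: a_inv_def)
 have \<psi>z: "\<psi> x \<in> \<int> ==> \<psi> x = 0" if "x \<in> H" for x
  using \<psi>(1)[OF that] frac_eq_id frac_eq_0_iff by metis
 have \<psi>0: "\<psi> \<zero> = 0"
 proof -
  have "frac (\<psi> \<zero>) = frac (\<psi> \<zero> + \<psi> \<zero>)" using \<psi>(1)[OF H0] \<psi>(2)[OF H0 H0] frac_eq_id[of "\<psi> \<zero>"] by simp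
  then show ?thesis using \<psi>z[OF H0] by (simp add: frac_eq_iff)
 qed
 have \<psi>n: "\<psi> (\<ominus> x) + \<psi> x \<in> \<int>" if "x \<in> H" for x
  using \<psi>(2)[OF Hneg[OF that] that] \<psi>0 Hc[OF that] by (simp add: l_neg)
 have \<psi>a: "\<psi> (x \<oplus> y) - (\<psi> x + \<psi> y) \<in> \<int>" if "x \<in> H" "y \<in> H" for x y
  using \<psi>(2)[OF that] frac_eq_iff[of "frac (\<psi> x + \<psi> y)" "\<psi> x + \<psi> y"] by simp
 define \<rho> where "\<rho> = {(x, q). x \<in> H \<and> q - \<psi> x \<in> \<int>}"
 have "partial_character G \<rho>"
  unfolding partial_character_def
 proof (intro conjI allI impI)
  show "fst ` \<rho> \<subseteq> carrier G" using Hc by (auto simp: \<rho>_def)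
  show "(\<zero>, q) \<in> \<rho> \<longleftrightarrow> q \<in> \<int>" for q using H0 by (simp add: \<rho>_def \<psi>0)
  fix x p assume x: "(x, p) \<in> \<rho>"
  then have "- (p - \<psi> x) - (\<psi> (\<ominus> x) + \<psi> x) \<in> \<int>"
   by (intro Ints_diff[OF Ints_minus] \<psi>n) (auto simp: \<rho>_def)
  then show "(\<ominus> x, - p) \<in> \<rho>" using x Hneg by (simp add: \<rho>_def algebra_simps)
  fix y q assume y: "(y, q) \<in> \<rho>"
  then have "(p - \<psi> x) + (q - \<psi> y) - (\<psi> (x \<oplus> y) - (\<psi> x + \<psi> y)) \<in> \<int>"
   using x by (intro Ints_diff[OF Ints_add] \<psi>a) (auto simp: \<rho>_def)
  then show "(x \<oplus> y, p + q) \<in> \<rho>" using x y Hadd by (simp add: \<rho>_def algebra_simps)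
 qed
 then obtain \<chi> where \<chi>: "\<chi> \<in> characters G" "\<forall>(x, q)\<in>\<rho>. \<chi> x = frac q"
  using partial_character_extend by blast
 have "\<chi> x = \<psi> x" if "x \<in> H" for x
 proof -
  have "(x, \<psi> x) \<in> \<rho>" using that by (simp add: \<rho>_def)
  then have "\<chi> x = frac (\<psi> x)" using \<chi>(2) by fast
  then show ?thesis using frac_eq_id[OF \<psi>(1)[OF that]] by simp
 qed
 then show ?thesis using \<chi>(1) by blast
qed

lemma character_separate:
 assumes H: "subgroup H (add_monoid G)" and x: "x \<in> carrier G" "x \<notin> H"
 shows "\<exists>\<chi>\<in>characters G. \<chi> x \<noteq> 0 \<and> (\<forall>y\<in>H. \<chi> y = 0)"
proof -
 have Hc: "x \<in> carrier G" if "x \<in> H" for x using subgroup.subset[OF H] that by auto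
 have H0: "\<zero> \<in> H" using subgroup.one_closed[OF H] by simp
 have Hadd: "x \<oplus> y \<in> H" if "x \<in> H" "y \<in> H" for x y using subgroup.m_closed[OF H that] by simp
 have Hneg: "\<ominus> x \<in> H" if "x \<in> H" for x
  using subgroup.m_inv_closed[OF H that] by (simp add: a_inv_def)
 have "partial_character G (H \<times> \<int>)" using Hc H0 Hadd Hneg by (auto simp: partial_character_def)
 moreover have "x \<notin> fst ` (H \<times> (\<int>::rat set))" using x by auto
 ultimately obtain \<sigma> c where s: "H \<times> \<int> \<subseteq> \<sigma>" "partial_character G \<sigma>" "(x, c) \<in> \<sigma>" "c \<notin> \<int>"
  using partial_character_step[OF _ x(1)] by blast
 obtain \<chi> where \<chi>: "\<chi> \<in> characters G" "!!x q. (x, q) \<in> \<sigma> ==> \<chi> x = frac q"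
  using partial_character_extend[OF s(2)] by blast
 have "\<chi> y = 0" if "y \<in> H" for y using \<chi>(2)[of y 0] subsetD[OF s(1), of "(y, 0)"] that by simp
 moreover have "\<chi> x \<noteq> 0" using \<chi>(2)[OF s(3)] s(4) by simp
 ultimately show ?thesis using \<chi>(1) by (intro bexI[of _ \<chi>]) simp_all
qed

end

subsection \<open>The character module of a bimodule\<close>

definition char_module :: "('a, 'b, 'm, 'e) bimodule_scheme => ('b, 'm => rat) module"
 where "char_module M = \<lparr>carrier = characters M, monoid.mult = undefined, one = undefined,
  ring.zero = (\<lambda>m\<in>carrier M. 0), ring.add = (\<lambda>\<chi> \<psi>. \<lambda>m\<in>carrier M. frac (\<chi> m + \<psi> m)),
  smult = (\<lambda>b \<chi>. \<lambda>m\<in>carrier M. \<chi> (rsmult M m b))\<rparr>"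

lemma char_module_simps [simp]:
 "carrier (char_module M) = characters M"
 "\<zero>\<^bsub>char_module M\<^esub> = (\<lambda>m\<in>carrier M. 0)"
 "\<chi> \<oplus>\<^bsub>char_module M\<^esub> \<psi> = (\<lambda>m\<in>carrier M. frac (\<chi> m + \<psi> m))"
 "b \<odot>\<^bsub>char_module M\<^esub> \<chi> = (\<lambda>m\<in>carrier M. \<chi> (rsmult M m b))"
 by (simp_all add: char_module_def)

lemma character_restrict: "\<chi> \<in> characters G ==> (\<lambda>x\<in>carrier G. \<chi> x) = \<chi>"
 unfolding characters_def by auto

lemma frac_diff_left: "frac (frac (x::rat) - y) = frac (x - y)" using frac_add_simps(1)[of x "- y"] by simp

lemma (in bimodule) lmod_char_module: "left_module B (char_module M)"
proof (rule left_moduleI)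
 note cc = character_closed character_add
 show "ring B" by (rule B.ring_axioms)
 show "\<zero>\<^bsub>char_module M\<^esub> \<in> carrier (char_module M)" by (auto intro!: characterI)
 fix \<chi> assume \<chi>: "\<chi> \<in> carrier (char_module M)"
 show "\<zero>\<^bsub>char_module M\<^esub> \<oplus>\<^bsub>char_module M\<^esub> \<chi> = \<chi>"
  using \<chi> by (intro trans[OF _ character_restrict[of \<chi> M]]) (auto simp: character_frac intro!: restrict_ext)
 show "\<one>\<^bsub>B\<^esub> \<odot>\<^bsub>char_module M\<^esub> \<chi> = \<chi>"
  using \<chi> by (intro trans[OF _ character_restrict[of \<chi> M]]) (auto simp: rsmult_one intro!: restrict_ext)
 have "(\<lambda>m\<in>carrier M. frac (- \<chi> m)) \<in> characters M"
  using \<chi> by (intro characterI) (auto simp: frac_lt_1 character_add frac_neg_frac frac_diff_left)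
 then show "\<exists>\<psi>\<in>carrier (char_module M). \<psi> \<oplus>\<^bsub>char_module M\<^esub> \<chi> = \<zero>\<^bsub>char_module M\<^esub>"
  by (intro bexI[of _ "\<lambda>m\<in>carrier M. frac (- \<chi> m)"]) (auto intro!: restrict_ext)
 fix \<psi> assume \<psi>: "\<psi> \<in> carrier (char_module M)"
 show "\<chi> \<oplus>\<^bsub>char_module M\<^esub> \<psi> \<in> carrier (char_module M)"
  using \<chi> \<psi> unfolding char_module_simps
  by (intro characterI) (auto simp: frac_lt_1 character_add, auto simp: add_ac)
 show "\<chi> \<oplus>\<^bsub>char_module M\<^esub> \<psi> = \<psi> \<oplus>\<^bsub>char_module M\<^esub> \<chi>" by (simp add: add.commute)
 fix \<upsilon> assume \<upsilon>: "\<upsilon> \<in> carrier (char_module M)"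
 show "\<chi> \<oplus>\<^bsub>char_module M\<^esub> \<psi> \<oplus>\<^bsub>char_module M\<^esub> \<upsilon> = \<chi> \<oplus>\<^bsub>char_module M\<^esub> (\<psi> \<oplus>\<^bsub>char_module M\<^esub> \<upsilon>)"
  by (auto simp: add_ac intro!: restrict_ext)
next
 fix b \<chi> assume b: "b \<in> carrier B" and \<chi>: "\<chi> \<in> carrier (char_module M)"
 show "b \<odot>\<^bsub>char_module M\<^esub> \<chi> \<in> carrier (char_module M)"
  using \<chi> b character_closed[of \<chi> M] unfolding char_module_simps
  by (intro characterI) (auto simp: character_add rsmult_closed rsmult_l_distr)
 fix c assume c: "c \<in> carrier B"
 show "(b \<oplus>\<^bsub>B\<^esub> c) \<odot>\<^bsub>char_module M\<^esub> \<chi> = b \<odot>\<^bsub>char_module M\<^esub> \<chi> \<oplus>\<^bsub>char_module M\<^esub> c \<odot>\<^bsub>char_module M\<^esub> \<chi>"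
  using \<chi> b c by (auto simp: character_add rsmult_closed rsmult_r_distr intro!: restrict_ext)
 show "(b \<otimes>\<^bsub>B\<^esub> c) \<odot>\<^bsub>char_module M\<^esub> \<chi> = b \<odot>\<^bsub>char_module M\<^esub> (c \<odot>\<^bsub>char_module M\<^esub> \<chi>)"
  using \<chi> b c by (auto simp: rsmult_closed rsmult_assoc intro!: restrict_ext)
next
 fix b \<chi> \<psi> assume "b \<in> carrier B" "\<chi> \<in> carrier (char_module M)" "\<psi> \<in> carrier (char_module M)"
 then show "b \<odot>\<^bsub>char_module M\<^esub> (\<chi> \<oplus>\<^bsub>char_module M\<^esub> \<psi>) = b \<odot>\<^bsub>char_module M\<^esub> \<chi> \<oplus>\<^bsub>char_module M\<^esub> b \<odot>\<^bsub>char_module M\<^esub> \<psi>"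
  by (auto simp: rsmult_closed intro!: restrict_ext)
qed

lemma subgroup_submodule:
 assumes "left_module R X" "submodule_of R X H" shows "subgroup H (add_monoid X)"
proof -
 interpret X: left_module R X by fact
 show ?thesis by (rule X.add.subgroupI)
   (use assms submodule_uminus[OF assms] in \<open>auto simp: submodule_of_def\<close>)
qed

text \<open>A homomorphism \<open>X \<rightarrow> M\<^sup>+\<close> is the same thing as a character of \<open>M \<otimes> X\<close>.\<close>

context tensor_context
begin

lemma balanced_pairing:
 assumes h: "h \<in> mod_hom B X (char_module M)"
 shows "balanced B M X char_group (\<lambda>m x. h x m)"
proof -
 have c: "h x \<in> characters M" if "x \<in> carrier X" for x using mhom_closed[OF h that] by simp
 have "0 \<le> h x m" "h x m < 1" if "x \<in> carrier X" "m \<in> carrier M" for x m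
  using character_closed[OF c that(2)] that(1) by auto
 then show ?thesis by (auto simp: balanced_def character_add[OF c] mhom_add[OF h] mhom_smult[OF h])
qed

lemma pairing_character:
 assumes h: "h \<in> mod_hom B X (char_module M)"
 shows "\<exists>\<xi>\<in>characters MX. \<forall>m\<in>carrier M. \<forall>x\<in>carrier X. \<xi> (pt m x) = h x m"
proof -
 interpret MX: left_module A MX by (rule lmod_MX)
 let ?l = "tensor_lift B M X char_group (\<lambda>m x. h x m)"
 note l = tensor_lift_facts[OF abelian_group_char_group balanced_pairing[OF h]]
 have "(\<lambda>t\<in>carrier MX. ?l t) \<in> characters MX" by (rule characterI) (use l in auto)
 then show ?thesis by (rule bexI[rotated]) (simp add: l)
qed

lemma character_pairing:
 assumes \<xi>: "\<xi> \<in> characters MX"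
 shows "(\<lambda>x\<in>carrier X. \<lambda>m\<in>carrier M. \<xi> (pt m x)) \<in> mod_hom B X (char_module M)"
proof (rule mhom_restrictI[OF md.left_module_axioms])
 fix x assume x: "x \<in> carrier X"
 show "(\<lambda>m\<in>carrier M. \<xi> (pt m x)) \<in> carrier (char_module M)"
  using x character_closed[OF \<xi>, OF pt_closed] unfolding char_module_simps
  by (intro characterI) (auto simp: pt_add_left character_add[OF \<xi>])
 show "(\<lambda>m\<in>carrier M. \<xi> (pt m (x \<oplus>\<^bsub>X\<^esub> y))) = (\<lambda>m\<in>carrier M. \<xi> (pt m x)) \<oplus>\<^bsub>char_module M\<^esub> (\<lambda>m\<in>carrier M. \<xi> (pt m y))"
  if y: "y \<in> carrier X" for y
  using x y by (auto simp: pt_add_right character_add[OF \<xi>] intro!: restrict_ext)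
 show "(\<lambda>m\<in>carrier M. \<xi> (pt m (b \<odot>\<^bsub>X\<^esub> x))) = b \<odot>\<^bsub>char_module M\<^esub> (\<lambda>m\<in>carrier M. \<xi> (pt m x))"
  if b: "b \<in> carrier B" for b using x b by (auto simp: pt_balanced rsmult_closed intro!: restrict_ext)
qed

lemma tensor_characters_eq:
 assumes "\<xi> \<in> characters MX" "\<zeta> \<in> characters MX"
  and eq: "!!m x. [|m \<in> carrier M; x \<in> carrier X|] ==> \<xi> (pt m x) = \<zeta> (pt m x)"
  and t: "t \<in> carrier MX"
 shows "\<xi> t = \<zeta> t" using t
proof (induction t rule: tensor_induct)
 case zero
 then show ?case using character_zero[OF abelian_group_MX] assms by metis
next
 case (diff s t)
 then show ?case using character_diff[OF abelian_group_MX] assms by metis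
qed (use eq in auto)

lemma tensor_zero_iff:
 assumes t: "t \<in> carrier MX" and \<xi>: "!!\<xi>. \<xi> \<in> characters MX ==> \<xi> t = 0"
 shows "t = \<zero>\<^bsub>MX\<^esub>"
proof (rule ccontr)
 interpret MX: left_module A MX by (rule lmod_MX)
 assume "t \<noteq> \<zero>\<^bsub>MX\<^esub>"
 then show False using MX.X.character_separate[OF MX.X.add.triv_subgroup, of t] t \<xi> by auto
qed

end

lemma tensor_map_facts:
 fixes M :: "('a, 'b, 'm) bimodule"
 assumes X: "tensor_context A B M X" and Y: "tensor_context A B M Y" and f: "f \<in> mod_hom B X Y"
 shows tensor_map_pt: "!!m x. [|m \<in> carrier M; x \<in> carrier X|] ==>
   tensor_map B M X Y f (pure_tensor B M X m x) = pure_tensor B M Y m (f x)"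
  and tensor_map_closed: "!!t. t \<in> carrier (tensor B M X) ==> tensor_map B M X Y f t \<in> carrier (tensor B M Y)"
  and tensor_map_add: "!!s t. [|s \<in> carrier (tensor B M X); t \<in> carrier (tensor B M X)|] ==>
   tensor_map B M X Y f (s \<oplus>\<^bsub>tensor B M X\<^esub> t) =
    tensor_map B M X Y f s \<oplus>\<^bsub>tensor B M Y\<^esub> tensor_map B M X Y f t"
  and mhom_tensor_map: "tensor_map B M X Y f \<in> mod_hom A (tensor B M X) (tensor B M Y)"
proof -
 interpret X: tensor_context A B M X by fact
 interpret Y: tensor_context A B M Y by fact
 interpret MX: left_module A "tensor B M X" by (rule X.lmod_MX)
 interpret MY: left_module A "tensor B M Y" by (rule Y.lmod_MX)
 have "balanced B M X (tensor B M Y) (\<lambda>m x. pure_tensor B M Y m (f x))"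
  using Y.balanced_pt mhom_closed[OF f] by (auto simp: balanced_def mhom_add[OF f] mhom_smult[OF f])
 note l = X.tensor_lift_facts[OF Y.abelian_group_MX this, folded tensor_map_def]
 show pt: "tensor_map B M X Y f (pure_tensor B M X m x) = pure_tensor B M Y m (f x)"
  if "m \<in> carrier M" "x \<in> carrier X" for m x using l(1)[OF that] .
 show c: "tensor_map B M X Y f t \<in> carrier (tensor B M Y)" if "t \<in> carrier (tensor B M X)" for t
  using l(2)[OF that] .
 show add: "tensor_map B M X Y f (s \<oplus>\<^bsub>tensor B M X\<^esub> t) =
    tensor_map B M X Y f s \<oplus>\<^bsub>tensor B M Y\<^esub> tensor_map B M X Y f t"
  if "s \<in> carrier (tensor B M X)" "t \<in> carrier (tensor B M X)" for s t using l(3)[OF that] .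
 have smult: "tensor_map B M X Y f (a \<odot>\<^bsub>tensor B M X\<^esub> t) = a \<odot>\<^bsub>tensor B M Y\<^esub> tensor_map B M X Y f t"
  if a: "a \<in> carrier A" and t: "t \<in> carrier (tensor B M X)" for a t using t
 proof (induction t rule: X.tensor_induct)
  case (pure m x)
  then show ?case using a mhom_closed[OF f] by (simp add: X.pt_smult Y.pt_smult pt X.smult_closed)
 next
  case zero
  have "tensor_map B M X Y f \<zero>\<^bsub>tensor B M X\<^esub> \<oplus>\<^bsub>tensor B M Y\<^esub> tensor_map B M X Y f \<zero>\<^bsub>tensor B M X\<^esub> =
    tensor_map B M X Y f \<zero>\<^bsub>tensor B M X\<^esub>"
   using add[of "\<zero>\<^bsub>tensor B M X\<^esub>" "\<zero>\<^bsub>tensor B M X\<^esub>"] by simp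
  then have "tensor_map B M X Y f \<zero>\<^bsub>tensor B M X\<^esub> = \<zero>\<^bsub>tensor B M Y\<^esub>"
   using c[of "\<zero>\<^bsub>tensor B M X\<^esub>"] by simp
  then show ?case using a by simp
 next
  case (diff s t)
  have e: "g (s \<ominus>\<^bsub>tensor B M X\<^esub> t) \<oplus>\<^bsub>tensor B M Y\<^esub> g t = g s"
   if "!!s t. [|s \<in> carrier (tensor B M X); t \<in> carrier (tensor B M X)|] ==>
    g (s \<oplus>\<^bsub>tensor B M X\<^esub> t) = g s \<oplus>\<^bsub>tensor B M Y\<^esub> g t" for g
   using that[of "s \<ominus>\<^bsub>tensor B M X\<^esub> t" t] diff(1,2) MX.diff_add_cancel by simp
  let ?u = "s \<ominus>\<^bsub>tensor B M X\<^esub> t"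
  have 1: "tensor_map B M X Y f (a \<odot>\<^bsub>tensor B M X\<^esub> ?u) \<oplus>\<^bsub>tensor B M Y\<^esub>
    tensor_map B M X Y f (a \<odot>\<^bsub>tensor B M X\<^esub> t) = tensor_map B M X Y f (a \<odot>\<^bsub>tensor B M X\<^esub> s)"
   by (rule e) (use a in \<open>simp add: MX.smult_r_distr add MX.smult_closed\<close>)
  have 2: "a \<odot>\<^bsub>tensor B M Y\<^esub> tensor_map B M X Y f ?u \<oplus>\<^bsub>tensor B M Y\<^esub>
    a \<odot>\<^bsub>tensor B M Y\<^esub> tensor_map B M X Y f t = a \<odot>\<^bsub>tensor B M Y\<^esub> tensor_map B M X Y f s"
   by (rule e) (use a in \<open>simp add: MY.smult_r_distr add c\<close>)
  show ?case using 1 2 diff a c MX.smult_closed MY.smult_closed by (metis MX.minus_closed MY.X.add.right_cancel)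
 qed
 show "tensor_map B M X Y f \<in> mod_hom A (tensor B M X) (tensor B M Y)"
  by (rule mod_homI) (use c add smult in \<open>auto simp: tensor_map_def tensor_lift_def\<close>)
qed

text \<open>
 A homomorphism from the syzygy of \<open>X\<close> to \<open>M\<^sup>+\<close> is a character of \<open>M \<otimes> F\<^sub>1\<close> vanishing on the image of \<open>M \<otimes> F\<^sub>2\<close>.
 As \<open>Tor\<^sub>1 (M, X) = 0\<close>, it depends only on the image in \<open>M \<otimes> F\<^sub>0\<close> and extends to a character of \<open>M \<otimes> F\<^sub>0\<close>, that
 is, to a homomorphism \<open>F\<^sub>0 \<rightarrow> M\<^sup>+\<close>.
\<close>

lemma Tor1_ext_zero:
 fixes M :: "('a, 'b, 'm) bimodule"
 assumes M: "bimodule A B M" and X: "left_module B X" and tor: "trivial_group (Tor1 B M X)"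
 shows "ext_zero B X (char_module M)"
 unfolding ext_zero_def
proof
 interpret M: bimodule A B M by fact
 let ?F0 = "res0 B X" and ?F1 = "res1 B X" and ?F2 = "res2 B X" and ?K = "syzygy B X"
 let ?d1 = "res_d1 B X" and ?d2 = "res_d2 B X"
 note F0 = lmod_res0[OF X] and F1 = lmod_res1[OF X] and F2 = lmod_res2[OF X]
 note d1 = mhom_res_d1[OF X] and d2 = mhom_res_d2[OF X]
 have tc: "tensor_context A B M Z" if "left_module B Z" for Z :: "('b, 'z) module"
  using M that by (rule tensor_context.intro)
 interpret T0: tensor_context A B M ?F0 by (intro tensor_context.intro M F0)
 interpret T1: tensor_context A B M ?F1 by (intro tensor_context.intro M F1)
 interpret T2: tensor_context A B M ?F2 by (intro tensor_context.intro M F2)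
 note t0 = T0.tensor_context_axioms and t1 = T1.tensor_context_axioms and t2 = T2.tensor_context_axioms
 interpret M0: left_module A T0.MX by (rule T0.lmod_MX)
 interpret M1: left_module A T1.MX by (rule T1.lmod_MX)
 let ?D1 = "tensor_map B M ?F1 ?F0 ?d1" and ?D2 = "tensor_map B M ?F2 ?F1 ?d2"
 note D1 = mhom_tensor_map[OF t1 t0 d1] and D2 = mhom_tensor_map[OF t2 t1 d2]
 have exact: "\<exists>u\<in>carrier T2.MX. t = ?D2 u" if t: "t \<in> carrier T1.MX" "?D1 t = \<zero>\<^bsub>T0.MX\<^esub>" for t
 proof -
  let ?G = "(add_monoid T1.MX)\<lparr>carrier := {t \<in> carrier T1.MX. ?D1 t = \<zero>\<^bsub>T0.MX\<^esub>}\<rparr>"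
  let ?N = "?D2 ` carrier T2.MX"
  have c: "carrier (?G Mod ?N) = {?N}" using tor by (simp add: Tor1_def trivial_group_def FactGroup_def)
  moreover have "?N #>\<^bsub>?G\<^esub> t \<in> carrier (?G Mod ?N)"
   using t by (auto simp: FactGroup_def RCOSETS_def)
  ultimately have "?N #>\<^bsub>?G\<^esub> t = ?N" by blast
  moreover have "t \<in> ?N #>\<^bsub>?G\<^esub> t"
  proof -
   have "\<zero>\<^bsub>T1.MX\<^esub> \<in> ?N"
    using submodule_image[OF T2.lmod_MX T1.lmod_MX D2] by (simp add: submodule_of_def)
   moreover have "t = \<zero>\<^bsub>T1.MX\<^esub> \<otimes>\<^bsub>?G\<^esub> t" using t(1) by (simp del: M1.X.add.r_cancel_one')
   ultimately show ?thesis unfolding r_coset_def by blast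
  qed
  ultimately show ?thesis by blast
 qed
 fix f assume f: "f \<in> mod_hom B ?K (char_module M)"
 define g where "g = compose (carrier ?F1) f ?d1"
 have g: "g \<in> mod_hom B ?F1 (char_module M)"
  unfolding g_def by (rule mhom_compose[OF F1 mhom_res_d1'[OF X] f])
 obtain \<xi> where \<xi>: "\<xi> \<in> characters T1.MX"
   "!!m x. [|m \<in> carrier M; x \<in> carrier ?F1|] ==> \<xi> (T1.pt m x) = g x m"
  using T1.pairing_character[OF g] by blast
 have zero: "f \<zero>\<^bsub>?K\<^esub> = (\<lambda>m\<in>carrier M. 0)"
  using mhom_zero[OF lmod_syzygy[OF X] M.lmod_char_module f] by simp
 have "(\<lambda>t\<in>carrier T2.MX. \<xi> (?D2 t)) u = (\<lambda>t\<in>carrier T2.MX. 0) u" if u: "u \<in> carrier T2.MX" for u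
 proof (rule T2.tensor_characters_eq[OF _ _ _ u])
  interpret M2: left_module A T2.MX by (rule T2.lmod_MX)
  show "(\<lambda>t\<in>carrier T2.MX. \<xi> (?D2 t)) \<in> characters T2.MX"
   using character_closed[OF \<xi>(1) mhom_closed[OF D2]]
   by (intro characterI) (auto simp: mhom_add[OF D2] character_add[OF \<xi>(1)] mhom_closed[OF D2])
  show "(\<lambda>t\<in>carrier T2.MX. 0) \<in> characters T2.MX" by (intro characterI) auto
  fix m x assume mx: "m \<in> carrier M" "x \<in> carrier ?F2"
  have "f (?d1 (?d2 x)) = (\<lambda>m\<in>carrier M. 0)"
   using zero res_d1_d2[OF X mx(2)] by (simp add: syzygy_def del: free_module_simps)
  then show "(\<lambda>t\<in>carrier T2.MX. \<xi> (?D2 t)) (T2.pt m x) = (\<lambda>t\<in>carrier T2.MX. 0) (T2.pt m x)"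
   using mx \<xi>(2)[of m "?d2 x"] mhom_closed[OF d2 mx(2)]
   by (simp add: tensor_map_pt[OF t2 t1 d2] g_def compose_def)
 qed
 then have \<xi>2: "\<xi> (?D2 u) = 0" if "u \<in> carrier T2.MX" for u using that by simp
 have \<xi>wd: "\<xi> s = \<xi> t" if st: "s \<in> carrier T1.MX" "t \<in> carrier T1.MX" "?D1 s = ?D1 t" for s t
 proof -
  have "?D1 (s \<ominus>\<^bsub>T1.MX\<^esub> t) = \<zero>\<^bsub>T0.MX\<^esub>"
   using st mhom_diff[OF T1.lmod_MX T0.lmod_MX D1 st(1,2)] mhom_closed[OF D1] by (simp add: M0.diff_self)
  then have "\<xi> (s \<ominus>\<^bsub>T1.MX\<^esub> t) = 0" using exact[of "s \<ominus>\<^bsub>T1.MX\<^esub> t"] st \<xi>2 by auto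
  then have "frac (\<xi> s - \<xi> t) = 0" using character_diff[OF T1.abelian_group_MX \<xi>(1) st(1,2)] by simp
  then have "frac (\<xi> s) = frac (\<xi> t)" by (simp add: frac_eq_iff)
  then show ?thesis using character_frac[OF \<xi>(1)] st by simp
 qed
 define \<psi> where "\<psi> = (\<lambda>y. \<xi> (inv_into (carrier T1.MX) ?D1 y))"
 have \<psi>: "\<psi> (?D1 t) = \<xi> t" if "t \<in> carrier T1.MX" for t
  unfolding \<psi>_def using that by (intro \<xi>wd) (simp_all add: inv_into_into f_inv_into_f)
 have "\<exists>\<chi>\<in>characters T0.MX. \<forall>y\<in>?D1 ` carrier T1.MX. \<chi> y = \<psi> y"
 proof (rule M0.X.character_extend)
  show "subgroup (?D1 ` carrier T1.MX) (add_monoid T0.MX)"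
   by (intro subgroup_submodule[OF T0.lmod_MX] submodule_image T0.lmod_MX T1.lmod_MX D1)
 next
  fix y assume "y \<in> ?D1 ` carrier T1.MX"
  then show "\<psi> y \<in> {0..<1}" using \<psi> character_closed[OF \<xi>(1)] by auto
 next
  fix y z assume "y \<in> ?D1 ` carrier T1.MX" "z \<in> ?D1 ` carrier T1.MX"
  then obtain s t where "s \<in> carrier T1.MX" "y = ?D1 s" "t \<in> carrier T1.MX" "z = ?D1 t" by blast
  then show "\<psi> (y \<oplus>\<^bsub>T0.MX\<^esub> z) = frac (\<psi> y + \<psi> z)"
   using \<psi>[of "s \<oplus>\<^bsub>T1.MX\<^esub> t"] mhom_add[OF D1, of s t] \<psi> character_add[OF \<xi>(1), of s t] by simp
 qed
 then obtain \<chi> where \<chi>: "\<chi> \<in> characters T0.MX" "!!t. t \<in> carrier T1.MX ==> \<chi> (?D1 t) = \<xi> t"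
  using \<psi> by auto
 let ?e = "\<lambda>x\<in>carrier ?F0. \<lambda>m\<in>carrier M. \<chi> (T0.pt m x)"
 have "?e k = f k" if k: "k \<in> carrier ?K" for k
 proof -
  note b = res_d1_basis[OF X k]
  have "\<chi> (T0.pt m k) = f k m" if m: "m \<in> carrier M" for m
   using \<chi>(2)[of "T1.pt m (free_basis B k)"] tensor_map_pt[OF t1 t0 d1 m b(1)] b \<xi>(2)[OF m b(1)] m
   by (simp add: g_def compose_def del: free_module_simps)
  moreover have "f k \<in> characters M" using mhom_closed[OF f k] by simp
  ultimately show ?thesis
   using syzygyD(1)[OF k] by (intro trans[OF _ character_restrict[of "f k" M]]) (auto intro!: restrict_ext)
 qed
 then show "\<exists>g\<in>mod_hom B ?F0 (char_module M). \<forall>k\<in>carrier ?K. g k = f k"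
  using T0.character_pairing[OF \<chi>(1)] by blast
qed

section \<open>Modules over the triangular matrix ring\<close>

subsection \<open>Corner modules\<close>

text \<open>
 The functor \<open>N \<mapsto> e N\<close> for an idempotent \<open>e = \<epsilon> 1\<close>, where \<open>\<epsilon>\<close> is a ring map that need not preserve the unit.
 Both components of a module over the triangular ring have this form.
\<close>

definition corner :: "('r => 't) => ('r, 'p) ring_scheme => ('t, 'x) module => ('r, 'x) module"
 where "corner \<epsilon> R N = \<lparr>carrier = (\<lambda>x. \<epsilon> \<one>\<^bsub>R\<^esub> \<odot>\<^bsub>N\<^esub> x) ` carrier N, monoid.mult = monoid.mult N, one = one N,
  ring.zero = ring.zero N, ring.add = ring.add N, smult = (\<lambda>a x. \<epsilon> a \<odot>\<^bsub>N\<^esub> x)\<rparr>"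

lemma corner_simps:
 "carrier (corner \<epsilon> R N) = (\<lambda>x. \<epsilon> \<one>\<^bsub>R\<^esub> \<odot>\<^bsub>N\<^esub> x) ` carrier N" "\<zero>\<^bsub>corner \<epsilon> R N\<^esub> = \<zero>\<^bsub>N\<^esub>"
 "x \<oplus>\<^bsub>corner \<epsilon> R N\<^esub> y = x \<oplus>\<^bsub>N\<^esub> y" "a \<odot>\<^bsub>corner \<epsilon> R N\<^esub> x = \<epsilon> a \<odot>\<^bsub>N\<^esub> x"
 by (simp_all add: corner_def)

locale corner_map = R: ring R + S: ring S for R :: "('r, 'p) ring_scheme" and S :: "('s, 'q) ring_scheme" +
 fixes \<epsilon>
 assumes closed: "a \<in> carrier R ==> \<epsilon> a \<in> carrier S"
  and add: "[|a \<in> carrier R; b \<in> carrier R|] ==> \<epsilon> (a \<oplus>\<^bsub>R\<^esub> b) = \<epsilon> a \<oplus>\<^bsub>S\<^esub> \<epsilon> b"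
  and mult: "[|a \<in> carrier R; b \<in> carrier R|] ==> \<epsilon> (a \<otimes>\<^bsub>R\<^esub> b) = \<epsilon> a \<otimes>\<^bsub>S\<^esub> \<epsilon> b"
begin

abbreviation "C \<equiv> corner \<epsilon> R"

lemma corner_smult:
 assumes "left_module S N" "a \<in> carrier R" "b \<in> carrier R" "x \<in> carrier N"
 shows "\<epsilon> a \<odot>\<^bsub>N\<^esub> (\<epsilon> b \<odot>\<^bsub>N\<^esub> x) = \<epsilon> (a \<otimes>\<^bsub>R\<^esub> b) \<odot>\<^bsub>N\<^esub> x"
 using left_module.smult_assoc[OF assms(1) closed closed] assms mult by simp

lemma corner_iff:
 assumes N: "left_module S N"
 shows "x \<in> carrier (C N) \<longleftrightarrow> x \<in> carrier N \<and> \<epsilon> \<one>\<^bsub>R\<^esub> \<odot>\<^bsub>N\<^esub> x = x"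
proof -
 have "\<epsilon> \<one>\<^bsub>R\<^esub> \<odot>\<^bsub>N\<^esub> y \<in> carrier N" "\<epsilon> \<one>\<^bsub>R\<^esub> \<odot>\<^bsub>N\<^esub> (\<epsilon> \<one>\<^bsub>R\<^esub> \<odot>\<^bsub>N\<^esub> y) = \<epsilon> \<one>\<^bsub>R\<^esub> \<odot>\<^bsub>N\<^esub> y" if "y \<in> carrier N" for y
  using that corner_smult[OF N] left_module.smult_closed[OF N] closed by simp_all
 then show ?thesis unfolding corner_simps image_iff by metis
qed

lemma corner_in: "[|left_module S N; a \<in> carrier R; x \<in> carrier N|] ==> \<epsilon> a \<odot>\<^bsub>N\<^esub> x \<in> carrier (C N)"
 unfolding corner_iff using left_module.smult_closed[of S N] closed by (simp add: corner_smult)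

lemma lmod_corner:
 assumes N: "left_module S N" shows "left_module R (C N)"
proof (rule left_moduleI)
 interpret N: left_module S N by fact
 fix x y assume xy: "x \<in> carrier (C N)" "y \<in> carrier (C N)"
 then show "x \<oplus>\<^bsub>C N\<^esub> y \<in> carrier (C N)"
  unfolding corner_iff[OF N] by (simp add: corner_simps N.smult_r_distr closed)
 show "x \<oplus>\<^bsub>C N\<^esub> y = y \<oplus>\<^bsub>C N\<^esub> x" using xy unfolding corner_iff[OF N] by (simp add: corner_simps N.a_comm)
 show "(x \<oplus>\<^bsub>C N\<^esub> y) \<oplus>\<^bsub>C N\<^esub> z = x \<oplus>\<^bsub>C N\<^esub> (y \<oplus>\<^bsub>C N\<^esub> z)" if "z \<in> carrier (C N)" for z
  using xy that unfolding corner_iff[OF N] by (simp add: corner_simps N.a_assoc)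
 show "a \<odot>\<^bsub>C N\<^esub> (x \<oplus>\<^bsub>C N\<^esub> y) = a \<odot>\<^bsub>C N\<^esub> x \<oplus>\<^bsub>C N\<^esub> a \<odot>\<^bsub>C N\<^esub> y" if "a \<in> carrier R" for a
  using xy that unfolding corner_iff[OF N] by (simp add: corner_simps(2-4) N.smult_r_distr closed)
next
 interpret N: left_module S N by fact
 show "\<zero>\<^bsub>C N\<^esub> \<in> carrier (C N)" unfolding corner_iff[OF N] by (simp add: corner_simps closed)
 fix x assume x': "x \<in> carrier (C N)"
 then have x: "x \<in> carrier N" "\<epsilon> \<one>\<^bsub>R\<^esub> \<odot>\<^bsub>N\<^esub> x = x" unfolding corner_iff[OF N] by blast+
 show "\<zero>\<^bsub>C N\<^esub> \<oplus>\<^bsub>C N\<^esub> x = x" "\<one>\<^bsub>R\<^esub> \<odot>\<^bsub>C N\<^esub> x = x" using x by (simp_all add: corner_simps)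
 have d: "\<epsilon> (a \<oplus>\<^bsub>R\<^esub> b) \<odot>\<^bsub>N\<^esub> x = \<epsilon> a \<odot>\<^bsub>N\<^esub> x \<oplus>\<^bsub>N\<^esub> \<epsilon> b \<odot>\<^bsub>N\<^esub> x" if "a \<in> carrier R" "b \<in> carrier R" for a b
  using that x(1) by (simp add: add closed N.smult_l_distr)
 have z: "\<epsilon> \<zero>\<^bsub>R\<^esub> \<odot>\<^bsub>N\<^esub> x = \<zero>\<^bsub>N\<^esub>"
  using d[of "\<zero>\<^bsub>R\<^esub>" "\<zero>\<^bsub>R\<^esub>"] N.smult_closed[OF closed x(1), of "\<zero>\<^bsub>R\<^esub>"] by simp
 show "\<exists>y\<in>carrier (C N). y \<oplus>\<^bsub>C N\<^esub> x = \<zero>\<^bsub>C N\<^esub>"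
 proof (rule bexI)
  show "\<epsilon> (\<ominus>\<^bsub>R\<^esub> \<one>\<^bsub>R\<^esub>) \<odot>\<^bsub>N\<^esub> x \<oplus>\<^bsub>C N\<^esub> x = \<zero>\<^bsub>C N\<^esub>"
   unfolding corner_simps(2,3) using d[of "\<ominus>\<^bsub>R\<^esub> \<one>\<^bsub>R\<^esub>" "\<one>\<^bsub>R\<^esub>"] z x(2) by (simp add: R.l_neg)
 qed (intro corner_in[OF N _ x(1)] R.a_inv_closed R.one_closed)
 fix a b assume a: "a \<in> carrier R"
 show "a \<odot>\<^bsub>C N\<^esub> x \<in> carrier (C N)" using corner_in[OF N a x(1)] by (simp only: corner_simps(4))
 assume b: "b \<in> carrier R"
 show "(a \<oplus>\<^bsub>R\<^esub> b) \<odot>\<^bsub>C N\<^esub> x = a \<odot>\<^bsub>C N\<^esub> x \<oplus>\<^bsub>C N\<^esub> b \<odot>\<^bsub>C N\<^esub> x"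
  using d[OF a b] by (simp only: corner_simps)
 show "(a \<otimes>\<^bsub>R\<^esub> b) \<odot>\<^bsub>C N\<^esub> x = a \<odot>\<^bsub>C N\<^esub> (b \<odot>\<^bsub>C N\<^esub> x)"
  using corner_smult[OF N a b x(1)] by (simp add: corner_simps)
qed (rule R.ring_axioms)

lemma hom_corner:
 assumes N: "left_module S N" and f: "f \<in> mod_hom S N V"
 shows "restrict f (carrier (C N)) \<in> mod_hom R (C N) (C V)"
proof -
 have "(\<lambda>x\<in>carrier (C N). f x) \<in> mod_hom R (C N) (C V)"
 proof (rule mhom_restrictI[OF lmod_corner[OF N]])
  fix x assume "x \<in> carrier (C N)"
  then have x: "x \<in> carrier N" "\<epsilon> \<one>\<^bsub>R\<^esub> \<odot>\<^bsub>N\<^esub> x = x" unfolding corner_iff[OF N] by blast+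
  have "f x = \<epsilon> \<one>\<^bsub>R\<^esub> \<odot>\<^bsub>V\<^esub> f x" using mhom_smult[OF f closed[OF R.one_closed] x(1)] x(2) by simp
  then show "f x \<in> carrier (C V)" unfolding corner_simps(1) by (rule image_eqI[OF _ mhom_closed[OF f x(1)]])
  show "f (x \<oplus>\<^bsub>C N\<^esub> y) = f x \<oplus>\<^bsub>C V\<^esub> f y" if y: "y \<in> carrier (C N)" for y
   using y mhom_add[OF f x(1)] unfolding corner_iff[OF N] corner_simps(3) by blast
  show "f (a \<odot>\<^bsub>C N\<^esub> x) = a \<odot>\<^bsub>C V\<^esub> f x" if a: "a \<in> carrier R" for a
   unfolding corner_simps(4) by (rule mhom_smult[OF f closed[OF a] x(1)])
 qed
 then show ?thesis by simp
qed

lemma short_exact_corner: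
 assumes X: "left_module S X" and Y: "left_module S Y" and Z: "left_module S Z"
  and se: "short_exact S X Y Z i p"
 shows "short_exact R (C X) (C Y) (C Z) (restrict i (carrier (C X))) (restrict p (carrier (C Y)))"
proof -
 note se' = short_exactD[OF se]
 note CX = corner_iff[OF X] and CY = corner_iff[OF Y] and CZ = corner_iff[OF Z]
 have ic: "i x \<in> carrier (C Y)" if "x \<in> carrier (C X)" for x
  using mhom_closed[OF hom_corner[OF X se'(1)] that] that by simp
 show ?thesis
 proof (rule short_exactI[OF lmod_corner[OF X] lmod_corner[OF Y] hom_corner[OF X se'(1)] hom_corner[OF Y se'(2)]])
  fix x assume x: "x \<in> carrier (C X)"
  then have xX: "x \<in> carrier X" using CX by blast
  show "x = \<zero>\<^bsub>C X\<^esub>" if "restrict i (carrier (C X)) x = \<zero>\<^bsub>C Y\<^esub>"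
   using that x inj_mod_hom_zero[OF X Y se'(1,3) xX] by (simp add: corner_simps(2))
  show "restrict p (carrier (C Y)) (restrict i (carrier (C X)) x) = \<zero>\<^bsub>C Z\<^esub>"
   using x ic[OF x] se'(4)[OF xX] by (simp add: corner_simps(2))
 next
  fix y assume y: "y \<in> carrier (C Y)" "restrict p (carrier (C Y)) y = \<zero>\<^bsub>C Z\<^esub>"
  then have yY: "y \<in> carrier Y" "\<epsilon> \<one>\<^bsub>R\<^esub> \<odot>\<^bsub>Y\<^esub> y = y" "p y = \<zero>\<^bsub>Z\<^esub>" using CY by (simp_all add: corner_simps(2))
  obtain x where x: "x \<in> carrier X" "y = i x" using se'(5)[OF yY(1,3)] by blast
  have "y = i (\<epsilon> \<one>\<^bsub>R\<^esub> \<odot>\<^bsub>X\<^esub> x)" using mhom_smult[OF se'(1) closed[OF R.one_closed] x(1)] x(2) yY(2) by simp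
  then show "\<exists>x\<in>carrier (C X). y = restrict i (carrier (C X)) x" using corner_in[OF X R.one_closed x(1)] by (metis restrict_apply')
 next
  fix z assume z: "z \<in> carrier (C Z)"
  then obtain y where y: "y \<in> carrier Y" "z = p y" using se'(6) CZ by blast
  have "z = p (\<epsilon> \<one>\<^bsub>R\<^esub> \<odot>\<^bsub>Y\<^esub> y)" using mhom_smult[OF se'(2) closed[OF R.one_closed] y(1)] y(2) z CZ by simp
  then show "\<exists>y\<in>carrier (C Y). z = restrict p (carrier (C Y)) y" using corner_in[OF Y R.one_closed y(1)] by (metis restrict_apply')
 qed
qed

end

locale tri = bimodule A B M
 for A :: "'a ring" and B :: "'b ring" and M :: "('a, 'b, 'm) bimodule"
begin

abbreviation "T \<equiv> tri_ring A B M"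
abbreviation "E1 a \<equiv> (a, \<zero>\<^bsub>M\<^esub>, \<zero>\<^bsub>B\<^esub>)"
abbreviation "EM m \<equiv> (\<zero>\<^bsub>A\<^esub>, m, \<zero>\<^bsub>B\<^esub>)"
abbreviation "E2 b \<equiv> (\<zero>\<^bsub>A\<^esub>, \<zero>\<^bsub>M\<^esub>, b)"
abbreviation "Fst \<equiv> tri_fst A B M"
abbreviation "Snd \<equiv> tri_snd A B M"
abbreviation "p1 N x \<equiv> E1 \<one>\<^bsub>A\<^esub> \<odot>\<^bsub>N\<^esub> x"
abbreviation "p2 N x \<equiv> E2 \<one>\<^bsub>B\<^esub> \<odot>\<^bsub>N\<^esub> x"

lemma rsmult_zero_left [simp]: "b \<in> carrier B ==> rsmult M \<zero>\<^bsub>M\<^esub> b = \<zero>\<^bsub>M\<^esub>"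
 using rsmult_l_distr[of "\<zero>\<^bsub>M\<^esub>" "\<zero>\<^bsub>M\<^esub>" b] rsmult_closed[of "\<zero>\<^bsub>M\<^esub>" b] by simp

lemma rsmult_zero_right [simp]: "m \<in> carrier M ==> rsmult M m \<zero>\<^bsub>B\<^esub> = \<zero>\<^bsub>M\<^esub>"
 using rsmult_r_distr[of m "\<zero>\<^bsub>B\<^esub>" "\<zero>\<^bsub>B\<^esub>"] rsmult_closed[of m "\<zero>\<^bsub>B\<^esub>"] by simp

lemma T_simps [simp]:
 "carrier T = carrier A \<times> carrier M \<times> carrier B"
 "(a, m, b) \<otimes>\<^bsub>T\<^esub> (a', m', b') =
  (a \<otimes>\<^bsub>A\<^esub> a', a \<odot>\<^bsub>M\<^esub> m' \<oplus>\<^bsub>M\<^esub> rsmult M m b', b \<otimes>\<^bsub>B\<^esub> b')"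
 "\<one>\<^bsub>T\<^esub> = (\<one>\<^bsub>A\<^esub>, \<zero>\<^bsub>M\<^esub>, \<one>\<^bsub>B\<^esub>)" "\<zero>\<^bsub>T\<^esub> = (\<zero>\<^bsub>A\<^esub>, \<zero>\<^bsub>M\<^esub>, \<zero>\<^bsub>B\<^esub>)"
 "(a, m, b) \<oplus>\<^bsub>T\<^esub> (a', m', b') = (a \<oplus>\<^bsub>A\<^esub> a', m \<oplus>\<^bsub>M\<^esub> m', b \<oplus>\<^bsub>B\<^esub> b')"
 by (simp_all add: tri_ring_def)

lemma ring_T: "ring T"
proof (rule ringI)
 note [simp] = smult_closed rsmult_closed
 show "abelian_group T"
 proof (rule abelian_groupI)
  fix x assume x: "x \<in> carrier T"
  show "\<exists>y\<in>carrier T. y \<oplus>\<^bsub>T\<^esub> x = \<zero>\<^bsub>T\<^esub>"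
   using x by (cases x, intro bexI[of _ "(\<ominus>\<^bsub>A\<^esub> fst x, \<ominus>\<^bsub>M\<^esub> fst (snd x), \<ominus>\<^bsub>B\<^esub> snd (snd x))"])
    (auto simp: R.l_neg X.l_neg B.l_neg)
 qed (auto simp: R.a_ac X.a_ac B.a_ac)
 show "Group.monoid T" by (rule Group.monoidI)
   (auto simp: R.m_assoc B.m_assoc smult_assoc rsmult_assoc smult_r_distr
    rsmult_l_distr smult_rsmult X.a_assoc smult_one rsmult_one)
 show "(x \<oplus>\<^bsub>T\<^esub> y) \<otimes>\<^bsub>T\<^esub> z = x \<otimes>\<^bsub>T\<^esub> z \<oplus>\<^bsub>T\<^esub> y \<otimes>\<^bsub>T\<^esub> z"
  if "x \<in> carrier T" "y \<in> carrier T" "z \<in> carrier T" for x y z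
  using that by (auto simp: R.l_distr B.l_distr smult_l_distr rsmult_l_distr X.a_ac)
 show "z \<otimes>\<^bsub>T\<^esub> (x \<oplus>\<^bsub>T\<^esub> y) = z \<otimes>\<^bsub>T\<^esub> x \<oplus>\<^bsub>T\<^esub> z \<otimes>\<^bsub>T\<^esub> y"
  if "x \<in> carrier T" "y \<in> carrier T" "z \<in> carrier T" for x y z
  using that by (auto simp: R.r_distr B.r_distr smult_r_distr rsmult_r_distr X.a_ac)
qed

subsection \<open>Peirce components\<close>

lemma Fst_simps [simp]:
 "carrier (Fst N) = p1 N ` carrier N" "\<zero>\<^bsub>Fst N\<^esub> = \<zero>\<^bsub>N\<^esub>" "x \<oplus>\<^bsub>Fst N\<^esub> y = x \<oplus>\<^bsub>N\<^esub> y"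
 "a \<odot>\<^bsub>Fst N\<^esub> x = E1 a \<odot>\<^bsub>N\<^esub> x" by (simp_all add: tri_fst_def)

lemma Snd_simps [simp]:
 "carrier (Snd N) = p2 N ` carrier N" "\<zero>\<^bsub>Snd N\<^esub> = \<zero>\<^bsub>N\<^esub>" "x \<oplus>\<^bsub>Snd N\<^esub> y = x \<oplus>\<^bsub>N\<^esub> y"
 "b \<odot>\<^bsub>Snd N\<^esub> x = E2 b \<odot>\<^bsub>N\<^esub> x" by (simp_all add: tri_snd_def)

context
 fixes N :: "('a \<times> 'm \<times> 'b, 'x) module"
 assumes N: "left_module T N"
begin

interpretation N: left_module T N by (rule N)

lemma T_smult_smult:
 assumes "a \<in> carrier A" "m \<in> carrier M" "b \<in> carrier B" "a' \<in> carrier A" "m' \<in> carrier M"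
  "b' \<in> carrier B" "x \<in> carrier N"
 shows "(a, m, b) \<odot>\<^bsub>N\<^esub> ((a', m', b') \<odot>\<^bsub>N\<^esub> x) =
  (a \<otimes>\<^bsub>A\<^esub> a', a \<odot>\<^bsub>M\<^esub> m' \<oplus>\<^bsub>M\<^esub> rsmult M m b', b \<otimes>\<^bsub>B\<^esub> b') \<odot>\<^bsub>N\<^esub> x"
 using N.smult_assoc[of "(a, m, b)" "(a', m', b')" x] assms by simp

lemma T_smult_closed:
 "[|a \<in> carrier A; m \<in> carrier M; b \<in> carrier B; x \<in> carrier N|] ==> (a, m, b) \<odot>\<^bsub>N\<^esub> x \<in> carrier N"
 by (rule N.smult_closed) auto

lemma T_smult_add:
 assumes "a \<in> carrier A" "m \<in> carrier M" "b \<in> carrier B" "a' \<in> carrier A" "m' \<in> carrier M"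
  "b' \<in> carrier B" "x \<in> carrier N"
 shows "(a \<oplus>\<^bsub>A\<^esub> a', m \<oplus>\<^bsub>M\<^esub> m', b \<oplus>\<^bsub>B\<^esub> b') \<odot>\<^bsub>N\<^esub> x =
  (a, m, b) \<odot>\<^bsub>N\<^esub> x \<oplus>\<^bsub>N\<^esub> (a', m', b') \<odot>\<^bsub>N\<^esub> x"
 using N.smult_l_distr[of "(a, m, b)" "(a', m', b')" x] assms by simp

lemma T_smult_distr:
 "[|a \<in> carrier A; m \<in> carrier M; b \<in> carrier B; x \<in> carrier N; y \<in> carrier N|] ==>
  (a, m, b) \<odot>\<^bsub>N\<^esub> (x \<oplus>\<^bsub>N\<^esub> y) = (a, m, b) \<odot>\<^bsub>N\<^esub> x \<oplus>\<^bsub>N\<^esub> (a, m, b) \<odot>\<^bsub>N\<^esub> y"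
 by (rule N.smult_r_distr) auto

lemma T_smult_zero: "[|a \<in> carrier A; m \<in> carrier M; b \<in> carrier B|] ==> (a, m, b) \<odot>\<^bsub>N\<^esub> \<zero>\<^bsub>N\<^esub> = \<zero>\<^bsub>N\<^esub>"
 by (rule N.smult_r_zero) auto

lemma T_zero_smult: "x \<in> carrier N ==> (\<zero>\<^bsub>A\<^esub>, \<zero>\<^bsub>M\<^esub>, \<zero>\<^bsub>B\<^esub>) \<odot>\<^bsub>N\<^esub> x = \<zero>\<^bsub>N\<^esub>"
 using N.smult_l_zero by simp

lemmas T_rules = T_smult_smult T_smult_closed T_smult_distr T_smult_zero T_zero_smult

lemma Fst_iff: "x \<in> carrier (Fst N) \<longleftrightarrow> x \<in> carrier N \<and> p1 N x = x"
 by (auto simp: T_smult_smult smult_one T_smult_closed image_iff) metis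

lemma Snd_iff: "x \<in> carrier (Snd N) \<longleftrightarrow> x \<in> carrier N \<and> p2 N x = x"
 by (auto simp: T_smult_smult T_smult_closed image_iff) metis

lemma p1_in: "x \<in> carrier N ==> p1 N x \<in> carrier (Fst N)" by simp

lemma p2_in: "x \<in> carrier N ==> p2 N x \<in> carrier (Snd N)" by simp

lemma peirce: "x \<in> carrier N ==> p1 N x \<oplus>\<^bsub>N\<^esub> p2 N x = x"
 using T_smult_add[of "\<one>\<^bsub>A\<^esub>" "\<zero>\<^bsub>M\<^esub>" "\<zero>\<^bsub>B\<^esub>" "\<zero>\<^bsub>A\<^esub>" "\<zero>\<^bsub>M\<^esub>" "\<one>\<^bsub>B\<^esub>" x] N.smult_one[of x] by simp

lemma FstD: "x \<in> carrier (Fst N) ==> x \<in> carrier N" "x \<in> carrier (Fst N) ==> p1 N x = x"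
 using Fst_iff by blast+

lemma SndD: "x \<in> carrier (Snd N) ==> x \<in> carrier N" "x \<in> carrier (Snd N) ==> p2 N x = x"
 using Snd_iff by blast+

lemma E1_in: "[|a \<in> carrier A; x \<in> carrier N|] ==> E1 a \<odot>\<^bsub>N\<^esub> x \<in> carrier (Fst N)"
 unfolding Fst_iff by (simp add: T_rules)

lemma EM_in: "[|m \<in> carrier M; x \<in> carrier N|] ==> EM m \<odot>\<^bsub>N\<^esub> x \<in> carrier (Fst N)"
 unfolding Fst_iff by (simp add: T_rules smult_one)

lemma T_smult_Fst:
 assumes "a \<in> carrier A" "m \<in> carrier M" "b \<in> carrier B" "x \<in> carrier (Fst N)"
 shows "(a, m, b) \<odot>\<^bsub>N\<^esub> x = E1 a \<odot>\<^bsub>N\<^esub> x"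
proof -
 have "(a, m, b) \<odot>\<^bsub>N\<^esub> p1 N x = E1 a \<odot>\<^bsub>N\<^esub> p1 N x"
  using assms FstD(1)[OF assms(4)] by (simp add: T_smult_smult del: Fst_simps)
 then show ?thesis using FstD(2)[OF assms(4)] by simp
qed

lemma T_smult_Snd:
 assumes "a \<in> carrier A" "m \<in> carrier M" "b \<in> carrier B" "x \<in> carrier (Snd N)"
 shows "(a, m, b) \<odot>\<^bsub>N\<^esub> x = EM m \<odot>\<^bsub>N\<^esub> x \<oplus>\<^bsub>N\<^esub> E2 b \<odot>\<^bsub>N\<^esub> x"
proof -
 have x: "x \<in> carrier N" "p2 N x = x" using SndD assms(4) by blast+
 have "(a, m, b) \<odot>\<^bsub>N\<^esub> p2 N x = (\<zero>\<^bsub>A\<^esub>, m, b) \<odot>\<^bsub>N\<^esub> p2 N x"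
  using assms(1-3) x(1) by (simp add: T_smult_smult rsmult_one)
 then show ?thesis
  using x T_smult_add[of "\<zero>\<^bsub>A\<^esub>" m "\<zero>\<^bsub>B\<^esub>" "\<zero>\<^bsub>A\<^esub>" "\<zero>\<^bsub>M\<^esub>" b x] assms by simp
qed

lemma p1_Snd: "x \<in> carrier (Snd N) ==> p1 N x = \<zero>\<^bsub>N\<^esub>"
 using T_smult_Snd[of "\<one>\<^bsub>A\<^esub>" "\<zero>\<^bsub>M\<^esub>" "\<zero>\<^bsub>B\<^esub>" x] SndD(1) T_zero_smult by simp

lemma p2_Fst: "x \<in> carrier (Fst N) ==> p2 N x = \<zero>\<^bsub>N\<^esub>"
 using T_smult_Fst[of "\<zero>\<^bsub>A\<^esub>" "\<zero>\<^bsub>M\<^esub>" "\<one>\<^bsub>B\<^esub>" x] FstD(1) T_zero_smult by simp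

lemma p1_smult:
 assumes "a \<in> carrier A" "m \<in> carrier M" "b \<in> carrier B" "x \<in> carrier N"
 shows "p1 N ((a, m, b) \<odot>\<^bsub>N\<^esub> x) = E1 a \<odot>\<^bsub>N\<^esub> p1 N x \<oplus>\<^bsub>N\<^esub> EM m \<odot>\<^bsub>N\<^esub> p2 N x"
 using assms T_smult_add[of a "\<zero>\<^bsub>M\<^esub>" "\<zero>\<^bsub>B\<^esub>" "\<zero>\<^bsub>A\<^esub>" m "\<zero>\<^bsub>B\<^esub>" x]
 by (simp add: T_smult_smult smult_one rsmult_one)

lemma p2_smult:
 assumes "a \<in> carrier A" "m \<in> carrier M" "b \<in> carrier B" "x \<in> carrier N"
 shows "p2 N ((a, m, b) \<odot>\<^bsub>N\<^esub> x) = E2 b \<odot>\<^bsub>N\<^esub> p2 N x"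
 using assms by (simp add: T_smult_smult)

end

lemma Fst_corner: "Fst V = corner E1 A V" and Snd_corner: "Snd V = corner E2 B V"
 by (simp_all add: tri_fst_def tri_snd_def corner_def)

sublocale fst: corner_map A T E1
 by (intro corner_map.intro corner_map_axioms.intro R.ring_axioms ring_T) simp_all

sublocale snd: corner_map B T E2
 by (intro corner_map.intro corner_map_axioms.intro B.ring_axioms ring_T) simp_all

lemmas lmod_Fst = fst.lmod_corner[folded Fst_corner]
 and lmod_Snd = snd.lmod_corner[folded Snd_corner]
 and T_hom_Fst = fst.hom_corner[folded Fst_corner]
 and T_hom_Snd = snd.hom_corner[folded Snd_corner]
 and short_exact_Fst = fst.short_exact_corner[folded Fst_corner]
 and short_exact_Snd = snd.short_exact_corner[folded Snd_corner]

subsection \<open>The modules \<open>(X, 0)\<close>, \<open>(0, Y)\<close> and \<open>(X, Y)\<close>\<close>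

text \<open>The modules \<open>X \<oplus> 0\<close> and \<open>0 \<oplus> Y\<close>, with the same elements as \<open>X\<close> and \<open>Y\<close>.\<close>

definition inc1 :: "('a, 'x) module => ('a \<times> 'm \<times> 'b, 'x) module"
 where "inc1 X = \<lparr>carrier = carrier X, monoid.mult = monoid.mult X, one = one X,
  ring.zero = ring.zero X, ring.add = ring.add X, smult = (\<lambda>(a, m, b) x. a \<odot>\<^bsub>X\<^esub> x)\<rparr>"

definition inc2 :: "('b, 'y) module => ('a \<times> 'm \<times> 'b, 'y) module"
 where "inc2 Y = \<lparr>carrier = carrier Y, monoid.mult = monoid.mult Y, one = one Y,
  ring.zero = ring.zero Y, ring.add = ring.add Y, smult = (\<lambda>(a, m, b) y. b \<odot>\<^bsub>Y\<^esub> y)\<rparr>"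

lemma inc1_simps [simp]:
 "carrier (inc1 X) = carrier X" "\<zero>\<^bsub>inc1 X\<^esub> = \<zero>\<^bsub>X\<^esub>" "x \<oplus>\<^bsub>inc1 X\<^esub> y = x \<oplus>\<^bsub>X\<^esub> y"
 "(a, m, b) \<odot>\<^bsub>inc1 X\<^esub> x = a \<odot>\<^bsub>X\<^esub> x" by (simp_all add: inc1_def)

lemma inc2_simps [simp]:
 "carrier (inc2 Y) = carrier Y" "\<zero>\<^bsub>inc2 Y\<^esub> = \<zero>\<^bsub>Y\<^esub>" "x \<oplus>\<^bsub>inc2 Y\<^esub> y = x \<oplus>\<^bsub>Y\<^esub> y"
 "(a, m, b) \<odot>\<^bsub>inc2 Y\<^esub> x = b \<odot>\<^bsub>Y\<^esub> x" by (simp_all add: inc2_def)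

lemma lmod_inc1:
 assumes "left_module A X" shows "left_module T (inc1 X)"
proof -
 interpret X: left_module A X by fact
 show ?thesis by (rule left_moduleI)
   (auto simp: ring_T X.a_ac X.smult_closed X.smult_l_distr X.smult_r_distr X.smult_assoc X.smult_one
    intro: bexI[of _ "\<ominus>\<^bsub>X\<^esub> x" for x] X.l_neg X.r_neg)
qed

lemma lmod_inc2:
 assumes "left_module B Y" shows "left_module T (inc2 Y)"
proof -
 interpret Y: left_module B Y by fact
 show ?thesis by (rule left_moduleI)
   (auto simp: ring_T Y.a_ac Y.smult_closed Y.smult_l_distr Y.smult_r_distr Y.smult_assoc Y.smult_one
    intro: bexI[of _ "\<ominus>\<^bsub>Y\<^esub> x" for x] Y.l_neg Y.r_neg)
qed

lemma Fst_inc1: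
 assumes "left_module A X" shows "Fst (inc1 X) = X"
proof -
 interpret X: left_module A X by fact
 have "(\<lambda>x. \<one>\<^bsub>A\<^esub> \<odot>\<^bsub>X\<^esub> x) ` carrier X = carrier X"
  using X.smult_one by force
 then show ?thesis by (simp add: tri_fst_def inc1_def)
qed

lemma Snd_inc2:
 assumes "left_module B Y" shows "Snd (inc2 Y) = Y"
proof -
 interpret Y: left_module B Y by fact
 have "(\<lambda>x. \<one>\<^bsub>B\<^esub> \<odot>\<^bsub>Y\<^esub> x) ` carrier Y = carrier Y"
  using Y.smult_one by force
 then show ?thesis by (simp add: tri_snd_def inc2_def)
qed

lemma Snd_inc1:
 assumes "left_module A X" shows "carrier (Snd (inc1 X)) = {\<zero>\<^bsub>X\<^esub>}"
proof -
 interpret X: left_module A X by fact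
 show ?thesis using X.zero_closed by force
qed

lemma Fst_inc2:
 assumes "left_module B Y" shows "carrier (Fst (inc2 Y)) = {\<zero>\<^bsub>Y\<^esub>}"
proof -
 interpret Y: left_module B Y by fact
 show ?thesis using Y.zero_closed by force
qed

lemma hom_inc1:
 assumes "left_module A X" "left_module T N"
 shows "mod_hom T (inc1 X) N = mod_hom A X (Fst N)"
proof (intro equalityI subsetI)
 interpret X: left_module A X by fact
 fix f assume f: "f \<in> mod_hom T (inc1 X) N"
 then show "f \<in> mod_hom A X (Fst N)" using T_hom_Fst[OF lmod_inc1[OF assms(1)] f] mhom_extensional[OF f]
  by (simp add: Fst_inc1[OF assms(1)] extensional_restrict del: Fst_simps)
next
 fix f assume f: "f \<in> mod_hom A X (Fst N)"
 have c: "f x \<in> carrier (Fst N)" if "x \<in> carrier X" for x using mhom_closed[OF f that] .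
 show "f \<in> mod_hom T (inc1 X) N"
 proof (rule mod_homI)
  show "f \<in> extensional (carrier (inc1 X))" using mhom_extensional[OF f] by simp
 next
  fix x assume "x \<in> carrier (inc1 X)"
  then show "f x \<in> carrier N" using FstD(1)[OF assms(2) c] by simp
 next
  fix x y assume "x \<in> carrier (inc1 X)" "y \<in> carrier (inc1 X)"
  then show "f (x \<oplus>\<^bsub>inc1 X\<^esub> y) = f x \<oplus>\<^bsub>N\<^esub> f y" using mhom_add[OF f] by simp
 next
  fix t x assume t: "t \<in> carrier T" and x: "x \<in> carrier (inc1 X)"
  obtain a m b where amb: "t = (a, m, b)" by (cases t)
  then have "f (t \<odot>\<^bsub>inc1 X\<^esub> x) = E1 a \<odot>\<^bsub>N\<^esub> f x" using t x mhom_smult[OF f] by simp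
  also have "\<dots> = t \<odot>\<^bsub>N\<^esub> f x"
   unfolding amb by (rule T_smult_Fst[OF assms(2), symmetric]) (use t x amb c in auto)
  finally show "f (t \<odot>\<^bsub>inc1 X\<^esub> x) = t \<odot>\<^bsub>N\<^esub> f x" .
 qed
qed

lemma hom_from_inc2:
 assumes "left_module B Y" "left_module T N" and f: "f \<in> mod_hom B Y (Snd N)"
  and z: "!!m y. [|m \<in> carrier M; y \<in> carrier Y|] ==> EM m \<odot>\<^bsub>N\<^esub> f y = \<zero>\<^bsub>N\<^esub>"
 shows "f \<in> mod_hom T (inc2 Y) N"
proof -
 interpret N: left_module T N by fact
 have c: "f x \<in> carrier (Snd N)" if "x \<in> carrier Y" for x using mhom_closed[OF f that] .
 show ?thesis
 proof (rule mod_homI)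
  show "f \<in> extensional (carrier (inc2 Y))" using mhom_extensional[OF f] by simp
 next
  fix x assume "x \<in> carrier (inc2 Y)"
  then show "f x \<in> carrier N" using SndD(1)[OF assms(2) c] by simp
 next
  fix x y assume "x \<in> carrier (inc2 Y)" "y \<in> carrier (inc2 Y)"
  then show "f (x \<oplus>\<^bsub>inc2 Y\<^esub> y) = f x \<oplus>\<^bsub>N\<^esub> f y" using mhom_add[OF f] by simp
 next
  fix t x assume t: "t \<in> carrier T" and x: "x \<in> carrier (inc2 Y)"
  obtain a m b where amb: "t = (a, m, b)" by (cases t)
  have bx: "E2 b \<odot>\<^bsub>N\<^esub> f x \<in> carrier N"
   using t x amb SndD(1)[OF assms(2) c] by (intro T_smult_closed[OF assms(2)]) auto
  have "f (t \<odot>\<^bsub>inc2 Y\<^esub> x) = E2 b \<odot>\<^bsub>N\<^esub> f x" using amb t x mhom_smult[OF f] by simp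
  also have "\<dots> = EM m \<odot>\<^bsub>N\<^esub> f x \<oplus>\<^bsub>N\<^esub> E2 b \<odot>\<^bsub>N\<^esub> f x" using z[of m x] t x amb bx by simp
  also have "\<dots> = t \<odot>\<^bsub>N\<^esub> f x"
   unfolding amb by (rule T_smult_Snd[OF assms(2), symmetric]) (use t x amb c in auto)
  finally show "f (t \<odot>\<^bsub>inc2 Y\<^esub> x) = t \<odot>\<^bsub>N\<^esub> f x" .
 qed
qed

lemma hom_into_inc2:
 assumes "left_module B Y" "left_module T N" and f: "f \<in> mod_hom B (Snd N) Y"
 shows "(\<lambda>x\<in>carrier N. f (p2 N x)) \<in> mod_hom T N (inc2 Y)"
proof (rule mhom_restrictI[OF assms(2)])
 fix x assume x: "x \<in> carrier N"
 show "f (p2 N x) \<in> carrier (inc2 Y)" using mhom_closed[OF f p2_in[OF assms(2) x]] by simp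
 fix y assume "y \<in> carrier N"
 then show "f (p2 N (x \<oplus>\<^bsub>N\<^esub> y)) = f (p2 N x) \<oplus>\<^bsub>inc2 Y\<^esub> f (p2 N y)"
  using mhom_add[OF f p2_in[OF assms(2) x] p2_in[OF assms(2)]] x by (simp add: T_smult_distr[OF assms(2)])
next
 fix t x assume t: "t \<in> carrier T" and x: "x \<in> carrier N"
 obtain a m b where "t = (a, m, b)" by (cases t)
 then show "f (p2 N (t \<odot>\<^bsub>N\<^esub> x)) = t \<odot>\<^bsub>inc2 Y\<^esub> f (p2 N x)"
  using t x mhom_smult[OF f _ p2_in[OF assms(2) x]] by (simp add: p2_smult[OF assms(2)])
qed

lemma hom_Snd_inc2:
 assumes "left_module B Y" "left_module T N" and f: "f \<in> mod_hom T N (inc2 Y)"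
 shows "restrict f (carrier (Snd N)) \<in> mod_hom B (Snd N) Y"
 using T_hom_Snd[OF assms(2) f] by (simp only: Snd_inc2[OF assms(1)])

definition tri_mod :: "('a, 'x) module => ('b, 'y) module => ('m => 'y => 'x) => ('a \<times> 'm \<times> 'b, 'x \<times> 'y) module"
 where "tri_mod X Y \<mu> = \<lparr>carrier = carrier X \<times> carrier Y, monoid.mult = undefined, one = undefined,
  ring.zero = (\<zero>\<^bsub>X\<^esub>, \<zero>\<^bsub>Y\<^esub>), ring.add = (\<lambda>u v. (fst u \<oplus>\<^bsub>X\<^esub> fst v, snd u \<oplus>\<^bsub>Y\<^esub> snd v)),
  smult = (\<lambda>(a, m, b) u. (a \<odot>\<^bsub>X\<^esub> fst u \<oplus>\<^bsub>X\<^esub> \<mu> m (snd u), b \<odot>\<^bsub>Y\<^esub> snd u))\<rparr>"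

lemma tri_mod_simps [simp]:
 "carrier (tri_mod X Y \<mu>) = carrier X \<times> carrier Y" "\<zero>\<^bsub>tri_mod X Y \<mu>\<^esub> = (\<zero>\<^bsub>X\<^esub>, \<zero>\<^bsub>Y\<^esub>)"
 "u \<oplus>\<^bsub>tri_mod X Y \<mu>\<^esub> v = (fst u \<oplus>\<^bsub>X\<^esub> fst v, snd u \<oplus>\<^bsub>Y\<^esub> snd v)"
 "(a, m, b) \<odot>\<^bsub>tri_mod X Y \<mu>\<^esub> u = (a \<odot>\<^bsub>X\<^esub> fst u \<oplus>\<^bsub>X\<^esub> \<mu> m (snd u), b \<odot>\<^bsub>Y\<^esub> snd u)"
 by (simp_all add: tri_mod_def)

text \<open>The data of a homomorphism \<open>M \<otimes> Y \<rightarrow> X\<close>, for which no tensor product has to be formed.\<close>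

definition bilinear :: "('a, 'x) module => ('b, 'y) module => ('m => 'y => 'x) => bool"
 where "bilinear X Y \<mu> \<longleftrightarrow> balanced B M Y X \<mu> \<and>
  (\<forall>a\<in>carrier A. \<forall>m\<in>carrier M. \<forall>y\<in>carrier Y. \<mu> (a \<odot>\<^bsub>M\<^esub> m) y = a \<odot>\<^bsub>X\<^esub> \<mu> m y)"

lemma bilinearI:
 assumes "!!m y. [|m \<in> carrier M; y \<in> carrier Y|] ==> \<mu> m y \<in> carrier X"
  "!!m n y. [|m \<in> carrier M; n \<in> carrier M; y \<in> carrier Y|] ==> \<mu> (m \<oplus>\<^bsub>M\<^esub> n) y = \<mu> m y \<oplus>\<^bsub>X\<^esub> \<mu> n y"
  "!!m y z. [|m \<in> carrier M; y \<in> carrier Y; z \<in> carrier Y|] ==> \<mu> m (y \<oplus>\<^bsub>Y\<^esub> z) = \<mu> m y \<oplus>\<^bsub>X\<^esub> \<mu> m z"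
  "!!m b y. [|m \<in> carrier M; b \<in> carrier B; y \<in> carrier Y|] ==> \<mu> (rsmult M m b) y = \<mu> m (b \<odot>\<^bsub>Y\<^esub> y)"
  "!!a m y. [|a \<in> carrier A; m \<in> carrier M; y \<in> carrier Y|] ==> \<mu> (a \<odot>\<^bsub>M\<^esub> m) y = a \<odot>\<^bsub>X\<^esub> \<mu> m y"
 shows "bilinear X Y \<mu>" using assms by (simp add: bilinear_def balanced_def)

lemma bilinearD:
 assumes "bilinear X Y \<mu>"
 shows "!!m y. [|m \<in> carrier M; y \<in> carrier Y|] ==> \<mu> m y \<in> carrier X"
  "!!m n y. [|m \<in> carrier M; n \<in> carrier M; y \<in> carrier Y|] ==> \<mu> (m \<oplus>\<^bsub>M\<^esub> n) y = \<mu> m y \<oplus>\<^bsub>X\<^esub> \<mu> n y"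
  "!!m y z. [|m \<in> carrier M; y \<in> carrier Y; z \<in> carrier Y|] ==> \<mu> m (y \<oplus>\<^bsub>Y\<^esub> z) = \<mu> m y \<oplus>\<^bsub>X\<^esub> \<mu> m z"
  "!!m b y. [|m \<in> carrier M; b \<in> carrier B; y \<in> carrier Y|] ==> \<mu> (rsmult M m b) y = \<mu> m (b \<odot>\<^bsub>Y\<^esub> y)"
  "!!a m y. [|a \<in> carrier A; m \<in> carrier M; y \<in> carrier Y|] ==> \<mu> (a \<odot>\<^bsub>M\<^esub> m) y = a \<odot>\<^bsub>X\<^esub> \<mu> m y"
 using assms by (simp_all add: bilinear_def balanced_def)

lemma bilinear_zero:
 assumes "left_module A X" "left_module B Y" "bilinear X Y \<mu>"
 shows "y \<in> carrier Y ==> \<mu> \<zero>\<^bsub>M\<^esub> y = \<zero>\<^bsub>X\<^esub>" "m \<in> carrier M ==> \<mu> m \<zero>\<^bsub>Y\<^esub> = \<zero>\<^bsub>X\<^esub>"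
proof -
 interpret X: left_module A X by fact
 interpret Y: left_module B Y by fact
 note b = bilinearD[OF assms(3)]
 show "\<mu> \<zero>\<^bsub>M\<^esub> y = \<zero>\<^bsub>X\<^esub>" if y: "y \<in> carrier Y"
  using b(2)[of "\<zero>\<^bsub>M\<^esub>" "\<zero>\<^bsub>M\<^esub>" y] b(1)[of "\<zero>\<^bsub>M\<^esub>" y] that by simp
 show "\<mu> m \<zero>\<^bsub>Y\<^esub> = \<zero>\<^bsub>X\<^esub>" if y: "m \<in> carrier M"
  using b(3)[of m "\<zero>\<^bsub>Y\<^esub>" "\<zero>\<^bsub>Y\<^esub>"] b(1)[of m "\<zero>\<^bsub>Y\<^esub>"] that by simp
qed

lemma lmod_tri_mod:
 assumes "left_module A X" "left_module B Y" "bilinear X Y \<mu>"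
 shows "left_module T (tri_mod X Y \<mu>)"
proof -
 interpret X: left_module A X by fact
 interpret Y: left_module B Y by fact
 note b = bilinearD[OF assms(3)] and z = bilinear_zero[OF assms]
 have n: "\<exists>y\<in>carrier (tri_mod X Y \<mu>). y \<oplus>\<^bsub>tri_mod X Y \<mu>\<^esub> x = \<zero>\<^bsub>tri_mod X Y \<mu>\<^esub>"
  if "x \<in> carrier (tri_mod X Y \<mu>)" for x
  by (rule bexI[where x = "(\<ominus>\<^bsub>X\<^esub> fst x, \<ominus>\<^bsub>Y\<^esub> snd x)"]) (use that in \<open>auto simp: X.l_neg Y.l_neg\<close>)
 show ?thesis by (rule left_moduleI)
   (use n in \<open>auto simp: ring_T b z X.a_ac Y.a_ac X.smult_closed Y.smult_closed smult_closed rsmult_closed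
    X.smult_l_distr Y.smult_l_distr X.smult_r_distr Y.smult_r_distr X.smult_assoc Y.smult_assoc
    X.smult_one Y.smult_one\<close>)
qed

lemma hom_into_tri_mod:
 assumes "left_module A X" "left_module B Y" "bilinear X Y \<mu>" "left_module T N"
  and f: "f \<in> mod_hom A (Fst N) X" and g: "g \<in> mod_hom B (Snd N) Y"
  and fg: "!!m y. [|m \<in> carrier M; y \<in> carrier (Snd N)|] ==> f (EM m \<odot>\<^bsub>N\<^esub> y) = \<mu> m (g y)"
 shows "(\<lambda>x\<in>carrier N. (f (p1 N x), g (p2 N x))) \<in> mod_hom T N (tri_mod X Y \<mu>)"
proof (rule mhom_restrictI[OF assms(4)])
 note p1 = p1_in[OF assms(4)] and p2 = p2_in[OF assms(4)]
 fix x assume x: "x \<in> carrier N"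
 show "(f (p1 N x), g (p2 N x)) \<in> carrier (tri_mod X Y \<mu>)"
  using mhom_closed[OF f p1[OF x]] mhom_closed[OF g p2[OF x]] by simp
 fix y assume y: "y \<in> carrier N"
 show "(f (p1 N (x \<oplus>\<^bsub>N\<^esub> y)), g (p2 N (x \<oplus>\<^bsub>N\<^esub> y))) =
   (f (p1 N x), g (p2 N x)) \<oplus>\<^bsub>tri_mod X Y \<mu>\<^esub> (f (p1 N y), g (p2 N y))"
  using mhom_add[OF f p1[OF x] p1[OF y]] mhom_add[OF g p2[OF x] p2[OF y]] x y
  by (simp add: T_smult_distr[OF assms(4)])
next
 note p1 = p1_in[OF assms(4)] and p2 = p2_in[OF assms(4)]
 fix t x assume t: "t \<in> carrier T" and x: "x \<in> carrier N"
 obtain a m b where amb: "t = (a, m, b)" by (cases t)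
 have c: "a \<in> carrier A" "m \<in> carrier M" "b \<in> carrier B" using t amb by auto
 have "f (E1 a \<odot>\<^bsub>N\<^esub> p1 N x \<oplus>\<^bsub>N\<^esub> EM m \<odot>\<^bsub>N\<^esub> p2 N x) = a \<odot>\<^bsub>X\<^esub> f (p1 N x) \<oplus>\<^bsub>X\<^esub> \<mu> m (g (p2 N x))"
  using mhom_add[OF f E1_in[OF assms(4) c(1) FstD(1)[OF assms(4) p1[OF x]]] EM_in[OF assms(4) c(2) SndD(1)[OF assms(4) p2[OF x]]]]
   mhom_smult[OF f c(1) p1[OF x]] fg[OF c(2) p2[OF x]] by simp
 moreover have "g (E2 b \<odot>\<^bsub>N\<^esub> p2 N x) = b \<odot>\<^bsub>Y\<^esub> g (p2 N x)"
  using mhom_smult[OF g c(3) p2[OF x]] by simp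
 ultimately show "(f (p1 N (t \<odot>\<^bsub>N\<^esub> x)), g (p2 N (t \<odot>\<^bsub>N\<^esub> x))) = t \<odot>\<^bsub>tri_mod X Y \<mu>\<^esub> (f (p1 N x), g (p2 N x))"
  unfolding amb using p1_smult[OF assms(4) c x] p2_smult[OF assms(4) c x] by simp
qed

lemma hom_from_tri_mod:
 assumes "left_module A X" "left_module B Y" "bilinear X Y \<mu>" "left_module T N"
  and f: "f \<in> mod_hom A X (Fst N)" and g: "g \<in> mod_hom B Y (Snd N)"
  and fg: "!!m y. [|m \<in> carrier M; y \<in> carrier Y|] ==> f (\<mu> m y) = EM m \<odot>\<^bsub>N\<^esub> g y"
 shows "(\<lambda>u\<in>carrier (tri_mod X Y \<mu>). f (fst u) \<oplus>\<^bsub>N\<^esub> g (snd u)) \<in> mod_hom T (tri_mod X Y \<mu>) N"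
proof (rule mhom_restrictI[OF lmod_tri_mod[OF assms(1-3)]])
 interpret N: left_module T N by fact
 interpret X: left_module A X by fact
 have fc: "f x \<in> carrier N" if "x \<in> carrier X" for x using FstD(1)[OF assms(4) mhom_closed[OF f that]] .
 have gc: "g y \<in> carrier N" if "y \<in> carrier Y" for y using SndD(1)[OF assms(4) mhom_closed[OF g that]] .
 fix x assume x: "x \<in> carrier (tri_mod X Y \<mu>)"
 then show "f (fst x) \<oplus>\<^bsub>N\<^esub> g (snd x) \<in> carrier N" using fc gc by auto
 {
  fix y assume "y \<in> carrier (tri_mod X Y \<mu>)"
  then show "f (fst (x \<oplus>\<^bsub>tri_mod X Y \<mu>\<^esub> y)) \<oplus>\<^bsub>N\<^esub> g (snd (x \<oplus>\<^bsub>tri_mod X Y \<mu>\<^esub> y)) =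
    f (fst x) \<oplus>\<^bsub>N\<^esub> g (snd x) \<oplus>\<^bsub>N\<^esub> (f (fst y) \<oplus>\<^bsub>N\<^esub> g (snd y))"
   using x fc gc mhom_add[OF f, of "fst x" "fst y"] mhom_add[OF g, of "snd x" "snd y"] by (auto simp: N.a_ac)
 next
  fix t assume t: "t \<in> carrier T"
  obtain a m b where amb: "t = (a, m, b)" by (cases t)
  have c: "a \<in> carrier A" "m \<in> carrier M" "b \<in> carrier B" using t amb by auto
  obtain u v where uv: "x = (u, v)" "u \<in> carrier X" "v \<in> carrier Y" using x by auto
  have "f (a \<odot>\<^bsub>X\<^esub> u \<oplus>\<^bsub>X\<^esub> \<mu> m v) \<oplus>\<^bsub>N\<^esub> g (b \<odot>\<^bsub>Y\<^esub> v) =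
    (E1 a \<odot>\<^bsub>N\<^esub> f u \<oplus>\<^bsub>N\<^esub> EM m \<odot>\<^bsub>N\<^esub> g v) \<oplus>\<^bsub>N\<^esub> E2 b \<odot>\<^bsub>N\<^esub> g v"
   using mhom_add[OF f X.smult_closed[OF c(1) uv(2)] bilinearD(1)[OF assms(3) c(2) uv(3)]]
    mhom_smult[OF f c(1) uv(2)] fg[OF c(2) uv(3)] mhom_smult[OF g c(3) uv(3)] by simp
  also have "\<dots> = E1 a \<odot>\<^bsub>N\<^esub> f u \<oplus>\<^bsub>N\<^esub> (EM m \<odot>\<^bsub>N\<^esub> g v \<oplus>\<^bsub>N\<^esub> E2 b \<odot>\<^bsub>N\<^esub> g v)"
   using fc[OF uv(2)] gc[OF uv(3)] c by (simp add: N.a_assoc T_smult_closed[OF assms(4)])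
  also have "\<dots> = (a, m, b) \<odot>\<^bsub>N\<^esub> f u \<oplus>\<^bsub>N\<^esub> (a, m, b) \<odot>\<^bsub>N\<^esub> g v"
   using T_smult_Fst[OF assms(4) c mhom_closed[OF f uv(2)]] T_smult_Snd[OF assms(4) c mhom_closed[OF g uv(3)]]
   by simp
  also have "\<dots> = (a, m, b) \<odot>\<^bsub>N\<^esub> (f u \<oplus>\<^bsub>N\<^esub> g v)"
   using T_smult_distr[OF assms(4) c fc[OF uv(2)] gc[OF uv(3)]] by simp
  finally show "f (fst (t \<odot>\<^bsub>tri_mod X Y \<mu>\<^esub> x)) \<oplus>\<^bsub>N\<^esub> g (snd (t \<odot>\<^bsub>tri_mod X Y \<mu>\<^esub> x)) =
    t \<odot>\<^bsub>N\<^esub> (f (fst x) \<oplus>\<^bsub>N\<^esub> g (snd x))" by (simp add: amb uv)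
 }
qed

end

section \<open>Ext over the triangular matrix ring\<close>

context tri
begin

lemma hom_inc2:
 assumes "left_module B X" "left_module B Y"
 shows "mod_hom B X Y \<subseteq> mod_hom T (inc2 X) (inc2 Y)" using assms by (auto simp: mod_hom_def)

lemma short_exact_inc1:
 assumes "left_module A X" "left_module A Y" "left_module A Z" "short_exact A X Y Z i p"
 shows "short_exact T (inc1 X) (inc1 Y) (inc1 Z) i p"
 using assms(4) hom_inc1[OF assms(1) lmod_inc1[OF assms(2)]] hom_inc1[OF assms(2) lmod_inc1[OF assms(3)]]
 by (simp add: short_exact_def Fst_inc1[OF assms(2)] Fst_inc1[OF assms(3)] del: Fst_simps)

text \<open>The functor \<open>X \<mapsto> X \<oplus> 0\<close> is exact and left adjoint to the exact functor \<open>N \<mapsto> N\<^sub>1\<close>.\<close>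

theorem ext_zero_inc1:
 fixes X :: "('a, 'x) module" and N :: "('a \<times> 'm \<times> 'b, 'n) module"
 assumes X: "left_module A X" and N: "left_module T N"
 shows "ext_zero T (inc1 X) N \<longleftrightarrow> ext_zero A X (Fst N)"
proof
 let ?K = "syzygy A X" and ?F = "res0 A X"
 note K = lmod_syzygy[OF X] and F = lmod_res0[OF X]
 note IX = lmod_inc1[OF X] and IK = lmod_inc1[OF K] and IF = lmod_inc1[OF F]
 assume ext: "ext_zero T (inc1 X) N"
 show "ext_zero A X (Fst N)"
  unfolding ext_zero_def
 proof
  fix f assume "f \<in> mod_hom A ?K (Fst N)"
  then have f: "f \<in> mod_hom T (inc1 ?K) N" by (simp only: hom_inc1[OF K N])
  obtain g where "g \<in> mod_hom T (inc1 ?F) N" "\<forall>x\<in>carrier (inc1 ?K). g ((\<lambda>k\<in>carrier ?K. k) x) = f x"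
   using ext_zero_extend[OF IK IF IX N short_exact_inc1[OF K F X short_exact_syzygy[OF X]] ext f] by blast
  then show "\<exists>g\<in>mod_hom A ?F (Fst N). \<forall>k\<in>carrier ?K. g k = f k"
   unfolding hom_inc1[OF F N] by (intro bexI[of _ g]) simp_all
 qed
next
 note IX = lmod_inc1[OF X]
 assume ext: "ext_zero A X (Fst N)"
 show "ext_zero T (inc1 X) N"
 proof (rule ext_zeroI_split[OF N IX])
  fix E :: "('a \<times> 'm \<times> 'b, ('n \<times> ('x => 'a \<times> 'm \<times> 'b)) set) module" and i p
  assume E: "left_module T E" and se: "short_exact T N E (inc1 X) i p"
  have "\<exists>s\<in>mod_hom A X (Fst E). \<forall>x\<in>carrier X. restrict p (carrier (Fst E)) (s x) = (\<lambda>x\<in>carrier X. x) x"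
   using ext_zero_lift[OF lmod_Fst[OF N] lmod_Fst[OF E] lmod_Fst[OF IX], unfolded Fst_inc1[OF X]]
    X short_exact_Fst[OF N E IX se, unfolded Fst_inc1[OF X]] ext mhom_id[OF X] by blast
  then obtain s where s: "s \<in> mod_hom A X (Fst E)"
    "!!x. x \<in> carrier X ==> restrict p (carrier (Fst E)) (s x) = x" by auto
  have "s \<in> mod_hom T (inc1 X) E" using s(1) by (simp only: hom_inc1[OF X E])
  then show "\<exists>r\<in>mod_hom T E N. \<forall>y\<in>carrier N. r (i y) = y"
   by (rule retraction_of_section[OF N E IX se])
    (use s(2) mhom_closed[OF s(1)] in \<open>simp del: Fst_simps\<close>)
 qed
qed

lemma p2_hom: "[|f \<in> mod_hom T N V; x \<in> carrier N|] ==> f (p2 N x) = p2 V (f x)"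
 using mhom_smult[of f T N V "E2 \<one>\<^bsub>B\<^esub>" x] by simp

lemma p1_hom: "[|f \<in> mod_hom T N V; x \<in> carrier N|] ==> f (p1 N x) = p1 V (f x)"
 using mhom_smult[of f T N V "E1 \<one>\<^bsub>A\<^esub>" x] by simp

lemma EM_hom: "[|f \<in> mod_hom T N V; m \<in> carrier M; x \<in> carrier N|] ==> f (EM m \<odot>\<^bsub>N\<^esub> x) = EM m \<odot>\<^bsub>V\<^esub> f x"
 using mhom_smult[of f T N V "EM m" x] by simp

lemma bilinear_T:
 assumes N: "left_module T N"
 shows "bilinear (Fst N) (Snd N) (\<lambda>m y. EM m \<odot>\<^bsub>N\<^esub> y)"
proof (rule bilinearI)
 note S = SndD(1)[OF N]
 show "EM m \<odot>\<^bsub>N\<^esub> y \<in> carrier (Fst N)" if "m \<in> carrier M" "y \<in> carrier (Snd N)" for m y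
  by (rule EM_in[OF N that(1) S[OF that(2)]])
 show "EM (m \<oplus>\<^bsub>M\<^esub> n) \<odot>\<^bsub>N\<^esub> y = EM m \<odot>\<^bsub>N\<^esub> y \<oplus>\<^bsub>Fst N\<^esub> EM n \<odot>\<^bsub>N\<^esub> y"
  if "m \<in> carrier M" "n \<in> carrier M" "y \<in> carrier (Snd N)" for m n y
  using T_smult_add[OF N, of "\<zero>\<^bsub>A\<^esub>" m "\<zero>\<^bsub>B\<^esub>" "\<zero>\<^bsub>A\<^esub>" n "\<zero>\<^bsub>B\<^esub>" y] that S[OF that(3)] by simp
 show "EM m \<odot>\<^bsub>N\<^esub> (y \<oplus>\<^bsub>Snd N\<^esub> z) = EM m \<odot>\<^bsub>N\<^esub> y \<oplus>\<^bsub>Fst N\<^esub> EM m \<odot>\<^bsub>N\<^esub> z"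
  if "m \<in> carrier M" "y \<in> carrier (Snd N)" "z \<in> carrier (Snd N)" for m y z
  using T_smult_distr[OF N _ that(1) _ S[OF that(2)] S[OF that(3)]] by simp
 show "EM (rsmult M m b) \<odot>\<^bsub>N\<^esub> y = EM m \<odot>\<^bsub>N\<^esub> (b \<odot>\<^bsub>Snd N\<^esub> y)"
  if "m \<in> carrier M" "b \<in> carrier B" "y \<in> carrier (Snd N)" for m b y
  using that(1,2) S[OF that(3)] by (simp add: T_smult_smult[OF N] rsmult_closed)
 show "EM (a \<odot>\<^bsub>M\<^esub> m) \<odot>\<^bsub>N\<^esub> y = a \<odot>\<^bsub>Fst N\<^esub> (EM m \<odot>\<^bsub>N\<^esub> y)"
  if "a \<in> carrier A" "m \<in> carrier M" "y \<in> carrier (Snd N)" for a m y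
  using that(1,2) S[OF that(3)] by (simp add: T_smult_smult[OF N] smult_closed)
qed

lemma bilinear_compose:
 assumes "bilinear X Y \<mu>" "g \<in> mod_hom B Z Y"
 shows "bilinear X Z (\<lambda>m z. \<mu> m (g z))" by (rule bilinearI)
  (use bilinearD[OF assms(1)] mhom_closed[OF assms(2)] in
   \<open>auto simp: mhom_add[OF assms(2)] mhom_smult[OF assms(2)]\<close>)

lemma bilinear_hom_compose:
 assumes "bilinear X Y \<mu>" "g \<in> mod_hom A X Z"
 shows "bilinear Z Y (\<lambda>m y. g (\<mu> m y))" by (rule bilinearI)
  (use bilinearD[OF assms(1)] mhom_closed[OF assms(2)] in
   \<open>auto simp: mhom_add[OF assms(2)] mhom_smult[OF assms(2)]\<close>)

lemma short_exact_inc2: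
 assumes X: "left_module B X" and Y: "left_module B Y" and Z: "left_module B Z" and se: "short_exact B X Y Z i p"
 shows "short_exact T (inc2 X) (inc2 Y) (inc2 Z) i p"
 using se subsetD[OF hom_inc2[OF X Y]] subsetD[OF hom_inc2[OF Y Z]] unfolding short_exact_def hom_kernel_def by simp

text \<open>
 An extension of \<open>N\<^sub>2\<close> by \<open>Y\<close> becomes one of \<open>0 \<oplus> N\<^sub>2\<close> by \<open>0 \<oplus> Y\<close>; a lift of \<open>N \<rightarrow> 0 \<oplus> N\<^sub>2\<close> splits it. Conversely, a
 retraction on second components extends to one of \<open>T\<close>-modules.
\<close>

theorem ext_zero_inc2:
 fixes Y :: "('b, 'y) module" and N :: "('a \<times> 'm \<times> 'b, 'n) module"
 assumes Y: "left_module B Y" and N: "left_module T N"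
 shows "ext_zero T N (inc2 Y) \<longleftrightarrow> ext_zero B (Snd N) Y"
proof
 note S = lmod_Snd[OF N]
 assume ext: "ext_zero T N (inc2 Y)"
 show "ext_zero B (Snd N) Y"
 proof (rule ext_zeroI_split[OF Y S])
  fix E :: "('b, ('y \<times> ('n => 'b)) set) module" and i p
  assume E: "left_module B E" and se: "short_exact B Y E (Snd N) i p"
  let ?u = "\<lambda>x\<in>carrier N. (\<lambda>y\<in>carrier (Snd N). y) (p2 N x)"
  obtain w where w: "w \<in> mod_hom T N (inc2 E)" "\<forall>x\<in>carrier N. p (w x) = ?u x"
   using ext_zero_lift[OF lmod_inc2[OF Y] lmod_inc2[OF E] lmod_inc2[OF S] N
     short_exact_inc2[OF Y E S se] ext hom_into_inc2[OF S N mhom_id[OF S]]] by blast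
  show "\<exists>r\<in>mod_hom B E Y. \<forall>y\<in>carrier Y. r (i y) = y"
  proof (rule retraction_of_section[OF Y E S se hom_Snd_inc2[OF E N w(1)]])
   show "p (restrict w (carrier (Snd N)) y) = y" if y: "y \<in> carrier (Snd N)" for y
    using w(2)[rule_format, OF SndD(1)[OF N y]] SndD[OF N y] y by (simp del: Snd_simps)
  qed
 qed
next
 note IY = lmod_inc2[OF Y]
 assume ext: "ext_zero B (Snd N) Y"
 show "ext_zero T N (inc2 Y)"
 proof (rule ext_zeroI_split[OF IY N])
  fix E :: "('a \<times> 'm \<times> 'b, ('y \<times> ('n => 'a \<times> 'm \<times> 'b)) set) module" and i p
  assume E: "left_module T E" and se: "short_exact T (inc2 Y) E N i p"
  note i = short_exactD(1)[OF se]
  have "\<exists>r\<in>mod_hom B (Snd E) Y. \<forall>y\<in>carrier Y. r (restrict i (carrier Y) y) = (\<lambda>y\<in>carrier Y. y) y"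
   using ext_zero_extend[OF lmod_Snd[OF IY] lmod_Snd[OF E] lmod_Snd[OF N], unfolded Snd_inc2[OF Y]]
    Y short_exact_Snd[OF IY E N se, unfolded Snd_inc2[OF Y]] ext mhom_id[OF Y] by blast
  then obtain r where r: "r \<in> mod_hom B (Snd E) Y" "!!y. y \<in> carrier Y ==> r (i y) = y" by auto
  have "p2 E (i y) = i y" if "y \<in> carrier Y" for y
   using p2_hom[OF i, of y] that left_module.smult_one[OF Y that] by simp
  then show "\<exists>r\<in>mod_hom T E (inc2 Y). \<forall>y\<in>carrier (inc2 Y). r (i y) = y"
   using r(2) mhom_closed[OF i] by (intro bexI[OF _ hom_into_inc2[OF Y E r(1)]]) simp
 qed
qed

subsection \<open>The modules \<open>(X, Hom (M, X))\<close>\<close>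

definition hom_mod :: "('a, 'x) module => ('b, 'm => 'x) module"
 where "hom_mod X = \<lparr>carrier = mod_hom A M X, monoid.mult = undefined, one = undefined,
  ring.zero = (\<lambda>m\<in>carrier M. \<zero>\<^bsub>X\<^esub>), ring.add = (\<lambda>f g. \<lambda>m\<in>carrier M. f m \<oplus>\<^bsub>X\<^esub> g m),
  smult = (\<lambda>b f. \<lambda>m\<in>carrier M. f (rsmult M m b))\<rparr>"

lemma hom_mod_simps [simp]:
 "carrier (hom_mod X) = mod_hom A M X" "\<zero>\<^bsub>hom_mod X\<^esub> = (\<lambda>m\<in>carrier M. \<zero>\<^bsub>X\<^esub>)"
 "f \<oplus>\<^bsub>hom_mod X\<^esub> g = (\<lambda>m\<in>carrier M. f m \<oplus>\<^bsub>X\<^esub> g m)"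
 "b \<odot>\<^bsub>hom_mod X\<^esub> f = (\<lambda>m\<in>carrier M. f (rsmult M m b))"
 by (simp_all add: hom_mod_def)

lemma M_mod: "left_module A M" by (rule left_module_axioms)

lemma lmod_hom_mod:
 assumes X: "left_module A X" shows "left_module B (hom_mod X)"
proof (rule left_moduleI)
 interpret X': left_module A X by fact
 have r: "(\<lambda>m\<in>carrier M. f m) = f" if "f \<in> mod_hom A M X" for f
  using mhom_extensional[OF that] by (rule extensional_restrict)
 show "\<zero>\<^bsub>hom_mod X\<^esub> \<in> carrier (hom_mod X)" using mhom_zero_map[OF M_mod X] by simp
 fix f assume f: "f \<in> carrier (hom_mod X)"
 show "\<zero>\<^bsub>hom_mod X\<^esub> \<oplus>\<^bsub>hom_mod X\<^esub> f = f"
  using f by (intro trans[OF _ r[of f]]) (auto simp: mhom_closed intro!: restrict_ext)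
 show "\<one>\<^bsub>B\<^esub> \<odot>\<^bsub>hom_mod X\<^esub> f = f"
  using f by (intro trans[OF _ r[of f]]) (auto simp: rsmult_one intro!: restrict_ext)
 show "\<exists>g\<in>carrier (hom_mod X). g \<oplus>\<^bsub>hom_mod X\<^esub> f = \<zero>\<^bsub>hom_mod X\<^esub>"
  using f mhom_uminus_map[OF M_mod X, of f]
  by (intro bexI[of _ "\<lambda>m\<in>carrier M. \<ominus>\<^bsub>X\<^esub> f m"]) (auto simp: mhom_closed X'.l_neg intro!: restrict_ext)
 fix g assume g: "g \<in> carrier (hom_mod X)"
 show "f \<oplus>\<^bsub>hom_mod X\<^esub> g \<in> carrier (hom_mod X)"
  using f g mhom_add_map[OF M_mod X, of f g] by simp
 show "f \<oplus>\<^bsub>hom_mod X\<^esub> g = g \<oplus>\<^bsub>hom_mod X\<^esub> f"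
  using f g by (auto simp: mhom_closed X'.a_comm intro!: restrict_ext)
 show "f \<oplus>\<^bsub>hom_mod X\<^esub> g \<oplus>\<^bsub>hom_mod X\<^esub> h = f \<oplus>\<^bsub>hom_mod X\<^esub> (g \<oplus>\<^bsub>hom_mod X\<^esub> h)"
  if "h \<in> carrier (hom_mod X)" for h
  using f g that by (auto simp: mhom_closed X'.a_assoc intro!: restrict_ext)
next
 interpret X': left_module A X by fact
 fix b f assume b: "b \<in> carrier B" and f: "f \<in> carrier (hom_mod X)"
 then have f': "f \<in> mod_hom A M X" by simp
 show "b \<odot>\<^bsub>hom_mod X\<^esub> f \<in> carrier (hom_mod X)"
  using b mhom_closed[OF f'] unfolding hom_mod_simps by (intro mhom_restrictI M_mod)
   (auto simp: rsmult_closed rsmult_l_distr mhom_add[OF f'] smult_rsmult mhom_smult[OF f'])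
 show "b \<odot>\<^bsub>hom_mod X\<^esub> (f \<oplus>\<^bsub>hom_mod X\<^esub> g) = b \<odot>\<^bsub>hom_mod X\<^esub> f \<oplus>\<^bsub>hom_mod X\<^esub> b \<odot>\<^bsub>hom_mod X\<^esub> g"
  for g using b by (auto simp: rsmult_closed intro!: restrict_ext)
 fix c assume c: "c \<in> carrier B"
 show "(b \<oplus>\<^bsub>B\<^esub> c) \<odot>\<^bsub>hom_mod X\<^esub> f = b \<odot>\<^bsub>hom_mod X\<^esub> f \<oplus>\<^bsub>hom_mod X\<^esub> c \<odot>\<^bsub>hom_mod X\<^esub> f"
  using b c by (auto simp: rsmult_closed rsmult_r_distr mhom_add[OF f'] intro!: restrict_ext)
 show "(b \<otimes>\<^bsub>B\<^esub> c) \<odot>\<^bsub>hom_mod X\<^esub> f = b \<odot>\<^bsub>hom_mod X\<^esub> (c \<odot>\<^bsub>hom_mod X\<^esub> f)"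
  using b c by (auto simp: rsmult_closed rsmult_assoc intro!: restrict_ext)
qed (rule B.ring_axioms)

lemma bilinear_adjoint:
 assumes X: "left_module A X" and Y: "left_module B Y" and \<mu>: "bilinear X Y \<mu>"
 shows "(\<lambda>y\<in>carrier Y. \<lambda>m\<in>carrier M. \<mu> m y) \<in> mod_hom B Y (hom_mod X)"
proof (rule mhom_restrictI[OF Y])
 note b = bilinearD[OF \<mu>]
 fix y assume y: "y \<in> carrier Y"
 show "(\<lambda>m\<in>carrier M. \<mu> m y) \<in> carrier (hom_mod X)"
  unfolding hom_mod_simps using y b by (intro mhom_restrictI M_mod) auto
 show "(\<lambda>m\<in>carrier M. \<mu> m (y \<oplus>\<^bsub>Y\<^esub> z)) = (\<lambda>m\<in>carrier M. \<mu> m y) \<oplus>\<^bsub>hom_mod X\<^esub> (\<lambda>m\<in>carrier M. \<mu> m z)"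
  if "z \<in> carrier Y" for z using y that b(3) by (auto intro!: restrict_ext)
 show "(\<lambda>m\<in>carrier M. \<mu> m (c \<odot>\<^bsub>Y\<^esub> y)) = c \<odot>\<^bsub>hom_mod X\<^esub> (\<lambda>m\<in>carrier M. \<mu> m y)"
  if "c \<in> carrier B" for c using y that b(4) rsmult_closed by (auto intro!: restrict_ext)
qed

lemma bilinear_eval:
 assumes X: "left_module A X" shows "bilinear X (hom_mod X) (\<lambda>m h. h m)"
 by (rule bilinearI) (auto simp: mhom_closed mhom_add mhom_smult)

abbreviation "coind X \<equiv> tri_mod X (hom_mod X) (\<lambda>m h. h m)"

lemma lmod_coind: "left_module A X ==> left_module T (coind X)"
 by (rule lmod_tri_mod[OF _ lmod_hom_mod bilinear_eval])

lemma coind_fst_hom: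
 assumes X: "left_module A X" and N: "left_module T N" and s: "s \<in> mod_hom T N (coind X)"
 shows "(\<lambda>u\<in>carrier (Fst N). fst (s u)) \<in> mod_hom A (Fst N) X"
proof (rule mhom_restrictI[OF lmod_Fst[OF N]])
 interpret X: left_module A X by fact
 fix x assume x: "x \<in> carrier (Fst N)"
 note x' = FstD(1)[OF N x]
 have sc: "fst (s x) \<in> carrier X" "snd (s x) \<in> mod_hom A M X" using mhom_closed[OF s x'] by auto
 show "fst (s x) \<in> carrier X" by (rule sc(1))
 show "fst (s (x \<oplus>\<^bsub>Fst N\<^esub> y)) = fst (s x) \<oplus>\<^bsub>X\<^esub> fst (s y)" if "y \<in> carrier (Fst N)" for y
  using mhom_add[OF s x' FstD(1)[OF N that]] by simp
 show "fst (s (a \<odot>\<^bsub>Fst N\<^esub> x)) = a \<odot>\<^bsub>X\<^esub> fst (s x)" if a: "a \<in> carrier A" for a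
  using mhom_smult[OF s _ x', of "E1 a"] a sc mhom_zero[OF M_mod X sc(2)] by (simp add: X.smult_closed)
qed

text \<open>The functor \<open>X \<mapsto> X \<oplus> Hom (M, X)\<close> is right adjoint to \<open>N \<mapsto> N\<^sub>1\<close>: existence, and below uniqueness.\<close>

lemma coind_lift:
 assumes X: "left_module A X" and N: "left_module T N" and g: "g \<in> mod_hom A (Fst N) X"
 shows "\<exists>r\<in>mod_hom T N (coind X). \<forall>u\<in>carrier (Fst N). fst (r u) = g u"
proof -
 have j: "bilinear X (Snd N) (\<lambda>m y. g (EM m \<odot>\<^bsub>N\<^esub> y))" by (rule bilinear_hom_compose[OF bilinear_T[OF N] g])
 have "(\<lambda>x\<in>carrier N. (g (p1 N x), (\<lambda>y\<in>carrier (Snd N). \<lambda>m\<in>carrier M. g (EM m \<odot>\<^bsub>N\<^esub> y)) (p2 N x))) \<in> mod_hom T N (coind X)"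
  by (rule hom_into_tri_mod[OF X lmod_hom_mod[OF X] bilinear_eval[OF X] N g
     bilinear_adjoint[OF X lmod_Snd[OF N] j]]) simp
 then show ?thesis by (rule bexI[rotated]) (use FstD[OF N] in \<open>simp del: Fst_simps Snd_simps\<close>)
qed

lemma coind_hom_eq:
 assumes X: "left_module A X" and N: "left_module T N"
  and f: "f \<in> mod_hom T N (coind X)" and g: "g \<in> mod_hom T N (coind X)"
  and eq: "!!u. u \<in> carrier (Fst N) ==> fst (f u) = fst (g u)" and x: "x \<in> carrier N"
 shows "f x = g x"
proof -
 interpret X: left_module A X by fact
 have d: "fst (h (p1 N x)) = fst (h x)" "!!m. m \<in> carrier M ==> fst (h (EM m \<odot>\<^bsub>N\<^esub> x)) = snd (h x) m"
  "snd (h x) \<in> extensional (carrier M)"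
  if h: "h \<in> mod_hom T N (coind X)" for h
 proof -
  have c: "fst (h x) \<in> carrier X" "snd (h x) \<in> mod_hom A M X" using mhom_closed[OF h x] by auto
  show "fst (h (p1 N x)) = fst (h x)"
   using p1_hom[OF h x] c mhom_zero[OF M_mod X c(2)] by (simp add: X.smult_one)
  show "fst (h (EM m \<odot>\<^bsub>N\<^esub> x)) = snd (h x) m" if "m \<in> carrier M" for m
   using EM_hom[OF h that x] c mhom_closed[OF c(2) that] by simp
  show "snd (h x) \<in> extensional (carrier M)" by (rule mhom_extensional[OF c(2)])
 qed
 have "fst (f x) = fst (g x)" using eq[OF p1_in[OF N x]] d(1)[OF f] d(1)[OF g] by simp
 moreover have "snd (f x) = snd (g x)"
 proof (rule extensionalityI[OF d(3)[OF f] d(3)[OF g]])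
  show "snd (f x) m = snd (g x) m" if "m \<in> carrier M" for m
   using eq[OF EM_in[OF N that x]] d(2)[OF f that] d(2)[OF g that] by simp
 qed
 ultimately show ?thesis by (simp add: prod_eq_iff)
qed

theorem ext_zero_coindI:
 fixes X :: "('a, 'x) module" and N :: "('a \<times> 'm \<times> 'b, 'n) module"
 assumes X: "left_module A X" and N: "left_module T N" and ext: "ext_zero A (Fst N) X"
 shows "ext_zero T N (coind X)"
proof (rule ext_zeroI_split[OF lmod_coind[OF X] N])
 note C = lmod_coind[OF X]
 fix E :: "('a \<times> 'm \<times> 'b, (('x \<times> ('m => 'x)) \<times> ('n => 'a \<times> 'm \<times> 'b)) set) module" and i p
 assume E: "left_module T E" and se: "short_exact T (coind X) E N i p"
 note i = short_exactD(1)[OF se]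
 obtain g where g: "g \<in> mod_hom A (Fst E) X"
  "\<forall>u\<in>carrier (Fst (coind X)). g (restrict i (carrier (Fst (coind X))) u) =
   (\<lambda>u\<in>carrier (Fst (coind X)). fst ((\<lambda>u\<in>carrier (coind X). u) u)) u"
  using ext_zero_extend[OF lmod_Fst[OF C] lmod_Fst[OF E] lmod_Fst[OF N] X
    short_exact_Fst[OF C E N se] ext coind_fst_hom[OF X C mhom_id[OF C]]] by blast
 obtain r where r: "r \<in> mod_hom T E (coind X)" "\<forall>u\<in>carrier (Fst E). fst (r u) = g u"
  using coind_lift[OF X E g(1)] by blast
 have "r (i x) = x" if x: "x \<in> carrier (coind X)" for x
 proof -
  have "compose (carrier (coind X)) r i x = (\<lambda>u\<in>carrier (coind X). u) x"
  proof (rule coind_hom_eq[OF X C mhom_compose[OF C i r(1)] mhom_id[OF C] _ x])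
   fix u assume u: "u \<in> carrier (Fst (coind X))"
   show "fst (compose (carrier (coind X)) r i u) = fst ((\<lambda>u\<in>carrier (coind X). u) u)"
    using bspec[OF g(2) u] bspec[OF r(2) mhom_closed[OF T_hom_Fst[OF C i] u]] u FstD(1)[OF C u]
    by (simp add: compose_def del: Fst_simps tri_mod_simps)
  qed
  then show ?thesis using x by (simp add: compose_def del: tri_mod_simps)
 qed
 then show "\<exists>r\<in>mod_hom T E (coind X). \<forall>y\<in>carrier (coind X). r (i y) = y" using r(1) by blast
qed

lemma coind_map:
 assumes U: "left_module A U" and f: "f \<in> mod_hom A U V"
 shows "(\<lambda>u\<in>carrier (coind U). (f (fst u), compose (carrier M) f (snd u))) \<in> mod_hom T (coind U) (coind V)"
proof (rule mhom_restrictI[OF lmod_coind[OF U]])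
 interpret U: left_module A U by fact
 fix u assume u: "u \<in> carrier (coind U)"
 then have c: "fst u \<in> carrier U" "snd u \<in> mod_hom A M U" by auto
 show "(f (fst u), compose (carrier M) f (snd u)) \<in> carrier (coind V)"
  using mhom_closed[OF f c(1)] mhom_compose[OF M_mod c(2) f] by simp
 fix v assume v: "v \<in> carrier (coind U)"
 then have c': "fst v \<in> carrier U" "snd v \<in> mod_hom A M U" by auto
 show "(f (fst (u \<oplus>\<^bsub>coind U\<^esub> v)), compose (carrier M) f (snd (u \<oplus>\<^bsub>coind U\<^esub> v))) =
   (f (fst u), compose (carrier M) f (snd u)) \<oplus>\<^bsub>coind V\<^esub> (f (fst v), compose (carrier M) f (snd v))"
  using mhom_add[OF f c(1) c'(1)] mhom_add[OF f mhom_closed[OF c(2)] mhom_closed[OF c'(2)]]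
  by (auto simp: compose_def intro!: restrict_ext)
next
 interpret U: left_module A U by fact
 fix t u assume t: "t \<in> carrier T" and u: "u \<in> carrier (coind U)"
 obtain a m b where amb: "t = (a, m, b)" by (cases t)
 have c: "fst u \<in> carrier U" "snd u \<in> mod_hom A M U" using u by auto
 show "(f (fst (t \<odot>\<^bsub>coind U\<^esub> u)), compose (carrier M) f (snd (t \<odot>\<^bsub>coind U\<^esub> u))) =
   t \<odot>\<^bsub>coind V\<^esub> (f (fst u), compose (carrier M) f (snd u))"
  using t amb mhom_closed[OF c(2)] c(1)
  by (auto simp: mhom_add[OF f] mhom_smult[OF f] U.smult_closed compose_def rsmult_closed intro!: restrict_ext)
qed

text \<open>The hypothesis \<open>Ext (M, X) = 0\<close> makes \<open>Hom (M, -)\<close> exact on the sequence.\<close>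

lemma short_exact_coind:
 assumes X: "left_module A X" and E: "left_module A E" and Z: "left_module A Z"
  and se: "short_exact A X E Z i p" and MX: "ext_zero A M X"
 shows "short_exact T (coind X) (coind E) (coind Z)
  (\<lambda>u\<in>carrier (coind X). (i (fst u), compose (carrier M) i (snd u)))
  (\<lambda>u\<in>carrier (coind E). (p (fst u), compose (carrier M) p (snd u)))"
proof -
 note i = short_exactD(1)[OF se] and p = short_exactD(2)[OF se]
 note CX = lmod_coind[OF X] and CE = lmod_coind[OF E]
 show ?thesis
 proof (rule short_exactI[OF CX CE coind_map[OF X i] coind_map[OF E p]])
  fix u assume u: "u \<in> carrier (coind X)"
  then have c: "fst u \<in> carrier X" "snd u \<in> mod_hom A M X" by auto
  have c': "i (fst u) \<in> carrier E" "compose (carrier M) i (snd u) \<in> mod_hom A M E"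
   using mhom_closed[OF i c(1)] mhom_compose[OF M_mod c(2) i] .
  show "(\<lambda>u\<in>carrier (coind E). (p (fst u), compose (carrier M) p (snd u)))
    ((\<lambda>u\<in>carrier (coind X). (i (fst u), compose (carrier M) i (snd u))) u) = \<zero>\<^bsub>coind Z\<^esub>"
   using u c' short_exactD(4)[OF se c(1)] short_exactD(4)[OF se mhom_closed[OF c(2)]]
   by (auto simp: compose_def intro!: restrict_ext)
  assume "(\<lambda>u\<in>carrier (coind X). (i (fst u), compose (carrier M) i (snd u))) u = \<zero>\<^bsub>coind E\<^esub>"
  then have e: "i (fst u) = \<zero>\<^bsub>E\<^esub>" "compose (carrier M) i (snd u) = (\<lambda>m\<in>carrier M. \<zero>\<^bsub>E\<^esub>)" using u by simp_all
  note z = inj_mod_hom_zero[OF X E i short_exactD(3)[OF se]]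
  have "snd u m = \<zero>\<^bsub>X\<^esub>" if m: "m \<in> carrier M" for m
   using z[OF mhom_closed[OF c(2) m]] fun_cong[OF e(2), of m] m by (simp add: compose_def)
  then have "snd u = (\<lambda>m\<in>carrier M. \<zero>\<^bsub>X\<^esub>)"
   using mhom_extensional[OF c(2)] by (intro extensionalityI[of _ "carrier M"]) auto
  then show "u = \<zero>\<^bsub>coind X\<^esub>" using z[OF c(1) e(1)] by (simp add: prod_eq_iff)
 next
  fix u assume u: "u \<in> carrier (coind E)"
   and "(\<lambda>u\<in>carrier (coind E). (p (fst u), compose (carrier M) p (snd u))) u = \<zero>\<^bsub>coind Z\<^esub>"
  then have e: "p (fst u) = \<zero>\<^bsub>Z\<^esub>" "compose (carrier M) p (snd u) = (\<lambda>m\<in>carrier M. \<zero>\<^bsub>Z\<^esub>)" by simp_all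
  have c: "fst u \<in> carrier E" "snd u \<in> mod_hom A M E" using u by auto
  obtain x where x: "x \<in> carrier X" "fst u = i x" using short_exactD(5)[OF se c(1) e(1)] by blast
  have "\<exists>x\<in>carrier X. snd u m = i x" if m: "m \<in> carrier M" for m
   using short_exactD(5)[OF se mhom_closed[OF c(2) m]] fun_cong[OF e(2), of m] m by (simp add: compose_def)
  from factor_through_inj[OF M_mod X E i short_exactD(3)[OF se] c(2) this]
  obtain k where k: "k \<in> mod_hom A M X" "!!m. m \<in> carrier M ==> i (k m) = snd u m" by blast
  have "compose (carrier M) i k = snd u"
   using mhom_extensional[OF c(2)] k(2) by (intro extensionalityI[of _ "carrier M"]) (auto simp: compose_def)
  then show "\<exists>v\<in>carrier (coind X). u = (\<lambda>u\<in>carrier (coind X). (i (fst u), compose (carrier M) i (snd u))) v"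
   using x k(1) by (intro bexI[of _ "(x, k)"]) (simp_all add: prod_eq_iff)
 next
  fix z assume z: "z \<in> carrier (coind Z)"
  then have c: "fst z \<in> carrier Z" "snd z \<in> mod_hom A M Z" by auto
  obtain e where e: "e \<in> carrier E" "fst z = p e" using short_exactD(6)[OF se c(1)] by blast
  obtain h where h: "h \<in> mod_hom A M E" "!!m. m \<in> carrier M ==> p (h m) = snd z m"
   using ext_zero_lift[OF X E Z M_mod se MX c(2)] by blast
  have "compose (carrier M) p h = snd z"
   using mhom_extensional[OF c(2)] h(2) by (intro extensionalityI[of _ "carrier M"]) (auto simp: compose_def)
  then show "\<exists>u\<in>carrier (coind E). z = (\<lambda>u\<in>carrier (coind E). (p (fst u), compose (carrier M) p (snd u))) u"
   using e h(1) by (intro bexI[of _ "(e, h)"]) (simp_all add: prod_eq_iff)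
 qed
qed

text \<open>
 An extension of \<open>N\<^sub>1\<close> by \<open>X\<close> induces one of coinduced modules; a lift of the canonical map
 \<open>N \<rightarrow> N\<^sub>1 \<oplus> Hom (M, N\<^sub>1)\<close> along it is a splitting in the first component.
\<close>

theorem ext_zero_coindD:
 fixes X :: "('a, 'x) module" and N :: "('a \<times> 'm \<times> 'b, 'n) module"
 assumes X: "left_module A X" and N: "left_module T N" and MX: "ext_zero A M X"
  and ext: "ext_zero T N (coind X)"
 shows "ext_zero A (Fst N) X"
proof (rule ext_zeroI_split[OF X lmod_Fst[OF N]])
 note P = lmod_Fst[OF N] and S = lmod_Snd[OF N]
 fix E :: "('a, ('x \<times> ('n => 'a)) set) module" and i p
 assume E: "left_module A E" and se: "short_exact A X E (Fst N) i p"
 let ?\<psi> = "\<lambda>y\<in>carrier (Snd N). \<lambda>m\<in>carrier M. EM m \<odot>\<^bsub>N\<^esub> y"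
 have "(\<lambda>x\<in>carrier N. ((\<lambda>u\<in>carrier (Fst N). u) (p1 N x), ?\<psi> (p2 N x))) \<in> mod_hom T N (coind (Fst N))"
  by (rule hom_into_tri_mod[OF P lmod_hom_mod[OF P] bilinear_eval[OF P] N mhom_id[OF P]
     bilinear_adjoint[OF P S bilinear_T[OF N]]])
   (use EM_in[OF N _ SndD(1)[OF N]] in \<open>simp del: Fst_simps Snd_simps\<close>)
 from ext_zero_lift[OF lmod_coind[OF X] lmod_coind[OF E] lmod_coind[OF P] N
   short_exact_coind[OF X E P se MX] ext this]
 obtain w where w: "w \<in> mod_hom T N (coind E)"
  "\<forall>x\<in>carrier N. (\<lambda>u\<in>carrier (coind E). (p (fst u), compose (carrier M) p (snd u))) (w x) =
   (\<lambda>x\<in>carrier N. ((\<lambda>u\<in>carrier (Fst N). u) (p1 N x), ?\<psi> (p2 N x))) x" by blast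
 have "p ((\<lambda>u\<in>carrier (Fst N). fst (w u)) u) = u" if u: "u \<in> carrier (Fst N)" for u
  using w(2)[rule_format, OF FstD(1)[OF N u]] mhom_closed[OF w(1) FstD(1)[OF N u]] FstD[OF N u] u
  by (simp del: Fst_simps Snd_simps)
 then show "\<exists>r\<in>mod_hom A E X. \<forall>y\<in>carrier X. r (i y) = y"
  by (rule retraction_of_section[OF X E P se coind_fst_hom[OF E N w(1)]])
qed

section \<open>The structure map \<open>\<phi>\<close>\<close>

lemma tensor_contextI: "left_module B Y ==> tensor_context A B M Y"
 by (intro tensor_context.intro bimodule_axioms)

abbreviation "Ten Y \<equiv> tensor B M Y"
abbreviation "pur Y \<equiv> pure_tensor B M Y"

lemma lmod_Ten: "left_module B Y ==> left_module A (Ten Y)" by (rule tensor_context.lmod_MX[OF tensor_contextI])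

lemma tensor_hom_eq:
 assumes Y: "left_module B Y" and X: "left_module A X"
  and f: "f \<in> mod_hom A (Ten Y) X" and g: "g \<in> mod_hom A (Ten Y) X"
  and eq: "!!m y. [|m \<in> carrier M; y \<in> carrier Y|] ==> f (pur Y m y) = g (pur Y m y)"
  and t: "t \<in> carrier (Ten Y)"
 shows "f t = g t"
proof -
 interpret tc: tensor_context A B M Y by (rule tensor_contextI[OF Y])
 note MY = lmod_Ten[OF Y]
 show ?thesis using t by (induction t rule: tc.tensor_induct)
   (use eq in \<open>simp_all add: mhom_zero[OF MY X f] mhom_zero[OF MY X g] mhom_diff[OF MY X f]
    mhom_diff[OF MY X g]\<close>)
qed

lemma bilinear_lift:
 assumes Y: "left_module B Y" and X: "left_module A X" and \<mu>: "bilinear X Y \<mu>"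
 shows "tensor_lift B M Y X \<mu> \<in> mod_hom A (Ten Y) X"
  and "!!m y. [|m \<in> carrier M; y \<in> carrier Y|] ==> tensor_lift B M Y X \<mu> (pur Y m y) = \<mu> m y"
proof -
 interpret tc: tensor_context A B M Y by (rule tensor_contextI[OF Y])
 interpret MY: left_module A "Ten Y" by (rule lmod_Ten[OF Y])
 interpret X': left_module A X by fact
 have bal: "balanced B M Y X \<mu>" using \<mu> by (simp add: bilinear_def)
 note l = tc.tensor_lift_facts[OF X'.X.abelian_group_axioms bal]
 let ?l = "tensor_lift B M Y X \<mu>"
 show "?l (pur Y m y) = \<mu> m y" if "m \<in> carrier M" "y \<in> carrier Y" for m y by (rule l(1)[OF that])
 have smult: "?l (a \<odot>\<^bsub>Ten Y\<^esub> t) = a \<odot>\<^bsub>X\<^esub> ?l t" if a: "a \<in> carrier A" and t: "t \<in> carrier (Ten Y)" for a t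
  using t
 proof (induction t rule: tc.tensor_induct)
  case (pure m y)
  then show ?case using a bilinearD(5)[OF \<mu>] by (simp add: tc.pt_smult l(1) smult_closed)
 next
  case zero
  have "?l \<zero>\<^bsub>Ten Y\<^esub> \<oplus>\<^bsub>X\<^esub> ?l \<zero>\<^bsub>Ten Y\<^esub> = ?l \<zero>\<^bsub>Ten Y\<^esub>"
   using l(3)[of "\<zero>\<^bsub>Ten Y\<^esub>" "\<zero>\<^bsub>Ten Y\<^esub>"] by simp
  then have "?l \<zero>\<^bsub>Ten Y\<^esub> = \<zero>\<^bsub>X\<^esub>" using l(2)[of "\<zero>\<^bsub>Ten Y\<^esub>"] by simp
  then show ?case using a by simp
 next
  case (diff s t)
  let ?u = "s \<ominus>\<^bsub>Ten Y\<^esub> t"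
  have e: "?l (a \<odot>\<^bsub>Ten Y\<^esub> ?u) \<oplus>\<^bsub>X\<^esub> ?l (a \<odot>\<^bsub>Ten Y\<^esub> t) = ?l (a \<odot>\<^bsub>Ten Y\<^esub> s)"
   using l(3)[of "a \<odot>\<^bsub>Ten Y\<^esub> ?u" "a \<odot>\<^bsub>Ten Y\<^esub> t"] diff(1,2) a
   by (simp add: MY.smult_closed MY.smult_r_distr[symmetric] MY.diff_add_cancel)
  have e': "a \<odot>\<^bsub>X\<^esub> ?l ?u \<oplus>\<^bsub>X\<^esub> a \<odot>\<^bsub>X\<^esub> ?l t = a \<odot>\<^bsub>X\<^esub> ?l s"
   using l(3)[of ?u t] diff(1,2) a l(2) by (simp add: X'.smult_r_distr[symmetric] MY.diff_add_cancel)
  have c: "?l (a \<odot>\<^bsub>Ten Y\<^esub> ?u) \<in> carrier X" "a \<odot>\<^bsub>X\<^esub> ?l ?u \<in> carrier X" "a \<odot>\<^bsub>X\<^esub> ?l t \<in> carrier X"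
   using diff(1,2) a l(2) by (simp_all add: MY.smult_closed X'.smult_closed)
  have "?l (a \<odot>\<^bsub>Ten Y\<^esub> ?u) \<oplus>\<^bsub>X\<^esub> a \<odot>\<^bsub>X\<^esub> ?l t = a \<odot>\<^bsub>X\<^esub> ?l ?u \<oplus>\<^bsub>X\<^esub> a \<odot>\<^bsub>X\<^esub> ?l t"
   using e e' diff(3,4) by simp
  then show ?case using c by simp
 qed
 show "?l \<in> mod_hom A (Ten Y) X"
  by (rule mod_homI) (use l smult in \<open>auto simp: tensor_lift_def\<close>)
qed

lemma bilinear_pure:
 assumes "left_module B Y" shows "bilinear (Ten Y) Y (pur Y)"
 using tensor_context.balanced_pt[OF tensor_contextI[OF assms]]
  tensor_context.pt_smult[OF tensor_contextI[OF assms]] by (simp add: bilinear_def)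

abbreviation "ind Y \<equiv> tri_mod (Ten Y) Y (pur Y)"

abbreviation "phi \<equiv> tri_phi A B M"

definition phi_image :: "('a \<times> 'm \<times> 'b, 'n) module => 'n set"
 where "phi_image N = phi N ` carrier (Ten (Snd N))"

definition phi_inj :: "('a \<times> 'm \<times> 'b, 'n) module => bool"
 where "phi_inj N \<longleftrightarrow> inj_on (phi N) (carrier (Ten (Snd N)))"

context
 fixes N :: "('a \<times> 'm \<times> 'b, 'n) module"
 assumes N: "left_module T N"
begin

interpretation N: left_module T N by (rule N)
interpretation P: left_module A "Fst N" by (rule lmod_Fst[OF N])
interpretation TS: left_module A "Ten (Snd N)" by (rule lmod_Ten[OF lmod_Snd[OF N]])
interpretation tc: tensor_context A B M "Snd N" by (rule tensor_contextI[OF lmod_Snd[OF N]])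

lemma phi_hom: "phi N \<in> mod_hom A (Ten (Snd N)) (Fst N)"
 and phi_pure: "!!m y. [|m \<in> carrier M; y \<in> carrier (Snd N)|] ==> phi N (pur (Snd N) m y) = EM m \<odot>\<^bsub>N\<^esub> y"
 unfolding tri_phi_def by (rule bilinear_lift[OF lmod_Snd[OF N] lmod_Fst[OF N] bilinear_T[OF N]])+

lemma submodule_phi_image: "submodule_of A (Fst N) (phi_image N)"
 unfolding phi_image_def by (rule submodule_image[OF TS.left_module_axioms P.left_module_axioms phi_hom])

lemma EM_phi_image: "[|m \<in> carrier M; y \<in> carrier (Snd N)|] ==> EM m \<odot>\<^bsub>N\<^esub> y \<in> phi_image N"
 unfolding phi_image_def using phi_pure tc.pt_closed by (metis imageI)

lemma phi_image_hom_eq: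
 assumes "left_module A Z" "f \<in> mod_hom A (sub_module (Fst N) (phi_image N)) Z"
  "g \<in> mod_hom A (sub_module (Fst N) (phi_image N)) Z"
  and eq: "!!m y. [|m \<in> carrier M; y \<in> carrier (Snd N)|] ==> f (EM m \<odot>\<^bsub>N\<^esub> y) = g (EM m \<odot>\<^bsub>N\<^esub> y)"
  and u: "u \<in> phi_image N"
 shows "f u = g u"
proof -
 have ph: "phi N \<in> mod_hom A (Ten (Snd N)) (sub_module (Fst N) (phi_image N))"
  by (rule mhom_into_sub[OF phi_hom]) (simp add: phi_image_def)
 obtain t where t: "t \<in> carrier (Ten (Snd N))" "u = phi N t" using u by (auto simp: phi_image_def)
 have "compose (carrier (Ten (Snd N))) f (phi N) t = compose (carrier (Ten (Snd N))) g (phi N) t"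
  by (rule tensor_hom_eq[OF lmod_Snd[OF N] assms(1) mhom_compose[OF TS.left_module_axioms ph assms(2)]
   mhom_compose[OF TS.left_module_axioms ph assms(3)] _ t(1)]) (simp add: compose_def phi_pure eq del: Snd_simps)
 then show ?thesis using t by (simp add: compose_def)
qed

lemma phi_universal:
 assumes inj: "phi_inj N" and Z: "left_module A Z" and j: "bilinear Z (Snd N) j"
 shows "\<exists>g\<in>mod_hom A (sub_module (Fst N) (phi_image N)) Z.
  \<forall>m\<in>carrier M. \<forall>y\<in>carrier (Snd N). g (EM m \<odot>\<^bsub>N\<^esub> y) = j m y"
proof -
 let ?I = "sub_module (Fst N) (phi_image N)"
 have I: "left_module A ?I" by (rule lmod_sub[OF P.left_module_axioms submodule_phi_image])
 have ph: "phi N \<in> mod_hom A (Ten (Snd N)) ?I" by (rule mhom_into_sub[OF phi_hom]) (simp add: phi_image_def)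
 have onto: "phi N ` carrier (Ten (Snd N)) = carrier ?I" by (simp add: phi_image_def)
 note l = bilinear_lift[OF lmod_Snd[OF N] Z j]
 have k: "tensor_lift B M (Snd N) Z j t = \<zero>\<^bsub>Z\<^esub>" if "t \<in> carrier (Ten (Snd N))" "phi N t = \<zero>\<^bsub>?I\<^esub>" for t
 proof -
  have "t = \<zero>\<^bsub>Ten (Snd N)\<^esub>"
   using inj_mod_hom_zero[OF TS.left_module_axioms P.left_module_axioms phi_hom inj[unfolded phi_inj_def] that(1)] that(2)
   by simp
  then show ?thesis using mhom_zero[OF TS.left_module_axioms Z l(1)] by simp
 qed
 obtain g where g: "g \<in> mod_hom A ?I Z" "!!t. t \<in> carrier (Ten (Snd N)) ==> g (phi N t) = tensor_lift B M (Snd N) Z j t"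
  using factor_through_surj[OF TS.left_module_axioms I Z ph onto l(1) k] by blast
 have "g (EM m \<odot>\<^bsub>N\<^esub> y) = j m y" if "m \<in> carrier M" "y \<in> carrier (Snd N)" for m y
  using g(2)[OF tc.pt_closed[OF that]] phi_pure[OF that] l(2)[OF that] by simp
 then show ?thesis using g(1) by blast
qed

lemma character_phi:
 assumes \<chi>: "\<chi> \<in> characters (Fst N)"
 shows "(\<lambda>t\<in>carrier (Ten (Snd N)). \<chi> (phi N t)) \<in> characters (Ten (Snd N))"
 using character_closed[OF \<chi> mhom_closed[OF phi_hom]] by (intro characterI)
  (auto simp: mhom_add[OF phi_hom] character_add[OF \<chi>] mhom_closed[OF phi_hom] simp del: Fst_simps)

text \<open>By \<open>tensor_zero_iff\<close>, characters detect that \<open>\<phi>\<close> is injective: the transpose of \<open>\<phi>\<close> must be onto.\<close>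

lemma phi_inj_iff:
 "phi_inj N \<longleftrightarrow> (\<forall>h\<in>mod_hom B (Snd N) (char_module M). \<exists>\<chi>\<in>characters (Fst N).
  \<forall>m\<in>carrier M. \<forall>y\<in>carrier (Snd N). \<chi> (EM m \<odot>\<^bsub>N\<^esub> y) = h y m)"
proof
 assume inj: "phi_inj N"
 show "\<forall>h\<in>mod_hom B (Snd N) (char_module M). \<exists>\<chi>\<in>characters (Fst N).
  \<forall>m\<in>carrier M. \<forall>y\<in>carrier (Snd N). \<chi> (EM m \<odot>\<^bsub>N\<^esub> y) = h y m"
 proof
  fix h assume "h \<in> mod_hom B (Snd N) (char_module M)"
  then obtain \<xi> where \<xi>: "\<xi> \<in> characters (Ten (Snd N))"
    "!!m x. [|m \<in> carrier M; x \<in> carrier (Snd N)|] ==> \<xi> (pur (Snd N) m x) = h x m"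
   using tc.pairing_character by blast
  define \<psi> where "\<psi> u = \<xi> (inv_into (carrier (Ten (Snd N))) (phi N) u)" for u
  have \<psi>: "\<psi> (phi N t) = \<xi> t" if "t \<in> carrier (Ten (Snd N))" for t
   using inj that by (simp add: \<psi>_def phi_inj_def)
  have sg: "subgroup (phi_image N) (add_monoid (Fst N))"
   by (rule subgroup_submodule[OF P.left_module_axioms submodule_phi_image])
  have "\<exists>\<chi>\<in>characters (Fst N). \<forall>u\<in>phi_image N. \<chi> u = \<psi> u"
  proof (rule P.X.character_extend[OF sg])
   fix u assume "u \<in> phi_image N"
   then obtain t where t: "t \<in> carrier (Ten (Snd N))" "u = phi N t" by (auto simp: phi_image_def)
   then show "\<psi> u \<in> {0..<1}" using \<psi> character_closed[OF \<xi>(1)] by simp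
   fix v assume "v \<in> phi_image N"
   then obtain s where s: "s \<in> carrier (Ten (Snd N))" "v = phi N s" by (auto simp: phi_image_def)
   show "\<psi> (u \<oplus>\<^bsub>Fst N\<^esub> v) = frac (\<psi> u + \<psi> v)"
    using t s \<psi>[OF TS.X.a_closed[OF t(1) s(1)]] \<psi> mhom_add[OF phi_hom t(1) s(1)] character_add[OF \<xi>(1) t(1) s(1)]
    by simp
  qed
  then obtain \<chi> where \<chi>: "\<chi> \<in> characters (Fst N)" "!!u. u \<in> phi_image N ==> \<chi> u = \<psi> u" by blast
  have "\<chi> (EM m \<odot>\<^bsub>N\<^esub> y) = h y m" if "m \<in> carrier M" "y \<in> carrier (Snd N)" for m y
   using \<chi>(2)[OF EM_phi_image[OF that]] \<psi>[OF tc.pt_closed[OF that]] phi_pure[OF that] \<xi>(2)[OF that] by simp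
  then show "\<exists>\<chi>\<in>characters (Fst N). \<forall>m\<in>carrier M. \<forall>y\<in>carrier (Snd N). \<chi> (EM m \<odot>\<^bsub>N\<^esub> y) = h y m"
   using \<chi>(1) by blast
 qed
next
 assume ex: "\<forall>h\<in>mod_hom B (Snd N) (char_module M). \<exists>\<chi>\<in>characters (Fst N).
  \<forall>m\<in>carrier M. \<forall>y\<in>carrier (Snd N). \<chi> (EM m \<odot>\<^bsub>N\<^esub> y) = h y m"
 have z: "t = \<zero>\<^bsub>Ten (Snd N)\<^esub>" if t: "t \<in> carrier (Ten (Snd N))" "phi N t = \<zero>\<^bsub>Fst N\<^esub>" for t
 proof (rule tc.tensor_zero_iff[OF t(1)])
  fix \<xi> assume \<xi>: "\<xi> \<in> characters (Ten (Snd N))"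
  obtain \<chi> where \<chi>: "\<chi> \<in> characters (Fst N)"
    "!!m y. [|m \<in> carrier M; y \<in> carrier (Snd N)|] ==> \<chi> (EM m \<odot>\<^bsub>N\<^esub> y) = \<xi> (pur (Snd N) m y)"
   using bspec[OF ex tc.character_pairing[OF \<xi>]] by (auto simp del: Snd_simps)
  have "(\<lambda>t\<in>carrier (Ten (Snd N)). \<chi> (phi N t)) t = \<xi> t"
  proof (rule tc.tensor_characters_eq[OF _ \<xi> _ t(1)])
   show "(\<lambda>t\<in>carrier (Ten (Snd N)). \<chi> (phi N t)) \<in> characters (Ten (Snd N))" by (rule character_phi[OF \<chi>(1)])
  qed (use \<chi>(2) phi_pure in \<open>simp del: Snd_simps\<close>)
  then show "\<xi> t = 0" using t character_zero[OF P.X.abelian_group_axioms \<chi>(1)] by simp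
 qed
 show "phi_inj N"
  unfolding phi_inj_def
 proof (rule inj_onI)
  fix s t assume st: "s \<in> carrier (Ten (Snd N))" "t \<in> carrier (Ten (Snd N))" "phi N s = phi N t"
  then have "phi N (s \<ominus>\<^bsub>Ten (Snd N)\<^esub> t) = \<zero>\<^bsub>Fst N\<^esub>"
   using mhom_diff[OF TS.left_module_axioms P.left_module_axioms phi_hom st(1,2)] mhom_closed[OF phi_hom st(2)]
    P.diff_self by simp
  then show "s = t" by (intro TS.diff_zero_imp_eq[OF st(1,2)] z TS.minus_closed st(1,2))
 qed
qed

text \<open>Characters of \<open>N\<^sub>1\<close> are determined on the image of \<open>\<phi>\<close> by their values at the products \<open>m y\<close>.\<close>

lemma character_phi_image_eq:
 assumes \<chi>: "\<chi> \<in> characters (Fst N)" "\<omega> \<in> characters (Fst N)"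
  and eq: "!!m y. [|m \<in> carrier M; y \<in> carrier (Snd N)|] ==> \<chi> (EM m \<odot>\<^bsub>N\<^esub> y) = \<omega> (EM m \<odot>\<^bsub>N\<^esub> y)"
  and u: "u \<in> phi_image N"
 shows "\<chi> u = \<omega> u"
proof -
 obtain t where t: "t \<in> carrier (Ten (Snd N))" "u = phi N t" using u by (auto simp: phi_image_def)
 have "(\<lambda>t\<in>carrier (Ten (Snd N)). \<chi> (phi N t)) t = (\<lambda>t\<in>carrier (Ten (Snd N)). \<omega> (phi N t)) t"
  by (rule tc.tensor_characters_eq[OF character_phi[OF \<chi>(1)] character_phi[OF \<chi>(2)] _ t(1)])
   (use eq phi_pure in \<open>simp del: Snd_simps\<close>)
 then show ?thesis using t by simp
qed

lemma phi_pairing: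
 assumes \<chi>: "\<chi> \<in> characters (Fst N)"
 shows "(\<lambda>y\<in>carrier (Snd N). \<lambda>m\<in>carrier M. \<chi> (EM m \<odot>\<^bsub>N\<^esub> y)) \<in> mod_hom B (Snd N) (char_module M)"
proof -
 have "(\<lambda>y\<in>carrier (Snd N). \<lambda>m\<in>carrier M. \<chi> (EM m \<odot>\<^bsub>N\<^esub> y)) = (\<lambda>y\<in>carrier (Snd N). \<lambda>m\<in>carrier M.
   (\<lambda>t\<in>carrier (Ten (Snd N)). \<chi> (phi N t)) (pur (Snd N) m y))"
  by (intro restrict_ext) (simp add: phi_pure tc.pt_closed del: Snd_simps)
 then show ?thesis using tc.character_pairing[OF character_phi[OF \<chi>]] by simp
qed

subsection \<open>The submodule generated by the second component\<close>

text \<open>The \<open>T\<close>-submodule generated by \<open>N\<^sub>2\<close>; it depends on \<open>N\<close>, which is fixed in the context.\<close>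

definition gen_sub :: "('a \<times> 'm \<times> 'b, 'n) module"
 where "gen_sub = sub_module N {x \<in> carrier N. p1 N x \<in> phi_image N}"

lemma gen_sub_mem: "x \<in> carrier gen_sub \<longleftrightarrow> x \<in> carrier N \<and> p1 N x \<in> phi_image N"
 by (simp add: gen_sub_def)

lemma phi_imageD: "u \<in> phi_image N ==> u \<in> carrier (Fst N)"
 using submodule_phi_image unfolding submodule_of_def by blast

lemma submodule_gen_sub: "submodule_of T N {x \<in> carrier N. p1 N x \<in> phi_image N}"
proof -
 note s = submodule_phi_image[unfolded submodule_of_def]
 have "p1 N ((a, m, b) \<odot>\<^bsub>N\<^esub> x) \<in> phi_image N"
  if "a \<in> carrier A" "m \<in> carrier M" "b \<in> carrier B" "x \<in> carrier N" "p1 N x \<in> phi_image N" for a m b x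
 proof -
  have "E1 a \<odot>\<^bsub>N\<^esub> p1 N x \<in> phi_image N" using s that(1,5) by simp
  moreover have "EM m \<odot>\<^bsub>N\<^esub> p2 N x \<in> phi_image N" by (rule EM_phi_image[OF that(2) p2_in[OF N that(4)]])
  ultimately show ?thesis using s p1_smult[OF N that(1-4)] by simp
 qed
 then show ?thesis using s T_smult_closed[OF N]
  by (auto simp: submodule_of_def T_smult_distr[OF N] T_smult_zero[OF N])
qed

lemma lmod_gen_sub: "left_module T gen_sub"
 unfolding gen_sub_def by (rule lmod_sub[OF N submodule_gen_sub])

lemma gen_sub_simps:
 "x \<oplus>\<^bsub>gen_sub\<^esub> y = x \<oplus>\<^bsub>N\<^esub> y" "t \<odot>\<^bsub>gen_sub\<^esub> x = t \<odot>\<^bsub>N\<^esub> x" "\<zero>\<^bsub>gen_sub\<^esub> = \<zero>\<^bsub>N\<^esub>"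
 by (simp_all add: gen_sub_def)

lemma Snd_gen_sub: "Snd gen_sub = Snd N"
proof -
 have "carrier (Snd gen_sub) = carrier (Snd N)"
 proof (intro equalityI subsetI)
  fix y assume "y \<in> carrier (Snd gen_sub)"
  then show "y \<in> carrier (Snd N)"
   unfolding Snd_iff[OF lmod_gen_sub] Snd_iff[OF N] by (simp add: gen_sub_mem gen_sub_simps)
 next
  fix y assume y: "y \<in> carrier (Snd N)"
  have "\<zero>\<^bsub>N\<^esub> \<in> phi_image N" using submodule_phi_image by (simp add: submodule_of_def)
  then show "y \<in> carrier (Snd gen_sub)"
   using y p1_Snd[OF N y] unfolding Snd_iff[OF lmod_gen_sub] Snd_iff[OF N] by (simp add: gen_sub_mem gen_sub_simps)
 qed
 then show ?thesis by (simp add: tri_snd_def gen_sub_def)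
qed

lemma carrier_Fst_gen_sub: "carrier (Fst gen_sub) = phi_image N"
proof (intro equalityI subsetI)
 fix y assume "y \<in> carrier (Fst gen_sub)"
 then show "y \<in> phi_image N"
  unfolding Fst_iff[OF lmod_gen_sub] by (metis gen_sub_mem gen_sub_simps(2))
next
 fix y assume y: "y \<in> phi_image N"
 then show "y \<in> carrier (Fst gen_sub)"
  using FstD[OF N phi_imageD[OF y]] unfolding Fst_iff[OF lmod_gen_sub] by (simp add: gen_sub_mem gen_sub_simps)
qed

lemma Fst_gen_sub: "Fst gen_sub = sub_module (Fst N) (phi_image N)"
 using carrier_Fst_gen_sub by (simp add: tri_fst_def gen_sub_def)

lemma short_exact_gen_sub:
 assumes C: "left_module A C" and q: "q \<in> mod_hom A (Fst N) C" "q ` carrier (Fst N) = carrier C"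
  "!!u. u \<in> carrier (Fst N) ==> q u = \<zero>\<^bsub>C\<^esub> \<longleftrightarrow> u \<in> phi_image N"
 shows "short_exact T gen_sub N (inc1 C) (\<lambda>x\<in>carrier gen_sub. x) (\<lambda>x\<in>carrier N. q (p1 N x))"
proof (rule short_exactI[OF lmod_gen_sub N])
 show "(\<lambda>x\<in>carrier gen_sub. x) \<in> mod_hom T gen_sub N"
  by (rule mhom_restrictI[OF lmod_gen_sub]) (simp_all add: gen_sub_mem gen_sub_simps)
 show "(\<lambda>x\<in>carrier N. q (p1 N x)) \<in> mod_hom T N (inc1 C)"
 proof (rule mhom_restrictI[OF N])
  fix x assume x: "x \<in> carrier N"
  show "q (p1 N x) \<in> carrier (inc1 C)" using mhom_closed[OF q(1) p1_in[OF N x]] by simp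
  show "q (p1 N (x \<oplus>\<^bsub>N\<^esub> y)) = q (p1 N x) \<oplus>\<^bsub>inc1 C\<^esub> q (p1 N y)" if y: "y \<in> carrier N" for y
   using mhom_add[OF q(1) p1_in[OF N x] p1_in[OF N y]] x y by (simp add: T_smult_distr[OF N])
  fix t assume t: "t \<in> carrier T"
  obtain a m b where amb: "t = (a, m, b)" by (cases t)
  have c: "a \<in> carrier A" "m \<in> carrier M" "b \<in> carrier B" using t amb by auto
  have e: "EM m \<odot>\<^bsub>N\<^esub> p2 N x \<in> phi_image N" by (rule EM_phi_image[OF c(2) p2_in[OF N x]])
  have "q (E1 a \<odot>\<^bsub>N\<^esub> p1 N x \<oplus>\<^bsub>N\<^esub> EM m \<odot>\<^bsub>N\<^esub> p2 N x) = a \<odot>\<^bsub>C\<^esub> q (p1 N x) \<oplus>\<^bsub>C\<^esub> \<zero>\<^bsub>C\<^esub>"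
   using mhom_add[OF q(1) P.smult_closed[OF c(1) p1_in[OF N x]] phi_imageD[OF e]]
    mhom_smult[OF q(1) c(1) p1_in[OF N x]] q(3)[OF phi_imageD[OF e]] e by simp
  moreover interpret C: left_module A C by fact
  have "a \<odot>\<^bsub>C\<^esub> q (p1 N x) \<in> carrier C" by (rule C.smult_closed[OF c(1) mhom_closed[OF q(1) p1_in[OF N x]]])
  ultimately show "q (p1 N (t \<odot>\<^bsub>N\<^esub> x)) = t \<odot>\<^bsub>inc1 C\<^esub> q (p1 N x)"
   unfolding amb using p1_smult[OF N c x] by simp
 qed
next
 fix x assume "x \<in> carrier gen_sub" "(\<lambda>x\<in>carrier gen_sub. x) x = \<zero>\<^bsub>N\<^esub>"
 then show "x = \<zero>\<^bsub>gen_sub\<^esub>" by (simp add: gen_sub_simps)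
next
 fix x assume "x \<in> carrier gen_sub"
 then show "(\<lambda>x\<in>carrier N. q (p1 N x)) ((\<lambda>x\<in>carrier gen_sub. x) x) = \<zero>\<^bsub>inc1 C\<^esub>"
  using q(3) phi_imageD by (simp add: gen_sub_mem)
next
 fix y assume "y \<in> carrier N" "(\<lambda>x\<in>carrier N. q (p1 N x)) y = \<zero>\<^bsub>inc1 C\<^esub>"
 then have "y \<in> carrier gen_sub" using q(3)[OF p1_in[OF N]] by (simp add: gen_sub_mem)
 then show "\<exists>x\<in>carrier gen_sub. y = (\<lambda>x\<in>carrier gen_sub. x) x" by (intro bexI[of _ y]) simp_all
next
 fix z assume "z \<in> carrier (inc1 C)"
 then have "z \<in> q ` carrier (Fst N)" using q(2) by simp
 then obtain u where u: "z = q u" "u \<in> carrier (Fst N)" by (rule imageE)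
 then show "\<exists>y\<in>carrier N. z = (\<lambda>x\<in>carrier N. q (p1 N x)) y"
  using FstD[OF N u(2)] by (intro bexI[of _ u]) simp_all
qed

end

text \<open>
 If \<open>\<phi>\<close> is injective, its image is \<open>M \<otimes> N\<^sub>2\<close>, so that the submodule generated by \<open>N\<^sub>2\<close> has the universal
 property of the induced module.
\<close>

lemma gen_sub_lift:
 assumes N: "left_module T N" and E: "left_module T E" and inj: "phi_inj N" and s: "s \<in> mod_hom B (Snd N) (Snd E)"
 shows "\<exists>k\<in>mod_hom T (gen_sub N) E. \<forall>y\<in>carrier (Snd N). k y = s y"
proof -
 let ?I = "gen_sub N" and ?W = "tri_mod (Fst E) (Snd E) (\<lambda>m y. EM m \<odot>\<^bsub>E\<^esub> y)"
 note I = lmod_gen_sub[OF N] and FE = lmod_Fst[OF E] and SE = lmod_Snd[OF E]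
 interpret E: left_module T E by fact
 interpret FE: left_module A "Fst E" by fact
 obtain g where g: "g \<in> mod_hom A (sub_module (Fst N) (phi_image N)) (Fst E)"
   "!!m y. [|m \<in> carrier M; y \<in> carrier (Snd N)|] ==> g (EM m \<odot>\<^bsub>N\<^esub> y) = EM m \<odot>\<^bsub>E\<^esub> s y"
  using phi_universal[OF N inj FE bilinear_compose[OF bilinear_T[OF E] s]] by blast
 have g': "g \<in> mod_hom A (Fst ?I) (Fst E)" and s': "s \<in> mod_hom B (Snd ?I) (Snd E)"
  using g(1) s by (simp_all only: Fst_gen_sub[OF N] Snd_gen_sub[OF N])
 let ?h = "\<lambda>x\<in>carrier ?I. (g (p1 ?I x), s (p2 ?I x))"
 let ?k = "\<lambda>u\<in>carrier ?W. (\<lambda>x\<in>carrier (Fst E). x) (fst u) \<oplus>\<^bsub>E\<^esub> (\<lambda>y\<in>carrier (Snd E). y) (snd u)"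
 have h: "?h \<in> mod_hom T ?I ?W" by (rule hom_into_tri_mod[OF FE SE bilinear_T[OF E] I g' s'])
   (simp add: g(2) Snd_gen_sub[OF N] gen_sub_simps[OF N] del: Snd_simps)
 have k: "?k \<in> mod_hom T ?W E"
  by (rule hom_from_tri_mod[OF FE SE bilinear_T[OF E] E mhom_id[OF FE] mhom_id[OF SE]])
   (use bilinearD(1)[OF bilinear_T[OF E]] in \<open>simp del: Fst_simps Snd_simps\<close>)
 have "compose (carrier ?I) ?k ?h y = s y" if y: "y \<in> carrier (Snd N)" for y
 proof -
  have yI: "y \<in> carrier (Snd ?I)" using y by (simp only: Snd_gen_sub[OF N])
  have "g \<zero>\<^bsub>N\<^esub> = \<zero>\<^bsub>E\<^esub>" "\<zero>\<^bsub>E\<^esub> \<in> carrier (Fst E)"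
   using mhom_zero[OF lmod_Fst[OF I] FE g'] FE.zero_closed by (simp_all add: gen_sub_simps[OF N])
  then show ?thesis using SndD[OF I yI] p1_Snd[OF I yI] mhom_closed[OF s y] SndD(1)[OF E mhom_closed[OF s y]]
   by (simp add: compose_def gen_sub_simps[OF N] del: Fst_simps Snd_simps)
 qed
 then show ?thesis using mhom_compose[OF I h k] by blast
qed

lemma gen_sub_hom_eq:
 fixes W :: "('a \<times> 'm \<times> 'b, 'w) module"
 assumes N: "left_module T N" and W: "left_module T W"
  and f: "f \<in> mod_hom T (gen_sub N) W" and g: "g \<in> mod_hom T (gen_sub N) W"
  and eq: "!!y. y \<in> carrier (Snd N) ==> f y = g y" and x: "x \<in> carrier (gen_sub N)"
 shows "f x = g x"
proof -
 let ?I = "gen_sub N"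
 note I = lmod_gen_sub[OF N]
 have r: "restrict f (carrier (Fst ?I)) \<in> mod_hom A (sub_module (Fst N) (phi_image N)) (Fst W)"
  if "f \<in> mod_hom T ?I W" for f using T_hom_Fst[OF I that] by (simp only: Fst_gen_sub[OF N])
 have "restrict f (carrier (Fst ?I)) u = restrict g (carrier (Fst ?I)) u" if u: "u \<in> phi_image N" for u
 proof (rule phi_image_hom_eq[OF N lmod_Fst[OF W] r[OF f] r[OF g] _ u])
  fix m y assume my: "m \<in> carrier M" "y \<in> carrier (Snd N)"
  then have yI: "y \<in> carrier ?I" using SndD(1)[OF I] by (simp only: Snd_gen_sub[OF N])
  show "restrict f (carrier (Fst ?I)) (EM m \<odot>\<^bsub>N\<^esub> y) = restrict g (carrier (Fst ?I)) (EM m \<odot>\<^bsub>N\<^esub> y)"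
   using EM_hom[OF f my(1) yI] EM_hom[OF g my(1) yI] eq[OF my(2)] by (simp add: gen_sub_simps[OF N] del: Fst_simps)
 qed
 then have "f (p1 ?I x) = g (p1 ?I x)"
  using p1_in[OF I x] by (simp add: carrier_Fst_gen_sub[OF N] del: Fst_simps)
 moreover have "f (p2 ?I x) = g (p2 ?I x)" using eq p2_in[OF I x] by (simp only: Snd_gen_sub[OF N])
 moreover have d: "h x = h (p1 ?I x) \<oplus>\<^bsub>W\<^esub> h (p2 ?I x)" if "h \<in> mod_hom T ?I W" for h
  using mhom_add[OF that FstD(1)[OF I p1_in[OF I x]] SndD(1)[OF I p2_in[OF I x]]] peirce[OF I x] by simp
 ultimately show ?thesis unfolding d[OF f] d[OF g] by (simp only:)
qed

theorem ext_zero_gen_sub: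
 fixes N :: "('a \<times> 'm \<times> 'b, 'n) module" and V :: "('a \<times> 'm \<times> 'b, 'v) module"
 assumes N: "left_module T N" and V: "left_module T V" and inj: "phi_inj N"
  and ext: "ext_zero B (Snd N) (Snd V)"
 shows "ext_zero T (gen_sub N) V"
proof (rule ext_zeroI_split[OF V lmod_gen_sub[OF N]])
 let ?I = "gen_sub N"
 note I = lmod_gen_sub[OF N] and S = lmod_Snd[OF N]
 fix E :: "('a \<times> 'm \<times> 'b, ('v \<times> ('n => 'a \<times> 'm \<times> 'b)) set) module" and i p
 assume E: "left_module T E" and se: "short_exact T V E ?I i p"
 note p = short_exactD(2)[OF se]
 obtain s where s: "s \<in> mod_hom B (Snd N) (Snd E)"
   "\<forall>y\<in>carrier (Snd N). restrict p (carrier (Snd E)) (s y) = (\<lambda>y\<in>carrier (Snd N). y) y"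
  using ext_zero_lift[OF lmod_Snd[OF V] lmod_Snd[OF E] S S
    short_exact_Snd[OF V E I se, unfolded Snd_gen_sub[OF N]] ext mhom_id[OF S]] by blast
 obtain k where k: "k \<in> mod_hom T ?I E" "\<forall>y\<in>carrier (Snd N). k y = s y"
  using gen_sub_lift[OF N E inj s(1)] by blast
 have "p (k x) = x" if x: "x \<in> carrier ?I" for x
 proof -
  have "compose (carrier ?I) p k x = (\<lambda>x\<in>carrier ?I. x) x"
  proof (rule gen_sub_hom_eq[OF N I mhom_compose[OF I k(1) p] mhom_id[OF I] _ x])
   fix y assume y: "y \<in> carrier (Snd N)"
   then have "y \<in> carrier ?I" using SndD(1)[OF I] by (simp only: Snd_gen_sub[OF N])
   then show "compose (carrier ?I) p k y = (\<lambda>x\<in>carrier ?I. x) y"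
    using bspec[OF s(2) y] k(2) y mhom_closed[OF s(1) y] by (simp add: compose_def del: Snd_simps)
  qed
  then show ?thesis using x by (simp add: compose_def)
 qed
 then show "\<exists>r\<in>mod_hom T E V. \<forall>y\<in>carrier V. r (i y) = y" by (rule retraction_of_section[OF V E I se k(1)])
qed

text \<open>Such an \<open>f\<close> kills the second component, and this generates the module.\<close>

lemma hom_gen_sub_inc1:
 assumes N: "left_module T N" and X: "left_module A X" and f: "f \<in> mod_hom T (gen_sub N) (inc1 X)"
  and x: "x \<in> carrier (gen_sub N)"
 shows "f x = \<zero>\<^bsub>X\<^esub>"
proof -
 note I = lmod_gen_sub[OF N] and IX = lmod_inc1[OF X]
 have "f x = (\<lambda>x\<in>carrier (gen_sub N). \<zero>\<^bsub>inc1 X\<^esub>) x"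
 proof (rule gen_sub_hom_eq[OF N IX f mhom_zero_map[OF I IX] _ x])
  fix y assume "y \<in> carrier (Snd N)"
  then have y: "y \<in> carrier (Snd (gen_sub N))" by (simp only: Snd_gen_sub[OF N])
  show "f y = (\<lambda>x\<in>carrier (gen_sub N). \<zero>\<^bsub>inc1 X\<^esub>) y"
   using mhom_closed[OF T_hom_Snd[OF I f] y] Snd_inc1[OF X] y SndD(1)[OF I y] by (simp del: Snd_simps)
 qed
 then show ?thesis using x by simp
qed

end

section \<open>Classes of modules in a universe\<close>

lemma Mod_catD: "X \<in> Mod_cat R ==> left_module R X" by (simp add: Mod_cat_def)

lemma right_perp_iff:
 assumes "\<S> \<subseteq> Mod_cat R"
 shows "X \<in> right_perp R \<S> \<longleftrightarrow> X \<in> Mod_cat R \<and> (\<forall>S\<in>\<S>. ext_zero R S X)"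
 using assms trivial_Ext1_iff[of R _ X] by (auto simp: right_perp_def Mod_cat_def subset_iff)

lemma left_perp_iff:
 assumes "\<S> \<subseteq> Mod_cat R"
 shows "X \<in> left_perp R \<S> \<longleftrightarrow> X \<in> Mod_cat R \<and> (\<forall>S\<in>\<S>. ext_zero R X S)"
 using assms trivial_Ext1_iff[of R X] by (auto simp: left_perp_def Mod_cat_def subset_iff)

lemma perp_subset: "right_perp R \<S> \<subseteq> Mod_cat R" "left_perp R \<S> \<subseteq> Mod_cat R"
 by (auto simp: right_perp_def left_perp_def)

lemma cotorsion_pairD:
 assumes "cotorsion_pair R \<X> \<Y>"
 shows "\<X> \<subseteq> Mod_cat R" "\<Y> \<subseteq> Mod_cat R"
  "X \<in> \<X> \<longleftrightarrow> X \<in> Mod_cat R \<and> (\<forall>Y\<in>\<Y>. ext_zero R X Y)"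
  "Y \<in> \<Y> \<longleftrightarrow> Y \<in> Mod_cat R \<and> (\<forall>X\<in>\<X>. ext_zero R X Y)"
proof -
 have e: "right_perp R \<X> = \<Y>" "\<X> = left_perp R \<Y>" using assms by (auto simp: cotorsion_pair_def)
 show s: "\<X> \<subseteq> Mod_cat R" "\<Y> \<subseteq> Mod_cat R" using e perp_subset by blast+
 show "X \<in> \<X> \<longleftrightarrow> X \<in> Mod_cat R \<and> (\<forall>Y\<in>\<Y>. ext_zero R X Y)"
  using e(2) left_perp_iff[OF s(2)] by blast
 show "Y \<in> \<Y> \<longleftrightarrow> Y \<in> Mod_cat R \<and> (\<forall>X\<in>\<X>. ext_zero R X Y)"
  using e(1) right_perp_iff[OF s(1)] by blast
qed

text \<open>A generating set and a description of the left class suffice, since \<open>\<S>\<close> is contained in the left class.\<close>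

lemma cotorsion_pairI:
 fixes \<S> \<X> \<Y> :: "('r, 'u) module set"
 assumes S: "\<S> \<subseteq> Mod_cat R" "\<S> \<prec> (UNIV :: 'u set)"
  and Y: "!!Z. Z \<in> Mod_cat R ==> Z \<in> \<Y> \<longleftrightarrow> (\<forall>S\<in>\<S>. ext_zero R S Z)"
  and X: "!!Z. Z \<in> Mod_cat R ==> Z \<in> \<X> \<longleftrightarrow> (\<forall>Y\<in>\<Y>. ext_zero R Z Y)"
  and sub: "\<X> \<subseteq> Mod_cat R" "\<Y> \<subseteq> Mod_cat R"
 shows "cotorsion_pair R \<X> \<Y>" "generated_by_set R \<X> \<Y>"
proof -
 have Y': "\<Y> = right_perp R \<S>" and X': "\<X> = left_perp R \<Y>"
  using X Y sub by (auto simp: right_perp_iff[OF S(1)] left_perp_iff[OF sub(2)])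
 have "\<S> \<subseteq> \<X>" using S(1) X Y sub by blast
 then have "Z \<in> right_perp R \<X> \<longleftrightarrow> Z \<in> \<Y>" for Z
  unfolding right_perp_iff[OF sub(1)] using X Y sub by blast
 then have "right_perp R \<X> = \<Y>" by blast
 then show "cotorsion_pair R \<X> \<Y>" using X' unfolding cotorsion_pair_def by (rule conjI)
 show "generated_by_set R \<X> \<Y>" unfolding generated_by_set_def using S Y' by blast
qed

lemma generated_ex:
 fixes \<X> \<Y> :: "('r, 'u) module set"
 assumes "cotorsion_pair R \<X> \<Y>" "generated_by_set R \<X> \<Y>"
 shows "\<exists>\<S>\<subseteq>\<X>. \<S> \<prec> (UNIV :: 'u set) \<and>
  (\<forall>Y. Y \<in> \<Y> \<longleftrightarrow> Y \<in> Mod_cat R \<and> (\<forall>S\<in>\<S>. ext_zero R S Y))"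
proof -
 obtain \<S> where S: "\<S> \<subseteq> Mod_cat R" "\<S> \<prec> (UNIV :: 'u set)" "\<Y> = right_perp R \<S>"
  using assms(2) by (auto simp: generated_by_set_def)
 have e: "Y \<in> \<Y> \<longleftrightarrow> Y \<in> Mod_cat R \<and> (\<forall>S\<in>\<S>. ext_zero R S Y)" for Y
  unfolding S(3) by (rule right_perp_iff[OF S(1)])
 then have "\<S> \<subseteq> \<X>" using S(1) cotorsion_pairD(3)[OF assms(1)] by blast
 then show ?thesis using S(2) e by (intro exI[of _ \<S>]) blast
qed

lemma ext_zero_summand_left:
 assumes "left_module R X" "left_module R Y" "left_module R V"
  and i: "i \<in> mod_hom R X Y" and p: "p \<in> mod_hom R Y X" "!!x. x \<in> carrier X ==> p (i x) = x"
  and ext: "ext_zero R Y V"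
 shows "ext_zero R X V"
proof -
 let ?K = "sub_module Y (hom_kernel Y X p)"
 interpret X: left_module R X by fact
 interpret Y: left_module R Y by fact
 have K: "left_module R ?K" by (rule lmod_sub[OF assms(2) submodule_hom_kernel[OF assms(2,1) p(1)]])
 have onto: "p ` carrier Y = carrier X" using p mhom_closed[OF p(1)] mhom_closed[OF i] by force
 show ?thesis
 proof (rule ext_zero_quotient[OF K assms(2,1,3) short_exact_kernel[OF assms(2,1) p(1) onto] ext])
  fix f assume f: "f \<in> mod_hom R ?K V"
  let ?d = "\<lambda>y\<in>carrier Y. (\<lambda>y\<in>carrier Y. y) y \<ominus>\<^bsub>Y\<^esub> compose (carrier Y) i p y"
  have d: "?d \<in> mod_hom R Y Y" by (intro mhom_diff_map assms(2) mhom_id mhom_compose[OF assms(2) p(1) i])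
  note c = mhom_closed[OF p(1)] mhom_closed[OF i]
  have d': "?d \<in> mod_hom R Y ?K" by (rule mhom_into_sub[OF d])
    (simp add: hom_kernel_def compose_def c mhom_diff[OF assms(2,1) p(1)] p(2) X.diff_self)
  have "compose (carrier Y) f ?d x = f x" if "x \<in> hom_kernel Y X p" for x
   using that mhom_zero[OF assms(1,2) i] Y.diff_add_cancel[of "\<zero>\<^bsub>Y\<^esub>" x]
   by (simp add: compose_def hom_kernel_def)
  then show "\<exists>g\<in>mod_hom R Y V. \<forall>x\<in>carrier ?K. g ((\<lambda>x\<in>hom_kernel Y X p. x) x) = f x"
   by (intro bexI[OF _ mhom_compose[OF assms(2) d' f]]) simp
 qed
qed

lemma ext_zero_summand_right:
 assumes N: "left_module R N" and i: "i \<in> mod_hom R X Y"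
  and p: "p \<in> mod_hom R Y X" "!!x. x \<in> carrier X ==> p (i x) = x" and ext: "ext_zero R N Y"
 shows "ext_zero R N X"
 unfolding ext_zero_def
proof
 fix f assume f: "f \<in> mod_hom R (syzygy R N) X"
 obtain g where g: "g \<in> mod_hom R (res0 R N) Y" "!!k. k \<in> carrier (syzygy R N) ==> g k = i (f k)"
  using ext[unfolded ext_zero_def, rule_format, OF mhom_compose[OF lmod_syzygy[OF N] f i]]
  by (auto simp: compose_def)
 have "compose (carrier (res0 R N)) p g k = f k" if "k \<in> carrier (syzygy R N)" for k
  using that syzygyD(1)[OF that] g(2) p(2) mhom_closed[OF f] by (simp add: compose_def)
 then show "\<exists>g\<in>mod_hom R (res0 R N) X. \<forall>k\<in>carrier (syzygy R N). g k = f k"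
  using mhom_compose[OF lmod_res0[OF N] g(1) p(1)] by blast
qed

text \<open>All closure conditions except one follow from the orthogonality, so that \<open>hereditary\<close> reduces to
 one closure condition on each side.\<close>

lemma cotorsion_pair_resolving:
 fixes \<X> \<Y> :: "('r, 'u) module set"
 assumes inf: "infinite (UNIV :: 'u set)" and cp: "cotorsion_pair R \<X> \<Y>"
 shows "resolving R \<X> \<longleftrightarrow> closed_under_epi_kernels R \<X>"
  and "coresolving R \<Y> \<longleftrightarrow> closed_under_mono_cokernels R \<Y>"
proof -
 note c = cotorsion_pairD[OF cp]
 note lm = subsetD[OF c(1), THEN Mod_catD] subsetD[OF c(2), THEN Mod_catD]
 have perp: "!!X. X \<in> \<X> ==> \<forall>Y\<in>\<Y>. ext_zero R X Y" "!!Y. Y \<in> \<Y> ==> \<forall>X\<in>\<X>. ext_zero R X Y"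
  using c(3,4) by blast+
 have "P \<in> \<X>" if "projective R P" for P
  using that projective_ext_zero[OF inf that] c(2) unfolding c(3) by (auto simp: projective_def)
 moreover have "closed_under_extensions R \<X>"
  unfolding closed_under_extensions_def
 proof (intro ballI allI impI)
  fix X Y Z :: "('r, 'u) module" and f g assume a: "X \<in> \<X>" "Y \<in> Mod_cat R" "Z \<in> \<X>" "short_exact R X Y Z f g"
  show "Y \<in> \<X>"
   unfolding c(3) using a(2) perp(1)[OF a(1)] perp(1)[OF a(3)]
   by (intro conjI ballI ext_zero_extension_left[OF lm(1)[OF a(1)] Mod_catD[OF a(2)] lm(1)[OF a(3)] lm(2) a(4)]) blast+
 qed
 moreover have "closed_under_summands R \<X>"
  unfolding closed_under_summands_def
 proof (intro ballI impI)
  fix X Y :: "('r, 'u) module" and i p assume a: "X \<in> Mod_cat R" "Y \<in> \<X>" "i \<in> mod_hom R X Y" "p \<in> mod_hom R Y X" "\<forall>x\<in>carrier X. p (i x) = x"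
  show "X \<in> \<X>"
   unfolding c(3) using a(1,5) perp(1)[OF a(2)]
   by (intro conjI ballI ext_zero_summand_left[OF Mod_catD[OF a(1)] lm(1)[OF a(2)] lm(2) a(3,4)]) blast+
 qed
 ultimately show "resolving R \<X> \<longleftrightarrow> closed_under_epi_kernels R \<X>" by (auto simp: resolving_def)
 have "J \<in> \<Y>" if "injective R J" for J
  using that injective_ext_zero[OF inf that] c(1) unfolding c(4) by (auto simp: injective_def)
 moreover have "closed_under_extensions R \<Y>"
  unfolding closed_under_extensions_def
 proof (intro ballI allI impI)
  fix X Y Z :: "('r, 'u) module" and f g assume a: "X \<in> \<Y>" "Y \<in> Mod_cat R" "Z \<in> \<Y>" "short_exact R X Y Z f g"
  show "Y \<in> \<Y>"
   unfolding c(4) using a(2) perp(2)[OF a(1)] perp(2)[OF a(3)]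
   by (intro conjI ballI ext_zero_extension_right[OF lm(2)[OF a(1)] Mod_catD[OF a(2)] lm(2)[OF a(3)] lm(1) a(4)]) blast+
 qed
 moreover have "closed_under_summands R \<Y>"
  unfolding closed_under_summands_def
 proof (intro ballI impI)
  fix X Y :: "('r, 'u) module" and i p assume a: "X \<in> Mod_cat R" "Y \<in> \<Y>" "i \<in> mod_hom R X Y" "p \<in> mod_hom R Y X" "\<forall>x\<in>carrier X. p (i x) = x"
  show "X \<in> \<Y>"
   unfolding c(4) using a(1,5) perp(2)[OF a(2)]
   by (intro conjI ballI ext_zero_summand_right[OF lm(1) a(3,4)]) blast+
 qed
 ultimately show "coresolving R \<Y> \<longleftrightarrow> closed_under_mono_cokernels R \<Y>" by (auto simp: coresolving_def)
qed

lemma hereditary_iff: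
 fixes \<X> \<Y> :: "('r, 'u) module set"
 assumes "infinite (UNIV :: 'u set)"
 shows "hereditary_cotorsion_pair R \<X> \<Y> \<longleftrightarrow> cotorsion_pair R \<X> \<Y> \<and>
  closed_under_epi_kernels R \<X> \<and> closed_under_mono_cokernels R \<Y>"
 using cotorsion_pair_resolving[OF assms] unfolding hereditary_cotorsion_pair_def by blast

lemma cotorsion_pair_zero:
 assumes "cotorsion_pair R \<X> \<Y>" "X \<in> Mod_cat R" "carrier X = {\<zero>\<^bsub>X\<^esub>}"
 shows "X \<in> \<X>" "X \<in> \<Y>"
proof -
 note c = cotorsion_pairD[OF assms(1)] and X = Mod_catD[OF assms(2)]
 show "X \<in> \<X>"
  unfolding c(3) using assms(2)
  by (intro conjI ballI ext_zero_zero_left[OF X _ assms(3)] Mod_catD[OF subsetD[OF c(2)]])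
 show "X \<in> \<Y>"
  unfolding c(4) using assms(2)
  by (intro conjI ballI ext_zero_zero_right[OF _ X assms(3)] Mod_catD[OF subsetD[OF c(1)]])
qed

lemma hom_quotient_iff:
 fixes X :: "('r, 'x) module"
 assumes X: "left_module R X" and H: "submodule_of R X H" and C: "left_module R C"
 shows "mod_iso R (quotient_module X H) C \<longleftrightarrow> (\<exists>q\<in>mod_hom R X C. q ` carrier X = carrier C \<and>
  (\<forall>x\<in>carrier X. q x = \<zero>\<^bsub>C\<^esub> \<longleftrightarrow> x \<in> H))"
proof
 let ?Q = "quotient_module X H" and ?\<pi> = "\<lambda>x\<in>carrier X. H +>\<^bsub>X\<^esub> x"
 note Q = lmod_quotient[OF X H] and \<pi> = mhom_quotient[OF X H]
 have onto: "?\<pi> ` carrier X = carrier ?Q" using quotient_onto[OF X H] by (simp cong: image_cong)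
 have z: "?\<pi> x = \<zero>\<^bsub>?Q\<^esub> \<longleftrightarrow> x \<in> H" if "x \<in> carrier X" for x using quotient_zero_iff[OF X H that] that by simp
 {
  assume "mod_iso R ?Q C"
  then obtain f where f: "f \<in> mod_hom R ?Q C" "bij_betw f (carrier ?Q) (carrier C)" by (auto simp: mod_iso_def)
  have "f c = \<zero>\<^bsub>C\<^esub> \<longleftrightarrow> c = \<zero>\<^bsub>?Q\<^esub>" if "c \<in> carrier ?Q" for c
   using inj_mod_hom_zero[OF Q C f(1) _ that] f(2) mhom_zero[OF Q C f(1)] by (auto simp: bij_betw_def)
  then have "compose (carrier X) f ?\<pi> x = \<zero>\<^bsub>C\<^esub> \<longleftrightarrow> x \<in> H" if "x \<in> carrier X" for x
   using z[OF that] mhom_closed[OF \<pi> that] that by (simp add: compose_def)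
  moreover have "compose (carrier X) f ?\<pi> ` carrier X = carrier C"
   by (rule surj_compose[OF onto]) (use f(2) in \<open>simp add: bij_betw_def\<close>)
  ultimately show "\<exists>q\<in>mod_hom R X C. q ` carrier X = carrier C \<and> (\<forall>x\<in>carrier X. q x = \<zero>\<^bsub>C\<^esub> \<longleftrightarrow> x \<in> H)"
   by (intro bexI[OF _ mhom_compose[OF X \<pi> f(1)]]) blast
 next
  assume "\<exists>q\<in>mod_hom R X C. q ` carrier X = carrier C \<and> (\<forall>x\<in>carrier X. q x = \<zero>\<^bsub>C\<^esub> \<longleftrightarrow> x \<in> H)"
  then obtain q where q: "q \<in> mod_hom R X C" "q ` carrier X = carrier C"
   "!!x. x \<in> carrier X ==> q x = \<zero>\<^bsub>C\<^esub> \<longleftrightarrow> x \<in> H" by blast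
  obtain f where f: "f \<in> mod_hom R ?Q C" "!!x. x \<in> carrier X ==> f (?\<pi> x) = q x"
   using factor_through_surj[OF X Q C \<pi> onto q(1)] z q(3) by blast
  interpret Q: left_module R ?Q by (rule Q)
  interpret C: left_module R C by fact
  have "inj_on f (carrier ?Q)"
  proof (rule inj_onI)
   fix c d assume cd: "c \<in> carrier ?Q" "d \<in> carrier ?Q" "f c = f d"
   then have "f (c \<ominus>\<^bsub>?Q\<^esub> d) = \<zero>\<^bsub>C\<^esub>"
    using mhom_diff[OF Q C f(1) cd(1,2)] mhom_closed[OF f(1)] by (simp add: C.diff_self)
   moreover obtain x where x: "x \<in> carrier X" "c \<ominus>\<^bsub>?Q\<^esub> d = ?\<pi> x"
    using Q.minus_closed[OF cd(1,2)] unfolding onto[symmetric] by (elim imageE)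
   ultimately have "c \<ominus>\<^bsub>?Q\<^esub> d = \<zero>\<^bsub>?Q\<^esub>" using f(2)[OF x(1)] q(3)[OF x(1)] z[OF x(1)] by metis
   then show "c = d" using Q.diff_zero_imp_eq cd by blast
  qed
  moreover have "f ` carrier ?Q = carrier C"
   unfolding onto[symmetric] q(2)[symmetric] image_image using f(2) by (rule image_cong[OF refl])
  ultimately show "mod_iso R ?Q C" using f(1) by (auto simp: mod_iso_def bij_betw_def)
 }
qed

subsection \<open>Smallness\<close>

lemma subset_small: "[|A \<subseteq> B; B \<prec> (UNIV :: 'u set)|] ==> A \<prec> (UNIV :: 'u set)"
 by (rule lesspoll_trans1[OF subset_imp_lepoll])

lemma image_small: "B \<prec> (UNIV :: 'u set) ==> f ` B \<prec> (UNIV :: 'u set)"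
 by (rule lesspoll_trans1[OF image_lepoll])

lemma un_small:
 assumes "infinite (UNIV :: 'u set)" "A \<prec> (UNIV :: 'u set)" "B \<prec> (UNIV :: 'u set)"
 shows "A \<union> B \<prec> (UNIV :: 'u set)"
 using assms unfolding lesspoll_iff_ordLess by (rule card_of_Un_ordLess_infinite)

lemma countable_small:
 assumes "uncountable (UNIV :: 'u set)" "countable A"
 shows "A \<prec> (UNIV :: 'u set)"
proof -
 have "|A| <o |UNIV :: 'u set|"
 proof (rule ccontr)
  assume "\<not> ?thesis"
  then have "|UNIV :: 'u set| \<le>o |A|" by (simp add: not_ordLess_iff_ordLeq)
  then show False using assms by (metis card_of_ordLeq countable_image_inj_on countable_subset)
 qed
 then show ?thesis by (simp add: lesspoll_iff_ordLess)
qed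

text \<open>
 The set is enlarged by an infinite countable set, since a free abelian group on an infinite set has the
 cardinality of that set.
\<close>

lemma free_abelian_small:
 fixes S :: "('m \<times> 'u) set"
 assumes unc: "uncountable (UNIV :: 'u set)" and S: "S \<prec> (UNIV :: 'u set)"
 shows "carrier (free_Abelian_group S) \<prec> (UNIV :: 'u set)"
proof -
 have inf: "infinite (UNIV :: 'u set)" using unc countable_finite by blast
 then have "infinite (UNIV :: ('m \<times> 'u) set)" by (simp add: finite_prod)
 then obtain W :: "('m \<times> 'u) set" where W: "countable W" "infinite W"
  using infinite_countable_subset' by blast
 have "S \<union> W \<prec> (UNIV :: 'u set)" by (rule un_small[OF inf S countable_small[OF unc W(1)]])
 moreover have "carrier (free_Abelian_group (S \<union> W)) \<approx> S \<union> W"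
  by (rule eqpoll_free_Abelian_group_infinite) (use W in simp)
 ultimately have "carrier (free_Abelian_group (S \<union> W)) \<prec> (UNIV :: 'u set)"
  using eqpoll_imp_lepoll lesspoll_trans1 by blast
 then show ?thesis by (rule subset_small[rotated]) auto
qed

lemma funcset_small:
 assumes "universe_for TYPE('u) I" "(X :: 'x set) \<prec> (UNIV :: 'u set)"
 shows "I \<rightarrow>\<^sub>E X \<prec> (UNIV :: 'u set)"
proof -
 obtain g :: "'x => 'u" where g: "inj_on g X" using assms(2) by (auto simp: lesspoll_def lepoll_def)
 have "I \<rightarrow>\<^sub>E g ` X \<prec> (UNIV :: 'u set)"
  using assms(1) image_small[OF assms(2), of g] by (simp add: universe_for_def)
 moreover have "I \<rightarrow>\<^sub>E X \<lesssim> I \<rightarrow>\<^sub>E g ` X"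
  unfolding lepoll_def
 proof (intro exI[of _ "compose I g"] conjI inj_onI)
  fix f h assume fh: "f \<in> I \<rightarrow>\<^sub>E X" "h \<in> I \<rightarrow>\<^sub>E X" "compose I g f = compose I g h"
  show "f = h"
  proof (rule PiE_ext[OF fh(1,2)])
   fix x assume x: "x \<in> I"
   then show "f x = h x"
    using fun_cong[OF fh(3), of x] inj_onD[OF g, of "f x" "h x"] PiE_mem[OF fh(1) x] PiE_mem[OF fh(2) x]
    by (simp add: compose_def)
  qed
 qed (auto simp: compose_def)
 ultimately show ?thesis using lesspoll_trans1 by blast
qed

subsection \<open>Regular modules and the injective cogenerator\<close>

definition regular :: "('r, 'p) ring_scheme => ('r, 'r, 'r) bimodule"
 where "regular R = \<lparr>carrier = carrier R, monoid.mult = undefined, one = undefined,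
  ring.zero = \<zero>\<^bsub>R\<^esub>, ring.add = ring.add R, smult = monoid.mult R, rsmult = monoid.mult R\<rparr>"

definition regular_module :: "('r, 'p) ring_scheme => ('r, 'r) module"
 where "regular_module R = module.truncate (regular R)"

lemma regular_simps [simp]:
 "carrier (regular R) = carrier R" "\<zero>\<^bsub>regular R\<^esub> = \<zero>\<^bsub>R\<^esub>" "x \<oplus>\<^bsub>regular R\<^esub> y = x \<oplus>\<^bsub>R\<^esub> y"
 "a \<odot>\<^bsub>regular R\<^esub> x = a \<otimes>\<^bsub>R\<^esub> x" "rsmult (regular R) x a = x \<otimes>\<^bsub>R\<^esub> a"
 by (simp_all add: regular_def)

lemma regular_module_simps [simp]:
 "carrier (regular_module R) = carrier R" "\<zero>\<^bsub>regular_module R\<^esub> = \<zero>\<^bsub>R\<^esub>"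
 "x \<oplus>\<^bsub>regular_module R\<^esub> y = x \<oplus>\<^bsub>R\<^esub> y" "a \<odot>\<^bsub>regular_module R\<^esub> x = a \<otimes>\<^bsub>R\<^esub> x"
 by (simp_all add: regular_module_def regular_def module.defs)

lemma bimodule_regular:
 assumes "ring R" shows "bimodule R R (regular R)"
proof -
 interpret ring R by fact
 have "left_module R (regular R)" by (rule left_moduleI)
   (auto simp: ring_axioms a_ac l_distr r_distr m_assoc intro: bexI[of _ "\<ominus>\<^bsub>R\<^esub> x" for x] l_neg r_neg)
 then show ?thesis
  by (intro bimodule.intro bimodule_axioms.intro) (auto simp: ring_axioms l_distr r_distr m_assoc)
qed

lemma lmod_regular:
 assumes "ring R" shows "left_module R (regular_module R)"
proof -
 interpret ring R by fact
 show ?thesis by (rule left_moduleI)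
   (auto simp: ring_axioms a_ac l_distr r_distr m_assoc intro: bexI[of _ "\<ominus>\<^bsub>R\<^esub> x" for x] l_neg r_neg)
qed

abbreviation "cogen R \<equiv> char_module (regular R)"

lemma lmod_cogen: "ring R ==> left_module R (cogen R)" by (rule bimodule.lmod_char_module[OF bimodule_regular])

text \<open>
 A homomorphism \<open>f\<close> into the character module of \<open>R\<close> is recovered from the character \<open>k \<mapsto> f k 1\<close>, and characters
 extend from subgroups.
\<close>

lemma ext_zero_cogen:
 assumes R: "ring R" and X: "left_module R X"
 shows "ext_zero R X (cogen R)"
 unfolding ext_zero_def
proof
 let ?F = "res0 R X" and ?K = "syzygy R X"
 interpret R: ring R by fact
 note F = lmod_res0[OF X] and K = lmod_syzygy[OF X] and C = lmod_cogen[OF R]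
 interpret F: left_module R ?F by fact
 interpret K: left_module R ?K by fact
 fix f assume f: "f \<in> mod_hom R ?K (cogen R)"
 have fc: "f k \<in> characters (regular R)" if "k \<in> carrier ?K" for k using mhom_closed[OF f that] by simp
 have Kop: "x \<oplus>\<^bsub>?F\<^esub> y = x \<oplus>\<^bsub>?K\<^esub> y" "a \<odot>\<^bsub>?F\<^esub> x = a \<odot>\<^bsub>?K\<^esub> x" for x y a by (simp_all add: syzygy_def)
 have sg: "subgroup (carrier ?K) (add_monoid ?F)"
  unfolding carrier_syzygy by (intro subgroup_submodule[OF F] submodule_hom_kernel F X mhom_augmentation)
 have "\<exists>\<chi>\<in>characters ?F. \<forall>k\<in>carrier ?K. \<chi> k = f k \<one>\<^bsub>R\<^esub>"
  by (rule F.X.character_extend[OF sg])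
   (use character_closed[OF fc] in \<open>auto simp: Kop mhom_add[OF f] simp del: free_module_simps\<close>)
 then obtain \<chi> where \<chi>: "\<chi> \<in> characters ?F" "!!k. k \<in> carrier ?K ==> \<chi> k = f k \<one>\<^bsub>R\<^esub>" by blast
 let ?g = "\<lambda>x\<in>carrier ?F. \<lambda>a\<in>carrier (regular R). \<chi> (a \<odot>\<^bsub>?F\<^esub> x)"
 have "?g \<in> mod_hom R ?F (cogen R)"
 proof (rule mhom_restrictI[OF F])
  fix x assume x: "x \<in> carrier ?F"
  show "(\<lambda>a\<in>carrier (regular R). \<chi> (a \<odot>\<^bsub>?F\<^esub> x)) \<in> carrier (cogen R)"
   using character_closed[OF \<chi>(1) F.smult_closed[OF _ x]] unfolding char_module_simps
   by (intro characterI) (auto simp: F.smult_l_distr x character_add[OF \<chi>(1)] F.smult_closed simp del: free_module_simps)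
  show "(\<lambda>a\<in>carrier (regular R). \<chi> (a \<odot>\<^bsub>?F\<^esub> (x \<oplus>\<^bsub>?F\<^esub> y))) =
    (\<lambda>a\<in>carrier (regular R). \<chi> (a \<odot>\<^bsub>?F\<^esub> x)) \<oplus>\<^bsub>cogen R\<^esub> (\<lambda>a\<in>carrier (regular R). \<chi> (a \<odot>\<^bsub>?F\<^esub> y))"
   if y: "y \<in> carrier ?F" for y
   unfolding char_module_simps
   by (rule restrict_ext) (simp add: F.smult_r_distr x y character_add[OF \<chi>(1)] F.smult_closed del: free_module_simps)
  show "(\<lambda>a\<in>carrier (regular R). \<chi> (a \<odot>\<^bsub>?F\<^esub> (b \<odot>\<^bsub>?F\<^esub> x))) =
    b \<odot>\<^bsub>cogen R\<^esub> (\<lambda>a\<in>carrier (regular R). \<chi> (a \<odot>\<^bsub>?F\<^esub> x))" if b: "b \<in> carrier R" for b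
   unfolding char_module_simps by (rule restrict_ext) (simp add: F.smult_assoc x b del: free_module_simps)
 qed
 moreover have "?g k = f k" if k: "k \<in> carrier ?K" for k
 proof -
  have "\<chi> (a \<odot>\<^bsub>?F\<^esub> k) = f k a" if a: "a \<in> carrier R" for a
   using \<chi>(2)[OF K.smult_closed[OF a k]] mhom_smult[OF f a k] a by (simp add: Kop)
  then show ?thesis
   using syzygyD(1)[OF k] by (intro trans[OF _ character_restrict[OF fc[OF k]]]) (auto intro!: restrict_ext)
 qed
 ultimately show "\<exists>g\<in>mod_hom R ?F (cogen R). \<forall>k\<in>carrier ?K. g k = f k" by blast
qed

lemma ext_zero_regular:
 fixes R :: "('r, 'p) ring_scheme" and V :: "('r, 'v, 'q) module_scheme"
 assumes R: "ring R" and V: "left_module R V"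
 shows "ext_zero R (regular_module R) V"
proof (rule ext_zeroI_split[OF V lmod_regular[OF R]])
 interpret R: ring R by fact
 note RM = lmod_regular[OF R]
 fix E :: "('r, ('v \<times> ('r => 'r)) set) module" and i p
 assume E: "left_module R E" and se: "short_exact R V E (regular_module R) i p"
 note p = short_exactD(2)[OF se]
 interpret E: left_module R E by fact
 obtain e where e: "e \<in> carrier E" "\<one>\<^bsub>R\<^esub> = p e" using short_exactD(6)[OF se, of "\<one>\<^bsub>R\<^esub>"] by auto
 have s: "(\<lambda>a\<in>carrier (regular_module R). a \<odot>\<^bsub>E\<^esub> e) \<in> mod_hom R (regular_module R) E"
  by (rule mhom_restrictI[OF RM]) (simp_all add: e E.smult_closed E.smult_l_distr E.smult_assoc)
 show "\<exists>r\<in>mod_hom R E V. \<forall>y\<in>carrier V. r (i y) = y"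
  by (rule retraction_of_section[OF V E RM se s]) (simp add: mhom_smult[OF p _ e(1)] e(2)[symmetric])
qed

lemma cogen_small:
 assumes "universe_for TYPE('u) (carrier R)"
 shows "carrier (cogen R) \<prec> (UNIV :: 'u set)"
proof -
 have "{0..<1::rat} \<prec> (UNIV :: 'u set)"
  by (rule countable_small) (use assms in \<open>simp_all add: universe_for_def\<close>)
 then have "carrier R \<rightarrow>\<^sub>E {0..<1::rat} \<prec> (UNIV :: 'u set)" by (rule funcset_small[OF assms])
 then show ?thesis by (rule subset_small[rotated]) (auto simp: characters_def)
qed

context tri
begin

section \<open>Extensions of modules in the classes \<open>\<Phi>\<close> and \<open>\<Psi>\<close>\<close>

lemma short_exact_tri_mod:
 assumes X: "left_module A X" and Y: "left_module B Y" and \<mu>: "bilinear X Y \<mu>"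
 shows "short_exact T (inc1 X) (tri_mod X Y \<mu>) (inc2 Y) (\<lambda>x\<in>carrier (inc1 X). (x, \<zero>\<^bsub>Y\<^esub>))
  (\<lambda>u\<in>carrier (tri_mod X Y \<mu>). snd u)"
proof -
 interpret X: left_module A X by fact
 interpret Y: left_module B Y by fact
 note z = bilinear_zero[OF assms] and I = lmod_inc1[OF X] and E = lmod_tri_mod[OF assms]
 have "(\<lambda>x\<in>carrier (inc1 X). (x, \<zero>\<^bsub>Y\<^esub>)) \<in> mod_hom T (inc1 X) (tri_mod X Y \<mu>)"
  by (rule mhom_restrictI[OF I]) (auto simp: z X.smult_closed)
 moreover have "(\<lambda>u\<in>carrier (tri_mod X Y \<mu>). snd u) \<in> mod_hom T (tri_mod X Y \<mu>) (inc2 Y)"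
  by (rule mhom_restrictI[OF E]) auto
 ultimately show ?thesis by (rule short_exactI[OF I E]) auto
qed

text \<open>
 The extension \<open>X \<oplus> Hom (M, X)\<close> of \<open>0 \<oplus> Hom (M, X)\<close> by \<open>X \<oplus> 0\<close> turns the vanishing of Ext into the statement
 that every \<open>N\<^sub>2 \<rightarrow> Hom (M, X)\<close> comes from some \<open>N\<^sub>1 \<rightarrow> X\<close>.
\<close>

lemma ext_zero_inc1_lift:
 assumes X: "left_module A X" and N: "left_module T N" and ext: "ext_zero T N (inc1 X)"
  and g: "g \<in> mod_hom B (Snd N) (hom_mod X)"
 shows "\<exists>f\<in>mod_hom A (Fst N) X. \<forall>m\<in>carrier M. \<forall>y\<in>carrier (Snd N). f (EM m \<odot>\<^bsub>N\<^esub> y) = g y m"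
proof -
 interpret X: left_module A X by fact
 note H = lmod_hom_mod[OF X] and C = lmod_coind[OF X]
 obtain s where s: "s \<in> mod_hom T N (coind X)"
  "\<forall>x\<in>carrier N. (\<lambda>u\<in>carrier (coind X). snd u) (s x) = (\<lambda>x\<in>carrier N. g (p2 N x)) x"
  using ext_zero_lift[OF lmod_inc1[OF X] C lmod_inc2[OF H] N
    short_exact_tri_mod[OF X H bilinear_eval[OF X]] ext hom_into_inc2[OF H N g]] by blast
 have sc: "fst (s x) \<in> carrier X" "snd (s x) \<in> mod_hom A M X" if "x \<in> carrier N" for x
  using mhom_closed[OF s(1) that] by auto
 note coind_fst_hom[OF X N s(1)]
 moreover have "fst (s (EM m \<odot>\<^bsub>N\<^esub> y)) = g y m" if m: "m \<in> carrier M" and y: "y \<in> carrier (Snd N)" for m y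
 proof -
  note y' = SndD[OF N y]
  have "snd (s y) = g y" using s(2)[rule_format, OF y'(1)] mhom_closed[OF s(1) y'(1)] y' by simp
  then show ?thesis using EM_hom[OF s(1) m y'(1)] m sc[OF y'(1)] mhom_closed[OF sc(2)[OF y'(1)] m] by simp
 qed
 ultimately show ?thesis
  using EM_in[OF N _ SndD(1)[OF N]] by (intro bexI[of _ "\<lambda>u\<in>carrier (Fst N). fst (s u)"]) (simp_all del: Fst_simps Snd_simps)
qed

text \<open>For the injective cogenerator \<open>J\<close> of \<open>A\<close>-Mod, \<open>Hom (M, J)\<close> is the character module \<open>M\<^sup>+\<close>, and \<open>phi_inj_iff\<close> applies.\<close>

lemma phi_injI:
 assumes N: "left_module T N" and ext: "ext_zero T N (inc1 (cogen A))"
 shows "phi_inj N"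
 unfolding phi_inj_iff[OF N]
proof
 fix h assume h: "h \<in> mod_hom B (Snd N) (char_module M)"
 note C = lmod_cogen[OF R.ring_axioms] and F = lmod_Fst[OF N] and S = lmod_Snd[OF N]
 interpret F: left_module A "Fst N" by (rule F)
 interpret S: left_module B "Snd N" by (rule S)
 have hc: "h y \<in> characters M" if "y \<in> carrier (Snd N)" for y using mhom_closed[OF h that] by simp
 let ?\<mu> = "\<lambda>m y. \<lambda>a\<in>carrier (regular A). h y (a \<odot>\<^bsub>M\<^esub> m)"
 have "bilinear (cogen A) (Snd N) ?\<mu>"
 proof (rule bilinearI)
  fix m y assume m: "m \<in> carrier M" and y: "y \<in> carrier (Snd N)"
  note c = hc[OF y]
  show "?\<mu> m y \<in> carrier (cogen A)"
   using character_closed[OF c smult_closed[OF _ m]] unfolding char_module_simps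
   by (intro characterI) (auto simp: smult_l_distr m character_add[OF c] smult_closed)
  show "?\<mu> (m \<oplus>\<^bsub>M\<^esub> n) y = ?\<mu> m y \<oplus>\<^bsub>cogen A\<^esub> ?\<mu> n y" if n: "n \<in> carrier M" for n
   unfolding char_module_simps
   by (rule restrict_ext) (simp add: smult_r_distr m n character_add[OF c] smult_closed)
  show "?\<mu> m (y \<oplus>\<^bsub>Snd N\<^esub> z) = ?\<mu> m y \<oplus>\<^bsub>cogen A\<^esub> ?\<mu> m z" if z: "z \<in> carrier (Snd N)" for z
   unfolding mhom_add[OF h y z] unfolding char_module_simps by (rule restrict_ext) (simp add: m smult_closed)
  show "?\<mu> (rsmult M m b) y = ?\<mu> m (b \<odot>\<^bsub>Snd N\<^esub> y)" if b: "b \<in> carrier B" for b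
   unfolding mhom_smult[OF h b y] unfolding char_module_simps
   by (rule restrict_ext) (simp add: m b smult_closed smult_rsmult)
  show "?\<mu> (a \<odot>\<^bsub>M\<^esub> m) y = a \<odot>\<^bsub>cogen A\<^esub> ?\<mu> m y" if a: "a \<in> carrier A" for a
   unfolding char_module_simps by (rule restrict_ext) (simp add: m a smult_assoc)
 qed
 from ext_zero_inc1_lift[OF C N ext bilinear_adjoint[OF C S this]]
 obtain f where f: "f \<in> mod_hom A (Fst N) (cogen A)"
  "!!m y. [|m \<in> carrier M; y \<in> carrier (Snd N)|] ==> f (EM m \<odot>\<^bsub>N\<^esub> y) = ?\<mu> m y"
  by (auto simp del: Fst_simps Snd_simps)
 have fc: "f u \<in> characters (regular A)" if "u \<in> carrier (Fst N)" for u using mhom_closed[OF f(1) that] by simp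
 have "(\<lambda>u\<in>carrier (Fst N). f u \<one>\<^bsub>A\<^esub>) \<in> characters (Fst N)"
  using character_closed[OF fc] mhom_add[OF f(1)] F.X.add.m_closed
  by (intro characterI) (simp_all del: Fst_simps)
 moreover have "f (EM m \<odot>\<^bsub>N\<^esub> y) \<one>\<^bsub>A\<^esub> = h y m" if "m \<in> carrier M" "y \<in> carrier (Snd N)" for m y
  using f(2)[OF that] that(1) by (simp add: smult_one)
 ultimately show "\<exists>\<chi>\<in>characters (Fst N). \<forall>m\<in>carrier M. \<forall>y\<in>carrier (Snd N). \<chi> (EM m \<odot>\<^bsub>N\<^esub> y) = h y m"
  using EM_in[OF N _ SndD(1)[OF N]]
  by (intro bexI[of _ "\<lambda>u\<in>carrier (Fst N). f u \<one>\<^bsub>A\<^esub>"]) (simp_all del: Fst_simps Snd_simps)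
qed

lemma phi_image_least:
 assumes N: "left_module T N" and H: "submodule_of A (Fst N) H"
  and gen: "!!m y. [|m \<in> carrier M; y \<in> carrier (Snd N)|] ==> EM m \<odot>\<^bsub>N\<^esub> y \<in> H"
 shows "phi_image N \<subseteq> H"
proof (rule subsetI, rule ccontr)
 fix u assume u: "u \<in> phi_image N" "u \<notin> H"
 interpret F: left_module A "Fst N" by (rule lmod_Fst[OF N])
 have "\<exists>\<chi>\<in>characters (Fst N). \<chi> u \<noteq> 0 \<and> (\<forall>y\<in>H. \<chi> y = 0)"
  using F.X.character_separate[OF subgroup_submodule[OF F.left_module_axioms H] phi_imageD[OF N u(1)] u(2)] .
 then obtain \<chi> where \<chi>: "\<chi> \<in> characters (Fst N)" "\<chi> u \<noteq> 0" "!!y. y \<in> H ==> \<chi> y = 0" by blast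
 have "(\<lambda>u\<in>carrier (Fst N). 0) \<in> characters (Fst N)" by (intro characterI F.X.a_closed) simp_all
 then have "\<chi> u = (\<lambda>u\<in>carrier (Fst N). 0) u"
 proof (rule character_phi_image_eq[OF N \<chi>(1) _ _ u(1)])
  fix m y assume "m \<in> carrier M" "y \<in> carrier (Snd N)"
  then show "\<chi> (EM m \<odot>\<^bsub>N\<^esub> y) = (\<lambda>u\<in>carrier (Fst N). 0) (EM m \<odot>\<^bsub>N\<^esub> y)"
   using \<chi>(3)[OF gen] EM_in[OF N _ SndD(1)[OF N]] by (simp del: Fst_simps Snd_simps)
 qed
 then show False using \<chi>(2) phi_imageD[OF N u(1)] by (simp del: Fst_simps)
qed

text \<open>A map to a module \<open>C\<close> in the universe that exhibits it as the cokernel of \<open>\<phi>\<close>.\<close>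

definition cokernel_map :: "('a \<times> 'm \<times> 'b, 'n) module => ('a, 'c) module => ('n => 'c) => bool"
 where "cokernel_map N C q \<longleftrightarrow> q \<in> mod_hom A (Fst N) C \<and> q ` carrier (Fst N) = carrier C \<and>
  (\<forall>u\<in>carrier (Fst N). q u = \<zero>\<^bsub>C\<^esub> \<longleftrightarrow> u \<in> phi_image N)"

lemma short_exact_cokernel:
 assumes "left_module T N" "left_module A C" "cokernel_map N C q"
 shows "short_exact T (gen_sub N) N (inc1 C) (\<lambda>x\<in>carrier (gen_sub N). x) (\<lambda>x\<in>carrier N. q (p1 N x))"
 using assms(3) unfolding cokernel_map_def by (intro short_exact_gen_sub assms(1,2)) blast+

lemma Phi_class_iff:
 fixes N :: "('a \<times> 'm \<times> 'b, 'u) module"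
 assumes "\<C> \<subseteq> Mod_cat A"
 shows "N \<in> Phi_class A B M \<C> \<D> \<longleftrightarrow>
  N \<in> Mod_cat T \<and> phi_inj N \<and> Snd N \<in> \<D> \<and> (\<exists>C\<in>\<C>. \<exists>q. cokernel_map N C q)"
proof -
 have "mod_iso A (quotient_module (Fst N) (phi_image N)) C \<longleftrightarrow> (\<exists>q. cokernel_map N C q)"
  if "N \<in> Mod_cat T" "C \<in> \<C>" for C
  unfolding cokernel_map_def
  using hom_quotient_iff[OF lmod_Fst submodule_phi_image Mod_catD, OF Mod_catD Mod_catD, OF that(1) that(1)] that(2) assms
  by (meson subsetD)
 then show ?thesis
  unfolding Phi_class_def phi_inj_def phi_image_def[symmetric] by auto
qed

text \<open>The module \<open>N\<close> is an extension of \<open>C \<oplus> 0\<close> by an induced module.\<close>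

theorem ext_zero_Phi:
 assumes N: "left_module T N" and V: "left_module T V" and C: "left_module A C"
  and q: "cokernel_map N C q" and inj: "phi_inj N"
  and ext: "ext_zero A C (Fst V)" "ext_zero B (Snd N) (Snd V)"
 shows "ext_zero T N V" using ext(1) unfolding ext_zero_inc1[OF C V, symmetric]
 by (rule ext_zero_extension_left[OF lmod_gen_sub[OF N] N lmod_inc1[OF C] V
    short_exact_cokernel[OF N C q] ext_zero_gen_sub[OF N V inj ext(2)]])

lemma lmod_ind: "left_module B Y ==> left_module T (ind Y)" by (rule lmod_tri_mod[OF lmod_Ten _ bilinear_pure])

context
 fixes Y :: "('b, 'y) module"
 assumes Y: "left_module B Y"
begin

lemma Snd_ind: "carrier (Snd (ind Y)) = {\<zero>\<^bsub>Ten Y\<^esub>} \<times> carrier Y"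
proof -
 interpret Y: left_module B Y by (rule Y)
 note z = bilinear_zero(1)[OF lmod_Ten[OF Y] Y bilinear_pure[OF Y]]
 interpret TY: left_module A "Ten Y" by (rule lmod_Ten[OF Y])
 have e: "p2 (ind Y) (t, y) = (\<zero>\<^bsub>Ten Y\<^esub>, y)" if "t \<in> carrier (Ten Y)" "y \<in> carrier Y" for t y
  using that z by (simp add: Y.smult_one)
 show ?thesis
 proof (intro equalityI subsetI)
  fix x assume x: "x \<in> carrier (Snd (ind Y))"
  obtain t y where ty: "x = (t, y)" by (cases x)
  then have c: "t \<in> carrier (Ten Y)" "y \<in> carrier Y" using SndD(1)[OF lmod_ind[OF Y] x] by simp_all
  show "x \<in> {\<zero>\<^bsub>Ten Y\<^esub>} \<times> carrier Y"
   using SndD(2)[OF lmod_ind[OF Y] x] unfolding ty e[OF c] using c(2) by blast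
 next
  fix x assume "x \<in> {\<zero>\<^bsub>Ten Y\<^esub>} \<times> carrier Y"
  then obtain y where y: "x = (\<zero>\<^bsub>Ten Y\<^esub>, y)" "y \<in> carrier Y" by blast
  show "x \<in> carrier (Snd (ind Y))"
   unfolding Snd_iff[OF lmod_ind[OF Y]] y(1) e[OF TY.X.zero_closed y(2)] using y(2) by simp
 qed
qed

lemma ind_unit: "(\<lambda>y\<in>carrier Y. (\<zero>\<^bsub>Ten Y\<^esub>, y)) \<in> mod_hom B Y (Snd (ind Y))"
 "bij_betw (\<lambda>y\<in>carrier Y. (\<zero>\<^bsub>Ten Y\<^esub>, y)) (carrier Y) (carrier (Snd (ind Y)))"
proof -
 interpret Y: left_module B Y by (rule Y)
 note TY = lmod_Ten[OF Y]
 interpret TY: left_module A "Ten Y" by (rule TY)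
 show "(\<lambda>y\<in>carrier Y. (\<zero>\<^bsub>Ten Y\<^esub>, y)) \<in> mod_hom B Y (Snd (ind Y))"
  by (rule mhom_restrictI[OF Y])
   (simp_all add: Snd_ind bilinear_zero(1)[OF TY Y bilinear_pure[OF Y]] del: Snd_simps(1))
 show "bij_betw (\<lambda>y\<in>carrier Y. (\<zero>\<^bsub>Ten Y\<^esub>, y)) (carrier Y) (carrier (Snd (ind Y)))"
  unfolding Snd_ind by (auto simp: bij_betw_def inj_on_def)
qed

lemma EM_ind:
 assumes "m \<in> carrier M" "y \<in> carrier Y"
 shows "EM m \<odot>\<^bsub>ind Y\<^esub> (\<zero>\<^bsub>Ten Y\<^esub>, y) = (pur Y m y, \<zero>\<^bsub>Y\<^esub>)"
proof -
 interpret Y: left_module B Y by (rule Y)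
 interpret TY: left_module A "Ten Y" by (rule lmod_Ten[OF Y])
 show ?thesis using bilinearD(1)[OF bilinear_pure[OF Y] assms] assms by simp
qed

lemma phi_inj_ind: "phi_inj (ind Y)"
 unfolding phi_inj_iff[OF lmod_ind[OF Y]]
proof
 note L = lmod_ind[OF Y]
 interpret FL: left_module A "Fst (ind Y)" by (rule lmod_Fst[OF L])
 fix h assume h: "h \<in> mod_hom B (Snd (ind Y)) (char_module M)"
 obtain \<xi> where \<xi>: "\<xi> \<in> characters (Ten Y)"
  "!!m y. [|m \<in> carrier M; y \<in> carrier Y|] ==> \<xi> (pur Y m y) = h (\<zero>\<^bsub>Ten Y\<^esub>, y) m"
  using tensor_context.pairing_character[OF tensor_contextI[OF Y] mhom_compose[OF Y ind_unit(1) h]]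
  by (auto simp: compose_def)
 have c: "fst u \<in> carrier (Ten Y)" if "u \<in> carrier (Fst (ind Y))" for u using FstD(1)[OF L that] by auto
 have "(\<lambda>u\<in>carrier (Fst (ind Y)). \<xi> (fst u)) \<in> characters (Fst (ind Y))"
  using character_closed[OF \<xi>(1) c] character_add[OF \<xi>(1) c c] FL.X.add.m_closed
  by (intro characterI) (simp_all del: Fst_simps(1))
 moreover have "\<xi> (fst (EM m \<odot>\<^bsub>ind Y\<^esub> y)) = h y m" if m: "m \<in> carrier M" and y: "y \<in> carrier (Snd (ind Y))" for m y
 proof -
  obtain y' where "y = (\<zero>\<^bsub>Ten Y\<^esub>, y')" "y' \<in> carrier Y" using y unfolding Snd_ind by blast
  then show ?thesis using EM_ind[OF m] \<xi>(2)[OF m] by simp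
 qed
 ultimately show "\<exists>\<chi>\<in>characters (Fst (ind Y)). \<forall>m\<in>carrier M. \<forall>y\<in>carrier (Snd (ind Y)). \<chi> (EM m \<odot>\<^bsub>ind Y\<^esub> y) = h y m"
  using EM_in[OF L _ SndD(1)[OF L]]
  by (intro bexI[of _ "\<lambda>u\<in>carrier (Fst (ind Y)). \<xi> (fst u)"]) (simp_all del: Fst_simps Snd_simps tri_mod_simps)
qed

text \<open>
 Both \<open>t \<mapsto> (t, 0)\<close> and the composite of \<open>\<phi>\<close> with the isomorphism from \<open>M \<otimes> Y\<close> to the tensor product of \<open>M\<close> and the
 second component are homomorphisms, and they agree on pure tensors.
\<close>

lemma phi_image_ind: "phi_image (ind Y) = carrier (Fst (ind Y))"
proof (intro equalityI subsetI)
 note L = lmod_ind[OF Y] and TY = lmod_Ten[OF Y]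
 show "u \<in> carrier (Fst (ind Y))" if "u \<in> phi_image (ind Y)" for u by (rule phi_imageD[OF L that])
 fix u assume u: "u \<in> carrier (Fst (ind Y))"
 let ?S = "Snd (ind Y)" and ?e = "\<lambda>y\<in>carrier Y. (\<zero>\<^bsub>Ten Y\<^esub>, y)"
 note S = lmod_Snd[OF L]
 note cY = tensor_contextI[OF Y] and cS = tensor_contextI[OF S]
 note m = mhom_tensor_map[OF cY cS ind_unit(1)]
 have i: "(\<lambda>t\<in>carrier (Ten Y). (t, \<zero>\<^bsub>Y\<^esub>)) \<in> mod_hom A (Ten Y) (Fst (ind Y))"
  using short_exactD(1)[OF short_exact_tri_mod[OF TY Y bilinear_pure[OF Y]]] unfolding hom_inc1[OF TY L] by simp
 obtain t where t: "t \<in> carrier (Ten Y)" "u = (t, \<zero>\<^bsub>Y\<^esub>)"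
  using FstD(1)[OF L u] p2_Fst[OF L u] left_module.smult_one[OF Y] by (cases u) auto
 have "(\<lambda>t\<in>carrier (Ten Y). (t, \<zero>\<^bsub>Y\<^esub>)) t = compose (carrier (Ten Y)) (phi (ind Y)) (tensor_map B M Y ?S ?e) t"
 proof (rule tensor_hom_eq[OF Y lmod_Fst[OF L] i mhom_compose[OF TY m phi_hom[OF L]] _ t(1)])
  fix n y assume n: "n \<in> carrier M" "y \<in> carrier Y"
  have "phi (ind Y) (pur ?S n (\<zero>\<^bsub>Ten Y\<^esub>, y)) = (pur Y n y, \<zero>\<^bsub>Y\<^esub>)"
   using phi_pure[OF L n(1), of "(\<zero>\<^bsub>Ten Y\<^esub>, y)"] n(2) EM_ind[OF n] unfolding Snd_ind by simp
  then show "(\<lambda>t\<in>carrier (Ten Y). (t, \<zero>\<^bsub>Y\<^esub>)) (pur Y n y) =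
    compose (carrier (Ten Y)) (phi (ind Y)) (tensor_map B M Y ?S ?e) (pur Y n y)"
   using tensor_map_pt[OF cY cS ind_unit(1) n] n bilinearD(1)[OF bilinear_pure[OF Y] n] by (simp add: compose_def)
 qed
 then have "u = phi (ind Y) (tensor_map B M Y ?S ?e t)" using t by (simp add: compose_def)
 then show "u \<in> phi_image (ind Y)" using mhom_closed[OF m t(1)] unfolding phi_image_def by blast
qed

lemma gen_sub_ind: "gen_sub (ind Y) = ind Y"
 using p1_in[OF lmod_ind[OF Y]] unfolding gen_sub_def[OF lmod_ind[OF Y]] phi_image_ind
 by (simp del: Fst_simps tri_mod_simps cong: conj_cong)

theorem ext_zero_indI:
 fixes V :: "('a \<times> 'm \<times> 'b, 'v) module"
 assumes V: "left_module T V" and ext: "ext_zero B Y (Snd V)"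
 shows "ext_zero T (ind Y) V"
proof -
 note L = lmod_ind[OF Y]
 have "ext_zero B (Snd (ind Y)) (Snd V)"
  by (rule ext_zero_iso_left[OF Y lmod_Snd[OF L] lmod_Snd[OF V] ind_unit ext])
 from ext_zero_gen_sub[OF L V phi_inj_ind this] show ?thesis unfolding gen_sub_ind .
qed

end

text \<open>Homomorphisms from the submodule generated by \<open>N\<^sub>2\<close> to \<open>X \<oplus> 0\<close> are zero and hence extend to \<open>N\<close>.\<close>

lemma ext_zero_cokernel:
 assumes N: "left_module T N" and C: "left_module A C" and X: "left_module A X"
  and q: "cokernel_map N C q" and ext: "ext_zero T N (inc1 X)"
 shows "ext_zero A C X"
proof -
 note I = lmod_inc1[OF X]
 have "ext_zero T (inc1 C) (inc1 X)"
 proof (rule ext_zero_quotient[OF lmod_gen_sub[OF N] N lmod_inc1[OF C] I short_exact_cokernel[OF N C q] ext])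
  fix f assume f: "f \<in> mod_hom T (gen_sub N) (inc1 X)"
  interpret X: left_module A X by fact
  have "(\<lambda>x\<in>carrier N. \<zero>\<^bsub>inc1 X\<^esub>) \<in> mod_hom T N (inc1 X)"
   by (rule mhom_restrictI[OF N]) (auto)
  then show "\<exists>g\<in>mod_hom T N (inc1 X). \<forall>x\<in>carrier (gen_sub N). g ((\<lambda>x\<in>carrier (gen_sub N). x) x) = f x"
   using hom_gen_sub_inc1[OF N X f] by (intro bexI) (auto simp: gen_sub_mem[OF N])
 qed
 then show ?thesis unfolding ext_zero_inc1[OF C I] Fst_inc1[OF X] .
qed

abbreviation "psi \<equiv> tri_psi A B M"
abbreviation "psi_ker N \<equiv> sub_module (Snd N) (hom_kernel (Snd N) (hom_mod (Fst N)) (psi N))"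
abbreviation "psi_onto N \<equiv> psi N ` carrier (Snd N) = mod_hom A M (Fst N)"

lemma Psi_class_iff:
 "N \<in> Psi_class A B M \<C> \<D> \<longleftrightarrow> N \<in> Mod_cat T \<and> psi_onto N \<and> Fst N \<in> \<C> \<and> psi_ker N \<in> \<D>"
 by (simp add: Psi_class_def hom_kernel_def)

context
 fixes N :: "('a \<times> 'm \<times> 'b, 'n) module"
 assumes N: "left_module T N"
begin

lemma psi_eq: "psi N = (\<lambda>y\<in>carrier (Snd N). \<lambda>m\<in>carrier M. EM m \<odot>\<^bsub>N\<^esub> y)"
 unfolding tri_psi_def by (intro restrict_ext) (simp add: phi_pure[OF N] del: Snd_simps)

lemma psi_app: "[|y \<in> carrier (Snd N); m \<in> carrier M|] ==> psi N y m = EM m \<odot>\<^bsub>N\<^esub> y"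
 by (simp add: psi_eq del: Snd_simps)

lemma psi_hom: "psi N \<in> mod_hom B (Snd N) (hom_mod (Fst N))"
 unfolding psi_eq by (rule bilinear_adjoint[OF lmod_Fst[OF N] lmod_Snd[OF N] bilinear_T[OF N]])

lemma psi_ontoI:
 assumes "!!g. g \<in> mod_hom A M (Fst N) ==> \<exists>y\<in>carrier (Snd N). \<forall>m\<in>carrier M. EM m \<odot>\<^bsub>N\<^esub> y = g m"
 shows "psi_onto N"
proof
 show "psi N ` carrier (Snd N) \<subseteq> mod_hom A M (Fst N)" using mhom_closed[OF psi_hom] by auto
 show "mod_hom A M (Fst N) \<subseteq> psi N ` carrier (Snd N)"
 proof
  fix g assume g: "g \<in> mod_hom A M (Fst N)"
  then obtain y where y: "y \<in> carrier (Snd N)" "!!m. m \<in> carrier M ==> EM m \<odot>\<^bsub>N\<^esub> y = g m" using assms by blast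
  have "psi N y \<in> mod_hom A M (Fst N)" using mhom_closed[OF psi_hom y(1)] by simp
  then have "psi N y = g" by (rule mhom_eqI[OF _ g]) (simp add: psi_app[OF y(1)] y(2))
  then show "g \<in> psi N ` carrier (Snd N)" using y(1) by blast
 qed
qed

lemma psi_ker_iff: "y \<in> carrier (psi_ker N) \<longleftrightarrow> y \<in> carrier (Snd N) \<and> (\<forall>m\<in>carrier M. EM m \<odot>\<^bsub>N\<^esub> y = \<zero>\<^bsub>N\<^esub>)"
proof -
 have "psi N y = (\<lambda>m\<in>carrier M. \<zero>\<^bsub>N\<^esub>) \<longleftrightarrow> (\<forall>m\<in>carrier M. EM m \<odot>\<^bsub>N\<^esub> y = \<zero>\<^bsub>N\<^esub>)"
  if "y \<in> carrier (Snd N)" using that by (auto simp: psi_eq restrict_def fun_eq_iff simp del: Snd_simps)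
 then show ?thesis by (auto simp: hom_kernel_def simp del: Snd_simps(1))
qed

lemma lmod_psi_ker: "left_module B (psi_ker N)"
 by (rule lmod_sub[OF lmod_Snd[OF N] submodule_hom_kernel[OF lmod_Snd[OF N]
    lmod_hom_mod[OF lmod_Fst[OF N]] psi_hom]])

text \<open>If \<open>\<psi>\<close> is onto, so is the unit \<open>N \<rightarrow> N\<^sub>1 \<oplus> Hom (M, N\<^sub>1)\<close>, and its kernel is \<open>0 \<oplus> ker \<psi>\<close>.\<close>

lemma short_exact_psi:
 assumes onto: "psi_onto N"
 shows "short_exact T (inc2 (psi_ker N)) N (coind (Fst N)) (\<lambda>y\<in>carrier (inc2 (psi_ker N)). y)
  (\<lambda>x\<in>carrier N. ((\<lambda>u\<in>carrier (Fst N). u) (p1 N x), psi N (p2 N x)))"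
proof -
 note F = lmod_Fst[OF N] and K = lmod_psi_ker
 interpret N: left_module T N by (rule N)
 have i: "(\<lambda>y\<in>carrier (psi_ker N). y) \<in> mod_hom B (psi_ker N) (Snd N)"
  by (rule mhom_restrictI[OF K]) (simp_all add: hom_kernel_def)
 have "(\<lambda>y\<in>carrier (psi_ker N). y) \<in> mod_hom T (inc2 (psi_ker N)) N"
  by (rule hom_from_inc2[OF K N i]) (use psi_ker_iff in simp)
 then have i': "(\<lambda>y\<in>carrier (inc2 (psi_ker N)). y) \<in> mod_hom T (inc2 (psi_ker N)) N" by simp
 have p: "(\<lambda>x\<in>carrier N. ((\<lambda>u\<in>carrier (Fst N). u) (p1 N x), psi N (p2 N x))) \<in> mod_hom T N (coind (Fst N))"
  by (rule hom_into_tri_mod[OF F lmod_hom_mod[OF F] bilinear_eval[OF F] N mhom_id[OF F] psi_hom])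
   (use EM_in[OF N _ SndD(1)[OF N]] in \<open>simp add: psi_app del: Fst_simps Snd_simps\<close>)
 show ?thesis
 proof (rule short_exactI[OF lmod_inc2[OF K] N i' p])
  fix y assume "y \<in> carrier (inc2 (psi_ker N))"
  then have y: "y \<in> carrier (psi_ker N)" by simp
  then have y': "y \<in> carrier (Snd N)" and y0: "psi N y = (\<lambda>m\<in>carrier M. \<zero>\<^bsub>N\<^esub>)"
   by (simp_all add: hom_kernel_def)
  show "(\<lambda>x\<in>carrier N. ((\<lambda>u\<in>carrier (Fst N). u) (p1 N x), psi N (p2 N x)))
    ((\<lambda>y\<in>carrier (inc2 (psi_ker N)). y) y) = \<zero>\<^bsub>coind (Fst N)\<^esub>"
   using y y0 SndD[OF N y'] p1_Snd[OF N y'] p1_in[OF N SndD(1)[OF N y']] by (simp del: Fst_simps(1))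
 next
  fix x assume x: "x \<in> carrier N" and z: "(\<lambda>x\<in>carrier N. ((\<lambda>u\<in>carrier (Fst N). u) (p1 N x), psi N (p2 N x))) x = \<zero>\<^bsub>coind (Fst N)\<^esub>"
  have "p1 N x = \<zero>\<^bsub>N\<^esub>" "psi N (p2 N x) = (\<lambda>m\<in>carrier M. \<zero>\<^bsub>N\<^esub>)"
   using z x p1_in[OF N x] by (simp_all del: Fst_simps(1))
  moreover from this have "p2 N x = x" using peirce[OF N x] p2_in[OF N x] SndD(1)[OF N] by (metis N.X.l_zero)
  ultimately have "x \<in> carrier (psi_ker N)" using p2_in[OF N x] by (simp add: hom_kernel_def del: Snd_simps(1))
  then show "\<exists>y\<in>carrier (inc2 (psi_ker N)). x = (\<lambda>y\<in>carrier (inc2 (psi_ker N)). y) y" by auto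
 next
  fix z assume "z \<in> carrier (coind (Fst N))"
  then obtain u g where z: "z = (u, g)" "u \<in> carrier (Fst N)" "g \<in> mod_hom A M (Fst N)" by (auto simp del: Fst_simps(1))
  obtain y where y: "y \<in> carrier (Snd N)" "g = psi N y" using z(3) unfolding onto[symmetric] by (elim imageE)
  note u' = FstD[OF N z(2)] and y' = SndD[OF N y(1)]
  have "p1 N (u \<oplus>\<^bsub>N\<^esub> y) = u" "p2 N (u \<oplus>\<^bsub>N\<^esub> y) = y"
   using u' y' p1_Snd[OF N y(1)] p2_Fst[OF N z(2)] by (simp_all add: T_smult_distr[OF N])
  then show "\<exists>x\<in>carrier N. z = (\<lambda>x\<in>carrier N. ((\<lambda>u\<in>carrier (Fst N). u) (p1 N x), psi N (p2 N x))) x"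
   using u'(1) y'(1) z(1,2) y(2) by (intro bexI[of _ "u \<oplus>\<^bsub>N\<^esub> y"]) (simp_all del: Fst_simps(1))
 qed auto
qed

theorem ext_zero_Psi:
 fixes V :: "('a \<times> 'm \<times> 'b, 'v) module"
 assumes V: "left_module T V" and onto: "psi_onto N"
  and ext: "ext_zero A (Fst V) (Fst N)" "ext_zero B (Snd V) (psi_ker N)"
 shows "ext_zero T V N"
proof (rule ext_zero_extension_right[OF _ N _ V short_exact_psi[OF onto]])
 note F = lmod_Fst[OF N] and K = lmod_psi_ker
 show "left_module T (inc2 (psi_ker N))" "left_module T (coind (Fst N))"
  by (intro lmod_inc2[OF K] lmod_coind[OF F])+
 show "ext_zero T V (inc2 (psi_ker N))" unfolding ext_zero_inc2[OF K V] by fact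
 show "ext_zero T V (coind (Fst N))" by (rule ext_zero_coindI[OF F V ext(1)])
qed

text \<open>Homomorphisms from \<open>0 \<oplus> Y\<close> to the coinduced module are zero and hence lift to \<open>N\<close>.\<close>

lemma ext_zero_psi_ker:
 fixes Y :: "('b, 'y) module"
 assumes onto: "psi_onto N" and Y: "left_module B Y" and ext: "ext_zero T (inc2 Y) N"
 shows "ext_zero B Y (psi_ker N)"
proof -
 note F = lmod_Fst[OF N] and K = lmod_psi_ker and I = lmod_inc2[OF Y]
 have "ext_zero T (inc2 Y) (inc2 (psi_ker N))"
 proof (rule ext_zero_submodule[OF lmod_inc2[OF K] N lmod_coind[OF F] I short_exact_psi[OF onto] ext])
  fix h assume h: "h \<in> mod_hom T (inc2 Y) (coind (Fst N))"
  interpret F: left_module A "Fst N" by (rule F)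
  interpret N: left_module T N by (rule N)
  note C = lmod_coind[OF F]
  have "h y = \<zero>\<^bsub>coind (Fst N)\<^esub>" if y: "y \<in> carrier (inc2 Y)" for y
  proof -
   have "h y = (\<lambda>y\<in>carrier (inc2 Y). \<zero>\<^bsub>coind (Fst N)\<^esub>) y"
   proof (rule coind_hom_eq[OF F I h mhom_zero_map[OF I C] _ y])
    fix u assume "u \<in> carrier (Fst (inc2 Y))"
    then have "u = \<zero>\<^bsub>inc2 Y\<^esub>" "u \<in> carrier (inc2 Y)" using Fst_inc2[OF Y] FstD(1)[OF I] by simp_all
    then show "fst (h u) = fst ((\<lambda>y\<in>carrier (inc2 Y). \<zero>\<^bsub>coind (Fst N)\<^esub>) u)"
     using mhom_zero[OF I C h] by simp
   qed
   then show ?thesis using y by simp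
  qed
  moreover have "(\<lambda>y\<in>carrier (inc2 Y). \<zero>\<^bsub>N\<^esub>) \<in> mod_hom T (inc2 Y) N"
   by (rule mhom_restrictI[OF I]) auto
  moreover have "p1 N \<zero>\<^bsub>N\<^esub> = \<zero>\<^bsub>N\<^esub>" "p2 N \<zero>\<^bsub>N\<^esub> = \<zero>\<^bsub>N\<^esub>" by (simp_all add: T_smult_zero[OF N])
  moreover have "psi N \<zero>\<^bsub>N\<^esub> = (\<lambda>m\<in>carrier M. \<zero>\<^bsub>N\<^esub>)"
   using mhom_zero[OF lmod_Snd[OF N] lmod_hom_mod[OF F] psi_hom] by simp
  moreover have "\<zero>\<^bsub>N\<^esub> \<in> carrier (Fst N)" using F.X.zero_closed by (simp del: Fst_simps(1))
  ultimately show "\<exists>w\<in>mod_hom T (inc2 Y) N. \<forall>y\<in>carrier (inc2 Y).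
    (\<lambda>x\<in>carrier N. ((\<lambda>u\<in>carrier (Fst N). u) (p1 N x), psi N (p2 N x))) (w y) = h y"
   by (intro bexI[of _ "\<lambda>y\<in>carrier (inc2 Y). \<zero>\<^bsub>N\<^esub>"]) (simp_all del: Fst_simps(1))
 qed
 then show ?thesis unfolding ext_zero_inc2[OF K I] Snd_inc2[OF Y] .
qed

text \<open>
 The module \<open>M \<otimes> B \<oplus> B\<close> is an extension of \<open>0 \<oplus> B\<close> by \<open>M \<otimes> B \<oplus> 0\<close>. A homomorphism \<open>M \<cong> M \<otimes> B \<rightarrow> N\<^sub>1\<close> extends
 to it, and the image of \<open>(0, 1)\<close> is then a preimage under \<open>\<psi>\<close>.
\<close>

lemma psi_ontoI_regular:
 assumes ext: "ext_zero T (inc2 (regular_module B)) N"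
 shows "psi_onto N"
proof (rule psi_ontoI)
 fix g assume g: "g \<in> mod_hom A M (Fst N)"
 let ?B = "regular_module B"
 note BB = lmod_regular[OF B.ring_axioms] and F = lmod_Fst[OF N]
 interpret F: left_module A "Fst N" by (rule F)
 interpret BB: left_module B ?B by (rule BB)
 note Te = lmod_Ten[OF BB] and I = lmod_ind[OF BB]
 interpret Te: left_module A "Ten ?B" by (rule Te)
 have "bilinear (Fst N) ?B (\<lambda>m b. g (rsmult M m b))"
  by (rule bilinearI) (simp_all add: mhom_closed[OF g] mhom_add[OF g] mhom_smult[OF g] rsmult_closed
    rsmult_l_distr rsmult_r_distr rsmult_assoc smult_rsmult smult_closed del: Fst_simps)
 note l = bilinear_lift[OF BB F this]
 let ?l = "tensor_lift B M ?B (Fst N) (\<lambda>m b. g (rsmult M m b))"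
 have "?l \<in> mod_hom T (inc1 (Ten ?B)) N" unfolding hom_inc1[OF Te N] by (rule l(1))
 from ext_zero_extend[OF lmod_inc1[OF Te] I lmod_inc2[OF BB] N
   short_exact_tri_mod[OF Te BB bilinear_pure[OF BB]] ext this]
 obtain r where r: "r \<in> mod_hom T (ind ?B) N" "!!t. t \<in> carrier (Ten ?B) ==> r (t, \<zero>\<^bsub>B\<^esub>) = ?l t"
  by auto
 let ?e = "(\<zero>\<^bsub>Ten ?B\<^esub>, \<one>\<^bsub>B\<^esub>)"
 have e: "?e \<in> carrier (ind ?B)" by simp
 have e2: "p2 (ind ?B) ?e = ?e"
  using bilinear_zero(1)[OF Te BB bilinear_pure[OF BB], of "\<one>\<^bsub>B\<^esub>"] Te.X.zero_closed by simp
 have re: "r ?e \<in> carrier (Snd N)"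
  unfolding Snd_iff[OF N] using mhom_closed[OF r(1) e] p2_hom[OF r(1) e] e2 by simp
 moreover have "EM m \<odot>\<^bsub>N\<^esub> r ?e = g m" if m: "m \<in> carrier M" for m
 proof -
  have pc: "pur ?B m \<one>\<^bsub>B\<^esub> \<in> carrier (Ten ?B)" by (rule bilinearD(1)[OF bilinear_pure[OF BB] m]) simp
  have "EM m \<odot>\<^bsub>N\<^esub> r ?e = r (EM m \<odot>\<^bsub>ind ?B\<^esub> ?e)" by (rule EM_hom[OF r(1) m e, symmetric])
  also have "\<dots> = r (pur ?B m \<one>\<^bsub>B\<^esub>, \<zero>\<^bsub>B\<^esub>)" using pc by simp
  also have "\<dots> = g m" using r(2)[OF pc] l(2)[OF m, of "\<one>\<^bsub>B\<^esub>"] m by (simp add: rsmult_one)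
  finally show ?thesis .
 qed
 ultimately show "\<exists>y\<in>carrier (Snd N). \<forall>m\<in>carrier M. EM m \<odot>\<^bsub>N\<^esub> y = g m" by blast
qed

end

section \<open>Closure properties of the three classes\<close>

lemma phi_image_map:
 assumes N: "left_module T N" and V: "left_module T V" and f: "f \<in> mod_hom T N V"
  and u: "u \<in> phi_image N"
 shows "f u \<in> phi_image V"
proof -
 note fN = T_hom_Fst[OF N f] and FD = FstD(1)[OF N]
 note p = submodule_phi_image[OF V, unfolded submodule_of_def]
 interpret F: left_module A "Fst N" by (rule lmod_Fst[OF N])
 have c: "x \<in> carrier (Fst N) ==> f x \<in> carrier (Fst V)" for x
  using mhom_closed[OF fN] by (simp del: Fst_simps)
 have "submodule_of A (Fst N) {u \<in> carrier (Fst N). f u \<in> phi_image V}"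
  unfolding submodule_of_def
 proof (intro conjI ballI CollectI)
  show "\<zero>\<^bsub>Fst N\<^esub> \<in> carrier (Fst N)" by (rule F.X.zero_closed)
  show "f \<zero>\<^bsub>Fst N\<^esub> \<in> phi_image V" using mhom_zero[OF N V f] p by simp
 next
  fix x y assume "x \<in> {u \<in> carrier (Fst N). f u \<in> phi_image V}" "y \<in> {u \<in> carrier (Fst N). f u \<in> phi_image V}"
  then show "x \<oplus>\<^bsub>Fst N\<^esub> y \<in> carrier (Fst N)" "f (x \<oplus>\<^bsub>Fst N\<^esub> y) \<in> phi_image V"
   using mhom_add[OF f FD FD, of x y] p F.X.a_closed[of x y] by (auto simp del: Fst_simps(1))
 next
  fix a x assume "a \<in> carrier A" "x \<in> {u \<in> carrier (Fst N). f u \<in> phi_image V}"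
  then show "a \<odot>\<^bsub>Fst N\<^esub> x \<in> carrier (Fst N)" "f (a \<odot>\<^bsub>Fst N\<^esub> x) \<in> phi_image V"
   using mhom_smult[OF f _ FD, of "E1 a" x] p F.smult_closed[of a x] by (auto simp del: Fst_simps(1))
 qed auto
 from phi_image_least[OF N this] u show ?thesis
  using EM_in[OF N _ SndD(1)[OF N]] EM_hom[OF f _ SndD(1)[OF N]] EM_phi_image[OF V]
   mhom_closed[OF T_hom_Snd[OF N f]] by (auto simp del: Fst_simps Snd_simps)
qed

lemma phi_image_onto:
 assumes N: "left_module T N" and V: "left_module T V" and f: "f \<in> mod_hom T N V"
  and onto: "f ` carrier (Snd N) = carrier (Snd V)" and v: "v \<in> phi_image V"
 shows "\<exists>u\<in>phi_image N. v = f u"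
proof -
 note S = lmod_sub[OF lmod_Fst[OF N] submodule_phi_image[OF N]]
 note fS = mhom_sub_incl[OF lmod_Fst[OF N] submodule_phi_image[OF N] T_hom_Fst[OF N f]]
 from submodule_image[OF S lmod_Fst[OF V] fS]
 have "submodule_of A (Fst V) (f ` phi_image N)"
  using phi_imageD[OF N] by (simp cong: image_cong del: Fst_simps)
 then have "phi_image V \<subseteq> f ` phi_image N"
 proof (rule phi_image_least[OF V])
  fix m y assume m: "m \<in> carrier M" and "y \<in> carrier (Snd V)"
  then obtain x where x: "x \<in> carrier (Snd N)" "y = f x" unfolding onto[symmetric] by (elim imageE)
  show "EM m \<odot>\<^bsub>V\<^esub> y \<in> f ` phi_image N"
   unfolding x(2) EM_hom[OF f m SndD(1)[OF N x(1)], symmetric] using EM_phi_image[OF N m x(1)] by (rule imageI)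
 qed
 then show ?thesis using v by blast
qed

text \<open>
 This part of the snake lemma is proved with characters. A homomorphism \<open>X\<^sub>2 \<rightarrow> M\<^sup>+\<close> extends to \<open>Y\<^sub>2\<close> because
 \<open>Ext (Z\<^sub>2, M\<^sup>+) = 0\<close>, and then comes from a character of \<open>Y\<^sub>1\<close>.
\<close>

lemma phi_kernel:
 assumes X': "left_module T X" and Y': "left_module T Y" and Z': "left_module T Z"
  and se: "short_exact T X Y Z i p" and inj: "phi_inj Y" "phi_inj Z" and tor: "ext_zero B (Snd Z) (char_module M)"
 shows "phi_inj X" and "!!u. [|u \<in> carrier (Fst X); i u \<in> phi_image Y|] ==> u \<in> phi_image X"
proof -
 note i = short_exactD(1)[OF se] and p = short_exactD(2)[OF se]
 note se1 = short_exact_Fst[OF X' Y' Z' se] and se2 = short_exact_Snd[OF X' Y' Z' se]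
 note FX = lmod_Fst[OF X'] and FY = lmod_Fst[OF Y'] and FZ = lmod_Fst[OF Z']
 note SX = lmod_Snd[OF X'] and SY = lmod_Snd[OF Y'] and SZ = lmod_Snd[OF Z']
 interpret FX: left_module A "Fst X" by (rule FX)
 interpret FY: left_module A "Fst Y" by (rule FY)
 have iF: "i u \<in> carrier (Fst Y)" if "u \<in> carrier (Fst X)" for u
  using mhom_closed[OF short_exactD(1)[OF se1] that] that by (simp del: Fst_simps)
 have pF: "p u \<in> carrier (Fst Z)" if "u \<in> carrier (Fst Y)" for u
  using mhom_closed[OF short_exactD(2)[OF se1] that] that by (simp del: Fst_simps)
 have iS: "i u \<in> carrier (Snd Y)" if "u \<in> carrier (Snd X)" for u
  using mhom_closed[OF short_exactD(1)[OF se2] that] that by (simp del: Snd_simps)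
 have pS: "p u \<in> carrier (Snd Z)" if "u \<in> carrier (Snd Y)" for u
  using mhom_closed[OF short_exactD(2)[OF se2] that] that by (simp del: Snd_simps)
 show "phi_inj X"
  unfolding phi_inj_iff[OF X']
 proof
  fix h assume h: "h \<in> mod_hom B (Snd X) (char_module M)"
  obtain h' where h': "h' \<in> mod_hom B (Snd Y) (char_module M)" "!!x. x \<in> carrier (Snd X) ==> h' (i x) = h x"
   using ext_zero_extend[OF SX SY SZ lmod_char_module se2 tor h] by (auto simp del: Snd_simps)
  obtain \<chi> where \<chi>: "\<chi> \<in> characters (Fst Y)"
   "!!m y. [|m \<in> carrier M; y \<in> carrier (Snd Y)|] ==> \<chi> (EM m \<odot>\<^bsub>Y\<^esub> y) = h' y m"
   using inj(1)[unfolded phi_inj_iff[OF Y'], rule_format, OF h'(1)] by blast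
  have "(\<lambda>u\<in>carrier (Fst X). \<chi> (i u)) \<in> characters (Fst X)"
   using character_closed[OF \<chi>(1) iF] character_add[OF \<chi>(1) iF iF] mhom_add[OF i FstD(1)[OF X'] FstD(1)[OF X']] FX.X.add.m_closed
   by (intro characterI) (simp_all del: Fst_simps(1))
  moreover have "\<chi> (i (EM m \<odot>\<^bsub>X\<^esub> y)) = h y m" if "m \<in> carrier M" "y \<in> carrier (Snd X)" for m y
   using EM_hom[OF i that(1) SndD(1)[OF X' that(2)]] \<chi>(2)[OF that(1) iS[OF that(2)]] h'(2)[OF that(2)] by simp
  ultimately show "\<exists>\<chi>\<in>characters (Fst X). \<forall>m\<in>carrier M. \<forall>y\<in>carrier (Snd X). \<chi> (EM m \<odot>\<^bsub>X\<^esub> y) = h y m"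
   using EM_in[OF X' _ SndD(1)[OF X']]
   by (intro bexI[of _ "\<lambda>u\<in>carrier (Fst X). \<chi> (i u)"]) (simp_all del: Fst_simps Snd_simps)
 qed
  show "u \<in> phi_image X" if u: "u \<in> carrier (Fst X)" and iu: "i u \<in> phi_image Y" for u
  proof (rule ccontr)
   assume nu: "u \<notin> phi_image X"
   \<comment> \<open>Separate \<open>i u\<close> from \<open>i (im \<phi>\<^sup>X)\<close>; the resulting pairing on \<open>Y\<^sub>2\<close> kills \<open>X\<^sub>2\<close>, hence comes from
    \<open>Z\<^sub>2\<close> and, \<open>\<phi>\<^sup>Z\<close> being injective, from a character of \<open>Z\<^sub>1\<close>.\<close>
   let ?H = "i ` phi_image X"
   note iH = mhom_sub_incl[OF FX submodule_phi_image[OF X'] short_exactD(1)[OF se1]]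
   from submodule_image[OF lmod_sub[OF FX submodule_phi_image[OF X']] FY iH]
   have H: "submodule_of A (Fst Y) ?H" using phi_imageD[OF X'] by (simp cong: image_cong del: Fst_simps)
   have "i u \<notin> ?H"
    using inj_onD[OF short_exactD(3)[OF se], of u] FstD(1)[OF X'] u nu phi_imageD[OF X'] by blast
   from FY.X.character_separate[OF subgroup_submodule[OF FY H] iF[OF u] this]
   obtain \<chi> where \<chi>: "\<chi> \<in> characters (Fst Y)" "\<chi> (i u) \<noteq> 0" "!!v. v \<in> phi_image X ==> \<chi> (i v) = 0" by blast
   let ?h = "\<lambda>y\<in>carrier (Snd Y). \<lambda>m\<in>carrier M. \<chi> (EM m \<odot>\<^bsub>Y\<^esub> y)"
   note h = phi_pairing[OF Y' \<chi>(1)]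
   have "\<exists>k\<in>mod_hom B (Snd Z) (char_module M). \<forall>y\<in>carrier (Snd Y). k (restrict p (carrier (Snd Y)) y) = ?h y"
   proof (rule factor_through_surj[OF SY SZ lmod_char_module short_exactD(2)[OF se2] short_exact_onto[OF se2] h])
    fix y assume y: "y \<in> carrier (Snd Y)" "restrict p (carrier (Snd Y)) y = \<zero>\<^bsub>Snd Z\<^esub>"
    obtain x where x: "x \<in> carrier (Snd X)" "y = i x"
     using short_exactD(5)[OF se2 y] by (auto simp del: Snd_simps)
    have "\<chi> (EM m \<odot>\<^bsub>Y\<^esub> y) = 0" if m: "m \<in> carrier M" for m
     unfolding x(2) EM_hom[OF i m SndD(1)[OF X' x(1)], symmetric] by (rule \<chi>(3)[OF EM_phi_image[OF X' m x(1)]])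
    then show "?h y = \<zero>\<^bsub>char_module M\<^esub>" using y(1) by (simp cong: restrict_cong del: Snd_simps)
   qed
   then obtain k where k: "k \<in> mod_hom B (Snd Z) (char_module M)"
    "!!y m. [|y \<in> carrier (Snd Y); m \<in> carrier M|] ==> k (p y) m = \<chi> (EM m \<odot>\<^bsub>Y\<^esub> y)" by (auto simp del: Snd_simps)
   obtain \<omega> where \<omega>: "\<omega> \<in> characters (Fst Z)"
    "!!m z. [|m \<in> carrier M; z \<in> carrier (Snd Z)|] ==> \<omega> (EM m \<odot>\<^bsub>Z\<^esub> z) = k z m"
    using inj(2)[unfolded phi_inj_iff[OF Z'], rule_format, OF k(1)] by blast
   let ?\<omega> = "\<lambda>v\<in>carrier (Fst Y). \<omega> (p v)"
   have "?\<omega> \<in> characters (Fst Y)"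
    using character_closed[OF \<omega>(1) pF] character_add[OF \<omega>(1) pF pF] mhom_add[OF p FstD(1)[OF Y'] FstD(1)[OF Y']] FY.X.add.m_closed
    by (intro characterI) (simp_all del: Fst_simps(1))
   then have "\<chi> (i u) = ?\<omega> (i u)"
   proof (rule character_phi_image_eq[OF Y' \<chi>(1) _ _ iu])
    fix m y assume m: "m \<in> carrier M" and y: "y \<in> carrier (Snd Y)"
    show "\<chi> (EM m \<odot>\<^bsub>Y\<^esub> y) = ?\<omega> (EM m \<odot>\<^bsub>Y\<^esub> y)"
     using \<omega>(2)[OF m pS[OF y]] k(2)[OF y m] EM_hom[OF p m SndD(1)[OF Y' y]] EM_in[OF Y' m SndD(1)[OF Y' y]]
     by (simp del: Fst_simps)
   qed
   also have "?\<omega> (i u) = \<omega> \<zero>\<^bsub>Fst Z\<^esub>" using iF[OF u] short_exactD(4)[OF se FstD(1)[OF X' u]] by (simp del: Fst_simps(1))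
   also have "\<omega> \<zero>\<^bsub>Fst Z\<^esub> = 0" by (rule character_zero[OF left_module.axioms(2)[OF FZ] \<omega>(1)])
   finally show False using \<chi>(2) by simp
  qed
qed

text \<open>
 The kernel of \<open>ind F \<rightarrow> ind Y\<close>, for \<open>F\<close> free over \<open>Y\<close>, is induced from the syzygy of \<open>Y\<close> by \<open>phi_kernel\<close>. So a
 homomorphism from the syzygy to \<open>V\<^sub>2\<close> yields one from this kernel to \<open>V\<close>, which extends to \<open>ind F\<close>.
\<close>

theorem ext_zero_indD:
 fixes Y :: "('b, 'y) module" and V :: "('a \<times> 'm \<times> 'b, 'v) module"
 assumes Y: "left_module B Y" and V: "left_module T V" and tor: "ext_zero B Y (char_module M)"
  and ext: "ext_zero T (ind Y) V"
 shows "ext_zero B Y (Snd V)"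
 unfolding ext_zero_def
proof
 let ?K = "syzygy B Y" and ?F = "res0 B Y" and ?a = "augmentation B Y"
 note F = lmod_res0[OF Y] and a = mhom_augmentation[OF Y]
 note LF = lmod_ind[OF F] and LY = lmod_ind[OF Y]
 interpret LY: left_module T "ind Y" by (rule LY)
 interpret V: left_module T V by (rule V)
 fix f assume f: "f \<in> mod_hom B ?K (Snd V)"
 have "(\<lambda>u\<in>carrier (Snd (ind ?F)). snd u) \<in> mod_hom B (Snd (ind ?F)) ?F"
  by (rule mhom_restrictI[OF lmod_Snd[OF LF]]) (auto simp: Snd_ind[OF F] simp del: Snd_simps(1) free_module_simps)
 note pr = mhom_compose[OF lmod_Snd[OF LF] mhom_compose[OF lmod_Snd[OF LF] this a] ind_unit(1)[OF Y]]
 obtain P where P: "P \<in> mod_hom T (ind ?F) (ind Y)" "!!x. x \<in> carrier ?F ==> P (\<zero>\<^bsub>Ten ?F\<^esub>, x) = (\<zero>\<^bsub>Ten Y\<^esub>, ?a x)"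
  using gen_sub_lift[OF LF LY phi_inj_ind[OF F] pr] mhom_closed[OF a]
  unfolding gen_sub_ind[OF F] Snd_ind[OF F] by (auto simp: compose_def)
 have "P ` carrier (Snd (ind ?F)) = carrier (Snd (ind Y))"
  unfolding Snd_ind[OF F] Snd_ind[OF Y] augmentation_onto[OF Y, symmetric] using P(2) by force
 note onto = phi_image_onto[OF LF LY P(1) this, unfolded phi_image_ind[OF F] phi_image_ind[OF Y]]
 have P_onto: "P ` carrier (ind ?F) = carrier (ind Y)"
 proof (intro equalityI subsetI)
  fix z assume z: "z \<in> carrier (ind Y)"
  obtain u where u: "u \<in> carrier (Fst (ind ?F))" "p1 (ind Y) z = P u" using onto[OF p1_in[OF LY z]] by blast
  have "p2 (ind Y) z \<in> P ` carrier (Snd (ind ?F))"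
   using p2_in[OF LY z] \<open>P ` carrier (Snd (ind ?F)) = _\<close> by (simp only:)
  then obtain v where v: "p2 (ind Y) z = P v" "v \<in> carrier (Snd (ind ?F))" by (rule imageE)
  interpret LF: left_module T "ind ?F" by (rule LF)
  note c = FstD(1)[OF LF u(1)] SndD(1)[OF LF v(2)]
  have "z = P (u \<oplus>\<^bsub>ind ?F\<^esub> v)" unfolding mhom_add[OF P(1) c] u(2)[symmetric] v(1)[symmetric] by (rule peirce[OF LY z, symmetric])
  then show "z \<in> P ` carrier (ind ?F)" using LF.a_closed[OF c] by (rule image_eqI)
 qed (use mhom_closed[OF P(1)] in blast)
 let ?L = "sub_module (ind ?F) (hom_kernel (ind ?F) (ind Y) P)"
 note H = submodule_hom_kernel[OF LF LY P(1)] and seL = short_exact_kernel[OF LF LY P(1) P_onto]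
 note L = lmod_sub[OF LF H]
 have Lsub: "u \<in> carrier (ind ?F)" if "u \<in> carrier ?L" for u using that by (simp add: hom_kernel_def del: tri_mod_simps)
 have torY: "ext_zero B (Snd (ind Y)) (char_module M)"
  by (rule ext_zero_iso_left[OF Y lmod_Snd[OF LY] lmod_char_module ind_unit[OF Y] tor])
 note ker = phi_kernel[OF L LF LY seL phi_inj_ind[OF F] phi_inj_ind[OF Y] torY]
 \<comment> \<open>The kernel \<open>L\<close> of \<open>ind F \<rightarrow> ind Y\<close> is generated by its second component, a copy of the syzygy of \<open>Y\<close>.\<close>
 have "p1 ?L u \<in> phi_image ?L" if u: "u \<in> carrier ?L" for u
 proof (rule ker(2)[OF p1_in[OF L u]])
  have "p1 ?L u \<in> hom_kernel (ind ?F) (ind Y) P" using FstD(1)[OF L p1_in[OF L u]] by simp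
  then show "(\<lambda>x\<in>hom_kernel (ind ?F) (ind Y) P. x) (p1 ?L u) \<in> phi_image (ind ?F)"
   using p1_in[OF LF Lsub[OF u]] unfolding phi_image_ind[OF F] by (simp del: Fst_simps tri_mod_simps)
 qed
 then have "{u \<in> carrier ?L. p1 ?L u \<in> phi_image ?L} = carrier ?L" by blast
 then have gen: "gen_sub ?L = ?L" unfolding gen_sub_def[OF L] by simp
 have SL: "u \<in> carrier (Snd ?L) \<longleftrightarrow> (\<exists>k\<in>carrier ?K. u = (\<zero>\<^bsub>Ten ?F\<^esub>, k))" for u
 proof -
  have "u \<in> carrier (Snd ?L) \<longleftrightarrow> u \<in> carrier (Snd (ind ?F)) \<and> P u = \<zero>\<^bsub>ind Y\<^esub>"
   unfolding Snd_iff[OF L] Snd_iff[OF LF] by (auto simp: hom_kernel_def simp del: tri_mod_simps)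
  then show ?thesis unfolding Snd_ind[OF F] by (auto simp: P(2) carrier_syzygy hom_kernel_def)
 qed
 have "(\<lambda>u\<in>carrier (Snd ?L). f (snd u)) \<in> mod_hom B (Snd ?L) (Snd V)"
 proof (rule mhom_restrictI[OF lmod_Snd[OF L]])
  fix u assume "u \<in> carrier (Snd ?L)"
  then obtain k where k: "k \<in> carrier ?K" "u = (\<zero>\<^bsub>Ten ?F\<^esub>, k)" unfolding SL by blast
  show "f (snd u) \<in> carrier (Snd V)" using mhom_closed[OF f k(1)] k(2) by simp
  show "f (snd (u \<oplus>\<^bsub>Snd ?L\<^esub> v)) = f (snd u) \<oplus>\<^bsub>Snd V\<^esub> f (snd v)" if "v \<in> carrier (Snd ?L)" for v
   using mhom_add[OF f k(1)] k(2) that unfolding SL by (auto simp: syzygy_def)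
  show "f (snd (b \<odot>\<^bsub>Snd ?L\<^esub> u)) = b \<odot>\<^bsub>Snd V\<^esub> f (snd u)" if "b \<in> carrier B" for b
   using mhom_smult[OF f that k(1)] k(2) by (simp add: syzygy_def)
 qed
 from gen_sub_lift[OF L V ker(1) this]
 obtain k where k: "k \<in> mod_hom T ?L V" "\<forall>u\<in>carrier (Snd ?L). k u = (\<lambda>u\<in>carrier (Snd ?L). f (snd u)) u"
  unfolding gen by blast
 obtain g where g: "g \<in> mod_hom T (ind ?F) V" "\<forall>u\<in>carrier ?L. g ((\<lambda>x\<in>hom_kernel (ind ?F) (ind Y) P. x) u) = k u"
  using ext_zero_extend[OF L LF LY V seL ext k(1)] by blast
 let ?g = "compose (carrier ?F) (restrict g (carrier (Snd (ind ?F)))) (\<lambda>x\<in>carrier ?F. (\<zero>\<^bsub>Ten ?F\<^esub>, x))"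
 have "?g x = f x" if x: "x \<in> carrier ?K" for x
 proof -
  have xL: "(\<zero>\<^bsub>Ten ?F\<^esub>, x) \<in> carrier (Snd ?L)" using x unfolding SL by blast
  note xL' = SndD(1)[OF L xL]
  have "g (\<zero>\<^bsub>Ten ?F\<^esub>, x) = f x" using bspec[OF g(2) xL'] bspec[OF k(2) xL] xL xL' by (simp del: Snd_simps tri_mod_simps)
  then show ?thesis using syzygyD(1)[OF x] by (simp add: compose_def Snd_ind[OF F] del: Snd_simps(1) free_module_simps)
 qed
 then show "\<exists>g\<in>mod_hom B ?F (Snd V). \<forall>x\<in>carrier ?K. g x = f x"
  using mhom_compose[OF F ind_unit(1)[OF F] T_hom_Snd[OF LF g(1)]] by blast
qed

lemma Fst_Mod_cat: "N \<in> Mod_cat T ==> Fst N \<in> Mod_cat A"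
 using lmod_Fst image_small by (auto simp: Mod_cat_def)

lemma Snd_Mod_cat: "N \<in> Mod_cat T ==> Snd N \<in> Mod_cat B"
 using lmod_Snd image_small by (auto simp: Mod_cat_def)

lemma inc1_Mod_cat: "X \<in> Mod_cat A ==> inc1 X \<in> Mod_cat T" using lmod_inc1 by (auto simp: Mod_cat_def)

lemma inc2_Mod_cat: "Y \<in> Mod_cat B ==> inc2 Y \<in> Mod_cat T" using lmod_inc2 by (auto simp: Mod_cat_def)

lemma sub_Mod_cat: "[|X \<in> Mod_cat R; submodule_of R X H|] ==> sub_module X H \<in> Mod_cat R"
 using lmod_sub subset_small by (auto simp: Mod_cat_def submodule_of_def)

text \<open>
 The cokernel of \<open>\<phi>\<^sup>X\<close> is the kernel of the surjection between the cokernels of \<open>\<phi>\<^sup>Y\<close> and \<open>\<phi>\<^sup>Z\<close>, by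
 \<open>phi_kernel\<close> and because \<open>p\<close> maps the image of \<open>\<phi>\<^sup>Y\<close> onto that of \<open>\<phi>\<^sup>Z\<close>.
\<close>

lemma Phi_closed_under_epi_kernels:
 fixes \<A> :: "('a, 'u) module set" and \<C> :: "('b, 'u) module set"
 assumes sub: "\<A> \<subseteq> Mod_cat A" and tor: "!!Y. Y \<in> \<C> ==> ext_zero B Y (char_module M)"
  and A: "closed_under_epi_kernels A \<A>" and C: "closed_under_epi_kernels B \<C>"
 shows "closed_under_epi_kernels T (Phi_class A B M \<A> \<C>)"
 unfolding closed_under_epi_kernels_def
proof (intro ballI allI impI)
 fix X Y Z :: "('a \<times> 'm \<times> 'b, 'u) module" and i p
 assume X: "X \<in> Mod_cat T" and Y: "Y \<in> Phi_class A B M \<A> \<C>" and Z: "Z \<in> Phi_class A B M \<A> \<C>"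
  and se: "short_exact T X Y Z i p"
 note X' = Mod_catD[OF X]
 obtain CY qY where Y': "left_module T Y" "phi_inj Y" "Snd Y \<in> \<C>" "CY \<in> \<A>" "cokernel_map Y CY qY"
  using Y unfolding Phi_class_iff[OF sub] Mod_cat_def by blast
 obtain CZ qZ where Z': "left_module T Z" "phi_inj Z" "Snd Z \<in> \<C>" "CZ \<in> \<A>" "cokernel_map Z CZ qZ"
  using Z unfolding Phi_class_iff[OF sub] Mod_cat_def by blast
 note CY = subsetD[OF sub Y'(4)] and CZ = subsetD[OF sub Z'(4)]
 note CY' = Mod_catD[OF CY] and CZ' = Mod_catD[OF CZ]
 note qY = Y'(5)[unfolded cokernel_map_def] and qZ = Z'(5)[unfolded cokernel_map_def]
 note i = short_exactD(1)[OF se] and p = short_exactD(2)[OF se]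
 note se1 = short_exact_Fst[OF X' Y'(1) Z'(1) se] and se2 = short_exact_Snd[OF X' Y'(1) Z'(1) se]
 note FX = lmod_Fst[OF X'] and FY = lmod_Fst[OF Y'(1)] and FZ = lmod_Fst[OF Z'(1)]
 interpret FX: left_module A "Fst X" by (rule FX)
 interpret FY: left_module A "Fst Y" by (rule FY)
 interpret CY: left_module A CY by (rule CY')
 have iF: "i u \<in> carrier (Fst Y)" if "u \<in> carrier (Fst X)" for u
  using mhom_closed[OF short_exactD(1)[OF se1] that] that by (simp del: Fst_simps)
 have pF: "p u \<in> carrier (Fst Z)" if "u \<in> carrier (Fst Y)" for u
  using mhom_closed[OF short_exactD(2)[OF se1] that] that by (simp del: Fst_simps)
 have onto: "p ` carrier (Snd Y) = carrier (Snd Z)" using short_exact_onto[OF se2] by (simp cong: image_cong del: Snd_simps)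
 have SXC: "Snd X \<in> \<C>" using C[unfolded closed_under_epi_kernels_def] Snd_Mod_cat[OF X] Y'(3) Z'(3) se2 by blast
 note ker = phi_kernel[OF X' Y'(1) Z'(1) se Y'(2) Z'(2) tor[OF Z'(3)]]
 note inj = ker(1)
 have "\<exists>r\<in>mod_hom A CY CZ. \<forall>u\<in>carrier (Fst Y). r (qY u) = compose (carrier (Fst Y)) qZ (restrict p (carrier (Fst Y))) u"
 proof (rule factor_through_surj[OF FY CY' CZ' conjunct1[OF qY]])
  show "compose (carrier (Fst Y)) qZ (restrict p (carrier (Fst Y))) \<in> mod_hom A (Fst Y) CZ"
   by (rule mhom_compose[OF FY short_exactD(2)[OF se1] conjunct1[OF qZ]])
  show "compose (carrier (Fst Y)) qZ (restrict p (carrier (Fst Y))) u = \<zero>\<^bsub>CZ\<^esub>"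
   if "u \<in> carrier (Fst Y)" "qY u = \<zero>\<^bsub>CY\<^esub>" for u
   using that qY qZ pF[OF that(1)] phi_image_map[OF Y'(1) Z'(1) p] by (simp add: compose_def del: Fst_simps)
 qed (use qY in blast)
 then obtain r where r: "r \<in> mod_hom A CY CZ" "!!u. u \<in> carrier (Fst Y) ==> r (qY u) = qZ (p u)"
  by (auto simp: compose_def simp del: Fst_simps)
 have r_onto: "r ` carrier CY = carrier CZ"
 proof (rule equalityI)
  show "carrier CZ \<subseteq> r ` carrier CY"
  proof
   fix c assume "c \<in> carrier CZ"
   then obtain z where z: "z \<in> carrier (Fst Z)" "c = qZ z" using qZ by blast
   obtain y where y: "y \<in> carrier (Fst Y)" "z = p y" using short_exactD(6)[OF se1 z(1)] by (auto simp del: Fst_simps)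
   show "c \<in> r ` carrier CY" using r(2)[OF y(1)] mhom_closed[OF conjunct1[OF qY] y(1)] z(2) y(2) by (metis imageI)
  qed
 qed (use mhom_closed[OF r(1)] in auto)
 let ?C = "sub_module CY (hom_kernel CY CZ r)"
 have sK: "submodule_of A CY (hom_kernel CY CZ r)" by (rule submodule_hom_kernel[OF CY' CZ' r(1)])
 have CA: "?C \<in> \<A>" using A[unfolded closed_under_epi_kernels_def] sub_Mod_cat[OF CY sK] Y'(4) Z'(4)
   short_exact_kernel[OF CY' CZ' r(1) r_onto] by blast
 let ?q = "compose (carrier (Fst X)) qY (restrict i (carrier (Fst X)))"
 have q_eq: "?q u = qY (i u)" if "u \<in> carrier (Fst X)" for u using that by (simp add: compose_def del: Fst_simps)
 have "?q \<in> mod_hom A (Fst X) CY" by (rule mhom_compose[OF FX short_exactD(1)[OF se1] conjunct1[OF qY]])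
 moreover have pi: "p (i u) = \<zero>\<^bsub>Z\<^esub>" if "u \<in> carrier (Fst X)" for u
  using short_exactD(4)[OF se FstD(1)[OF X' that]] .
 have qz0: "qZ \<zero>\<^bsub>Z\<^esub> = \<zero>\<^bsub>CZ\<^esub>" using mhom_zero[OF FZ CZ' conjunct1[OF qZ]] by simp
 ultimately have "?q \<in> mod_hom A (Fst X) ?C" by (intro mhom_into_sub)
   (simp_all add: q_eq hom_kernel_def r(2)[OF iF] iF pi qz0 mhom_closed[OF conjunct1[OF qY]] del: Fst_simps)
 moreover have "?q ` carrier (Fst X) = carrier ?C"
 proof (rule equalityI)
  show "?q ` carrier (Fst X) \<subseteq> carrier ?C" using mhom_closed[OF calculation] by blast
  show "carrier ?C \<subseteq> ?q ` carrier (Fst X)"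
  proof
   fix c assume "c \<in> carrier ?C"
   then have c: "c \<in> carrier CY" "r c = \<zero>\<^bsub>CZ\<^esub>" by (simp_all add: hom_kernel_def)
   obtain y where y: "y \<in> carrier (Fst Y)" "c = qY y" using c(1) qY by blast
   have "p y \<in> phi_image Z" using c(2) y(2) r(2)[OF y(1)] qZ pF[OF y(1)] by (simp del: Fst_simps)
   then obtain w where w: "w \<in> phi_image Y" "p y = p w" using phi_image_onto[OF Y'(1) Z'(1) p onto] by blast
   note w' = phi_imageD[OF Y'(1) w(1)] and d = FY.minus_closed[OF y(1) phi_imageD[OF Y'(1) w(1)]]
   interpret FZ: left_module A "Fst Z" by (rule FZ)
   have "restrict p (carrier (Fst Y)) (y \<ominus>\<^bsub>Fst Y\<^esub> w) = \<zero>\<^bsub>Fst Z\<^esub>"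
    unfolding mhom_diff[OF FY FZ short_exactD(2)[OF se1] y(1) w'] using y(1) w' w(2) FZ.diff_self[OF pF[OF w']]
    by (simp del: Fst_simps)
   then obtain x where x: "x \<in> carrier (Fst X)" "y \<ominus>\<^bsub>Fst Y\<^esub> w = i x"
    using short_exactD(5)[OF se1 d] by (auto simp del: Fst_simps)
   have "qY y = qY (i x) \<oplus>\<^bsub>CY\<^esub> qY w"
    using mhom_add[OF conjunct1[OF qY] d w'] FY.diff_add_cancel[OF w' y(1)] x(2) by simp
   moreover have "qY w = \<zero>\<^bsub>CY\<^esub>" using qY w(1) w' by blast
   ultimately have "c = ?q x" using y(2) q_eq[OF x(1)] mhom_closed[OF conjunct1[OF qY] iF[OF x(1)]]
    by (simp del: Fst_simps)
   then show "c \<in> ?q ` carrier (Fst X)" using x(1) by blast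
  qed
 qed
 moreover have "?q u = \<zero>\<^bsub>?C\<^esub> \<longleftrightarrow> u \<in> phi_image X" if u: "u \<in> carrier (Fst X)" for u
 proof -
  have "i u \<in> phi_image Y \<longleftrightarrow> u \<in> phi_image X" using ker(2)[OF u] phi_image_map[OF X' Y'(1) i] by blast
  then show ?thesis using qY iF[OF u] q_eq[OF u] by (simp del: Fst_simps)
 qed
 ultimately have "cokernel_map X ?C ?q" unfolding cokernel_map_def by blast
 then show "X \<in> Phi_class A B M \<A> \<C>"
  unfolding Phi_class_iff[OF sub] using X inj SXC CA by blast
qed

text \<open>
 As \<open>Ext (M, X\<^sub>1) = 0\<close>, homomorphisms \<open>M \<rightarrow> Z\<^sub>1\<close> lift to \<open>Y\<^sub>1\<close>, so \<open>\<psi>\<^sup>Z\<close> is onto; and the kernels of \<open>\<psi>\<close> form a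
 short exact sequence because \<open>\<psi>\<^sup>X\<close> is onto.
\<close>

lemma Psi_closed_under_mono_cokernels:
 fixes \<B> :: "('a, 'u) module set" and \<D> :: "('b, 'u) module set"
 assumes ext: "!!X. X \<in> \<B> ==> ext_zero A M X"
  and B: "closed_under_mono_cokernels A \<B>" and D: "closed_under_mono_cokernels B \<D>"
 shows "closed_under_mono_cokernels T (Psi_class A B M \<B> \<D>)"
 unfolding closed_under_mono_cokernels_def
proof (intro ballI allI impI)
 fix X Y Z :: "('a \<times> 'm \<times> 'b, 'u) module" and i p
 assume X: "X \<in> Psi_class A B M \<B> \<D>" and Y: "Y \<in> Psi_class A B M \<B> \<D>" and Z: "Z \<in> Mod_cat T"
  and se: "short_exact T X Y Z i p"
 note Z' = Mod_catD[OF Z]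
 have X': "left_module T X" "psi_onto X" "Fst X \<in> \<B>" "psi_ker X \<in> \<D>"
  and Y': "left_module T Y" "psi_onto Y" "Fst Y \<in> \<B>" "psi_ker Y \<in> \<D>"
  using X Y unfolding Psi_class_iff Mod_cat_def by blast+
 note i = short_exactD(1)[OF se] and p = short_exactD(2)[OF se]
 note se1 = short_exact_Fst[OF X'(1) Y'(1) Z' se] and se2 = short_exact_Snd[OF X'(1) Y'(1) Z' se]
 note FX = lmod_Fst[OF X'(1)] and FY = lmod_Fst[OF Y'(1)] and FZ = lmod_Fst[OF Z']
 note SX = lmod_Snd[OF X'(1)] and SY = lmod_Snd[OF Y'(1)] and SZ = lmod_Snd[OF Z']
 note KX = lmod_psi_ker[OF X'(1)] and KY = lmod_psi_ker[OF Y'(1)] and KZ = lmod_psi_ker[OF Z']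
 have iS: "i u \<in> carrier (Snd Y)" if "u \<in> carrier (Snd X)" for u
  using mhom_closed[OF short_exactD(1)[OF se2] that] that by (simp del: Snd_simps)
 have pS: "p u \<in> carrier (Snd Z)" if "u \<in> carrier (Snd Y)" for u
  using mhom_closed[OF short_exactD(2)[OF se2] that] that by (simp del: Snd_simps)
 have FZB: "Fst Z \<in> \<B>" using B[unfolded closed_under_mono_cokernels_def] X'(3) Y'(3) Fst_Mod_cat[OF Z] se1 by blast
 have onto: "psi_onto Z"
 proof (rule psi_ontoI[OF Z'])
  fix g assume g: "g \<in> mod_hom A M (Fst Z)"
  obtain g' where g': "g' \<in> mod_hom A M (Fst Y)" "\<forall>m\<in>carrier M. restrict p (carrier (Fst Y)) (g' m) = g m"
   using ext_zero_lift[OF FX FY FZ M_mod se1 ext[OF X'(3)] g] by blast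
  obtain y where y: "y \<in> carrier (Snd Y)" "g' = psi Y y" using g'(1) unfolding Y'(2)[symmetric] by (elim imageE)
  have "EM m \<odot>\<^bsub>Z\<^esub> p y = g m" if m: "m \<in> carrier M" for m
   using g'(2)[rule_format, OF m] mhom_closed[OF g'(1) m] EM_hom[OF p m SndD(1)[OF Y'(1) y(1)]]
    psi_app[OF Y'(1) y(1) m] y(2) by (simp del: Fst_simps)
  then show "\<exists>y\<in>carrier (Snd Z). \<forall>m\<in>carrier M. EM m \<odot>\<^bsub>Z\<^esub> y = g m" using pS[OF y(1)] by blast
 qed
 have iK: "i u \<in> carrier (psi_ker Y)" if "u \<in> carrier (psi_ker X)" for u
  using that iS EM_hom[OF i _ SndD(1)[OF X'(1)], symmetric] mhom_zero[OF X'(1) Y'(1) i]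
  unfolding psi_ker_iff[OF X'(1)] psi_ker_iff[OF Y'(1)] by (simp del: Snd_simps)
 have pK: "p u \<in> carrier (psi_ker Z)" if "u \<in> carrier (psi_ker Y)" for u
  using that pS EM_hom[OF p _ SndD(1)[OF Y'(1)], symmetric] mhom_zero[OF Y'(1) Z' p]
  unfolding psi_ker_iff[OF Z'] psi_ker_iff[OF Y'(1)] by (simp del: Snd_simps)
 have KS: "u \<in> carrier (psi_ker N) ==> u \<in> carrier (Snd N)" for u and N :: "('a \<times> 'm \<times> 'b, 'u) module"
  by (simp add: hom_kernel_def)
 have restr: "restrict f (carrier (psi_ker N)) \<in> mod_hom B (psi_ker N) (psi_ker V)"
  if "left_module T N" "f \<in> mod_hom T N V" "!!u. u \<in> carrier (psi_ker N) ==> f u \<in> carrier (psi_ker V)"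
  for f and N V :: "('a \<times> 'm \<times> 'b, 'u) module"
  using mhom_add[OF T_hom_Snd[OF that(1,2)] KS KS] mhom_smult[OF T_hom_Snd[OF that(1,2)] _ KS]
   KS left_module.smult_closed[OF lmod_Snd[OF that(1)]] abelian_monoid.a_closed[OF abelian_group.axioms(1)[OF left_module.axioms(2)[OF lmod_Snd[OF that(1)]]]]
  by (intro mhom_restrictI[OF lmod_psi_ker[OF that(1)]] that(3)) (simp_all del: Snd_simps)
 have "short_exact B (psi_ker X) (psi_ker Y) (psi_ker Z) (restrict i (carrier (psi_ker X))) (restrict p (carrier (psi_ker Y)))"
 proof (rule short_exactI[OF KX KY restr[OF X'(1) i iK] restr[OF Y'(1) p pK]])
  fix x assume x: "x \<in> carrier (psi_ker X)"
  note xX = SndD(1)[OF X'(1) KS[OF x]]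
  show "x = \<zero>\<^bsub>psi_ker X\<^esub>" if "restrict i (carrier (psi_ker X)) x = \<zero>\<^bsub>psi_ker Y\<^esub>"
   using that x inj_mod_hom_zero[OF X'(1) Y'(1) i short_exactD(3)[OF se] xX] by (simp del: Snd_simps(1))
  show "restrict p (carrier (psi_ker Y)) (restrict i (carrier (psi_ker X)) x) = \<zero>\<^bsub>psi_ker Z\<^esub>"
   using x iK[OF x] short_exactD(4)[OF se xX] by simp
 next
  fix y assume y: "y \<in> carrier (psi_ker Y)" "restrict p (carrier (psi_ker Y)) y = \<zero>\<^bsub>psi_ker Z\<^esub>"
  have "restrict p (carrier (Snd Y)) y = \<zero>\<^bsub>Snd Z\<^esub>" using y KS[OF y(1)] by (simp del: Snd_simps(1))
  from short_exactD(5)[OF se2 KS[OF y(1)] this]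
  obtain x where x: "x \<in> carrier (Snd X)" "y = i x" by (auto simp del: Snd_simps)
  have "EM m \<odot>\<^bsub>X\<^esub> x = \<zero>\<^bsub>X\<^esub>" if m: "m \<in> carrier M" for m
  proof (rule inj_mod_hom_zero[OF X'(1) Y'(1) i short_exactD(3)[OF se]])
   show "EM m \<odot>\<^bsub>X\<^esub> x \<in> carrier X" by (rule FstD(1)[OF X'(1) EM_in[OF X'(1) m SndD(1)[OF X'(1) x(1)]]])
   show "i (EM m \<odot>\<^bsub>X\<^esub> x) = \<zero>\<^bsub>Y\<^esub>"
    unfolding EM_hom[OF i m SndD(1)[OF X'(1) x(1)]] x(2)[symmetric] using y(1) m unfolding psi_ker_iff[OF Y'(1)] by blast
  qed
  then have "x \<in> carrier (psi_ker X)" using x(1) unfolding psi_ker_iff[OF X'(1)] by blast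
  then show "\<exists>x\<in>carrier (psi_ker X). y = restrict i (carrier (psi_ker X)) x" using x(2) by (intro bexI[of _ x]) simp_all
 next
  fix z assume z: "z \<in> carrier (psi_ker Z)"
  obtain y where y: "y \<in> carrier (Snd Y)" "z = p y" using short_exactD(6)[OF se2 KS[OF z]] by (auto simp del: Snd_simps)
  \<comment> \<open>The map \<open>m \<mapsto> m y\<close> takes values in \<open>X\<^sub>1\<close>, so it is \<open>\<psi> (x)\<close> for some \<open>x \<in> X\<^sub>2\<close>, and \<open>y - x\<close> still
   lies over \<open>z\<close>.\<close>
  have psiy: "psi Y y \<in> mod_hom A M (Fst Y)" using y(1) unfolding Y'(2)[symmetric] by (rule imageI)
  have "\<exists>k\<in>mod_hom A M (Fst X). \<forall>m\<in>carrier M. restrict i (carrier (Fst X)) (k m) = psi Y y m"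
  proof (rule factor_through_inj[OF M_mod FX FY short_exactD(1,3)[OF se1] psiy])
   fix m assume m: "m \<in> carrier M"
   have "p (EM m \<odot>\<^bsub>Y\<^esub> y) = \<zero>\<^bsub>Z\<^esub>"
    unfolding EM_hom[OF p m SndD(1)[OF Y'(1) y(1)]] y(2)[symmetric] using z m unfolding psi_ker_iff[OF Z'] by blast
   then show "\<exists>x\<in>carrier (Fst X). psi Y y m = restrict i (carrier (Fst X)) x"
    unfolding psi_app[OF Y'(1) y(1) m] using EM_in[OF Y'(1) m SndD(1)[OF Y'(1) y(1)]]
    by (intro short_exactD(5)[OF se1]) (simp_all del: Fst_simps(1))
  qed
  then obtain k where k: "k \<in> mod_hom A M (Fst X)" "\<forall>m\<in>carrier M. restrict i (carrier (Fst X)) (k m) = psi Y y m" by blast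
  obtain x where x: "x \<in> carrier (Snd X)" "k = psi X x" using k(1) unfolding X'(2)[symmetric] by (elim imageE)
  have im: "EM m \<odot>\<^bsub>Y\<^esub> i x = EM m \<odot>\<^bsub>Y\<^esub> y" if m: "m \<in> carrier M" for m
   using k(2)[rule_format, OF m] mhom_closed[OF k(1) m] EM_hom[OF i m SndD(1)[OF X'(1) x(1)]]
    psi_app[OF X'(1) x(1) m] psi_app[OF Y'(1) y(1) m] x(2) by (simp del: Fst_simps)
  interpret SY: left_module B "Snd Y" by (rule SY)
  interpret SZ: left_module B "Snd Z" by (rule SZ)
  interpret HY: left_module B "hom_mod (Fst Y)" by (rule lmod_hom_mod[OF FY])
  note d = SY.minus_closed[OF y(1) iS[OF x(1)]]
  have "psi Y (i x) = psi Y y" using y(1) iS[OF x(1)] im by (simp add: psi_eq[OF Y'(1)] cong: restrict_cong del: Snd_simps)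
  then have "psi Y (y \<ominus>\<^bsub>Snd Y\<^esub> i x) = \<zero>\<^bsub>hom_mod (Fst Y)\<^esub>"
   using mhom_diff[OF SY lmod_hom_mod[OF FY] psi_hom[OF Y'(1)] y(1) iS[OF x(1)]]
    HY.diff_self[OF mhom_closed[OF psi_hom[OF Y'(1)] y(1)]] by (simp only:)
  then have dK: "y \<ominus>\<^bsub>Snd Y\<^esub> i x \<in> carrier (psi_ker Y)" using d by (simp add: hom_kernel_def del: Snd_simps)
  have "p (y \<ominus>\<^bsub>Snd Y\<^esub> i x) \<oplus>\<^bsub>Snd Z\<^esub> p (i x) = p y"
   using mhom_add[OF short_exactD(2)[OF se2] d iS[OF x(1)]] SY.diff_add_cancel[OF iS[OF x(1)] y(1)] d y(1) iS[OF x(1)]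
   by (simp del: Snd_simps)
  then have "p (y \<ominus>\<^bsub>Snd Y\<^esub> i x) = z"
   using short_exactD(4)[OF se SndD(1)[OF X'(1) x(1)]] SZ.X.r_zero[OF pS[OF d]] y(2) by simp
  then show "\<exists>y\<in>carrier (psi_ker Y). z = restrict p (carrier (psi_ker Y)) y"
   using dK by (intro bexI[of _ "y \<ominus>\<^bsub>Snd Y\<^esub> i x"]) simp_all
 qed
 moreover have "psi_ker Z \<in> Mod_cat B"
  by (rule sub_Mod_cat[OF Snd_Mod_cat[OF Z] submodule_hom_kernel[OF SZ lmod_hom_mod[OF FZ] psi_hom[OF Z']]])
 ultimately have "psi_ker Z \<in> \<D>" using D[unfolded closed_under_mono_cokernels_def] X'(4) Y'(4) by blast
 then show "Z \<in> Psi_class A B M \<B> \<D>" unfolding Psi_class_iff using Z onto FZB by blast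
qed

end

section \<open>The two cotorsion pairs over the triangular ring\<close>

abbreviation zeros_in :: "('r, 'p) ring_scheme => ('r, 'u) module set => bool"
 where "zeros_in R \<X> \<equiv> \<forall>X\<in>Mod_cat R. carrier X = {\<zero>\<^bsub>X\<^esub>} --> X \<in> \<X>"

text \<open>
 Both closure conditions of a hereditary pair have this form, with \<open>P\<close> an implication between the three
 memberships, so that they can be treated together.
\<close>

definition closed_in ::
 "(bool => bool => bool => bool) => ('r, 'p) ring_scheme => ('r, 'u) module set => bool"
 where "closed_in P R \<X> \<longleftrightarrow> (\<forall>X\<in>Mod_cat R. \<forall>Y\<in>Mod_cat R. \<forall>Z\<in>Mod_cat R. \<forall>f g.
  short_exact R X Y Z f g --> P (X \<in> \<X>) (Y \<in> \<X>) (Z \<in> \<X>))"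

lemma closed_in_iff:
 assumes "\<X> \<subseteq> Mod_cat R"
 shows "closed_under_epi_kernels R \<X> \<longleftrightarrow> closed_in (\<lambda>a b c. b \<and> c --> a) R \<X>"
  and "closed_under_mono_cokernels R \<X> \<longleftrightarrow> closed_in (\<lambda>a b c. a \<and> b --> c) R \<X>"
 using assms unfolding closed_in_def closed_under_epi_kernels_def closed_under_mono_cokernels_def by blast+

lemma small_copy_ext:
 fixes X :: "('r, 'x) module"
 assumes X: "left_module R X" and small: "carrier X \<prec> (UNIV :: 'u set)"
 shows "\<exists>X' \<in> (Mod_cat R :: ('r, 'u) module set). \<exists>g\<in>mod_hom R X X'. bij_betw g (carrier X) (carrier X') \<and>
  (\<forall>V :: ('r, 'u) module. left_module R V --> (ext_zero R X' V \<longleftrightarrow> ext_zero R X V) \<and> (ext_zero R V X' \<longleftrightarrow> ext_zero R V X))"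
proof -
 obtain X' :: "('r, 'u) module" and g where X': "X' \<in> Mod_cat R" and g: "g \<in> mod_hom R X X'" "bij_betw g (carrier X) (carrier X')"
  using small_copy[OF assms] by blast
 note L = Mod_catD[OF X']
 obtain k where k: "k \<in> mod_hom R X' X" "bij_betw k (carrier X') (carrier X)"
  using mhom_inverse[OF X L g] by blast
 have "(ext_zero R X' V \<longleftrightarrow> ext_zero R X V) \<and> (ext_zero R V X' \<longleftrightarrow> ext_zero R V X)"
  if V: "left_module R V" for V :: "('r, 'u) module"
  using ext_zero_iso_left[OF X L V g] ext_zero_iso_left[OF L X V k] ext_zero_iso_right[OF V X L g] ext_zero_iso_right[OF V L X k]
  by blast
 then show ?thesis using X' g by blast
qed

context tri
begin

lemma Rep_class_iff: "N \<in> Rep_class A B M \<C> \<D> \<longleftrightarrow> N \<in> Mod_cat T \<and> Fst N \<in> \<C> \<and> Snd N \<in> \<D>"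
 by (simp add: Rep_class_def)

lemma Snd_inc1_Mod_cat: "X \<in> Mod_cat A ==> Snd (inc1 X) \<in> Mod_cat B \<and> carrier (Snd (inc1 X)) = {\<zero>\<^bsub>Snd (inc1 X)\<^esub>}"
 using Snd_Mod_cat[OF inc1_Mod_cat] Snd_inc1[OF Mod_catD] by (simp del: Snd_simps(1)) blast

lemma Fst_inc2_Mod_cat: "Y \<in> Mod_cat B ==> Fst (inc2 Y) \<in> Mod_cat A \<and> carrier (Fst (inc2 Y)) = {\<zero>\<^bsub>Fst (inc2 Y)\<^esub>}"
 using Fst_Mod_cat[OF inc2_Mod_cat] Fst_inc2[OF Mod_catD] by (simp del: Fst_simps(1)) blast

lemma inc1_Rep:
 assumes "zeros_in B \<D>" "X \<in> Mod_cat A" shows "inc1 X \<in> Rep_class A B M \<C> \<D> \<longleftrightarrow> X \<in> \<C>"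
 using assms Snd_inc1_Mod_cat[OF assms(2)] Fst_inc1[OF Mod_catD[OF assms(2)]] inc1_Mod_cat[OF assms(2)]
 by (auto simp: Rep_class_iff)

lemma inc2_Rep:
 assumes "zeros_in A \<C>" "Y \<in> Mod_cat B" shows "inc2 Y \<in> Rep_class A B M \<C> \<D> \<longleftrightarrow> Y \<in> \<D>"
 using assms Fst_inc2_Mod_cat[OF assms(2)] Snd_inc2[OF Mod_catD[OF assms(2)]] inc2_Mod_cat[OF assms(2)]
 by (auto simp: Rep_class_iff)

lemma zeros_in_Rep:
 fixes \<C> :: "('a, 'u) module set" and \<D> :: "('b, 'u) module set"
 assumes "zeros_in T (Rep_class A B M \<C> \<D>)"
 shows "zeros_in A \<C>" "zeros_in B \<D>"
proof -
 show "zeros_in A \<C>"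
 proof (intro ballI impI)
  fix X :: "('a, 'u) module" assume X: "X \<in> Mod_cat A" "carrier X = {\<zero>\<^bsub>X\<^esub>}"
  then have "inc1 X \<in> Rep_class A B M \<C> \<D>" using assms inc1_Mod_cat[OF X(1)] by simp
  then show "X \<in> \<C>" unfolding Rep_class_iff Fst_inc1[OF Mod_catD[OF X(1)]] by blast
 qed
 show "zeros_in B \<D>"
 proof (intro ballI impI)
  fix Y :: "('b, 'u) module" assume Y: "Y \<in> Mod_cat B" "carrier Y = {\<zero>\<^bsub>Y\<^esub>}"
  then have "inc2 Y \<in> Rep_class A B M \<C> \<D>" using assms inc2_Mod_cat[OF Y(1)] by simp
  then show "Y \<in> \<D>" unfolding Rep_class_iff Snd_inc2[OF Mod_catD[OF Y(1)]] by blast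
 qed
qed

lemma Rep_closed_in:
 fixes \<C> :: "('a, 'u) module set" and \<D> :: "('b, 'u) module set"
 assumes z: "zeros_in A \<C>" "zeros_in B \<D>"
  and P: "!!a b c a' b' c'. [|P a b c; P a' b' c'|] ==> P (a \<and> a') (b \<and> b') (c \<and> c')"
 shows "closed_in P T (Rep_class A B M \<C> \<D>) \<longleftrightarrow> closed_in P A \<C> \<and> closed_in P B \<D>"
proof (intro iffI conjI)
 assume *: "closed_in P T (Rep_class A B M \<C> \<D>)"
 show "closed_in P A \<C>"
  unfolding closed_in_def
 proof (intro ballI allI impI)
  fix X Y Z :: "('a, 'u) module" and f g
  assume c: "X \<in> Mod_cat A" "Y \<in> Mod_cat A" "Z \<in> Mod_cat A" and se: "short_exact A X Y Z f g"
  show "P (X \<in> \<C>) (Y \<in> \<C>) (Z \<in> \<C>)"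
   using *[unfolded closed_in_def, rule_format, OF c[THEN inc1_Mod_cat] short_exact_inc1[OF c[THEN Mod_catD] se]]
   unfolding inc1_Rep[OF z(2) c(1)] inc1_Rep[OF z(2) c(2)] inc1_Rep[OF z(2) c(3)] .
 qed
 show "closed_in P B \<D>"
  unfolding closed_in_def
 proof (intro ballI allI impI)
  fix X Y Z :: "('b, 'u) module" and f g
  assume c: "X \<in> Mod_cat B" "Y \<in> Mod_cat B" "Z \<in> Mod_cat B" and se: "short_exact B X Y Z f g"
  show "P (X \<in> \<D>) (Y \<in> \<D>) (Z \<in> \<D>)"
   using *[unfolded closed_in_def, rule_format, OF c[THEN inc2_Mod_cat] short_exact_inc2[OF c[THEN Mod_catD] se]]
   unfolding inc2_Rep[OF z(1) c(1)] inc2_Rep[OF z(1) c(2)] inc2_Rep[OF z(1) c(3)] .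
 qed
next
 assume *: "closed_in P A \<C> \<and> closed_in P B \<D>"
 show "closed_in P T (Rep_class A B M \<C> \<D>)"
  unfolding closed_in_def
 proof (intro ballI allI impI)
  fix X Y Z :: "('a \<times> 'm \<times> 'b, 'u) module" and f g
  assume c: "X \<in> Mod_cat T" "Y \<in> Mod_cat T" "Z \<in> Mod_cat T" and se: "short_exact T X Y Z f g"
  have "P (Fst X \<in> \<C>) (Fst Y \<in> \<C>) (Fst Z \<in> \<C>)"
   by (rule conjunct1[OF *, unfolded closed_in_def, rule_format, OF c[THEN Fst_Mod_cat] short_exact_Fst[OF c[THEN Mod_catD] se]])
  moreover have "P (Snd X \<in> \<D>) (Snd Y \<in> \<D>) (Snd Z \<in> \<D>)"
   by (rule conjunct2[OF *, unfolded closed_in_def, rule_format, OF c[THEN Snd_Mod_cat] short_exact_Snd[OF c[THEN Mod_catD] se]])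
  ultimately show "P (X \<in> Rep_class A B M \<C> \<D>) (Y \<in> Rep_class A B M \<C> \<D>) (Z \<in> Rep_class A B M \<C> \<D>)"
   using P c by (simp add: Rep_class_iff)
 qed
qed

lemma Rep_closed:
 fixes \<C> :: "('a, 'u) module set" and \<D> :: "('b, 'u) module set"
 assumes z: "zeros_in A \<C>" "zeros_in B \<D>" and sub: "\<C> \<subseteq> Mod_cat A" "\<D> \<subseteq> Mod_cat B"
 shows "closed_under_epi_kernels T (Rep_class A B M \<C> \<D>) \<longleftrightarrow>
   closed_under_epi_kernels A \<C> \<and> closed_under_epi_kernels B \<D>"
  and "closed_under_mono_cokernels T (Rep_class A B M \<C> \<D>) \<longleftrightarrow>
   closed_under_mono_cokernels A \<C> \<and> closed_under_mono_cokernels B \<D>"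
proof -
 have T: "Rep_class A B M \<C> \<D> \<subseteq> Mod_cat T" by (auto simp: Rep_class_iff)
 show "closed_under_epi_kernels T (Rep_class A B M \<C> \<D>) \<longleftrightarrow>
   closed_under_epi_kernels A \<C> \<and> closed_under_epi_kernels B \<D>"
  unfolding closed_in_iff(1)[OF T] closed_in_iff(1)[OF sub(1)] closed_in_iff(1)[OF sub(2)]
  by (rule Rep_closed_in[OF z]) blast
 show "closed_under_mono_cokernels T (Rep_class A B M \<C> \<D>) \<longleftrightarrow>
   closed_under_mono_cokernels A \<C> \<and> closed_under_mono_cokernels B \<D>"
  unfolding closed_in_iff(2)[OF T] closed_in_iff(2)[OF sub(1)] closed_in_iff(2)[OF sub(2)]
  by (rule Rep_closed_in[OF z]) blast
qed

lemma inc1_Phi: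
 assumes z: "zeros_in B \<C>" and sub: "\<A> \<subseteq> Mod_cat A" and X: "X \<in> \<A>"
 shows "inc1 X \<in> Phi_class A B M \<A> \<C>"
proof -
 note Xc = subsetD[OF sub X]
 note X' = Mod_catD[OF Xc] and C = lmod_cogen[OF R.ring_axioms]
 note I = lmod_inc1[OF X']
 interpret X: left_module A X by (rule X')
 have "phi_inj (inc1 X)" by (rule phi_injI[OF I])
   (simp add: ext_zero_inc1[OF X' lmod_inc1[OF C]] Fst_inc1[OF C] ext_zero_cogen[OF R.ring_axioms X'])
 moreover have "phi_image (inc1 X) \<subseteq> {\<zero>\<^bsub>X\<^esub>}"
 proof (rule phi_image_least[OF I])
  show "submodule_of A (Fst (inc1 X)) {\<zero>\<^bsub>X\<^esub>}" unfolding Fst_inc1[OF X'] by (simp add: submodule_of_def)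
  show "EM m \<odot>\<^bsub>inc1 X\<^esub> y \<in> {\<zero>\<^bsub>X\<^esub>}" if "m \<in> carrier M" "y \<in> carrier (Snd (inc1 X))" for m y
   using SndD(1)[OF I that(2)] by simp
 qed
 then have "cokernel_map (inc1 X) X (\<lambda>x\<in>carrier X. x)"
  using submodule_phi_image[OF I] mhom_id[OF X']
  unfolding cokernel_map_def Fst_inc1[OF X'] submodule_of_def by auto
 ultimately show ?thesis
  unfolding Phi_class_iff[OF sub] using inc1_Mod_cat[OF Xc] Snd_inc1_Mod_cat[OF Xc] X z by blast
qed

lemma inc2_Psi:
 assumes z: "zeros_in A \<B>" and Yc: "Y \<in> Mod_cat B"
 shows "inc2 Y \<in> Psi_class A B M \<B> \<D> \<longleftrightarrow> Y \<in> \<D>"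
proof -
 note Y = Mod_catD[OF Yc]
 note I = lmod_inc2[OF Y]
 interpret Y: left_module B Y by (rule Y)
 have "psi_onto (inc2 Y)"
 proof (rule psi_ontoI[OF I])
  fix g assume "g \<in> mod_hom A M (Fst (inc2 Y))"
  then have "g m = \<zero>\<^bsub>Y\<^esub>" if "m \<in> carrier M" for m
   using mhom_closed[of g A M "Fst (inc2 Y)"] that unfolding Fst_inc2[OF Y] by blast
  then show "\<exists>y\<in>carrier (Snd (inc2 Y)). \<forall>m\<in>carrier M. EM m \<odot>\<^bsub>inc2 Y\<^esub> y = g m"
   unfolding Snd_inc2[OF Y] by (intro bexI[of _ "\<zero>\<^bsub>Y\<^esub>"]) simp_all
 qed
 moreover have "carrier (psi_ker (inc2 Y)) = carrier Y"
  using psi_ker_iff[OF I] unfolding Snd_inc2[OF Y] by (intro equalityI subsetI) simp_all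
 then have "psi_ker (inc2 Y) = Y" unfolding Snd_inc2[OF Y] by simp
 ultimately show ?thesis
  unfolding Psi_class_iff using inc2_Mod_cat[OF Yc] Fst_inc2_Mod_cat[OF Yc] z by auto
qed

context
 fixes \<A> \<B> :: "('a, 'u) module set" and \<C> \<D> :: "('b, 'u) module set"
 assumes univ: "universe_for TYPE('u) (carrier A)" "universe_for TYPE('u) (carrier B)"
   "universe_for TYPE('u) (carrier M)"
  and sub: "\<A> \<subseteq> Mod_cat A" "\<B> \<subseteq> Mod_cat A" "\<C> \<subseteq> Mod_cat B" "\<D> \<subseteq> Mod_cat B"
  and tor: "!!Y. Y \<in> \<C> ==> ext_zero B Y (char_module M)"
  and extM: "!!X. X \<in> \<B> ==> ext_zero A M X"
begin

abbreviation "Phi \<equiv> Phi_class A B M \<A> \<C>"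
abbreviation "RepB \<equiv> Rep_class A B M \<B> \<D>"
abbreviation "RepA \<equiv> Rep_class A B M \<A> \<C>"
abbreviation "Psi \<equiv> Psi_class A B M \<B> \<D>"

lemma universe: "uncountable (UNIV :: 'u set)" "infinite (UNIV :: 'u set)"
 using univ(1) countable_finite by (auto simp: universe_for_def)

lemma classes_T: "Phi \<subseteq> Mod_cat T" "RepB \<subseteq> Mod_cat T" "RepA \<subseteq> Mod_cat T" "Psi \<subseteq> Mod_cat T"
 by (auto simp: Phi_class_def Rep_class_def Psi_class_def)

lemma ext_zero_from_Phi:
 fixes V :: "('a \<times> 'm \<times> 'b, 'v) module"
 assumes N: "N \<in> Phi" and V: "left_module T V"
  and ext: "!!C. C \<in> \<A> ==> ext_zero A C (Fst V)" "!!Y. Y \<in> \<C> ==> ext_zero B Y (Snd V)"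
 shows "ext_zero T N V"
proof -
 obtain C q where "phi_inj N" "Snd N \<in> \<C>" "C \<in> \<A>" "cokernel_map N C q"
  using N unfolding Phi_class_iff[OF sub(1)] by blast
 then show ?thesis
  using ext_zero_Phi[OF Mod_catD[OF subsetD[OF classes_T(1) N]] V Mod_catD[OF subsetD[OF sub(1)]]] ext by blast
qed

lemma ext_zero_to_Psi:
 fixes N :: "('a \<times> 'm \<times> 'b, 'n) module"
 assumes V: "V \<in> Psi" and N: "left_module T N"
  and ext: "!!X. X \<in> \<B> ==> ext_zero A (Fst N) X" "!!Y. Y \<in> \<D> ==> ext_zero B (Snd N) Y"
 shows "ext_zero T N V"
 using ext_zero_Psi[OF Mod_catD[OF subsetD[OF classes_T(4) V]] N] V ext unfolding Psi_class_iff by blast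

lemma ind_small:
 assumes "Y \<in> (Mod_cat B :: ('b, 'u) module set)"
 shows "carrier (ind Y) \<prec> (UNIV :: 'u set)"
proof -
 have Y: "carrier Y \<prec> (UNIV :: 'u set)" using assms by (simp add: Mod_cat_def)
 have "carrier (Ten Y) = tensor_class B M Y ` carrier (free_Abelian_group (carrier M \<times> carrier Y))"
  by (simp add: tensor_def Let_def)
 also have "\<dots> \<prec> (UNIV :: 'u set)"
  using univ(3) Y by (intro image_small free_abelian_small universe times_small) (simp_all add: universe_for_def)
 finally show ?thesis using times_small[OF universe(2) _ Y] by simp
qed

lemma coind_small:
 assumes "X \<in> (Mod_cat A :: ('a, 'u) module set)"
 shows "carrier (coind X) \<prec> (UNIV :: 'u set)"
proof -
 have X: "carrier X \<prec> (UNIV :: 'u set)" using assms by (simp add: Mod_cat_def)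
 have "mod_hom A M X \<subseteq> carrier M \<rightarrow>\<^sub>E carrier X"
 proof
  fix f assume f: "f \<in> mod_hom A M X"
  show "f \<in> carrier M \<rightarrow>\<^sub>E carrier X"
   unfolding PiE_iff using mhom_closed[OF f] mhom_extensional[OF f] by blast
 qed
 then have "mod_hom A M X \<prec> (UNIV :: 'u set)" by (rule subset_small[OF _ funcset_small[OF univ(3) X]])
 then show ?thesis using times_small[OF universe(2) X] by simp
qed

context
 assumes cpA: "cotorsion_pair A \<A> \<B>" and genA: "generated_by_set A \<A> \<B>"
  and cpB: "cotorsion_pair B \<C> \<D>" and genB: "generated_by_set B \<C> \<D>"
begin

lemma zeros: "zeros_in A \<A>" "zeros_in A \<B>" "zeros_in B \<C>" "zeros_in B \<D>"
 using cotorsion_pair_zero[OF cpA] cotorsion_pair_zero[OF cpB] by blast+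

lemma ext_A: "[|X \<in> \<A>; V \<in> \<B>|] ==> ext_zero A X V" and ext_B: "[|Y \<in> \<C>; W \<in> \<D>|] ==> ext_zero B Y W"
 using cotorsion_pairD(3)[OF cpA] cotorsion_pairD(3)[OF cpB] by blast+

text \<open>A copy in the universe of the injective cogenerator lies in \<open>\<B>\<close>.\<close>

lemma phi_inj_of_perp:
 assumes Z: "left_module T Z" and ext: "!!V. V \<in> RepB ==> ext_zero T Z V"
 shows "phi_inj Z"
proof (rule phi_injI[OF Z])
 note C = lmod_cogen[OF R.ring_axioms]
 obtain J :: "('a, 'u) module" and g where J: "J \<in> Mod_cat A" "g \<in> mod_hom A (cogen A) J" "bij_betw g (carrier (cogen A)) (carrier J)"
  "\<forall>V :: ('a, 'u) module. left_module A V -->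
   (ext_zero A J V \<longleftrightarrow> ext_zero A (cogen A) V) \<and> (ext_zero A V J \<longleftrightarrow> ext_zero A V (cogen A))"
  using small_copy_ext[OF C cogen_small[OF univ(1)]] by blast
 note J' = Mod_catD[OF J(1)]
 have "J \<in> \<B>"
  unfolding cotorsion_pairD(4)[OF cpA]
 proof (intro conjI ballI J(1))
  fix X assume "X \<in> \<A>"
  then have X: "left_module A X" using sub(1) Mod_catD by blast
  show "ext_zero A X J" using J(4) X ext_zero_cogen[OF R.ring_axioms X] by blast
 qed
 then have e: "ext_zero T Z (inc1 J)" using inc1_Rep[OF zeros(4) J(1)] ext by blast
 obtain k where k: "k \<in> mod_hom A J (cogen A)" "bij_betw k (carrier J) (carrier (cogen A))"
  using mhom_inverse[OF C J' J(2,3)] by blast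
 have "k \<in> mod_hom T (inc1 J) (inc1 (cogen A))"
  unfolding hom_inc1[OF J' lmod_inc1[OF C]] Fst_inc1[OF C] by (rule k(1))
 from ext_zero_iso_right[OF Z lmod_inc1[OF J'] lmod_inc1[OF C] this _ e] k(2)
 show "ext_zero T Z (inc1 (cogen A))" by simp
qed

lemma Phi_perp:
 assumes Z: "Z \<in> Mod_cat T"
 shows "Z \<in> Phi \<longleftrightarrow> (\<forall>V\<in>RepB. ext_zero T Z V)"
proof
 assume "Z \<in> Phi"
 then show "\<forall>V\<in>RepB. ext_zero T Z V"
  using ext_A ext_B by (intro ballI ext_zero_from_Phi Mod_catD) (auto simp: Rep_class_iff)
next
 assume ext: "\<forall>V\<in>RepB. ext_zero T Z V"
 note Z' = Mod_catD[OF Z]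
 have "ext_zero B (Snd Z) Y" if Y: "Y \<in> \<D>" for Y
 proof -
  note Yc = subsetD[OF sub(4) Y]
  show ?thesis using ext inc2_Rep[OF zeros(2) Yc] Y ext_zero_inc2[OF Mod_catD[OF Yc] Z'] by blast
 qed
 then have S: "Snd Z \<in> \<C>" unfolding cotorsion_pairD(3)[OF cpB] using Snd_Mod_cat[OF Z] by blast
 have inj: "phi_inj Z" using phi_inj_of_perp[OF Z'] ext by blast
 note F = lmod_Fst[OF Z'] and I = submodule_phi_image[OF Z']
 have "carrier (quotient_module (Fst Z) (phi_image Z)) \<prec> (UNIV :: 'u set)"
  unfolding quotient_onto[OF F I, symmetric] by (intro image_small) (use Fst_Mod_cat[OF Z] in \<open>simp add: Mod_cat_def\<close>)
 then obtain C :: "('a, 'u) module" where C: "C \<in> Mod_cat A" "mod_iso A (quotient_module (Fst Z) (phi_image Z)) C"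
  using small_copy[OF lmod_quotient[OF F I]] unfolding mod_iso_def by blast
 note C' = Mod_catD[OF C(1)]
 obtain q where q: "cokernel_map Z C q"
  using C(2) unfolding hom_quotient_iff[OF F I C'] cokernel_map_def by blast
 have "ext_zero A C X" if X: "X \<in> \<B>" for X
 proof -
  note Xc = subsetD[OF sub(2) X]
  show ?thesis using ext_zero_cokernel[OF Z' C' Mod_catD[OF Xc] q] ext inc1_Rep[OF zeros(4) Xc] X by blast
 qed
 then have "C \<in> \<A>" unfolding cotorsion_pairD(3)[OF cpA] using C(1) by blast
 then show "Z \<in> Phi" unfolding Phi_class_iff[OF sub(1)] using Z inj S q by blast
qed

text \<open>
 The first pair is generated by \<open>X \<oplus> 0\<close> and copies of \<open>M \<otimes> Y \<oplus> Y\<close> for generators \<open>X\<close> of \<open>(\<A>, \<B>)\<close> and \<open>Y\<close> of \<open>(\<C>, \<D>)\<close>.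
\<close>

theorem Phi_cotorsion_pair: "cotorsion_pair T Phi RepB" "generated_by_set T Phi RepB"
proof -
 obtain SA where SA: "SA \<subseteq> \<A>" "SA \<prec> (UNIV :: 'u set)"
  "!!X. X \<in> \<B> \<longleftrightarrow> X \<in> Mod_cat A \<and> (\<forall>S\<in>SA. ext_zero A S X)" using generated_ex[OF cpA genA] by blast
 obtain SC where SC: "SC \<subseteq> \<C>" "SC \<prec> (UNIV :: 'u set)"
  "!!X. X \<in> \<D> \<longleftrightarrow> X \<in> Mod_cat B \<and> (\<forall>S\<in>SC. ext_zero B S X)" using generated_ex[OF cpB genB] by blast
 have SCm: "Y \<in> Mod_cat B" if "Y \<in> SC" for Y using that SC(1) sub(3) by blast
 have "\<forall>Y\<in>SC. \<exists>I :: ('a \<times> 'm \<times> 'b, 'u) module. I \<in> Mod_cat T \<and>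
   (\<forall>V :: ('a \<times> 'm \<times> 'b, 'u) module. left_module T V --> (ext_zero T I V \<longleftrightarrow> ext_zero T (ind Y) V))"
 proof
  fix Y assume Y: "Y \<in> SC"
  show "\<exists>I :: ('a \<times> 'm \<times> 'b, 'u) module. I \<in> Mod_cat T \<and>
   (\<forall>V :: ('a \<times> 'm \<times> 'b, 'u) module. left_module T V --> (ext_zero T I V \<longleftrightarrow> ext_zero T (ind Y) V))"
   using small_copy_ext[OF lmod_ind[OF Mod_catD[OF SCm[OF Y]]] ind_small[OF SCm[OF Y]]] by blast
 qed
 from bchoice[OF this] obtain I :: "('b, 'u) module => ('a \<times> 'm \<times> 'b, 'u) module" where
  I: "\<forall>Y\<in>SC. I Y \<in> Mod_cat T \<and>
   (\<forall>V :: ('a \<times> 'm \<times> 'b, 'u) module. left_module T V --> (ext_zero T (I Y) V \<longleftrightarrow> ext_zero T (ind Y) V))"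
  by blast
 have S: "inc1 ` SA \<union> I ` SC \<subseteq> Mod_cat T" using I SA(1) sub(1) inc1_Mod_cat by blast
 have small: "inc1 ` SA \<union> I ` SC \<prec> (UNIV :: 'u set)" by (intro un_small universe(2) image_small SA(2) SC(2))
 have perp: "Z \<in> RepB \<longleftrightarrow> (\<forall>S\<in>inc1 ` SA \<union> I ` SC. ext_zero T S Z)" if Z: "Z \<in> Mod_cat T" for Z
 proof -
  note Z' = Mod_catD[OF Z]
  have "ext_zero T (inc1 X) Z \<longleftrightarrow> ext_zero A X (Fst Z)" if "X \<in> SA" for X
   using ext_zero_inc1[OF Mod_catD Z'] that SA(1) sub(1) by blast
  moreover have "ext_zero T (I Y) Z \<longleftrightarrow> ext_zero B Y (Snd Z)" if Y: "Y \<in> SC" for Y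
  proof -
   have "ext_zero T (I Y) Z \<longleftrightarrow> ext_zero T (ind Y) Z" using I Y Z' by blast
   also have "\<dots> \<longleftrightarrow> ext_zero B Y (Snd Z)"
    using ext_zero_indI[OF Mod_catD[OF SCm[OF Y]] Z'] ext_zero_indD[OF Mod_catD[OF SCm[OF Y]] Z' tor[OF subsetD[OF SC(1) Y]]]
    by (rule iffI[rotated])
   finally show ?thesis .
  qed
  ultimately show ?thesis
   unfolding Rep_class_iff SA(3) SC(3) using Z Fst_Mod_cat[OF Z] Snd_Mod_cat[OF Z] by blast
 qed
 show "cotorsion_pair T Phi RepB" "generated_by_set T Phi RepB"
  by (rule cotorsion_pairI[OF S small perp Phi_perp classes_T(1,2)]; assumption)+
qed

text \<open>
 The second pair is generated by \<open>X \<oplus> 0\<close>, \<open>0 \<oplus> Y\<close> and \<open>0 \<oplus> P\<close> for generators \<open>X\<close> and \<open>Y\<close> and a copy \<open>P\<close> of \<open>B\<close>. That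
 the first component of a left orthogonal \<open>Z\<close> lies in \<open>\<A>\<close> is tested on \<open>X \<oplus> Hom (M, X)\<close>.
\<close>

theorem Psi_cotorsion_pair: "cotorsion_pair T RepA Psi" "generated_by_set T RepA Psi"
proof -
 obtain SA where SA: "SA \<subseteq> \<A>" "SA \<prec> (UNIV :: 'u set)"
  "!!X. X \<in> \<B> \<longleftrightarrow> X \<in> Mod_cat A \<and> (\<forall>S\<in>SA. ext_zero A S X)" using generated_ex[OF cpA genA] by blast
 obtain SC where SC: "SC \<subseteq> \<C>" "SC \<prec> (UNIV :: 'u set)"
  "!!X. X \<in> \<D> \<longleftrightarrow> X \<in> Mod_cat B \<and> (\<forall>S\<in>SC. ext_zero B S X)" using generated_ex[OF cpB genB] by blast
 note BB = lmod_regular[OF B.ring_axioms]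
 have "carrier (regular_module B) \<prec> (UNIV :: 'u set)" using univ(2) by (simp add: universe_for_def)
 then obtain P :: "('b, 'u) module" and g where P: "P \<in> Mod_cat B"
  "g \<in> mod_hom B (regular_module B) P" "bij_betw g (carrier (regular_module B)) (carrier P)"
  "\<forall>V :: ('b, 'u) module. left_module B V --> (ext_zero B P V \<longleftrightarrow> ext_zero B (regular_module B) V) \<and>
   (ext_zero B V P \<longleftrightarrow> ext_zero B V (regular_module B))" using small_copy_ext[OF BB] by blast
 note P' = Mod_catD[OF P(1)]
 have "P \<in> \<C>"
  unfolding cotorsion_pairD(3)[OF cpB]
 proof (intro conjI ballI P(1))
  fix Y assume "Y \<in> \<D>"
  then have Y: "left_module B Y" using sub(4) Mod_catD by blast
  show "ext_zero B P Y" using P(4) Y ext_zero_regular[OF B.ring_axioms Y] by blast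
 qed
 then have SCP: "insert P SC \<subseteq> \<C>" using SC(1) by blast
 let ?S = "inc1 ` SA \<union> inc2 ` ({P} \<union> SC)"
 have SR: "?S \<subseteq> RepA"
 proof -
  have "inc1 X \<in> RepA" if "X \<in> \<A>" for X using inc1_Rep[OF zeros(3) subsetD[OF sub(1) that]] that by blast
  moreover have "inc2 Y \<in> RepA" if "Y \<in> \<C>" for Y using inc2_Rep[OF zeros(1) subsetD[OF sub(3) that]] that by blast
  ultimately show ?thesis using SA(1) SCP by blast
 qed
 have small: "?S \<prec> (UNIV :: 'u set)"
  by (intro un_small universe(2) image_small SA(2) SC(2) countable_small[OF universe(1)]) simp
 have RepA_Psi: "ext_zero T N V" if N: "N \<in> RepA" and V: "V \<in> Psi" for N V
  using ext_zero_to_Psi[OF V Mod_catD[OF subsetD[OF classes_T(3) N]]] N ext_A ext_B unfolding Rep_class_iff by blast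
 have perp: "Z \<in> Psi \<longleftrightarrow> (\<forall>S\<in>?S. ext_zero T S Z)" if Z: "Z \<in> Mod_cat T" for Z
 proof
  assume "Z \<in> Psi" then show "\<forall>S\<in>?S. ext_zero T S Z" using RepA_Psi SR by blast
 next
  assume ext: "\<forall>S\<in>?S. ext_zero T S Z"
  note Z' = Mod_catD[OF Z]
  have "ext_zero A X (Fst Z)" if X: "X \<in> SA" for X
   using ext ext_zero_inc1[OF Mod_catD[OF subsetD[OF sub(1) subsetD[OF SA(1) X]]] Z'] X by blast
  then have F: "Fst Z \<in> \<B>" unfolding SA(3) using Fst_Mod_cat[OF Z] by blast
  obtain k where k: "k \<in> mod_hom B P (regular_module B)" "bij_betw k (carrier P) (carrier (regular_module B))"
   using mhom_inverse[OF BB P' P(2,3)] by blast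
  have eP: "ext_zero T (inc2 P) Z" using ext by blast
  have "ext_zero T (inc2 (regular_module B)) Z"
   by (rule ext_zero_iso_left[OF lmod_inc2[OF P'] lmod_inc2[OF BB] Z' subsetD[OF hom_inc2[OF P' BB] k(1)] _ eP])
    (use k(2) in simp)
  then have onto: "psi_onto Z" by (rule psi_ontoI_regular[OF Z'])
  have "ext_zero B Y (psi_ker Z)" if Y: "Y \<in> SC" for Y
   using ext ext_zero_psi_ker[OF Z' onto Mod_catD[OF subsetD[OF sub(3) subsetD[OF SC(1) Y]]]] Y by blast
  moreover have "psi_ker Z \<in> Mod_cat B"
   by (rule sub_Mod_cat[OF Snd_Mod_cat[OF Z] submodule_hom_kernel[OF lmod_Snd[OF Z']
      lmod_hom_mod[OF lmod_Fst[OF Z']] psi_hom[OF Z']]])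
  ultimately show "Z \<in> Psi" unfolding Psi_class_iff SC(3) using Z onto F by blast
 qed
 have perp': "Z \<in> RepA \<longleftrightarrow> (\<forall>V\<in>Psi. ext_zero T Z V)" if Z: "Z \<in> Mod_cat T" for Z
 proof
  assume "Z \<in> RepA" then show "\<forall>V\<in>Psi. ext_zero T Z V" using RepA_Psi by blast
 next
  assume ext: "\<forall>V\<in>Psi. ext_zero T Z V"
  note Z' = Mod_catD[OF Z]
  have "ext_zero B (Snd Z) Y" if Y: "Y \<in> \<D>" for Y
  proof -
   note Yc = subsetD[OF sub(4) Y]
   show ?thesis using ext inc2_Psi[OF zeros(2) Yc] Y ext_zero_inc2[OF Mod_catD[OF Yc] Z'] by blast
  qed
  then have S: "Snd Z \<in> \<C>" unfolding cotorsion_pairD(3)[OF cpB] using Snd_Mod_cat[OF Z] by blast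
  have "ext_zero A (Fst Z) X" if X: "X \<in> \<B>" for X
  proof -
   note Xc = subsetD[OF sub(2) X]
   note X' = Mod_catD[OF Xc]
   obtain W :: "('a \<times> 'm \<times> 'b, 'u) module" where W: "W \<in> Mod_cat T"
    "\<forall>V :: ('a \<times> 'm \<times> 'b, 'u) module. left_module T V --> (ext_zero T V W \<longleftrightarrow> ext_zero T V (coind X))"
    using small_copy_ext[OF lmod_coind[OF X'] coind_small[OF Xc]] by blast
   have "ext_zero T S W" if S: "S \<in> ?S" for S
   proof -
    have "S \<in> RepA" using subsetD[OF SR S] .
    then have SA: "Fst S \<in> \<A>" and S': "left_module T S" unfolding Rep_class_iff using Mod_catD by blast+
    show ?thesis using W(2) S' ext_zero_coindI[OF X' S' ext_A[OF SA X]] by blast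
   qed
   then have "W \<in> Psi" unfolding perp[OF W(1)] by blast
   then have "ext_zero T Z (coind X)" using ext W(2) Z' by blast
   then show ?thesis by (rule ext_zero_coindD[OF X' Z' extM[OF X]])
  qed
  then have "Fst Z \<in> \<A>" unfolding cotorsion_pairD(3)[OF cpA] using Fst_Mod_cat[OF Z] by blast
  then show "Z \<in> RepA" unfolding Rep_class_iff using Z S by blast
 qed
 note SM = subset_trans[OF SR classes_T(3)]
 show "cotorsion_pair T RepA Psi" "generated_by_set T RepA Psi"
  by (rule cotorsion_pairI[OF SM small perp perp' classes_T(3,4)]; assumption)+
qed

end

context
 assumes cp1: "cotorsion_pair T Phi RepB" and gen1: "generated_by_set T Phi RepB"
  and cp2: "cotorsion_pair T RepA Psi"
begin

lemma component_zeros: "zeros_in A \<A>" "zeros_in A \<B>" "zeros_in B \<C>" "zeros_in B \<D>"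
proof -
 have z: "zeros_in T RepA" "zeros_in T RepB"
  using cotorsion_pair_zero[OF cp1] cotorsion_pair_zero[OF cp2] by blast+
 show "zeros_in A \<A>" "zeros_in A \<B>" "zeros_in B \<C>" "zeros_in B \<D>"
  using zeros_in_Rep[OF z(1)] zeros_in_Rep[OF z(2)] by blast+
qed

text \<open>
 The modules \<open>X \<oplus> 0\<close> and \<open>0 \<oplus> Y\<close> lie in the classes over \<open>T\<close> iff \<open>X\<close> and \<open>Y\<close> lie in the given classes, because
 all of these contain the zero modules.
\<close>

theorem component_cotorsion_pairs:
 "cotorsion_pair A \<A> \<B>" "generated_by_set A \<A> \<B>" "cotorsion_pair B \<C> \<D>" "generated_by_set B \<C> \<D>"
proof -
 note z = component_zeros
 obtain S where S: "S \<subseteq> Phi" "S \<prec> (UNIV :: 'u set)"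
  "!!V. V \<in> RepB \<longleftrightarrow> V \<in> Mod_cat T \<and> (\<forall>N\<in>S. ext_zero T N V)" using generated_ex[OF cp1 gen1] by blast
 have "N \<in> Mod_cat T \<and> phi_inj N \<and> Snd N \<in> \<C> \<and> (\<exists>C\<in>\<A>. \<exists>q. cokernel_map N C q)" if "N \<in> S" for N
  using subsetD[OF S(1) that] unfolding Phi_class_iff[OF sub(1)] .
 then have S': "!!N. N \<in> S ==> left_module T N" "!!N. N \<in> S ==> phi_inj N" "!!N. N \<in> S ==> Snd N \<in> \<C>"
  "!!N. N \<in> S ==> \<exists>C\<in>\<A>. \<exists>q. cokernel_map N C q" using Mod_catD by blast+
 have "\<forall>N\<in>S. \<exists>C. C \<in> \<A> \<and> (\<exists>q. cokernel_map N C q)" using S'(4) by blast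
 from bchoice[OF this] obtain c where c: "\<forall>N\<in>S. c N \<in> \<A> \<and> (\<exists>q. cokernel_map N (c N) q)" by blast
 have ext_A: "ext_zero A X V" if X: "X \<in> \<A>" and V: "V \<in> \<B>" for X V
 proof -
  note Xc = subsetD[OF sub(1) X] and Vc = subsetD[OF sub(2) V]
  have "ext_zero T (inc1 X) (inc1 V)"
   using inc1_Phi[OF z(3) sub(1) X] inc1_Rep[OF z(4) Vc] V cotorsion_pairD(3)[OF cp1] by blast
  then show ?thesis
   unfolding ext_zero_inc1[OF Mod_catD[OF Xc] lmod_inc1[OF Mod_catD[OF Vc]]] Fst_inc1[OF Mod_catD[OF Vc]] .
 qed
 have perpA: "V \<in> \<B> \<longleftrightarrow> (\<forall>X\<in>c ` S. ext_zero A X V)" if V: "V \<in> Mod_cat A" for V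
 proof
  assume "V \<in> \<B>" then show "\<forall>X\<in>c ` S. ext_zero A X V" using ext_A c by blast
 next
  assume ext: "\<forall>X\<in>c ` S. ext_zero A X V"
  note V' = Mod_catD[OF V]
  note I = lmod_inc1[OF V']
  have "ext_zero T N (inc1 V)" if N: "N \<in> S" for N
  proof -
   have cN: "c N \<in> \<A>" and "\<exists>q. cokernel_map N (c N) q" using c N by blast+
   then obtain q where q: "cokernel_map N (c N) q" by blast
   have "ext_zero A (c N) (Fst (inc1 V))" unfolding Fst_inc1[OF V'] using ext N by blast
   moreover have "ext_zero B (Snd N) (Snd (inc1 V))"
    using Snd_inc1_Mod_cat[OF V] by (intro ext_zero_zero_right lmod_Snd S'(1)[OF N] I) blast
   ultimately show ?thesis
    by (rule ext_zero_Phi[OF S'(1)[OF N] I Mod_catD[OF subsetD[OF sub(1) cN]] q S'(2)[OF N]])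
  qed
  then have "inc1 V \<in> RepB" unfolding S(3) using inc1_Mod_cat[OF V] by blast
  then show "V \<in> \<B>" unfolding inc1_Rep[OF z(4) V] .
 qed
 have perpA': "X \<in> \<A> \<longleftrightarrow> (\<forall>V\<in>\<B>. ext_zero A X V)" if X: "X \<in> Mod_cat A" for X
 proof
  assume "X \<in> \<A>" then show "\<forall>V\<in>\<B>. ext_zero A X V" using ext_A by blast
 next
  assume ext: "\<forall>V\<in>\<B>. ext_zero A X V"
  have "ext_zero T (inc1 X) V" if V: "V \<in> Psi" for V
   using V ext ext_zero_inc1[OF Mod_catD[OF X] Mod_catD[OF subsetD[OF classes_T(4) V]]] unfolding Psi_class_iff by blast
  then have "inc1 X \<in> RepA" unfolding cotorsion_pairD(3)[OF cp2] using inc1_Mod_cat[OF X] by blast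
  then show "X \<in> \<A>" unfolding inc1_Rep[OF z(3) X] .
 qed
 have cS: "c ` S \<subseteq> Mod_cat A" using c sub(1) by blast
 show "cotorsion_pair A \<A> \<B>" "generated_by_set A \<A> \<B>"
  by (rule cotorsion_pairI[OF cS image_small[OF S(2)] perpA perpA' sub(1,2)]; assumption)+
 have ext_B: "ext_zero B Y W" if Y: "Y \<in> \<C>" and W: "W \<in> \<D>" for Y W
 proof -
  note Yc = subsetD[OF sub(3) Y] and Wc = subsetD[OF sub(4) W]
  have "ext_zero T (inc2 Y) (inc2 W)"
   using inc2_Rep[OF z(1) Yc] inc2_Psi[OF z(2) Wc] Y W cotorsion_pairD(3)[OF cp2] by blast
  then show ?thesis
   unfolding ext_zero_inc2[OF Mod_catD[OF Wc] lmod_inc2[OF Mod_catD[OF Yc]]] Snd_inc2[OF Mod_catD[OF Yc]] .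
 qed
 have perpB: "W \<in> \<D> \<longleftrightarrow> (\<forall>Y\<in>Snd ` S. ext_zero B Y W)" if W: "W \<in> Mod_cat B" for W
 proof
  assume "W \<in> \<D>" then show "\<forall>Y\<in>Snd ` S. ext_zero B Y W" using ext_B S'(3) by blast
 next
  assume ext: "\<forall>Y\<in>Snd ` S. ext_zero B Y W"
  have "ext_zero T N (inc2 W)" if N: "N \<in> S" for N
   using ext N ext_zero_inc2[OF Mod_catD[OF W] S'(1)[OF N]] by blast
  then have "inc2 W \<in> RepB" unfolding S(3) using inc2_Mod_cat[OF W] by blast
  then show "W \<in> \<D>" unfolding inc2_Rep[OF z(2) W] .
 qed
 have perpB': "Y \<in> \<C> \<longleftrightarrow> (\<forall>W\<in>\<D>. ext_zero B Y W)" if Y: "Y \<in> Mod_cat B" for Y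
 proof
  assume "Y \<in> \<C>" then show "\<forall>W\<in>\<D>. ext_zero B Y W" using ext_B by blast
 next
  assume ext: "\<forall>W\<in>\<D>. ext_zero B Y W"
  note Y' = Mod_catD[OF Y]
  note I = lmod_inc2[OF Y']
  have "ext_zero T (inc2 Y) V" if V: "V \<in> Psi" for V
  proof (rule ext_zero_to_Psi[OF V I])
   show "ext_zero A (Fst (inc2 Y)) X" if "X \<in> \<B>" for X
    using Fst_inc2_Mod_cat[OF Y] Mod_catD[OF subsetD[OF sub(2) that]]
    by (intro ext_zero_zero_left lmod_Fst I) blast+
   show "ext_zero B (Snd (inc2 Y)) W" if "W \<in> \<D>" for W unfolding Snd_inc2[OF Y'] using ext that by blast
  qed
  then have "inc2 Y \<in> RepA" unfolding cotorsion_pairD(3)[OF cp2] using inc2_Mod_cat[OF Y] by blast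
  then show "Y \<in> \<C>" unfolding inc2_Rep[OF z(1) Y] .
 qed
 have SS: "Snd ` S \<subseteq> Mod_cat B" using S'(3) sub(3) by blast
 show "cotorsion_pair B \<C> \<D>" "generated_by_set B \<C> \<D>"
  by (rule cotorsion_pairI[OF SS image_small[OF S(2)] perpB perpB' sub(3,4)]; assumption)+
qed

end

theorem hereditary_pairs_iff:
 "(hereditary_cotorsion_pair A \<A> \<B> \<and> generated_by_set A \<A> \<B> \<and>
   hereditary_cotorsion_pair B \<C> \<D> \<and> generated_by_set B \<C> \<D>) \<longleftrightarrow>
  (hereditary_cotorsion_pair T Phi RepB \<and> generated_by_set T Phi RepB \<and>
   hereditary_cotorsion_pair T RepA Psi \<and> generated_by_set T RepA Psi)"
 unfolding hereditary_iff[OF universe(2)]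
proof (intro iffI; elim conjE)
 assume cpA: "cotorsion_pair A \<A> \<B>" and gA: "generated_by_set A \<A> \<B>"
  and cpB: "cotorsion_pair B \<C> \<D>" and gB: "generated_by_set B \<C> \<D>"
  and eA: "closed_under_epi_kernels A \<A>" and mA: "closed_under_mono_cokernels A \<B>"
  and eB: "closed_under_epi_kernels B \<C>" and mB: "closed_under_mono_cokernels B \<D>"
 note z = zeros[OF cpA gA cpB gB]
 show "(cotorsion_pair T Phi RepB \<and> closed_under_epi_kernels T Phi \<and> closed_under_mono_cokernels T RepB) \<and>
   generated_by_set T Phi RepB \<and>
   (cotorsion_pair T RepA Psi \<and> closed_under_epi_kernels T RepA \<and> closed_under_mono_cokernels T Psi) \<and>
   generated_by_set T RepA Psi" using Phi_cotorsion_pair[OF cpA gA cpB gB] Psi_cotorsion_pair[OF cpA gA cpB gB]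
   Phi_closed_under_epi_kernels[OF sub(1) tor eA eB] Psi_closed_under_mono_cokernels[OF extM mA mB]
   Rep_closed(1)[OF z(1,3) sub(1,3)] Rep_closed(2)[OF z(2,4) sub(2,4)] eA eB mA mB by blast
next
 assume cp1: "cotorsion_pair T Phi RepB" and g1: "generated_by_set T Phi RepB"
  and cp2: "cotorsion_pair T RepA Psi"
  and e: "closed_under_epi_kernels T RepA" and m: "closed_under_mono_cokernels T RepB"
 note z = component_zeros[OF cp1 g1 cp2]
 show "(cotorsion_pair A \<A> \<B> \<and> closed_under_epi_kernels A \<A> \<and> closed_under_mono_cokernels A \<B>) \<and>
   generated_by_set A \<A> \<B> \<and>
   (cotorsion_pair B \<C> \<D> \<and> closed_under_epi_kernels B \<C> \<and> closed_under_mono_cokernels B \<D>) \<and>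
   generated_by_set B \<C> \<D>" using component_cotorsion_pairs[OF cp1 g1 cp2] e m
   Rep_closed(1)[OF z(1,3) sub(1,3)] Rep_closed(2)[OF z(2,4) sub(2,4)] by blast
qed

end

end

theorem theorem3p8:
  fixes A :: "'a ring" and B :: "'b ring" and M :: "('a, 'b, 'm) bimodule"
    and \<A> \<B> :: "('a, 'u) module set" and \<C> \<D> :: "('b, 'u) module set"
  assumes "ring A" and "ring B" and "bimodule A B M"
    and "universe_for TYPE('u) (carrier A)" and "universe_for TYPE('u) (carrier B)"
    and "universe_for TYPE('u) (carrier M)"
    and "\<A> \<subseteq> Mod_cat A" and "\<B> \<subseteq> Mod_cat A" and "\<C> \<subseteq> Mod_cat B" and "\<D> \<subseteq> Mod_cat B"
    and "\<And>E. E \<in> \<C> \<Longrightarrow> trivial_group (Tor1 B M E)"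
    and "\<And>F. F \<in> \<B> \<Longrightarrow> trivial_group (Ext1 A M F)"
  shows
    "(hereditary_cotorsion_pair A \<A> \<B> \<and> generated_by_set A \<A> \<B> \<and>
      hereditary_cotorsion_pair B \<C> \<D> \<and> generated_by_set B \<C> \<D>)
     \<longleftrightarrow>
     (hereditary_cotorsion_pair (tri_ring A B M) (Phi_class A B M \<A> \<C>) (Rep_class A B M \<B> \<D>) \<and>
      generated_by_set (tri_ring A B M) (Phi_class A B M \<A> \<C>) (Rep_class A B M \<B> \<D>) \<and>
      hereditary_cotorsion_pair (tri_ring A B M) (Rep_class A B M \<A> \<C>) (Psi_class A B M \<B> \<D>) \<and>
      generated_by_set (tri_ring A B M) (Rep_class A B M \<A> \<C>) (Psi_class A B M \<B> \<D>))"
proof -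
  interpret tri A B M by (rule tri.intro) fact
  show ?thesis
  proof (rule hereditary_pairs_iff)
    show "ext_zero B Y (char_module M)" if "Y \<in> \<C>" for Y
      using assms(3,11) that by (intro Tor1_ext_zero Mod_catD[OF subsetD[OF assms(9)]])
    show "ext_zero A M X" if "X \<in> \<B>" for X
      using trivial_Ext1_iff[OF M_mod Mod_catD[OF subsetD[OF assms(8) that]]] assms(12)[OF that] by blast
  qed fact+
qed

end
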